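(* Let $p$ be a prime, let $K$ be a finite extension of $\mathbb{Q}_p$, and let $\phi\in K(z)$ be a sub-hyperbolic rational map of degree at least $2$. Then $\mathbb{P}^1_K$ has a decomposition into pairwise disjoint subsets $$\mathbb{P}^1_K=P\sqcup M\sqcup B\sqcup J$$ where: (1) $P$ is a finite set consisting of all non-repelling periodic points of $\phi$ (in $\mathbb{P}^1_K$); (2) $M=\bigsqcup_i M_i$ is the union of all (at most countably many) clopen invariant sets $M_i$ such that each $M_i$ is a finite union of $\mathbb{P}^1_K$-disks and each subsystem $\phi:M_i\to M_i$ can be decomposed into minimal subsystems; (3) $B$ is the set of points in the basin of a periodic orbit or of a subsystem $\phi:M_i\to M_i$; (4) $J=J_K(\phi)$ is the Julia set of $\phi$, on which the dynamical behavior is characterized by a countable state Markov shift: there exist a countable state Markov shift $(\Sigma_A,\sigma)$ and a bijection $h:J_K(\phi)\to\Sigma_A$ such that $(I_K(\phi),\phi)$ is topologically conjugate to $(h(I_K(\phi)),\sigma)$ via $h$.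
   Context: $\mathbb{C}_p$ is the completion of an algebraic closure of $\mathbb{Q}_p$ (containing $K$), with $p$-adic absolute value $|\cdot|_p$. For $L\in\{K,\mathbb{C}_p\}$, $\mathbb{P}^1_L=L\cup\{\infty\}$ carries the spherical metric $\rho(x,y)=\frac{|x-y|_p}{\max\{|x|_p,1\}\max\{|y|_p,1\}}$ for $x,y\in L$, $\rho(x,\infty)=1$ if $|x|_p\le 1$ and $\rho(x,\infty)=1/|x|_p$ if $|x|_p>1$. The Fatou set $F_L(\phi)$ is the set of points of $\mathbb{P}^1_L$ having a neighborhood in $\mathbb{P}^1_L$ on which $\{\phi^n\}_{n\ge 0}$ is equicontinuous with respect to $\rho$; the Julia set is $J_L(\phi)=\mathbb{P}^1_L\setminus F_L(\phi)$. A $\mathbb{P}^1_K$-disk is a set of the form $\{z\in K:|z-x|_p<r\}$, $\{z\in K:|z-x|_p\le r\}$, or the complement in $\mathbb{P}^1_K$ of such a set ($x\in K$, $r>0$). A system is minimal if every orbit is dense. A subsystem $\phi:M_i\to M_i$ is decomposed into minimal subsystems if $M_i$ is a disjoint union of closed invariant subsets on each of which $\phi$ is minimal. The basin of a (non-repelling) periodic orbit is the set of points whose forward orbits converge to that periodic orbit; the basin of $\phi:M_i\to M_i$ is the set of points whose forward orbits eventually enter $M_i$; since the decomposition is disjoint, $B$ consists of such points not already in $P$ or $M$. The map $\phi$ is sub-hyperbolic if every critical point of $\phi$ (in $\mathbb{P}^1_{\mathbb{C}_p}$) lying in $J_{\mathbb{C}_p}(\phi)$ is eventually periodic, i.e.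 satisfies $\phi^{m+n}(x)=\phi^m(x)$ for some $m\ge 0$, $n\ge 1$. $\mathrm{Crit}_K^\ast(\phi)$ is the set of critical points of $\phi$ in $J_{\mathbb{C}_p}(\phi)\cap\mathbb{P}^1_K$; $\mathrm{GO}_K(\mathrm{Crit}_K^\ast(\phi))$ is the union of the grand orbits in $\mathbb{P}^1_K$ of its elements, where the grand orbit of $x$ is $\{y\in\mathbb{P}^1_K:\phi^m(y)=\phi^n(x)\text{ for some }m,n\ge0\}$; and $I_K(\phi)=J_K(\phi)\setminus\mathrm{GO}_K(\mathrm{Crit}_K^\ast(\phi))$. A countable state Markov shift: given a countable (possibly finite) discrete set $\mathcal{A}$ and a zero-one matrix $A=(A_{ab})_{a,b\in\mathcal{A}}$, $\Sigma_A=\{(a_i)_{i\ge0}\in\mathcal{A}^{\mathbb{N}}:A_{a_ia_{i+1}}=1\ \forall i\}$ with the subspace topology of the product topology, and $\sigma$ is the left shift. "Topologically conjugate via $h$" means that $h$ restricts to a homeomorphism $I_K(\phi)\to h(I_K(\phi))$ with $h\circ\phi=\sigma\circ h$ on $I_K(\phi)$.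
   Formalization: The union of all such sets M_i can meet P (for z^2 over Q_p, p odd, the disk 1+pZ_p contains the fixed point 1), so M is taken as a countable disjoint union of such sets, disjoint from P, with every such set contained in the union of P and M. *)

theory Defs
  imports "HOL-Analysis.Analysis" "HOL-Computational_Algebra.Polynomial"
    "HOL-Library.Disjoint_Sets"
begin

text \<open>
  The field \<open>\<complex>\<^sub>p\<close> is a type \<open>'c\<close> together with an absolute value \<open>v\<close>; the predicate \<open>is_Cp\<close>
  below says that the pair is a completion of an algebraic closure of \<open>\<rat>\<^sub>p\<close>. All other
  fields are subsets of this one.
\<close>

definition nonarch_abs :: "('c::field \<Rightarrow> real) \<Rightarrow> bool" where
  "nonarch_abs v \<longleftrightarrow>
     (\<forall>x. 0 \<le> v x) \<and> (\<forall>x. v x = 0 \<longleftrightarrow> x = 0) \<and>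
     (\<forall>x y. v (x * y) = v x * v y) \<and> (\<forall>x y. v (x + y) \<le> max (v x) (v y))"

definition padic_abs :: "nat \<Rightarrow> rat \<Rightarrow> real" where
  "padic_abs p q =
     (if q = 0 then 0
      else real p powi (int (multiplicity (int p) (snd (quotient_of q)))
                        - int (multiplicity (int p) (fst (quotient_of q)))))"

abbreviation abs_dist :: "('c::field \<Rightarrow> real) \<Rightarrow> 'c \<Rightarrow> 'c \<Rightarrow> real" where
  "abs_dist v \<equiv> (\<lambda>x y. v (x - y))"

abbreviation abs_topology :: "('c::field \<Rightarrow> real) \<Rightarrow> 'c topology" where
  "abs_topology v \<equiv> Metric_space.mtopology UNIV (abs_dist v)"

definition is_subfield :: "'c::field set \<Rightarrow> bool" where
  "is_subfield F \<longleftrightarrow> 0 \<in> F \<and> 1 \<in> F \<and>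
     (\<forall>x\<in>F. \<forall>y\<in>F. x + y \<in> F \<and> x * y \<in> F) \<and> (\<forall>x\<in>F. - x \<in> F \<and> inverse x \<in> F)"

definition is_algebraic_closure_of :: "'c::field set \<Rightarrow> 'c set \<Rightarrow> bool" where
  "is_algebraic_closure_of A F \<longleftrightarrow> is_subfield A \<and> F \<subseteq> A \<and>
     (\<forall>x\<in>A. \<exists>q. q \<noteq> 0 \<and> set (coeffs q) \<subseteq> F \<and> poly q x = 0) \<and>
     (\<forall>q. set (coeffs q) \<subseteq> A \<and> degree q > 0 \<longrightarrow> (\<exists>x\<in>A. poly q x = 0))"

text \<open>
  In a complete field whose absolute value restricts to the \<open>p\<close>-adic one on \<open>\<rat>\<close>, the completion
  \<open>\<rat>\<^sub>p\<close> of \<open>\<rat>\<close> is the topological closure of \<open>\<rat>\<close>.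
\<close>

definition Qp :: "('c::field_char_0 \<Rightarrow> real) \<Rightarrow> 'c set" where
  "Qp v = abs_topology v closure_of \<rat>"

definition is_Cp :: "nat \<Rightarrow> ('c::field_char_0 \<Rightarrow> real) \<Rightarrow> bool" where
  "is_Cp p v \<longleftrightarrow>
     nonarch_abs v \<and> (\<forall>q. v (of_rat q) = padic_abs p q) \<and>
     Metric_space.mcomplete UNIV (abs_dist v) \<and>
     (\<exists>A. is_algebraic_closure_of A (Qp v) \<and> abs_topology v closure_of A = UNIV)"

definition is_finite_extension_of :: "'c::field set \<Rightarrow> 'c set \<Rightarrow> bool" where
  "is_finite_extension_of K F \<longleftrightarrow> is_subfield K \<and> F \<subseteq> K \<and>
     (\<exists>B. finite B \<and> K = {\<Sum>b\<in>B. c b * b |c. \<forall>b\<in>B. c b \<in> F})"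

datatype 'c P1 = Fin 'c | Infty

definition P1_of :: "'c set \<Rightarrow> 'c P1 set" where
  "P1_of L = insert Infty (Fin ` L)"

fun spherical :: "('c::field \<Rightarrow> real) \<Rightarrow> 'c P1 \<Rightarrow> 'c P1 \<Rightarrow> real" where
  "spherical v (Fin x) (Fin y) = v (x - y) / (max (v x) 1 * max (v y) 1)"
| "spherical v (Fin x) Infty = (if v x \<le> 1 then 1 else 1 / v x)"
| "spherical v Infty (Fin x) = (if v x \<le> 1 then 1 else 1 / v x)"
| "spherical v Infty Infty = 0"

abbreviation P1_topology :: "('c::field \<Rightarrow> real) \<Rightarrow> 'c set \<Rightarrow> 'c P1 topology" where
  "P1_topology v L \<equiv> Metric_space.mtopology (P1_of L) (spherical v)"

definition P1_disk :: "('c::field \<Rightarrow> real) \<Rightarrow> 'c set \<Rightarrow> 'c P1 set \<Rightarrow> bool" where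
  "P1_disk v K D \<longleftrightarrow>
     (\<exists>x\<in>K. \<exists>r>0.
        D = Fin ` {z\<in>K. v (z - x) < r} \<or> D = Fin ` {z\<in>K. v (z - x) \<le> r} \<or>
        D = P1_of K - Fin ` {z\<in>K. v (z - x) < r} \<or> D = P1_of K - Fin ` {z\<in>K. v (z - x) \<le> r})"

text \<open>An element of \<open>K(z)\<close> is given by a numerator and a denominator in lowest terms.\<close>

definition rational_over :: "'c::field set \<Rightarrow> 'c poly \<Rightarrow> 'c poly \<Rightarrow> bool" where
  "rational_over K f g \<longleftrightarrow> set (coeffs f) \<subseteq> K \<and> set (coeffs g) \<subseteq> K \<and> g \<noteq> 0 \<and> coprime f g"

definition rat_degree :: "'c::field poly \<Rightarrow> 'c poly \<Rightarrow> nat" where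
  "rat_degree f g = max (degree f) (degree g)"

fun rat_map :: "'c::field poly \<Rightarrow> 'c poly \<Rightarrow> 'c P1 \<Rightarrow> 'c P1" where
  "rat_map f g (Fin x) = (if poly g x = 0 then Infty else Fin (poly f x / poly g x))"
| "rat_map f g Infty =
     (let d = rat_degree f g
      in if coeff g d = 0 then Infty else Fin (coeff f d / coeff g d))"

text \<open>
  Derivatives are taken in the coordinate \<open>z\<close> near a finite point and \<open>1/z\<close> near infinity.
  The values \<open>coord_at (Fin a) Infty\<close> and \<open>coord_at Infty (Fin 0)\<close> are irrelevant: these points
  lie outside the domain of the respective coordinate.
\<close>

fun coord_at :: "'c::field P1 \<Rightarrow> 'c P1 \<Rightarrow> 'c" where
  "coord_at (Fin a) (Fin z) = z"
| "coord_at (Fin a) Infty = 0"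
| "coord_at Infty (Fin z) = inverse z"
| "coord_at Infty Infty = 0"

fun param_at :: "'c::field P1 \<Rightarrow> 'c \<Rightarrow> 'c P1" where
  "param_at (Fin a) t = Fin t"
| "param_at Infty t = (if t = 0 then Infty else Fin (inverse t))"

definition has_P1_derivative ::
    "('c::field \<Rightarrow> real) \<Rightarrow> ('c P1 \<Rightarrow> 'c P1) \<Rightarrow> 'c P1 \<Rightarrow> 'c \<Rightarrow> bool" where
  "has_P1_derivative v F a l \<longleftrightarrow>
     (let G = (\<lambda>t. coord_at (F a) (F (param_at a t))); t0 = coord_at a a
      in limitin (abs_topology v) (\<lambda>t. (G t - G t0) / (t - t0)) l (atin (abs_topology v) t0))"

definition critical_point :: "('c::field \<Rightarrow> real) \<Rightarrow> ('c P1 \<Rightarrow> 'c P1) \<Rightarrow> 'c P1 \<Rightarrow> bool" where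
  "critical_point v \<phi> x \<longleftrightarrow> has_P1_derivative v \<phi> x 0"

definition nonrepelling_periodic ::
    "('c::field \<Rightarrow> real) \<Rightarrow> ('c P1 \<Rightarrow> 'c P1) \<Rightarrow> 'c P1 \<Rightarrow> bool" where
  "nonrepelling_periodic v \<phi> x \<longleftrightarrow>
     (\<exists>n\<ge>1. (\<phi> ^^ n) x = x \<and> (\<exists>l. has_P1_derivative v (\<phi> ^^ n) x l \<and> v l \<le> 1))"

definition equicontinuous_iterates ::
    "('c::field \<Rightarrow> real) \<Rightarrow> ('c P1 \<Rightarrow> 'c P1) \<Rightarrow> 'c P1 set \<Rightarrow> bool" where
  "equicontinuous_iterates v \<phi> U \<longleftrightarrow>
     (\<forall>x\<in>U. \<forall>\<epsilon>>0. \<exists>\<delta>>0. \<forall>y\<in>U. spherical v x y < \<delta> \<longrightarrow>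
        (\<forall>n. spherical v ((\<phi> ^^ n) x) ((\<phi> ^^ n) y) < \<epsilon>))"

definition fatou :: "('c::field \<Rightarrow> real) \<Rightarrow> 'c set \<Rightarrow> ('c P1 \<Rightarrow> 'c P1) \<Rightarrow> 'c P1 set" where
  "fatou v L \<phi> = {x \<in> P1_of L.
     \<exists>U. openin (P1_topology v L) U \<and> x \<in> U \<and> equicontinuous_iterates v \<phi> U}"

definition julia :: "('c::field \<Rightarrow> real) \<Rightarrow> 'c set \<Rightarrow> ('c P1 \<Rightarrow> 'c P1) \<Rightarrow> 'c P1 set" where
  "julia v L \<phi> = P1_of L - fatou v L \<phi>"

definition eventually_periodic :: "('a \<Rightarrow> 'a) \<Rightarrow> 'a \<Rightarrow> bool" where
  "eventually_periodic \<phi> x \<longleftrightarrow> (\<exists>m n. n \<ge> 1 \<and> (\<phi> ^^ (m + n)) x = (\<phi> ^^ m) x)"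

definition sub_hyperbolic :: "('c::field \<Rightarrow> real) \<Rightarrow> ('c P1 \<Rightarrow> 'c P1) \<Rightarrow> bool" where
  "sub_hyperbolic v \<phi> \<longleftrightarrow>
     (\<forall>x. critical_point v \<phi> x \<and> x \<in> julia v UNIV \<phi> \<longrightarrow> eventually_periodic \<phi> x)"

definition grand_orbit :: "'c set \<Rightarrow> ('c P1 \<Rightarrow> 'c P1) \<Rightarrow> 'c P1 \<Rightarrow> 'c P1 set" where
  "grand_orbit K \<phi> x = {y \<in> P1_of K. \<exists>m n. (\<phi> ^^ m) y = (\<phi> ^^ n) x}"

definition crit_star :: "('c::field \<Rightarrow> real) \<Rightarrow> 'c set \<Rightarrow> ('c P1 \<Rightarrow> 'c P1) \<Rightarrow> 'c P1 set" where
  "crit_star v K \<phi> = {x \<in> julia v UNIV \<phi> \<inter> P1_of K. critical_point v \<phi> x}"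

definition julia_regular :: "('c::field \<Rightarrow> real) \<Rightarrow> 'c set \<Rightarrow> ('c P1 \<Rightarrow> 'c P1) \<Rightarrow> 'c P1 set" where
  "julia_regular v K \<phi> = julia v K \<phi> - (\<Union>x\<in>crit_star v K \<phi>. grand_orbit K \<phi> x)"

definition orbit :: "('a \<Rightarrow> 'a) \<Rightarrow> 'a \<Rightarrow> 'a set" where
  "orbit \<phi> x = {(\<phi> ^^ n) x |n. True}"

definition minimal_system :: "'a topology \<Rightarrow> ('a \<Rightarrow> 'a) \<Rightarrow> bool" where
  "minimal_system X \<phi> \<longleftrightarrow> (\<forall>x\<in>topspace X. X closure_of (orbit \<phi> x) = topspace X)"

definition decomposes_into_minimal :: "'a topology \<Rightarrow> ('a \<Rightarrow> 'a) \<Rightarrow> bool" where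
  "decomposes_into_minimal X \<phi> \<longleftrightarrow>
     (\<exists>\<Z>. partition_on (topspace X) \<Z> \<and>
        (\<forall>Z\<in>\<Z>. closedin X Z \<and> \<phi> ` Z \<subseteq> Z \<and> minimal_system (subtopology X Z) \<phi>))"

definition minimal_piece ::
    "('c::field \<Rightarrow> real) \<Rightarrow> 'c set \<Rightarrow> ('c P1 \<Rightarrow> 'c P1) \<Rightarrow> 'c P1 set \<Rightarrow> bool" where
  "minimal_piece v K \<phi> N \<longleftrightarrow>
     openin (P1_topology v K) N \<and> closedin (P1_topology v K) N \<and> \<phi> ` N \<subseteq> N \<and>
     (\<exists>\<D>. finite \<D> \<and> (\<forall>D\<in>\<D>. P1_disk v K D) \<and> N = \<Union>\<D>) \<and>
     decomposes_into_minimal (subtopology (P1_topology v K) N) \<phi>"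

definition periodic_basin ::
    "('c::field \<Rightarrow> real) \<Rightarrow> 'c set \<Rightarrow> ('c P1 \<Rightarrow> 'c P1) \<Rightarrow> 'c P1 \<Rightarrow> 'c P1 set" where
  "periodic_basin v K \<phi> y = {x \<in> P1_of K.
     \<forall>\<epsilon>>0. \<forall>\<^sub>F n in sequentially. \<exists>z\<in>orbit \<phi> y. spherical v ((\<phi> ^^ n) x) z < \<epsilon>}"

definition set_basin :: "'c set \<Rightarrow> ('c P1 \<Rightarrow> 'c P1) \<Rightarrow> 'c P1 set \<Rightarrow> 'c P1 set" where
  "set_basin K \<phi> N = {x \<in> P1_of K. \<exists>n. (\<phi> ^^ n) x \<in> N}"

text \<open>A countable discrete alphabet is, up to renaming of its letters, a subset of \<open>\<nat>\<close>.\<close>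

definition zero_one_matrix :: "nat set \<Rightarrow> (nat \<Rightarrow> nat \<Rightarrow> nat) \<Rightarrow> bool" where
  "zero_one_matrix S A \<longleftrightarrow> (\<forall>a\<in>S. \<forall>b\<in>S. A a b \<in> {0, 1})"

definition markov_shift :: "nat set \<Rightarrow> (nat \<Rightarrow> nat \<Rightarrow> nat) \<Rightarrow> (nat \<Rightarrow> nat) set" where
  "markov_shift S A = {a. (\<forall>i. a i \<in> S) \<and> (\<forall>i. A (a i) (a (Suc i)) = 1)}"

definition markov_topology :: "nat set \<Rightarrow> (nat \<Rightarrow> nat \<Rightarrow> nat) \<Rightarrow> (nat \<Rightarrow> nat) topology" where
  "markov_topology S A =
     subtopology (product_topology (\<lambda>_. discrete_topology S) UNIV) (markov_shift S A)"

definition left_shift :: "(nat \<Rightarrow> nat) \<Rightarrow> nat \<Rightarrow> nat" where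
  "left_shift a = (\<lambda>i. a (Suc i))"

definition conjugate_via ::
    "'a topology \<Rightarrow> ('a \<Rightarrow> 'a) \<Rightarrow> 'b topology \<Rightarrow> ('b \<Rightarrow> 'b) \<Rightarrow> ('a \<Rightarrow> 'b) \<Rightarrow> bool" where
  "conjugate_via X \<phi> Y \<psi> h \<longleftrightarrow>
     homeomorphic_map X Y h \<and> (\<forall>x\<in>topspace X. h (\<phi> x) = \<psi> (h x))"

end

theory Submission
  imports Defs
begin

text \<open>
  Dynamics and arithmetic are separated. The dynamical part concerns a self-map of a compact
  ultrametric space that near every point \<open>z\<close> acts on distances from \<open>z\<close> as a power and, at every
  nearby point, is an exact similarity on a ball of radius proportional to the distance from \<open>z\<close>;
  moreover a finite forward invariant set \<open>Q\<close> is given (the orbits of the critical points in the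
  Julia set) whose periodic points are repelling. Measuring radii relative to a gauge \<open>g\<close> that
  vanishes exactly on \<open>Q\<close> and is adapted to the multiplicities makes the derivative \<open>1\<close> near \<open>Q\<close>, so
  that an orbit avoiding \<open>Q\<close> is controlled by the products \<open>S n\<close> of its scaled derivatives.
  If these are bounded, the pigeonhole principle gives a ball that an iterate maps into itself by a
  contraction or by an isometry: the point is attracted to a non-repelling cycle or enters a minimal
  piece. If they are unbounded, the point lies in the Julia set, and the balls on which all iterates
  up to the next minimum of \<open>S\<close> are similarities form a countable Markov partition.

  For a rational map the local form follows from divided differences. Fatou critical points are
  contracting by a Schwarz lemma: over the algebraically closed field the maximum principle holds
  because some point of a sphere is far from all zeros of a given polynomial. A ball on which an
  iterate is isometric contains finitely many periodic points, since a further iterate is so close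
  to the identity that all periodic points are fixed, and an iterate has finitely many fixed points.
\<close>

section \<open>Similarities of compact ultrametric spaces\<close>

text \<open>The obstacle is a critical point in the Julia set: the derivative tends to 0 there.
  Measured relative to the distance from it, a map of local degree m multiplies by |m| alone, and
  |m| < 1 is possible (wild ramification); so the gauge carries weights along the orbits in
  \<open>Q\<close> that absorb these factors. The weights are consistent because a cycle in
  \<open>Q\<close> contains no critical point. \<open>Q\<close> comes from the Julia set over the
  algebraically closed field, since the Schwarz lemma needs all zeros of a polynomial and hence a
  Fatou point over that field. Points whose orbit meets \<open>Q\<close> have no itinerary in balls
  that avoid \<open>Q\<close>; only a bijection is demanded there and they are countably many, so
  each gets a letter of its own with a loop. Non-repelling periodic points may lie inside sets that
  decompose into minimal ones; as P and M must be disjoint, M consists of the pieces that avoid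
  these points, and every larger piece is exhausted by such pieces up to finitely many
  points.\<close>

locale ultra_space = Metric_space M d for M :: "'a set" and d :: "'a => 'a => real" +
 assumes ultra: "[|x \<in> M; y \<in> M; z \<in> M|] ==> d x z <= max (d x y) (d y z)"
  and compact_M: "compact_space mtopology"
begin

lemma isosceles: "[|x \<in> M; y \<in> M; z \<in> M; d x y < d x z|] ==> d y z = d x z"
 using ultra[of x y z] ultra[of y x z] commute[of y x] by linarith

lemma mcball_eq: "y \<in> mcball x r ==> mcball y r = mcball x r"
proof -
 assume a: "y \<in> mcball x r"
 have "d x z <= r" if "z \<in> M" "d y z <= r" for z
  using ultra[of x y z] a that by auto
 moreover have "d y z <= r" if "z \<in> M" "d x z <= r" for z
  using ultra[of y x z] a that by (auto simp: commute)
 ultimately show ?thesis using a by auto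
qed

lemma mcball_subset_ultra: "y \<in> mcball x r ==> r' <= r ==> mcball y r' \<subseteq> mcball x r"
 using mcball_eq[of y x r] mcball_subset_concentric[of r' r y] by auto

lemma openin_mcball: "0 < r ==> openin mtopology (mcball x r)"
 unfolding openin_mtopology_mcball using mcball_eq mcball_subset_mspace by blast

lemma cover:
 assumes "closedin mtopology E" "!!z. z \<in> E ==> 0 < \<rho> z"
 obtains F where "finite F" "F \<subseteq> E" "E \<subseteq> (\<Union>z\<in>F. mcball z (\<rho> z))"
proof -
 have E: "compactin mtopology E" "E \<subseteq> M"
  using assms(1) compact_M closedin_compact_space closedin_metric by blast+
 have "E \<subseteq> \<Union>((%z. mcball z (\<rho> z)) ` E)"
  using E assms(2) by (force intro: less_imp_le)
 moreover have "openin mtopology U" if "U \<in> (%z. mcball z (\<rho> z)) ` E" for U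
  using that openin_mcball assms(2) by auto
 ultimately obtain \<F> where \<F>: "finite \<F>" "\<F> \<subseteq> (%z. mcball z (\<rho> z)) ` E" "E \<subseteq> \<Union>\<F>"
  using compactinD[OF E(1)] by metis
 then obtain F where F: "F \<subseteq> E" "finite F" "\<F> = (%z. mcball z (\<rho> z)) ` F"
  using finite_subset_image[OF \<F>(1,2)] by blast
 show ?thesis by (rule that[of F]) (use F \<F> in simp_all)
qed

text \<open>The local constants of a finite subcover have a positive minimum, and \<open>Pr\<close>
  persists when its constant shrinks. Used for radii inside clopen sets, for the relative radius of
  the gauge and for the lower bound on the products \<open>S\<close>.\<close>

lemma uniform_bound:
 assumes "closedin mtopology E"
  and "!!z. z \<in> E ==> EX r>0. EX c>0. ALL x:mcball z r. Pr c x"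
  and mono: "!!x c c'. Pr c x ==> 0 < c' ==> c' <= c ==> Pr c' x"
 shows "EX c>0::real. ALL x:E. Pr c x"
proof -
 obtain r c where rc: "!!z. z \<in> E ==> 0 < r z" "!!z. z \<in> E ==> 0 < c z"
   "!!z x. z \<in> E ==> x \<in> mcball z (r z) ==> Pr (c z) x"
  using assms(2) by metis
 obtain F where F: "finite F" "F \<subseteq> E" "E \<subseteq> (\<Union>z\<in>F. mcball z (r z))"
  using cover[OF assms(1), of r] rc(1) by metis
 \<comment> \<open>The 1 keeps \<open>Min\<close> meaningful when the cover is empty.\<close>
 define c0 where "c0 = Min (insert 1 (c ` F))"
 have "c0 > 0" using F rc(2) unfolding c0_def by (subst Min_gr_iff) auto
 moreover have "Pr c0 x" if xE: "x \<in> E" for x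
 proof -
  obtain z where z: "z \<in> F" "x \<in> mcball z (r z)" using F(3) xE by blast
  have "c0 <= c z" unfolding c0_def using z F by (auto intro!: Min_le)
  thus ?thesis using mono[OF rc(3)[of z x], of c0] z F \<open>c0 > 0\<close> by auto
 qed
 ultimately show ?thesis by blast
qed

text \<open>Two closed balls of equal radius are equal or disjoint, so the members of a finite cover
  by such balls are all there are.\<close>

lemma finite_mcballs:
 assumes "0 < r" shows "finite ((%x. mcball x r) ` M)"
proof -
 obtain F where F: "finite F" "F \<subseteq> M" "M \<subseteq> (\<Union>z\<in>F. mcball z r)"
  using cover[of M "%_. r"] assms closedin_topspace[of mtopology] by auto
 have "(%x. mcball x r) ` M \<subseteq> (%x. mcball x r) ` F"
 proof
  fix A assume "A \<in> (%x. mcball x r) ` M"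
  then obtain x where "x \<in> M" "A = mcball x r" by blast
  moreover obtain z where "z \<in> F" "x \<in> mcball z r" using F(3) calculation by blast
  ultimately show "A \<in> (%x. mcball x r) ` F" using mcball_eq by blast
 qed
 thus ?thesis using F(1) finite_subset by blast
qed

lemma infinite_same_ball:
 assumes "infinite A" "0 < r" "!!n. n \<in> A ==> f n \<in> M"
 obtains c where "c \<in> M" "infinite {n \<in> A. f n \<in> mcball c r}"
proof -
 have "finite ((%n. mcball (f n) r) ` A)"
  by (rule finite_subset[OF _ finite_mcballs[OF assms(2)]]) (use assms(3) in auto)
 from pigeonhole_infinite[OF assms(1) this] obtain a where
  a: "a \<in> A" "infinite {n \<in> A. mcball (f n) r = mcball (f a) r}" by blast
 have "{n \<in> A. mcball (f n) r = mcball (f a) r} \<subseteq> {n \<in> A. f n \<in> mcball (f a) r}"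
 proof
  fix n assume n: "n \<in> {n \<in> A. mcball (f n) r = mcball (f a) r}"
  hence "n \<in> A" by blast
  hence "f n \<in> mcball (f n) r" using assms(2) assms(3)[of n] by simp
  hence "f n \<in> mcball (f a) r" using n by blast
  thus "n \<in> {n \<in> A. f n \<in> mcball (f a) r}" using n by blast
 qed
 hence "infinite {n \<in> A. f n \<in> mcball (f a) r}" using a(2) infinite_super by blast
 thus ?thesis using that[of "f a"] a(1) assms(3) by blast
qed

lemma convergent_subseq:
 assumes "!!n. \<sigma> n \<in> M"
 obtains l r where "l \<in> M" "strict_mono (r::nat=>nat)" "!!\<epsilon>. \<epsilon> > 0 ==> EX N. ALL n>=N. d (\<sigma> (r n)) l < \<epsilon>"
proof -
 obtain l r where "l \<in> M" "strict_mono r" "limitin mtopology (\<sigma> \<circ> r) l sequentially"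
  using compact_M assms unfolding compact_space_sequentially by blast
 thus ?thesis using that[of l r] by (force simp: limit_metric_sequentially)
qed

lemma closure_of_iff:
 "x \<in> mtopology closure_of A \<longleftrightarrow> x \<in> M & (ALL e>0. EX y:A. y \<in> M & d x y < e)"
 unfolding metric_closure_of by auto

lemma closedin_seq:
 assumes "closedin mtopology A" "!!e. e > 0 ==> EX y:A. d x y < e" "x \<in> M"
 shows "x \<in> A"
proof -
 have "x \<in> mtopology closure_of A"
  using assms closedin_metric unfolding closure_of_iff by blast
 thus ?thesis using assms(1) closure_of_closedin by blast
qed

text \<open>The radii run through a sequence so that clopen sets can be counted, and they stay below
  1 because \<open>disk_mcball\<close> recognises such balls as disks.\<close>

lemma clopen_mcballs:
 assumes "openin mtopology N" "closedin mtopology N"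
 obtains n where "N = \<Union>((%x. mcball x (1 / real (n + 2))) ` N)"
proof -
 have "EX r>0. EX c>0. ALL x:mcball z r. mcball x c \<subseteq> N" if z: "z \<in> N" for z
 proof -
  obtain r where "r > 0" "mcball z r \<subseteq> N"
   using assms(1) z unfolding openin_mtopology_mcball by blast
  moreover from this have "ALL x:mcball z r. mcball x r \<subseteq> N" using mcball_eq by blast
  ultimately show ?thesis by blast
 qed
 hence "EX c>0. ALL x:N. mcball x c \<subseteq> N"
  by (rule uniform_bound[OF assms(2)]) (use mcball_subset_concentric in blast)+
 then obtain c where c: "c > 0" "ALL x:N. mcball x c \<subseteq> N" by blast
 obtain n where "inverse (real (Suc n)) < c" using c(1) reals_Archimedean by blast
 hence "1 / real (n + 2) <= c" using c(1) by (simp add: field_simps)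
 hence "mcball x (1 / real (n + 2)) \<subseteq> N" if "x \<in> N" for x
  using c(2) mcball_subset_concentric that by (meson subset_trans)
 moreover have "x \<in> mcball x (1 / real (n + 2))" if "x \<in> N" for x
  using that closedin_subset[OF assms(2)] by auto
 ultimately have "N = \<Union>((%x. mcball x (1 / real (n + 2))) ` N)"
  by blast
 thus ?thesis using that by blast
qed

lemma countable_clopen: "countable {N. openin mtopology N & closedin mtopology N}"
proof -
 let ?B = "%n. (%x. mcball x (1 / real (n + 2))) ` M"
 have "{N. openin mtopology N & closedin mtopology N} \<subseteq> (\<Union>n. Union ` Pow (?B n))"
 proof
  fix N assume "N \<in> {N. openin mtopology N & closedin mtopology N}"
  hence N: "openin mtopology N" "closedin mtopology N" by auto
  obtain n where n: "N = \<Union>((%x. mcball x (1 / real (n + 2))) ` N)"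
   by (rule clopen_mcballs[OF N])
  have "(%x. mcball x (1 / real (n + 2))) ` N \<in> Pow (?B n)"
   using closedin_subset[OF N(2)] by auto
  with n show "N \<in> (\<Union>n. Union ` Pow (?B n))" by blast
 qed
 moreover have c: "countable (Union ` Pow (?B n))" for n
 proof -
  have "finite (Pow (?B n))" using finite_mcballs[of "1 / real (n + 2)"] by simp
  thus ?thesis by (simp add: countable_finite)
 qed
 moreover have "countable (\<Union>n. Union ` Pow (?B n))" by (rule countable_UN[OF countableI_type c])
 ultimately show ?thesis by (metis (no_types, lifting) countable_subset)
qed

text \<open>The last clause asks for the whole image ball: scaling of distances gives injectivity
  only, whereas inverse branches and the Markov property require surjectivity.\<close>

definition exact :: "('a => 'a) => 'a => real => real => bool" where
 "exact F x r s \<longleftrightarrow> 0 < s & F x \<in> M &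
   (ALL y:mcball x r. ALL y':mcball x r. d (F y) (F y') = s * d y y') &
   F ` mcball x r = mcball (F x) (s * r)"

lemma exactD:
 assumes "exact F x r s"
 shows "0 < s" "F x \<in> M"
  "!!y y'. y \<in> mcball x r ==> y' \<in> mcball x r ==> d (F y) (F y') = s * d y y'"
  "!!y. y \<in> mcball x r ==> F y \<in> mcball (F x) (s * r)"
  "F ` mcball x r = mcball (F x) (s * r)"
 using assms unfolding exact_def by auto

lemma exact_sub:
 assumes e: "exact F x r s" and y: "y \<in> mcball x r" and "r' <= r"
 shows "exact F y r' s"
proof -
 note D = exactD[OF e]
 have sub: "mcball y r' \<subseteq> mcball x r" using mcball_subset_ultra[OF y assms(3)] .
 have Fy: "F y \<in> mcball (F x) (s * r)" by (rule D(4)[OF y])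
 have "F ` mcball y r' = mcball (F y) (s * r')"
 proof
  show "F ` mcball y r' \<subseteq> mcball (F y) (s * r')"
  proof
   fix w assume "w \<in> F ` mcball y r'"
   then obtain u where u: "u \<in> mcball y r'" "w = F u" by blast
   hence "d (F y) (F u) = s * d y u" using D(3)[OF y, of u] sub by blast
   moreover have "F u \<in> M" using D(4)[of u] sub u by auto
   ultimately show "w \<in> mcball (F y) (s * r')" using u D(1) Fy by auto
  qed
  show "mcball (F y) (s * r') \<subseteq> F ` mcball y r'"
  proof
   fix w assume w: "w \<in> mcball (F y) (s * r')"
   have "s * r' <= s * r" using assms(3) D(1) by simp
   hence "w \<in> mcball (F x) (s * r)" using w mcball_subset_ultra[OF Fy] by blast
   then obtain u where u: "u \<in> mcball x r" "w = F u" using D(5) by blast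
   have "d (F y) (F u) = s * d y u" using D(3)[OF y u(1)] .
   hence "s * d y u <= s * r'" using w u by auto
   hence "d y u <= r'" using D(1) by simp
   thus "w \<in> F ` mcball y r'" using u y by auto
  qed
 qed
 thus ?thesis unfolding exact_def using D sub Fy by (simp add: subset_iff)
qed

lemma exact_comp:
 assumes F: "exact F x r s" and G: "exact G (F x) (s * r) s'"
 shows "exact (G \<circ> F) x r (s' * s)"
proof -
 note D = exactD[OF F] and E = exactD[OF G]
 have "(G \<circ> F) ` mcball x r = mcball (G (F x)) (s' * s * r)"
  using D(5) E(5) by (simp only: image_comp[symmetric] o_apply mult.assoc)
 thus ?thesis unfolding exact_def using D E by (auto simp del: in_mcball)
qed

lemma exact_id: "x \<in> M ==> exact id x r 1" "x \<in> M ==> exact (%x. x) x r 1"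
 unfolding exact_def by auto

lemma exact_surj:
 assumes "exact F x r s" "w \<in> mcball (F x) (s * r)"
 obtains u where "u \<in> mcball x r" "F u = w"
 using exactD(5)[OF assms(1)] assms(2) by (metis imageE)

text \<open>For the rational map on the projective line over \<open>K\<close> these turn out to be
  its critical points, see \<open>critset_iff\<close>.\<close>

definition critset :: "('a => 'a) => 'a set" where
 "critset F = {z \<in> M. ~ (EX r>0. EX s. exact F z r s)}"

lemma finite_critset:
 assumes "!!z. z \<in> M ==> EX r>0. ALL x:M. 0 < d z x & d z x <= r --> (EX k>0. EX s. exact F x k s)"
 shows "finite (critset F)"
proof -
 have "EX r>0. mcball z r \<inter> critset F \<subseteq> {z}" if z: "z \<in> M" for z
 proof -
  obtain r where r: "r > 0" "!!x. x \<in> M ==> 0 < d z x ==> d z x <= r ==> EX k>0. EX s. exact F x k s"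
   using assms[OF z] by blast
  have "x ~: critset F" if "x \<in> mcball z r" "x ~= z" for x
  proof -
   have "0 < d z x" "x \<in> M" "d z x <= r" using that by auto
   thus ?thesis using r(2) unfolding critset_def by blast
  qed
  thus ?thesis using r(1) by blast
 qed
 then obtain \<rho> where \<rho>: "!!z. z \<in> M ==> 0 < \<rho> z" "!!z. z \<in> M ==> mcball z (\<rho> z) \<inter> critset F \<subseteq> {z}" by metis
 have "closedin mtopology M" by blast
 from cover[OF this, of \<rho>] \<rho>(1) obtain S where S: "finite S" "S \<subseteq> M" "M \<subseteq> (\<Union>z\<in>S. mcball z (\<rho> z))" by blast
 have "critset F \<subseteq> S"
 proof
  fix x assume x: "x \<in> critset F"
  hence "x \<in> M" unfolding critset_def by blast
  then obtain z where "z \<in> S" "x \<in> mcball z (\<rho> z)" using S(3) by blast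
  thus "x \<in> S" using \<rho>(2)[of z] x S(2) by blast
 qed
 thus ?thesis using S(1) finite_subset by blast
qed

end

section \<open>Maps with local power behaviour\<close>

text \<open>Kept free of compactness, since it is also instantiated on the projective line over the
  whole field, to obtain forward invariance of the Julia set there.\<close>

locale metric_dyn = Metric_space M d for M :: "'a set" and d :: "'a => 'a => real" +
 fixes T :: "'a => 'a"
 assumes maps: "x \<in> M ==> T x \<in> M"
  and cont: "[|x \<in> M; 0 < e|] ==> EX \<delta>>0. ALL y:M. d x y < \<delta> --> d (T x) (T y) < e"
begin

definition equi :: "'a set => bool" where
 "equi U \<longleftrightarrow> (ALL x:U. ALL \<epsilon>>0. EX \<delta>>0. ALL y:U. d x y < \<delta> --> (ALL n. d ((T ^^ n) x) ((T ^^ n) y) < \<epsilon>))"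

definition Fat :: "'a set" where
 "Fat = {x \<in> M. EX U. openin mtopology U & x \<in> U & equi U}"

definition Jul :: "'a set" where "Jul = M - Fat"

lemma Jul_subset: "Jul \<subseteq> M" unfolding Jul_def by blast

lemma Jul_I:
 assumes "x \<in> M" "0 < \<epsilon>" "!!r. 0 < r ==> EX y:mcball x r. EX n. \<epsilon> <= d ((T ^^ n) x) ((T ^^ n) y)"
 shows "x \<in> Jul"
proof (rule ccontr)
 assume "x ~: Jul"
 then obtain U where U: "openin mtopology U" "x \<in> U" "equi U"
  using assms(1) unfolding Jul_def Fat_def by blast
 obtain r where r: "r > 0" "mcball x r \<subseteq> U" using U(1,2) unfolding openin_mtopology_mcball by blast
 obtain \<delta> where \<delta>: "\<delta> > 0" "ALL y:U. d x y < \<delta> --> (ALL n. d ((T ^^ n) x) ((T ^^ n) y) < \<epsilon>)"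
  using U(2,3) assms(2) unfolding equi_def by blast
 obtain y n where y: "y \<in> mcball x (min r (\<delta>/2))" "\<epsilon> <= d ((T ^^ n) x) ((T ^^ n) y)"
  using assms(3)[of "min r (\<delta>/2)"] r \<delta> by auto
 have "y \<in> mcball x r" "d x y < \<delta>" using y(1) \<delta>(1) by auto
 hence "d ((T ^^ n) x) ((T ^^ n) y) < \<epsilon>" using \<delta>(2) r(2) by blast
 thus False using y(2) by simp
qed

lemma openin_Fat: "openin mtopology Fat"
proof -
 have "Fat = \<Union>{U. openin mtopology U & equi U}"
  unfolding Fat_def using openin_subset[of mtopology] by auto
 moreover have "openin mtopology (\<Union>{U. openin mtopology U & equi U})" by blast
 ultimately show ?thesis by simp
qed

lemma closedin_Jul: "closedin mtopology Jul"
 unfolding Jul_def using openin_Fat by (metis closedin_diff closedin_topspace topspace_mtopology)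

text \<open>Equicontinuity on \<open>U\<close> passes to its preimage with indices shifted by one.
  Bounding \<open>d y z\<close> by \<open>\<epsilon>\<close> as well takes care of the iterate 0,
  which the shift does not reach.\<close>

lemma Fat_backward:
 assumes "x \<in> M" "T x \<in> Fat" shows "x \<in> Fat"
proof -
 obtain U where U: "openin mtopology U" "T x \<in> U" "equi U" using assms(2) unfolding Fat_def by blast
 define V where "V = {y \<in> M. T y \<in> U}"
 have "openin mtopology V" unfolding openin_mtopology
 proof (intro conjI allI impI)
  show "V \<subseteq> M" unfolding V_def by blast
  fix y assume y: "y \<in> V"
  then obtain e where e: "e > 0" "mball (T y) e \<subseteq> U" using U(1) unfolding V_def openin_mtopology by blast
  obtain \<delta> where "\<delta> > 0" "ALL z:M. d y z < \<delta> --> d (T y) (T z) < e"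
   using cont[of y e] y e(1) unfolding V_def by blast
  hence "z \<in> V" if "z \<in> mball y \<delta>" for z
  proof -
   have "T z \<in> mball (T y) e" using \<open>ALL z:M. _ z\<close> that maps by auto
   thus ?thesis using e(2) that unfolding V_def by auto
  qed
  hence "mball y \<delta> \<subseteq> V" by blast
  thus "EX r>0. mball y r \<subseteq> V" using \<open>\<delta> > 0\<close> by blast
 qed
 moreover have "equi V" unfolding equi_def
 proof (intro ballI allI impI)
  fix y and \<epsilon> :: real assume y: "y \<in> V" and e: "\<epsilon> > 0"
  obtain \<delta> where \<delta>: "\<delta> > 0" "ALL w:U. d (T y) w < \<delta> --> (ALL n. d ((T ^^ n) (T y)) ((T ^^ n) w) < \<epsilon>)"
   using U(3) y e unfolding equi_def V_def by blast
  obtain \<delta>' where \<delta>': "\<delta>' > 0" "ALL z:M. d y z < \<delta>' --> d (T y) (T z) < \<delta>"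
   using cont[of y \<delta>] y \<delta>(1) unfolding V_def by blast
  have "d ((T ^^ n) y) ((T ^^ n) z) < \<epsilon>" if z: "z \<in> V" "d y z < min \<epsilon> \<delta>'" for z n
  proof (cases n)
   case 0 thus ?thesis using z by simp
  next
   case (Suc k)
   have "d (T y) (T z) < \<delta>" using \<delta>'(2) z unfolding V_def by simp
   hence "d ((T ^^ k) (T y)) ((T ^^ k) (T z)) < \<epsilon>" using \<delta>(2) z unfolding V_def by simp
   thus ?thesis using Suc by (simp only: funpow_Suc_right o_apply)
  qed
  thus "EX \<delta>>0. ALL z:V. d y z < \<delta> --> (ALL n. d ((T ^^ n) y) ((T ^^ n) z) < \<epsilon>)"
   using e \<delta>'(1) by (intro exI[of _ "min \<epsilon> \<delta>'"]) auto
 qed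
 moreover have "x \<in> V" using assms(1) U(2) unfolding V_def by blast
 ultimately show ?thesis unfolding Fat_def using assms(1) by blast
qed

lemma Jul_forward: "x \<in> Jul ==> (T ^^ n) x \<in> Jul"
 by (induction n) (use Fat_backward maps in "auto simp: Jul_def")

end

text \<open>In the intended instance of \<open>local_form\<close>, \<open>m\<close> is the local
  degree and \<open>mu\<close> the absolute value of the integer \<open>m\<close>: at distance u
  from \<open>z\<close> the derivative is \<open>mu * a * u^(m-1)\<close>, valid on a ball whose
  radius is proportional to u. \<open>power_form\<close> speaks of all iterates, also through
  critical points. The last two assumptions are the arithmetic input: contraction at critical points
  outside \<open>Q\<close>, and finitely many periodic points in isometric return balls.\<close>

locale ultra_dyn = ultra_space M d + metric_dyn M d T
 for M :: "'a set" and d :: "'a => 'a => real" and T +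
 fixes Q :: "'a set"
 assumes perfect: "EX q>1. ALL x:M. ALL r. 0 < r & r <= 1 --> (EX y:M. r / q <= d x y & d x y <= r)"
  and local_form: "z \<in> M ==> EX r>0. EX a>0. EX m k mu. 1 <= m & 0 < k & k < 1 & 0 < mu &
    (ALL x:M. 0 < d z x & d z x <= r --> d (T z) (T x) = a * d z x ^ m &
      exact T x (k * d z x) (mu * a * d z x ^ (m - 1))) &
    (m = 1 --> mu = 1 & exact T z r a)"
  and power_form: "x \<in> M ==> EX r>0. EX a>0. EX m>=1. ALL y:M. d x y <= r -->
    d ((T ^^ n) x) ((T ^^ n) y) = a * d x y ^ m"
  and finite_fiber: "finite {x \<in> M. T x = q}"
  and finite_Q: "finite Q" and Q_subset: "Q \<subseteq> M" and Q_invariant: "z \<in> Q ==> T z \<in> Q"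
  and Q_noncrit: "[|z \<in> Q; 1 <= n; (T ^^ n) z = z|] ==> z ~: critset T"
  and Q_repelling: "[|z \<in> Q; 1 <= n; (T ^^ n) z = z|] ==>
    EX r>0. EX l>1. ALL x:mcball z r. d z ((T ^^ n) x) = l * d z x"
  and fatou_crit: "z \<in> critset T - Q ==> EX t>0. EX \<eta><1. ALL n>=1. ALL x:mcball z t. ALL y:mcball z t.
    d ((T ^^ n) x) ((T ^^ n) y) <= \<eta> * d x y"
  and isometry_periodic: "[|x \<in> M; 0 < R; R < 1; 1 <= n; exact (T ^^ n) x R 1; (T ^^ n) x \<in> mcball x R|]
    ==> finite {y \<in> mcball x R. EX k>=1. (T ^^ k) y = y}"
begin

lemma iter_in_M: "x \<in> M ==> (T ^^ n) x \<in> M"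
 by (induction n) (auto simp: maps)

lemma iter_Q: "x \<in> Q ==> (T ^^ n) x \<in> Q"
 by (induction n) (auto simp: Q_invariant)

lemma other_point:
 assumes "x \<in> M" "0 < r"
 obtains y where "y \<in> M" "y ~= x" "0 < d x y" "d x y <= r"
proof -
 obtain q where q: "q > 1" "ALL x:M. ALL r. 0 < r & r <= 1 --> (EX y:M. r / q <= d x y & d x y <= r)"
  using perfect by blast
 have "0 < min r 1 & min r 1 <= 1" using assms by auto
 then obtain y where y: "y \<in> M" "min r 1 / q <= d x y" "d x y <= min r 1" using q(2) assms(1) by blast
 have "0 < min r 1 / q" using assms q(1) by simp
 hence "0 < d x y" using y(2) by linarith
 thus ?thesis using that[of y] y assms(1) by auto
qed

lemma infinite_mcball:
 assumes "x \<in> M" "0 < r" shows "infinite (mcball x r)"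
proof
 assume fin: "finite (mcball x r)"
 define e where "e = Min (insert r (d x ` (mcball x r - {x})))"
 have "e > 0" unfolding e_def using fin assms by (subst Min_gr_iff) (auto simp: mdist_pos_less)
 then obtain y where y: "y \<in> M" "y ~= x" "0 < d x y" "d x y <= e / 2"
  using other_point[of x "e/2"] assms by auto
 have "e <= r" unfolding e_def using fin by (intro Min_le) auto
 hence "y \<in> mcball x r - {x}" using y \<open>e > 0\<close> assms by auto
 hence "e <= d x y" unfolding e_def using fin by (intro Min_le) auto
 thus False using y \<open>e > 0\<close> by simp
qed

abbreviation "crit \<equiv> critset T"

definition der :: "'a => real" where "der x = (THE s. EX r>0. exact T x r s)"

text \<open>A point other than \<open>x\<close> that lies in both balls determines the factor; such
  points exist arbitrarily close to \<open>x\<close>. This makes \<open>der\<close> well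
  defined.\<close>

lemma exact_unique:
 assumes "x \<in> M" "exact F x r s" "exact F x r' s'" "0 < r" "0 < r'"
 shows "s = s'"
proof -
 obtain y where y: "y \<in> M" "y ~= x" "0 < d x y" "d x y <= min r r'"
  using other_point[of x "min r r'"] assms by auto
 hence "d (F x) (F y) = s * d x y" "d (F x) (F y) = s' * d x y"
  using exactD(3)[OF assms(2), of x y] exactD(3)[OF assms(3), of x y] assms by auto
 thus ?thesis using y by simp
qed

lemma der_eq: "x \<in> M ==> 0 < r ==> exact T x r s ==> der x = s"
 unfolding der_def by (rule the_equality) (use exact_unique in blast)+

lemma noncrit_exact:
 assumes "x \<in> M" "x ~: crit"
 obtains r where "0 < r" "exact T x r (der x)"
 using assms der_eq unfolding critset_def by blast

lemma finite_crit: "finite crit"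
proof (rule finite_critset)
 fix z assume "z \<in> M"
 thus "EX r>0. ALL x:M. 0 < d z x & d z x <= r --> (EX k>0. EX s. exact T x k s)"
  using local_form[of z] by (metis mult_pos_pos)
qed

lemma Q_eventually_periodic:
 assumes "z \<in> Q" obtains k n where "1 <= n" "(T ^^ n) ((T ^^ k) z) = (T ^^ k) z"
proof -
 have "finite (range (%i. (T ^^ i) z))" using iter_Q[OF assms] finite_Q by (meson finite_subset image_subsetI)
 hence "~ inj (%i. (T ^^ i) z)" using finite_imageD infinite_UNIV_nat by blast
 then obtain i j where "i < j" "(T ^^ i) z = (T ^^ j) z" unfolding inj_def by (metis linorder_neqE_nat)
 hence "(T ^^ (j - i)) ((T ^^ i) z) = (T ^^ i) z"
  by (metis funpow_add o_apply le_add_diff_inverse2 less_imp_le)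
 thus ?thesis using that[of "j - i" i] \<open>i < j\<close> by simp
qed

text \<open>The distance to \<open>z\<close> is multiplied by \<open>l\<close> per period as long as
  it stays within \<open>r\<close>, so it exceeds \<open>r\<close> at some time. The clause
  \<open>(T ^^ i) z = z\<close> records that this happens at a return time of \<open>z\<close>,
  which a later comparison with the orbit of \<open>z\<close> requires.\<close>

lemma repelled:
 assumes "z \<in> Q" "1 <= n" "(T ^^ n) z = z"
 shows "EX r>0. ALL w:M. w ~= z --> (EX i. r < d z ((T ^^ i) w) & (T ^^ i) z = z)"
proof -
 obtain r l where r: "r > 0" "l > 1" "ALL x:mcball z r. d z ((T ^^ n) x) = l * d z x"
  using Q_repelling[OF assms] by blast
 have zM: "z \<in> M" using assms(1) Q_subset by blast
 have per: "(T ^^ (n * i)) z = z" for i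
  by (induction i) (use assms(3) in "auto simp: funpow_add")
 have "EX i. r < d z ((T ^^ (n * i)) w)" if w: "w \<in> M" "w ~= z" for w
 proof (rule ccontr)
  assume "~ ?thesis"
  hence small: "d z ((T ^^ (n * i)) w) <= r" for i by (meson not_le)
  have grow: "d z ((T ^^ (n * i)) w) = l ^ i * d z w" for i
  proof (induction i)
   case (Suc i)
   have "(T ^^ (n * Suc i)) w = (T ^^ n) ((T ^^ (n * i)) w)" by (simp add: funpow_add)
   moreover have "(T ^^ (n * i)) w \<in> mcball z r" using small[of i] iter_in_M w zM by simp
   ultimately show ?case using r(3) Suc by simp
  qed simp
  have "0 < d z w" using w zM by auto
  moreover obtain i where "r / d z w < l ^ i" using real_arch_pow[OF r(2)] by blast
  ultimately have "r < l ^ i * d z w" by (simp add: field_simps)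
  thus False using small[of i] grow[of i] by simp
 qed
 thus ?thesis using r(1) per by metis
qed

text \<open>The power form of the iterate sends points near \<open>x\<close>, other than
  \<open>x\<close>, close to a repelling periodic point without hitting it; from there they are
  pushed a fixed distance away.\<close>

lemma hits_Q_Jul:
 assumes "x \<in> M" "(T ^^ k) x \<in> Q" shows "x \<in> Jul"
proof -
 obtain j n where n: "1 <= n" "(T ^^ n) ((T ^^ j) ((T ^^ k) x)) = (T ^^ j) ((T ^^ k) x)"
  using Q_eventually_periodic[OF assms(2)] by metis
 define z where "z = (T ^^ (j + k)) x"
 have z: "z \<in> Q" "(T ^^ n) z = z" unfolding z_def funpow_add o_apply using n iter_Q assms(2) by auto
 obtain r where r: "r > 0" "ALL w:M. w ~= z --> (EX i. r < d z ((T ^^ i) w) & (T ^^ i) z = z)"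
  using repelled[OF z(1) n(1) z(2)] by blast
 obtain \<rho> a m where \<rho>: "\<rho> > 0" "a > 0" "m >= 1"
  "ALL y:M. d x y <= \<rho> --> d ((T ^^ (j + k)) x) ((T ^^ (j + k)) y) = a * d x y ^ m"
  using power_form[OF assms(1), of "j + k"] by blast
 show ?thesis
 proof (rule Jul_I[OF assms(1) r(1)])
  fix e :: real assume "e > 0"
  then obtain y where y: "y \<in> M" "y ~= x" "0 < d x y" "d x y <= min e \<rho>"
   using other_point[OF assms(1), of "min e \<rho>"] \<rho>(1) by auto
  have "0 < d z ((T ^^ (j + k)) y)" unfolding z_def using \<rho> y by auto
  hence "(T ^^ (j + k)) y ~= z" using z(1) Q_subset by auto
  then obtain i where "r < d z ((T ^^ i) ((T ^^ (j + k)) y))" "(T ^^ i) z = z"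
   using r(2) iter_in_M[OF y(1)] by blast
  hence "r <= d ((T ^^ (i + (j + k))) x) ((T ^^ (i + (j + k))) y)"
   unfolding funpow_add[of i "j + k"] o_apply by (simp add: z_def)
  thus "EX y:mcball x e. EX n. r <= d ((T ^^ n) x) ((T ^^ n) y)" using y assms(1) by auto
 qed
qed

lemma Q_Jul: "Q \<subseteq> Jul"
 using hits_Q_Jul[of _ 0] Q_subset by auto

lemma contracted_Fat:
 assumes "c \<in> M" "0 < t" "\<eta> < 1" "ALL n>=1. ALL x:mcball c t. ALL y:mcball c t. d ((T ^^ n) x) ((T ^^ n) y) <= \<eta> * d x y"
 shows "mcball c t \<subseteq> Fat"
proof -
 have le: "d ((T ^^ n) x) ((T ^^ n) y) <= d x y" if "x \<in> mcball c t" "y \<in> mcball c t" for n x y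
 proof (cases "n = 0")
  case False
  hence "d ((T ^^ n) x) ((T ^^ n) y) <= \<eta> * d x y" using assms(4) that by simp
  also have "\<dots> <= d x y" using mult_right_mono[of \<eta> 1 "d x y"] assms(3) by simp
  finally show ?thesis .
 qed simp
 have "equi (mcball c t)" unfolding equi_def
  using le by (metis order_le_less_trans)
 thus ?thesis unfolding Fat_def using openin_mcball[OF assms(2)] mcball_subset_mspace by blast
qed

end

section \<open>The gauge\<close>

context ultra_dyn
begin

definition sing :: "('a => real) => 'a set" where
 "sing t = (\<Union>c\<in>crit - Q. mcball c (t c))"

text \<open>The derivative with respect to distances divided by \<open>g\<close>. If
  \<open>T x\<close> lies in \<open>Q\<close> the denominator is 0 and so, by default, is the value;
  estimates therefore keep \<open>T x\<close> outside \<open>Q\<close>.\<close>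

definition sder :: "('a => real) => 'a => real" where
 "sder g x = der x * g x / g (T x)"

end

text \<open>\<open>g\<close> plays the part of a distance to \<open>Q\<close>:
  \<open>\<delta>\<close> separates near from far, and \<open>g\<close> is constant on balls of
  radius \<open>\<kappa> * g x\<close>. The purpose of the construction is \<open>near\<close>. The
  exit from the neighbourhood of \<open>Q\<close> is described by \<open>leaves_Q\<close>, the entry
  from outside by \<open>blow_up\<close>: it gains an arbitrarily large factor because
  \<open>g (T x)\<close> is small while \<open>g x\<close> is not.\<close>

locale gauged_dyn = ultra_dyn M d T Q
 for M :: "'a set" and d :: "'a => 'a => real" and T Q +
 fixes t :: "'a => real" and g :: "'a => real" and \<kappa> \<delta> :: real
 assumes t_pos: "c \<in> crit - Q ==> 0 < t c"
  and contr: "c \<in> crit - Q ==> EX \<eta><1. ALL n>=1. ALL x:mcball c (t c). ALL y:mcball c (t c).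
    d ((T ^^ n) x) ((T ^^ n) y) <= \<eta> * d x y"
  and \<kappa>: "0 < \<kappa>" "\<kappa> < 1" "c \<in> crit - Q ==> \<kappa> <= t c"
  and \<delta>: "0 < \<delta>" "\<delta> <= 1"
  and g_range: "x \<in> M ==> 0 <= g x" "x \<in> M ==> g x <= 1"
  and g_zero: "x \<in> M ==> g x = 0 \<longleftrightarrow> x \<in> Q"
  and g_const: "y \<in> mcball x (\<kappa> * g x) ==> g y = g x"
  and g_small: "z \<in> Q ==> EX r>0. ALL x:mcball z r. g x < \<delta>"
  and g_exact: "[|x \<in> M; x ~: sing t; x ~: Q|] ==> exact T x (\<kappa> * g x) (der x)"
  and near: "[|x \<in> M; x ~: Q; g x < \<delta>|] ==> T x ~: Q & x ~: sing t & sder g x = 1"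
  and leaves_Q: "[|x \<in> M; !!n. (T ^^ n) x ~: Q|] ==> EX n. \<delta> <= g ((T ^^ n) x)"
  and blow_up: "[|z \<in> M; z ~: Q; z ~: sing t; T z \<in> Q|] ==>
    EX r>0. ALL x:mcball z r. T x ~: Q --> B <= sder g x"

context ultra_dyn
begin

text \<open>On a similarity ball \<open>a * u ^ (m - 1)\<close> would be the same number for two
  different distances u.\<close>

lemma noncrit_exponent:
 assumes z: "z \<in> M" "z ~: crit" and "0 < r" "0 < a" "1 <= m"
  and f: "!!x. x \<in> M ==> 0 < d z x ==> d z x <= r ==> d (T z) (T x) = a * d z x ^ m"
 shows "m = 1"
proof (rule ccontr)
 assume "m ~= 1"
 then obtain j where j: "m = Suc j" "0 < j" using assms(5) by (cases m) auto
 obtain r1 where r1: "0 < r1" "exact T z r1 (der z)" using noncrit_exact z by blast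
 have e: "der z = a * d z x ^ j" if x: "x \<in> M" "0 < d z x" "d z x <= min r r1" for x
 proof -
  have "d (T z) (T x) = der z * d z x" using exactD(3)[OF r1(2), of z x] x z r1 by auto
  hence "der z * d z x = a * d z x ^ j * d z x" using f[of x] x j(1) by simp
  thus ?thesis using x by simp
 qed
 obtain x where x: "x \<in> M" "0 < d z x" "d z x <= min r r1"
  using other_point[OF z(1), of "min r r1"] assms r1 by auto
 obtain y where y: "y \<in> M" "0 < d z y" "d z y <= d z x / 2"
  using other_point[OF z(1), of "d z x / 2"] x by auto
 have "der z = a * d z x ^ j" by (rule e[OF x])
 moreover have "der z = a * d z y ^ j" by (rule e) (use x y in auto)
 ultimately have "a * d z x ^ j = a * d z y ^ j" by metis
 moreover have "d z y ^ j < d z x ^ j" using x y j(2) by (intro power_strict_mono) auto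
 ultimately show False using assms(4) by simp
qed

text \<open>The many smallness conditions on the radii below are phrased as events at 0 from the
  right, so that finitely many of them can be met by one number.\<close>

lemma eventually_at_right_0_I: "0 < (e::real) ==> (!!x. 0 < x ==> x <= e ==> P x) ==> eventually P (at_right 0)"
 unfolding eventually_at_right_field by (metis less_imp_le)

lemma eventually_at_right_0_D: "eventually P (at_right (0::real)) ==> EX e>0. P e"
 unfolding eventually_at_right_field using dense by blast

text \<open>Near \<open>z\<close> in \<open>Q\<close> the gauge is a weight times the distance to
  \<open>z\<close>, and 1 away from \<open>Q\<close>. The weights have to satisfy
  \<open>b (T z) = mu z * b z\<close> for the scaled derivative to be 1 near
  \<open>Q\<close>.\<close>

lemma gauge_exists: "EX t g \<kappa> \<delta>. gauged_dyn M d T Q t g \<kappa> \<delta>"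
proof -
 obtain t \<eta> where t: "!!c. c \<in> crit - Q ==> 0 < t c" "!!c. c \<in> crit - Q ==> \<eta> c < (1::real)"
  "!!c. c \<in> crit - Q ==> ALL n>=1. ALL x:mcball c (t c). ALL y:mcball c (t c).
    d ((T ^^ n) x) ((T ^^ n) y) <= \<eta> c * d x y"
  using fatou_crit by metis
 have crit_M: "crit \<subseteq> M" unfolding critset_def by blast
 let ?W = "sing t"
 have W_Fat: "?W \<subseteq> Fat" unfolding sing_def using contracted_Fat[OF _ t(1) t(2) t(3)] crit_M by blast
 hence WQ: "?W \<inter> Q = {}" using Q_Jul unfolding Jul_def by blast
 have finC: "finite (crit - Q)" using finite_crit by simp
 have openW: "openin mtopology ?W" unfolding sing_def using openin_mcball t(1) by blast
 have closedW: "closedin mtopology ?W" unfolding sing_def using finC by (intro closedin_Union) auto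
 have crit_W: "crit \<subseteq> Q \<union> ?W"
 proof
  fix x assume x: "x \<in> crit"
  hence "x ~: Q ==> x \<in> mcball x (t x)" using t(1)[of x] crit_M by auto
  thus "x \<in> Q \<union> ?W" unfolding sing_def using x by blast
 qed
 define L where "L z r a m k mu \<longleftrightarrow> 0 < r & 0 < a & (1::nat) <= m & 0 < k & k < 1 & 0 < mu &
    (ALL x:M. 0 < d z x & d z x <= r --> d (T z) (T x) = a * d z x ^ m &
      exact T x (k * d z x) (mu * a * d z x ^ (m - 1))) &
    (m = 1 --> mu = 1 & exact T z r a)" for z r a m k mu
 have "ALL z:M. EX r a m k mu. L z r a m k mu"
  unfolding L_def using local_form by blast
 then obtain r0 a m k mu where L: "!!z. z \<in> M ==> L z (r0 z) (a z) (m z) (k z) (mu z)"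
  by metis
 hence lf: "!!z. z \<in> M ==> 0 < r0 z" "!!z. z \<in> M ==> 0 < a z"
   "!!z. z \<in> M ==> 1 <= m z" "!!z. z \<in> M ==> 0 < (k z :: real)" "!!z. z \<in> M ==> k z < 1" "!!z. z \<in> M ==> 0 < (mu z :: real)"
   "!!z x. z \<in> M ==> x \<in> M ==> 0 < d z x ==> d z x <= r0 z ==> d (T z) (T x) = a z * d z x ^ m z"
   "!!z x. z \<in> M ==> x \<in> M ==> 0 < d z x ==> d z x <= r0 z ==>
     exact T x (k z * d z x) (mu z * a z * d z x ^ (m z - 1))"
   "!!z. z \<in> M ==> m z = 1 ==> mu z = 1"
  unfolding L_def by blast+
 \<comment> \<open>Passing from \<open>z\<close> to \<open>T z\<close> drops the factor
   \<open>inverse (mu z)\<close> from this product, unless \<open>z\<close> is periodic; but then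
   \<open>z\<close> is not critical and \<open>mu z = 1\<close>. Either way
   \<open>b (T z) = mu z * b z\<close>.\<close>
 define b where "b z = (\<Prod>w\<in>orbit T z. inverse (mu w))" for z
 have orb_Q: "orbit T z \<subseteq> Q" if "z \<in> Q" for z unfolding orbit_def using iter_Q that by blast
 have fin_orb: "finite (orbit T z)" if "z \<in> Q" for z using orb_Q[OF that] finite_Q finite_subset by blast
 have b_pos: "0 < b z" if "z \<in> Q" for z
  unfolding b_def using orb_Q[OF that] Q_subset lf(6) by (intro prod_pos) fastforce
 have b_step: "b (T z) = mu z * b z" if zQ: "z \<in> Q" for z
 proof -
  have ins: "orbit T z = insert z (orbit T (T z))"
  proof -
   have "x \<in> insert z (orbit T (T z))" if "x = (T ^^ n) z" for x n
    using that by (cases n) (auto simp: orbit_def funpow_swap1)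
   moreover have "z = (T ^^ 0) z" "(T ^^ n) (T z) = (T ^^ Suc n) z" for n by (simp_all add: funpow_swap1)
   ultimately show ?thesis unfolding orbit_def by blast
  qed
  have zM: "z \<in> M" using zQ Q_subset by blast
  show ?thesis
  proof (cases "z \<in> orbit T (T z)")
   case True
   then obtain n where "z = (T ^^ n) (T z)" unfolding orbit_def by blast
   hence "(T ^^ Suc n) z = z" by (simp add: funpow_swap1)
   hence "z ~: crit" using Q_noncrit[OF zQ, of "Suc n"] by simp
   hence "m z = 1" using noncrit_exponent[OF zM _ lf(1)[OF zM] lf(2)[OF zM] lf(3)[OF zM]] lf(7)[OF zM] by blast
   hence "mu z = 1" using lf(9)[OF zM] by blast
   moreover have "orbit T z = orbit T (T z)" using ins True by (simp add: insert_absorb)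
   ultimately show ?thesis unfolding b_def by simp
  next
   case False
   have "b z = inverse (mu z) * b (T z)" unfolding b_def ins
    using False fin_orb[OF Q_invariant[OF zQ]] by simp
   thus ?thesis using lf(6)[OF zM] by (simp add: field_simps)
  qed
 qed
 \<comment> \<open>A condition on periodic points only; the orbit of any other point of
   \<open>Q\<close> is compared after it has entered its cycle.\<close>
 define rep where "rep z r \<longleftrightarrow> ((EX n>=1. (T ^^ n) z = z) -->
   (ALL w:M. w ~= z --> (EX i. r < d z ((T ^^ i) w) & (T ^^ i) z = z)))" for z and r :: real
 \<comment> \<open>Conditions on the outer radius \<open>e0\<close>: balls about distinct points of
   \<open>Q\<close> stay apart, the gauge stays at most 1, the contracting balls are avoided, the
   local forms apply.\<close>
 define P0 where "P0 z e \<longleftrightarrow> (ALL z':Q. z' ~= z --> e < d z z') & b z * e <= 1 & mcball z e \<inter> ?W = {} & e <= r0 z & e <= 1" for z e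
 have P0_ev: "eventually (P0 z) (at_right 0)" if zQ: "z \<in> Q" for z
 proof -
  have zM: "z \<in> M" using zQ Q_subset by blast
  have "ALL z':Q. eventually (%e. z' ~= z --> e < d z z') (at_right 0)"
  proof
   fix z' assume z': "z' \<in> Q"
   show "eventually (%e. z' ~= z --> e < d z z') (at_right 0)"
   proof (cases "z' = z")
    case False
    hence "0 < d z z'" using z' zM Q_subset by auto
    thus ?thesis by (intro eventually_at_right_0_I[of "d z z' / 2"]) auto
   qed simp
  qed
  hence 1: "eventually (%e. ALL z':Q. z' ~= z --> e < d z z') (at_right 0)"
   by (rule eventually_ball_finite[OF finite_Q])
  have 2: "eventually (%e. b z * e <= 1) (at_right 0)"
   using b_pos[OF zQ] by (intro eventually_at_right_0_I[of "1 / b z"]) (auto simp: field_simps)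
  have "openin mtopology (M - ?W)" using closedW by (metis openin_diff openin_topspace topspace_mtopology)
  moreover have "z \<in> M - ?W" using zM WQ zQ by blast
  ultimately obtain e where e: "e > 0" "mcball z e \<subseteq> M - ?W" unfolding openin_mtopology_mcball by blast
  have 3: "eventually (%e. mcball z e \<inter> ?W = {}) (at_right 0)"
  proof (rule eventually_at_right_0_I[OF e(1)])
   fix e' assume "e' <= e"
   hence "mcball z e' \<subseteq> mcball z e" by (rule mcball_subset_concentric)
   thus "mcball z e' \<inter> ?W = {}" using e(2) by blast
  qed
  have 4: "eventually (%e. e <= r0 z) (at_right 0)" "eventually (%e. e <= (1::real)) (at_right 0)"
   using lf(1)[OF zM] by (auto intro: eventually_at_right_0_I[of "r0 z"] eventually_at_right_0_I[of 1])
  show ?thesis unfolding P0_def using 1 2 3 4 by (simp add: eventually_conj)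
 qed
 have "eventually (%e. ALL z:Q. P0 z e) (at_right 0)"
  by (intro eventually_ball_finite[OF finite_Q] ballI P0_ev)
 from eventually_at_right_0_D[OF this] obtain e0 where e0: "e0 > 0" "!!z. z \<in> Q ==> P0 z e0" by blast
 \<comment> \<open>The inner radius \<open>e1\<close> is such that \<open>T\<close> sends the
   \<open>e1\<close>-ball about \<open>z\<close> into the \<open>e0\<close>-ball about
   \<open>T z\<close>, where \<open>g\<close> is again linear in the distance.\<close>
 define P1 where "P1 z e \<longleftrightarrow> a z * e <= e0 & e <= e0 & rep z e" for z e
 have P1_ev: "eventually (P1 z) (at_right 0)" if zQ: "z \<in> Q" for z
 proof -
  have zM: "z \<in> M" using zQ Q_subset by blast
  have 1: "eventually (%e. a z * e <= e0) (at_right 0)"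
   by (rule eventually_at_right_0_I[of "e0 / a z"]) (use lf(2)[OF zM] e0(1) in "simp_all add: field_simps")
  have 3: "eventually (%e. e <= e0) (at_right 0)"
   by (rule eventually_at_right_0_I[OF e0(1)])
  have 2: "eventually (%e. rep z e) (at_right 0)"
  proof (cases "EX n>=1. (T ^^ n) z = z")
   case True
   then obtain n where n: "n >= 1" "(T ^^ n) z = z" by blast
   from repelled[OF zQ n] obtain r where r: "r > 0"
     "ALL w:M. w ~= z --> (EX i. r < d z ((T ^^ i) w) & (T ^^ i) z = z)" by blast
   show ?thesis
   proof (rule eventually_at_right_0_I[OF r(1)])
    fix e assume "0 < e" "e <= r"
    thus "rep z e" unfolding rep_def using r(2) by (meson order_le_less_trans)
   qed
  next
   case False
   hence "rep z e" for e unfolding rep_def by blast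
   thus ?thesis by simp
  qed
  show ?thesis unfolding P1_def using 1 2 3 by (simp add: eventually_conj)
 qed
 have "eventually (%e. ALL z:Q. P1 z e) (at_right 0)"
  by (intro eventually_ball_finite[OF finite_Q] ballI P1_ev)
 from eventually_at_right_0_D[OF this] obtain e1 where e1: "e1 > 0" "!!z. z \<in> Q ==> P1 z e1" by blast
 have uniq: "z = z'" if "z \<in> Q" "z' \<in> Q" "x \<in> M" "d z x <= e0" "d z' x <= e0" for z z' x
 proof (rule ccontr)
  assume "z ~= z'"
  hence "e0 < d z z'" using e0(2)[OF that(1)] that(2) unfolding P0_def by auto
  moreover have "d z z' <= max (d z x) (d x z')" using ultra that Q_subset by blast
  ultimately show False using that(4,5) commute[of x z'] by simp
 qed
 define g where "g x = (if EX z:Q. d z x <= e0 then let z = SOME z. z \<in> Q & d z x <= e0 in b z * d z x else 1)" for x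
 have g_near: "g x = b z * d z x" if "z \<in> Q" "x \<in> M" "d z x <= e0" for x z
 proof -
  have "(SOME z. z \<in> Q & d z x <= e0) = z"
   by (rule some_equality) (use that uniq in auto)
  thus ?thesis unfolding g_def Let_def using that by auto
 qed
 have g_far: "g x = 1" if "~ (EX z:Q. d z x <= e0)" for x
  unfolding g_def using that by simp
 have g_range: "0 <= g x & g x <= 1" if "x \<in> M" for x
 proof (cases "EX z:Q. d z x <= e0")
  case True
  then obtain z where z: "z \<in> Q" "d z x <= e0" by blast
  have "b z * d z x <= b z * e0" using b_pos[OF z(1)] z by simp
  also have "\<dots> <= 1" using e0(2)[OF z(1)] unfolding P0_def by auto
  finally show ?thesis using g_near[OF z(1) that z(2)] b_pos[OF z(1)] by simp
 qed (use g_far in simp)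
 have g_zero: "g x = 0 \<longleftrightarrow> x \<in> Q" if xM: "x \<in> M" for x
 proof (cases "EX z:Q. d z x <= e0")
  case True
  then obtain z where z: "z \<in> Q" "d z x <= e0" by blast
  have "g x = b z * d z x" by (rule g_near[OF z(1) xM z(2)])
  moreover have "z = x" if "x \<in> Q" using uniq[OF z(1) that xM z(2)] e0(1) xM by simp
  ultimately show ?thesis using b_pos[OF z(1)] z(1) xM Q_subset by auto
 next
  case False
  hence "x ~: Q" using e0(1) xM by auto
  thus ?thesis using g_far[OF False] by simp
 qed
 \<comment> \<open>With u the distance to \<open>z\<close>, the numerator
   \<open>mu * a * u^(m-1) * b z * u\<close> of the scaled derivative and its denominator
   \<open>b (T z) * a * u^m\<close> agree by the choice of the weights.\<close>
 have core: "T x ~: Q & x ~: ?W & sder g x = 1 & exact T x (k z * d z x) (der x) & d (T z) (T x) <= e0"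
  if zQ: "z \<in> Q" and x: "x \<in> M" "x ~= z" "d z x <= e1" for z x
 proof -
  have zM: "z \<in> M" using zQ Q_subset by blast
  define u where "u = d z x"
  have u: "0 < u" "u <= e1" unfolding u_def using x zM by auto
  have le: "u <= e0" "u <= r0 z" "u <= 1" using u(2) e1(2)[OF zQ] e0(2)[OF zQ] unfolding P0_def P1_def by auto
  have dphi: "d (T z) (T x) = a z * u ^ m z" using lf(7)[OF zM x(1)] u le unfolding u_def by simp
  have ex: "exact T x (k z * u) (mu z * a z * u ^ (m z - 1))"
   using lf(8)[OF zM x(1)] u le unfolding u_def by simp
  hence der: "der x = mu z * a z * u ^ (m z - 1)"
   by (intro der_eq[OF x(1) _ ex]) (use lf(4)[OF zM] u in simp)
  have "u ^ m z <= u" using u le lf(3)[OF zM] power_decreasing[of 1 "m z" u] by simp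
  hence "a z * u ^ m z <= a z * e1" using u(2) lf(2)[OF zM] by simp
  also have "\<dots> <= e0" using e1(2)[OF zQ] unfolding P1_def by simp
  finally have dle: "d (T z) (T x) <= e0" using dphi by simp
  have phQ: "T z \<in> Q" using Q_invariant zQ by blast
  have dpos: "0 < d (T z) (T x)" using dphi u lf(2)[OF zM] by simp
  have nQ: "T x ~: Q"
  proof
   assume "T x \<in> Q"
   hence "T z = T x" using uniq[OF phQ _ maps[OF x(1)] dle] e0(1) maps[OF x(1)] by simp
   thus False using dpos maps[OF x(1)] by simp
  qed
  have "x \<in> mcball z e0" using le x zM unfolding u_def by simp
  hence nW: "x ~: ?W" using e0(2)[OF zQ] unfolding P0_def by blast
  have gx: "g x = b z * u" using g_near[OF zQ x(1)] le unfolding u_def by simp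
  have gpx: "g (T x) = mu z * b z * (a z * u ^ m z)"
   using g_near[OF phQ maps[OF x(1)] dle] b_step[OF zQ] dphi by simp
  have "u ^ m z = u ^ (m z - 1) * u" using lf(3)[OF zM] power_minus_mult[of "m z" u] by simp
  hence "sder g x = 1" unfolding sder_def der gx gpx
   using u lf(2,6)[OF zM] b_pos[OF zQ] by (simp add: field_simps)
  thus ?thesis using nQ nW ex der dle unfolding u_def by simp
 qed
 define E where "E = M - ?W"
 have closedE: "closedin mtopology E" unfolding E_def
  using openW by (metis closedin_diff closedin_topspace topspace_mtopology)
 \<comment> \<open>Near \<open>Q\<close> the similarity radius is proportional to the distance and
   hence to \<open>g\<close>; elsewhere \<open>g <= 1\<close> and a fixed radius serves. Compactness
   of \<open>E\<close> gives one proportion for all.\<close>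
 have "EX c>0. ALL x:E. x \<in> M - Q --> exact T x (c * g x) (der x)"
 proof (rule uniform_bound[OF closedE])
  fix z assume z: "z \<in> E"
  hence zM: "z \<in> M" unfolding E_def by blast
  show "EX r>0. EX c>0. ALL x:mcball z r. x \<in> M - Q --> exact T x (c * g x) (der x)"
  proof (cases "z \<in> Q")
   case True
   have "exact T x (k z / b z * g x) (der x)" if x: "x \<in> mcball z e1" "x ~: Q" for x
   proof -
    have "x \<in> M" "x ~= z" "d z x <= e1" "d z x <= e0" using x True e1(2)[OF True] unfolding P1_def by auto
    thus ?thesis using core[OF True] g_near[OF True] b_pos[OF True] by simp
   qed
   moreover have "k z / b z > 0" using lf(4)[OF zM] b_pos[OF True] by simp
   ultimately show ?thesis using e1(1) by blast
  next
   case False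
   hence "z ~: crit" using z crit_W unfolding E_def by blast
   then obtain r where r: "0 < r" "exact T z r (der z)" using noncrit_exact zM by blast
   have "exact T x (r * g x) (der x)" if x: "x \<in> mcball z r" for x
   proof -
    have xM: "x \<in> M" using x by simp
    have "exact T x r (der z)" using exact_sub[OF r(2) x] by simp
    hence 1: "der x = der z" using der_eq r(1) xM by blast
    have "r * g x <= r" using r(1) g_range[OF xM] by (simp add: mult_left_le)
    thus ?thesis using exact_sub[OF r(2) x] 1 by simp
   qed
   thus ?thesis using r(1) by blast
  qed
 next
  fix x c c' assume h: "x \<in> M - Q --> exact T x (c * g x) (der x)" "(0::real) < c'" "c' <= c"
  show "x \<in> M - Q --> exact T x (c' * g x) (der x)"
  proof
   assume x: "x \<in> M - Q"
   hence ex: "exact T x (c * g x) (der x)" and xM: "x \<in> M" using h by blast+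
   have "c' * g x <= c * g x" "0 <= c * g x" using h(2,3) g_range[OF xM] by (simp_all add: mult_right_mono)
   thus "exact T x (c' * g x) (der x)" using exact_sub[OF ex, of x "c' * g x"] xM by simp
  qed
 qed
 then obtain c where c: "c > 0" "!!x. x \<in> E ==> x ~: Q ==> exact T x (c * g x) (der x)"
  unfolding E_def by blast
 \<comment> \<open>For \<open>\<kappa>\<close> this keeps \<open>mcball x (\<kappa> * g x)\<close>
   on the sphere about \<open>z\<close> through \<open>x\<close>, where \<open>g\<close> is
   constant; \<open>\<kappa> <= e0\<close> prevents a ball about a point far from \<open>Q\<close>
   from meeting an \<open>e0\<close>-ball.\<close>
 have "eventually (%e. ALL z:Q. e * b z < 1) (at_right 0)"
 proof (intro eventually_ball_finite[OF finite_Q] ballI)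
  fix z assume "z \<in> Q"
  from b_pos[OF this] show "eventually (%e. e * b z < 1) (at_right 0)"
   by (intro eventually_at_right_0_I[of "1 / (2 * b z)"]) (simp_all add: field_simps)
 qed
 moreover have "eventually (%e. ALL z:crit - Q. e <= t z) (at_right 0)"
  by (intro eventually_ball_finite[OF finC] ballI eventually_at_right_0_I[OF t(1)])
 moreover have "eventually (%e. e <= e0) (at_right 0)" "eventually (%e. e <= c) (at_right 0)"
   "eventually (%e. e < (1::real)) (at_right 0)" "eventually (%e. 0 < (e::real)) (at_right 0)"
  using e0(1) c(1) by (auto intro: eventually_at_right_0_I[of e0] eventually_at_right_0_I[of c] eventually_at_right_0_I[of "1/2"] simp: eventually_at_right_less)
 ultimately have "eventually (%e. (ALL z:Q. e * b z < 1) & (ALL z:crit - Q. e <= t z) & e <= e0 & e <= c & e < 1 & 0 < e) (at_right 0)"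
  by (simp add: eventually_conj)
 then obtain \<kappa> where \<kappa>: "!!z. z \<in> Q ==> \<kappa> * b z < 1" "!!z. z \<in> crit - Q ==> \<kappa> <= t z" "\<kappa> <= e0" "\<kappa> <= c" "\<kappa> < 1" "0 < \<kappa>"
  using eventually_at_right_0_D by blast
 have g_const: "g y = g x" if y: "y \<in> mcball x (\<kappa> * g x)" for x y
 proof -
  have yM: "x \<in> M" "y \<in> M" "d x y <= \<kappa> * g x" using y by auto
  show ?thesis
  proof (cases "EX z:Q. d z x <= e0")
   case True
   then obtain z where z: "z \<in> Q" "d z x <= e0" by blast
   have zM: "z \<in> M" using z Q_subset by blast
   have gx: "g x = b z * d z x" by (rule g_near[OF z(1) yM(1) z(2)])
   show ?thesis
   proof (cases "x = z")
    case True
    hence "g x = 0" using gx zM by simp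
    hence "d x y = 0" using yM(3) nonneg[of x y] by simp
    thus ?thesis using yM by simp
   next
    case False
    hence "0 < d z x" using zM yM by auto
    hence "\<kappa> * b z * d z x < 1 * d z x" using \<kappa>(1)[OF z(1)] by (intro mult_strict_right_mono)
    hence "d x y < d x z" using yM(3) unfolding gx by (simp add: commute mult.assoc)
    hence "d y z = d x z" using isosceles yM zM by blast
    thus ?thesis using gx g_near[OF z(1) yM(2)] z(2) by (simp add: commute)
   qed
  next
   case False
   have "~ (EX z:Q. d z y <= e0)"
   proof
    assume "EX z:Q. d z y <= e0"
    then obtain z where z: "z \<in> Q" "d z y <= e0" by blast
    have "d x y <= e0" using yM(3) g_far[OF False] \<kappa>(3) by simp
    moreover have "d z x <= max (d z y) (d y x)" using ultra z yM Q_subset by blast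
    ultimately show False using z False commute[of x y] by auto
   qed
   thus ?thesis using g_far False by simp
  qed
 qed
 \<comment> \<open>With \<open>\<delta> <= b z * e1\<close>, a gauge below \<open>\<delta>\<close>
   puts a point into the inner ball of a point of \<open>Q\<close>.\<close>
 have "eventually (%e. ALL z:Q. e <= b z * e1) (at_right 0)"
  using e1(1) by (intro eventually_ball_finite[OF finite_Q] ballI)
   (rule eventually_at_right_0_I[OF mult_pos_pos[OF b_pos]])
 moreover have "eventually (%e. e <= (1::real)) (at_right 0)" "eventually (%e. 0 < (e::real)) (at_right 0)"
  by (auto intro: eventually_at_right_0_I[of "1"] simp: eventually_at_right_less)
 ultimately have "eventually (%e. (ALL z:Q. e <= b z * e1) & e <= 1 & 0 < e) (at_right 0)"
  by (simp add: eventually_conj)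
 then obtain \<delta> where \<delta>: "!!z. z \<in> Q ==> \<delta> <= b z * e1" "\<delta> <= 1" "0 < \<delta>"
  using eventually_at_right_0_D by blast
 have small: "EX z:Q. d z x <= e1" if xM: "x \<in> M" and gx: "g x < \<delta>" for x
 proof -
  obtain z where z: "z \<in> Q" "d z x <= e0" using g_far[of x] gx \<delta>(2) by force
  have "b z * d z x < b z * e1" using g_near[OF z(1) xM z(2)] gx \<delta>(1)[OF z(1)] by simp
  hence "d z x <= e1" using b_pos[OF z(1)] by simp
  thus ?thesis using z(1) by blast
 qed
 \<comment> \<open>Otherwise the orbit would follow that of some \<open>z\<close> in
   \<open>Q\<close> within \<open>e1\<close> for ever; once the latter is periodic, repulsion beyond
   \<open>e1\<close> contradicts this.\<close>
 have leaves: "EX n. \<delta> <= g ((T ^^ n) x)" if x: "x \<in> M" "!!n. (T ^^ n) x ~: Q" for x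
 proof (rule ccontr)
  assume "~ ?thesis"
  hence lt: "g ((T ^^ n) x) < \<delta>" for n by (meson not_le)
  obtain z where z: "z \<in> Q" "d z x <= e1" using small[OF x(1)] lt[of 0] by auto
  have follow: "d ((T ^^ n) z) ((T ^^ n) x) <= e1" for n
  proof (induction n)
   case (Suc n)
   have zQ: "(T ^^ n) z \<in> Q" "(T ^^ Suc n) z \<in> Q" using iter_Q z(1) by blast+
   have "(T ^^ n) x ~= (T ^^ n) z" using x(2) zQ(1) by metis
   hence "d ((T ^^ Suc n) z) ((T ^^ Suc n) x) <= e0"
    using core[OF zQ(1) iter_in_M[OF x(1)] _ Suc] by simp
   moreover obtain z' where z': "z' \<in> Q" "d z' ((T ^^ Suc n) x) <= e1"
    using small[OF iter_in_M[OF x(1)] lt] by blast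
   moreover have "e1 <= e0" using e1(2)[OF z(1)] unfolding P1_def by simp
   ultimately have "z' = (T ^^ Suc n) z"
    using uniq[OF z'(1) zQ(2) iter_in_M[OF x(1), of "Suc n"]] by simp
   thus ?case using z' by simp
  qed (use z in simp)
  obtain j n where n: "1 <= n" "(T ^^ n) ((T ^^ j) z) = (T ^^ j) z"
   using Q_eventually_periodic[OF z(1)] by metis
  have "rep ((T ^^ j) z) e1" using e1(2)[OF iter_Q[OF z(1)]] unfolding P1_def by blast
  moreover have "(T ^^ j) x ~= (T ^^ j) z" using x(2)[of j] iter_Q[OF z(1), of j] by metis
  ultimately obtain i where i: "e1 < d ((T ^^ j) z) ((T ^^ i) ((T ^^ j) x))" "(T ^^ i) ((T ^^ j) z) = (T ^^ j) z"
   unfolding rep_def using n iter_in_M[OF x(1), of j] by blast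
  have "d ((T ^^ (i + j)) z) ((T ^^ (i + j)) x) <= e1" by (rule follow)
  thus False using i by (simp add: funpow_add)
 qed
 have blow: "EX r>0. ALL x:mcball z r. T x ~: Q --> B <= sder g x"
  if z: "z \<in> M" "z ~: Q" "z ~: ?W" "T z \<in> Q" for z B
 proof -
  have "z ~: crit" using z crit_W by blast
  then obtain r where r: "0 < r" "exact T z r (der z)" using noncrit_exact z(1) by blast
  define s where "s = der z"
  have s: "0 < s" unfolding s_def using exactD(1)[OF r(2)] .
  have gz: "0 < g z" using g_range[OF z(1)] g_zero[OF z(1)] z(2) by (simp add: less_le)
  have bp: "0 < b (T z)" using b_pos z(4) by blast
  \<comment> \<open>The bound \<open>e0 / s\<close> puts \<open>T x\<close> where \<open>g\<close>
    is linear in the distance to \<open>T z\<close>; the last one makes the quotient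
    \<open>g z / (b (T z) * d z x)\<close>, which is the scaled derivative, at least
    \<open>max B 1\<close>.\<close>
  define r1 where "r1 = min (min r (\<kappa> * g z)) (min (e0 / s) (g z / (b (T z) * max B 1)))"
  have "r1 > 0" unfolding r1_def using r(1) \<kappa>(6) gz e0(1) s bp by simp
  moreover have "B <= sder g x" if x: "x \<in> mcball z r1" "T x ~: Q" for x
  proof -
   have xr: "x \<in> mcball z r" "x \<in> mcball z (\<kappa> * g z)" "d z x <= e0 / s" "d z x <= g z / (b (T z) * max B 1)"
    using x(1) unfolding r1_def by auto
   have xM: "x \<in> M" using x by simp
   have "exact T x r s" using exact_sub[OF r(2) xr(1)] unfolding s_def by simp
   hence der: "der x = s" using der_eq r(1) xM by blast
   have gx: "g x = g z" using g_const[OF xr(2)] .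
   have dphi: "d (T z) (T x) = s * d z x" using exactD(3)[OF r(2) _ xr(1), of z] r(1) z(1) unfolding s_def by simp
   hence "d (T z) (T x) <= e0" using xr(3) s by (simp add: field_simps)
   hence gp: "g (T x) = b (T z) * (s * d z x)" using g_near[OF z(4) maps[OF xM]] dphi by simp
   have "x ~= z" using x(2) z(4) by blast
   hence u: "0 < d z x" using xM z(1) by auto
   have e: "sder g x = g z / (b (T z) * d z x)" unfolding sder_def der gx gp using s by (simp add: field_simps)
   have "max B 1 * (b (T z) * d z x) <= g z" using xr(4) bp by (simp add: field_simps)
   hence "max B 1 <= sder g x" unfolding e using bp u by (subst pos_le_divide_eq) simp_all
   thus ?thesis by simp
  qed
  ultimately show ?thesis by blast
 qed
 have g_small: "EX r>0. ALL x:mcball z r. g x < \<delta>" if z: "z \<in> Q" for z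
 proof -
  define r where "r = min e0 (\<delta> / (2 * b z))"
  have "0 < r" unfolding r_def using e0(1) \<delta>(3) b_pos[OF z] by simp
  moreover have "g x < \<delta>" if x: "x \<in> mcball z r" for x
  proof -
   have "x \<in> M" "d z x <= e0" "d z x <= \<delta> / (2 * b z)" using x unfolding r_def by auto
   moreover have "b z * (\<delta> / (2 * b z)) < \<delta>" using \<delta>(3) b_pos[OF z] by simp
   moreover have "b z * d z x <= b z * (\<delta> / (2 * b z))" using calculation(3) b_pos[OF z] by (intro mult_left_mono) auto
   ultimately show ?thesis using g_near[OF z] by simp
  qed
  ultimately show ?thesis by blast
 qed
 have "gauged_dyn M d T Q t g \<kappa> \<delta>"
 proof unfold_locales
  fix x assume x: "x \<in> M" "x ~: ?W" "x ~: Q"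
  hence ex: "exact T x (c * g x) (der x)" using c(2) unfolding E_def by blast
  have "\<kappa> * g x <= c * g x" "0 <= c * g x" using \<kappa>(4) c(1) g_range[OF x(1)] by (simp_all add: mult_right_mono)
  thus "exact T x (\<kappa> * g x) (der x)" using exact_sub[OF ex, of x "\<kappa> * g x"] x(1) by simp
 next
  fix x assume x: "x \<in> M" "x ~: Q" "g x < \<delta>"
  then obtain z where "z \<in> Q" "d z x <= e1" using small by blast
  thus "T x ~: Q & x ~: ?W & sder g x = 1" using core[of z x] x by blast
 next
  fix c assume "c \<in> crit - Q"
  from t(2,3)[OF this] show "EX \<eta><1. ALL n>=1. ALL x:mcball c (t c). ALL y:mcball c (t c).
    d ((T ^^ n) x) ((T ^^ n) y) <= \<eta> * d x y" by blast
 qed (use t \<kappa> \<delta> g_range g_zero g_const g_small leaves blow in "auto simp del: in_mcball")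
 thus ?thesis by blast
qed

end

context gauged_dyn
begin

abbreviation "W \<equiv> sing t"

lemma W_subset_Fat: "W \<subseteq> Fat"
proof
 fix x assume "x \<in> W"
 then obtain c where c: "c \<in> crit - Q" "x \<in> mcball c (t c)" unfolding sing_def by blast
 then obtain \<eta> where "\<eta> < 1" "ALL n>=1. ALL x:mcball c (t c). ALL y:mcball c (t c).
    d ((T ^^ n) x) ((T ^^ n) y) <= \<eta> * d x y" using contr by blast
 hence "mcball c (t c) \<subseteq> Fat" using contracted_Fat[OF _ t_pos[OF c(1)]] c unfolding critset_def by blast
 thus "x \<in> Fat" using c(2) by blast
qed

text \<open>\<open>\<kappa>\<close> is at most every radius \<open>t c\<close>, so a ball of radius
  \<open>\<kappa>\<close> that meets a contracting ball lies inside it.\<close>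

lemma W_ball: "x ~: W ==> y \<in> mcball x \<kappa> ==> y ~: W"
proof
 assume x: "x ~: W" and y: "y \<in> mcball x \<kappa>" and "y \<in> W"
 then obtain c where c: "c \<in> crit - Q" "y \<in> mcball c (t c)" unfolding sing_def by blast
 have "x \<in> mcball y (t c)" using y \<kappa>(3)[OF c(1)] by (auto simp: commute)
 hence "x \<in> mcball c (t c)" using mcball_eq[OF c(2)] by blast
 thus False using x c(1) unfolding sing_def by blast
qed

lemma g_pos: "x \<in> M ==> x ~: Q ==> 0 < g x"
 using g_range(1) g_zero by (metis less_le)

lemma sder_pos: "[|x \<in> M; x ~: W; x ~: Q; T x ~: Q|] ==> 0 < sder g x"
 unfolding sder_def using exactD(1)[OF g_exact] g_pos maps by simp

text \<open>By telescoping, the scaling factor of \<open>T ^^ n\<close> at \<open>x\<close> is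
  \<open>S n x * g ((T ^^ n) x) / g x\<close>: derivatives are governed by \<open>S\<close> up to
  the two end values of the gauge.\<close>

definition S :: "nat => 'a => real" where
 "S n x = (\<Prod>i<n. sder g ((T ^^ i) x))"

lemma S_0 [simp]: "S 0 x = 1" unfolding S_def by simp

lemma S_Suc: "S (Suc n) x = S n x * sder g ((T ^^ n) x)" unfolding S_def by simp

lemma S_add: "S (m + n) x = S m x * S n ((T ^^ m) x)"
proof (induction n)
 case (Suc n)
 have "(T ^^ n) ((T ^^ m) x) = (T ^^ (m + n)) x" by (simp add: funpow_add add.commute[of m n])
 thus ?case using Suc by (simp add: S_Suc)
qed simp

definition reg :: "'a => bool" where
 "reg x \<longleftrightarrow> x \<in> M & (ALL n. (T ^^ n) x ~: Q) & (ALL n. (T ^^ n) x ~: W)"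

lemma regD: "reg x ==> x \<in> M" "reg x ==> (T ^^ n) x \<in> M" "reg x ==> (T ^^ n) x ~: Q" "reg x ==> (T ^^ n) x ~: W"
 unfolding reg_def using iter_in_M by auto

lemma reg_iter: "reg x ==> reg ((T ^^ n) x)"
 unfolding reg_def using iter_in_M by (metis funpow_add o_apply)

lemma reg_g_pos: "reg x ==> 0 < g ((T ^^ n) x)"
 using g_pos regD by blast

lemma S_pos:
 assumes "reg x" shows "0 < S n x"
proof (induction n)
 case (Suc n)
 have "0 < sder g ((T ^^ n) x)" using sder_pos[OF regD(2,4,3)[OF assms]] regD(3)[OF assms, of "Suc n"] by simp
 thus ?case using Suc by (simp add: S_Suc)
qed simp

text \<open>Balls measured in the scale \<open>g\<close> are mapped exactly as long as the scaled derivative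
 keeps their images small.\<close>

lemma ball_iter:
 assumes x: "x \<in> M" and nQ: "!!i. i <= n ==> (T ^^ i) x ~: Q" and nW: "!!i. i < n ==> (T ^^ i) x ~: W"
  and V: "0 < V" "!!i. i <= n ==> V * S i x <= 1"
 shows "exact (T ^^ n) x (\<kappa> * V * g x) (S n x * g ((T ^^ n) x) / g x) &
  (ALL y:mcball x (\<kappa> * V * g x). S n y = S n x & g ((T ^^ n) y) = g ((T ^^ n) x) &
    (T ^^ n) y \<in> mcball ((T ^^ n) x) (\<kappa> * g ((T ^^ n) x)))"
 using nQ nW V(2)
proof (induction n)
 case 0
 have gx: "0 < g x" using g_pos[OF x] 0(1)[of 0] by simp
 have "V <= 1" using 0(3)[of 0] by simp
 hence "\<kappa> * V * g x <= \<kappa> * g x" using \<kappa>(1) gx by simp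
 hence sub: "mcball x (\<kappa> * V * g x) \<subseteq> mcball x (\<kappa> * g x)" by (rule mcball_subset_concentric)
 have "exact (%a. a) x (\<kappa> * V * g x) 1" by (rule exact_id(2)[OF x])
 moreover have "y \<in> mcball x (\<kappa> * g x)" if "y \<in> mcball x (\<kappa> * V * g x)" for y
  using sub that by blast
 ultimately show ?case using gx g_const by (simp del: in_mcball)
next
 case (Suc n)
 let ?r = "\<kappa> * V * g x"
 define xn where "xn = (T ^^ n) x"
 have xn: "xn \<in> M" "xn ~: Q" "xn ~: W" "T xn ~: Q" "T xn \<in> M"
  unfolding xn_def using iter_in_M[OF x, of n] Suc.prems(1)[of n] Suc.prems(1)[of "Suc n"] Suc.prems(2)[of n]
   by (auto simp: maps)
 have gx: "0 < g x" using g_pos[OF x] Suc.prems(1)[of 0] by simp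
 have gn: "0 < g xn" "0 < g (T xn)" using g_pos xn by auto
 have IH: "exact (T ^^ n) x ?r (S n x * g xn / g x)"
  "!!y. y \<in> mcball x ?r ==> S n y = S n x & g ((T ^^ n) y) = g xn & (T ^^ n) y \<in> mcball xn (\<kappa> * g xn)"
  using Suc unfolding xn_def by auto
 have ex: "exact T xn (\<kappa> * g xn) (der xn)" using g_exact xn by blast
 \<comment> \<open>The image ball has radius \<open>\<kappa> * (V * S n x) * g xn\<close>, and
   \<open>V * S n x <= 1\<close> puts it inside the ball on which \<open>T\<close> is a
   similarity.\<close>
 have img: "S n x * g xn / g x * ?r = \<kappa> * (V * S n x) * g xn" using gx by simp
 have "\<kappa> * (V * S n x) * g xn <= \<kappa> * 1 * g xn"
  using Suc.prems(3)[of n] \<kappa>(1) gn by (intro mult_right_mono mult_left_mono) auto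
 hence le: "\<kappa> * (V * S n x) * g xn <= \<kappa> * g xn" by simp
 have xin: "xn \<in> mcball xn (\<kappa> * g xn)" using xn gn \<kappa>(1) by simp
 have "exact T ((T ^^ n) x) (S n x * g xn / g x * ?r) (der xn)"
  unfolding img using exact_sub[OF ex xin le] by (simp add: xn_def)
 from exact_comp[OF IH(1) this] have 1: "exact (T ^^ Suc n) x ?r (der xn * (S n x * g xn / g x))" by simp
 have fac: "der xn * (S n x * g xn / g x) = S (Suc n) x * g (T xn) / g x"
  using gn gx unfolding S_Suc sder_def xn_def[symmetric] by simp
 have r2: "S (Suc n) x * g (T xn) / g x * ?r = \<kappa> * (V * S (Suc n) x) * g (T xn)" using gx by simp
 have "\<kappa> * (V * S (Suc n) x) * g (T xn) <= \<kappa> * 1 * g (T xn)"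
  using Suc.prems(3)[of "Suc n"] \<kappa>(1) gn by (intro mult_right_mono mult_left_mono) auto
 hence le2: "S (Suc n) x * g (T xn) / g x * ?r <= \<kappa> * g (T xn)" unfolding r2 by simp
 have "S (Suc n) y = S (Suc n) x & g ((T ^^ Suc n) y) = g (T xn) &
    (T ^^ Suc n) y \<in> mcball (T xn) (\<kappa> * g (T xn))" if y: "y \<in> mcball x ?r" for y
 proof -
  have yn: "S n y = S n x" "g ((T ^^ n) y) = g xn" "(T ^^ n) y \<in> mcball xn (\<kappa> * g xn)"
   using IH(2)[OF y] by auto
  have "exact T ((T ^^ n) y) (\<kappa> * g xn) (der xn)" using exact_sub[OF ex yn(3)] by simp
  hence der: "der ((T ^^ n) y) = der xn" using der_eq[of "(T ^^ n) y" "\<kappa> * g xn"] yn(3) gn \<kappa>(1) by simp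
  have "(T ^^ Suc n) y \<in> mcball (T xn) (S (Suc n) x * g (T xn) / g x * ?r)"
   using exactD(4)[OF 1 y] unfolding fac by (simp add: xn_def del: in_mcball)
  hence m: "(T ^^ Suc n) y \<in> mcball (T xn) (\<kappa> * g (T xn))"
   using mcball_subset_concentric[OF le2] by blast
  hence "g ((T ^^ Suc n) y) = g (T xn)" by (rule g_const)
  thus ?thesis using m yn der unfolding S_Suc sder_def by (simp add: xn_def del: in_mcball)
 qed
 moreover have "T xn = (T ^^ Suc n) x" by (simp add: xn_def)
 ultimately show ?case using 1 unfolding fac by metis
qed

text \<open>A point with the same positive gauge is outside \<open>Q\<close>, and one within
  \<open>\<kappa>\<close> of a point outside \<open>W\<close> is outside \<open>W\<close>; so the
  whole ball shares the regularity of its centre.\<close>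

lemma ball_iter':
 assumes x: "x \<in> M" and nQ: "!!i. i <= n ==> (T ^^ i) x ~: Q" and nW: "!!i. i < n ==> (T ^^ i) x ~: W"
  and V: "0 < V" "!!i. i <= n ==> V * S i x <= 1" and y: "y \<in> mcball x (\<kappa> * V * g x)" and "i <= n"
 shows "S i y = S i x" "g ((T ^^ i) y) = g ((T ^^ i) x)" "(T ^^ i) y ~: Q" "i < n ==> (T ^^ i) y ~: W"
proof -
 have b: "S i y = S i x & g ((T ^^ i) y) = g ((T ^^ i) x) &
    (T ^^ i) y \<in> mcball ((T ^^ i) x) (\<kappa> * g ((T ^^ i) x))"
  using ball_iter[OF x, of i V] assms by auto
 thus "S i y = S i x" "g ((T ^^ i) y) = g ((T ^^ i) x)" by auto
 have "y \<in> M" using y by simp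
 thus "(T ^^ i) y ~: Q"
  using b nQ[OF \<open>i <= n\<close>] g_zero iter_in_M x by metis
 have "\<kappa> * g ((T ^^ i) x) <= \<kappa>" using g_range[OF iter_in_M[OF x, of i]] \<kappa>(1) by (simp add: mult_left_le)
 hence "(T ^^ i) y \<in> mcball ((T ^^ i) x) \<kappa>" using b mcball_subset_concentric by blast
 thus "i < n ==> (T ^^ i) y ~: W" using W_ball nW by blast
qed

lemma reg_exact:
 assumes "reg x" "0 < V" "!!i. i <= n ==> V * S i x <= 1"
 shows "exact (T ^^ n) x (\<kappa> * V * g x) (S n x * g ((T ^^ n) x) / g x)"
 using ball_iter[OF regD(1,3,4)[OF assms(1)] assms(2,3)] by blast

lemma reg_ball:
 assumes "reg x" "0 < V" "!!i. i <= n ==> V * S i x <= 1" "y \<in> mcball x (\<kappa> * V * g x)"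
 shows "S n y = S n x" "g ((T ^^ n) y) = g ((T ^^ n) x)" "(T ^^ n) y ~: Q"
 using ball_iter'[OF regD(1,3,4)[OF assms(1)] assms(2-4), of n] by auto

text \<open>Until the gauge first reaches \<open>\<delta>\<close>, every factor of \<open>S\<close>
  is 1 by \<open>near\<close>.\<close>

lemma exit_S:
 assumes "reg x"
 obtains n where "\<delta> <= g ((T ^^ n) x)" "!!i. i <= n ==> S i x = 1"
proof -
 define n where "n = (LEAST n. \<delta> <= g ((T ^^ n) x))"
 have ex: "EX n. \<delta> <= g ((T ^^ n) x)" using leaves_Q regD[OF assms] by blast
 have 1: "\<delta> <= g ((T ^^ n) x)" unfolding n_def by (rule LeastI_ex[OF ex])
 have 2: "g ((T ^^ i) x) < \<delta>" if "i < n" for i using not_less_Least[of i] that unfolding n_def by force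
 have "S i x = 1" if "i <= n" for i
  using that
 proof (induction i)
  case (Suc i)
  hence "sder g ((T ^^ i) x) = 1" using near[OF regD(2,3)[OF assms] 2[of i]] by simp
  thus ?case using Suc by (simp add: S_Suc)
 qed simp
 thus ?thesis using that 1 by blast
qed

text \<open>The first time at which \<open>S\<close> exceeds \<open>B\<close> is a maximum so far.
  Waiting until the orbit leaves the neighbourhood of \<open>Q\<close> adds only factors 1, so the
  gauge becomes at least \<open>\<delta>\<close> without losing the record.\<close>

lemma S_record:
 assumes x: "reg x" and unb: "ALL B. EX n. B < S n x"
 obtains n where "B < S n x" "!!i. i <= n ==> S i x <= S n x" "\<delta> <= g ((T ^^ n) x)"
proof -
 define n where "n = (LEAST n. B < S n x)"
 have 1: "B < S n x" unfolding n_def using unb LeastI_ex by metis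
 have 2: "S i x <= S n x" if "i <= n" for i
 proof (cases "i = n")
  case False
  hence "~ B < S i x" using that not_less_Least[of i "%n. B < S n x"] unfolding n_def by simp
  thus ?thesis using 1 by simp
 qed simp
 obtain e where e: "\<delta> <= g ((T ^^ e) ((T ^^ n) x))" "!!i. i <= e ==> S i ((T ^^ n) x) = 1"
  using exit_S[OF reg_iter[OF x]] by blast
 have 3: "S (n + i) x = S n x" if "i <= e" for i using e(2)[OF that] by (simp add: S_add)
 have "S i x <= S (n + e) x" if "i <= n + e" for i
 proof (cases "i <= n")
  case True thus ?thesis using 2 3[of e] by simp
 next
  case False
  thus ?thesis using 3[of "i - n"] 3[of e] that by simp
 qed
 moreover have "(T ^^ e) ((T ^^ n) x) = (T ^^ (n + e)) x" by (simp add: funpow_add add.commute[of n e])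
 ultimately show ?thesis using that[of "n + e"] 1 3[of e] e(1) by simp
qed

text \<open>At a record time \<open>n\<close> a ball of radius \<open>\<kappa> * g y / S n y\<close>
  about \<open>y\<close> is blown up to radius at least \<open>\<kappa> * \<delta>\<close>. A
  suitable point near \<open>x\<close> lands in its outer part, up to the factor
  \<open>q ^ m\<close> lost by \<open>perfect\<close>. The first \<open>k\<close> steps are covered
  by \<open>power_form\<close>, so the orbit of \<open>x\<close> itself may be irregular at
  first.\<close>

lemma unbounded_Jul:
 assumes x: "x \<in> M" and y: "reg ((T ^^ k) x)" and unb: "ALL B. EX n. B < S n ((T ^^ k) x)"
 shows "x \<in> Jul"
proof -
 define y where "y = (T ^^ k) x"
 have ry: "reg y" unfolding y_def by (rule assms(2))
 have gy: "0 < g y" using reg_g_pos[OF ry, of 0] by simp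
 obtain \<rho> a m where \<rho>: "\<rho> > 0" "a > 0" "m >= 1"
  "!!x'. x' \<in> M ==> d x x' <= \<rho> ==> d y ((T ^^ k) x') = a * d x x' ^ m"
  using power_form[OF x, of k] unfolding y_def by blast
 obtain q where q: "q > 1" "!!x r. x \<in> M ==> 0 < r ==> r <= 1 ==> EX y:M. r / q <= d x y & d x y <= r"
  using perfect by blast
 have eps: "0 < \<kappa> * \<delta> / q ^ m" using \<kappa>(1) \<delta> q(1) by simp
 show ?thesis
 proof (rule Jul_I[OF x eps])
  fix e :: real assume "0 < e"
  define e' where "e' = min e (min \<rho> 1)"
  have e': "0 < e'" "e' <= e" "e' <= \<rho>" "e' <= 1" unfolding e'_def using \<open>0 < e\<close> \<rho>(1) by auto
  obtain n where n: "\<kappa> * g y / (a * e' ^ m) < S n y" "!!i. i <= n ==> S i y <= S n y" "\<delta> <= g ((T ^^ n) y)"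
   using S_record[OF ry] unb unfolding y_def by metis
  have Sn: "0 < S n y" by (rule S_pos[OF ry])
  define R where "R = \<kappa> * g y / S n y"
  have R: "0 < R" unfolding R_def using \<kappa>(1) gy Sn by simp
  have "R <= a * e' ^ m" unfolding R_def using n(1) Sn \<rho>(2) e'(1) by (simp add: field_simps)
  \<comment> \<open>\<open>a * u0 ^ m = R\<close>: a point at distance \<open>u0\<close> from
    \<open>x\<close> would be sent to distance exactly \<open>R\<close> from
    \<open>y\<close>.\<close>
  define u0 where "u0 = root m (R / a)"
  have u0: "0 < u0" "u0 ^ m = R / a" unfolding u0_def using R \<rho>(2,3) by auto
  have "u0 ^ m <= e' ^ m" unfolding u0 using \<open>R <= a * e' ^ m\<close> \<rho>(2) by (simp add: field_simps)
  hence "u0 <= e'" using power_mono_iff[of u0 e' m] u0 e' \<rho>(3) by simp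
  then obtain x' where x': "x' \<in> M" "u0 / q <= d x x'" "d x x' <= u0" using q(2)[OF x u0(1)] e' by auto
  have dy: "d y ((T ^^ k) x') = a * d x x' ^ m" using \<rho>(4)[OF x'(1)] x'(3) \<open>u0 <= e'\<close> e'(3) by simp
  have "d x x' ^ m <= u0 ^ m" using x'(3) by (intro power_mono) auto
  hence up: "d y ((T ^^ k) x') <= R" using dy u0(2) \<rho>(2) by (simp add: field_simps)
  have "(u0 / q) ^ m <= d x x' ^ m" using x'(2) u0(1) q(1) by (intro power_mono) auto
  hence "R / a / q ^ m <= d x x' ^ m" by (simp add: u0(2)[symmetric] power_divide)
  hence "a * (R / a / q ^ m) <= a * d x x' ^ m" using \<rho>(2) by (intro mult_left_mono) auto
  hence low: "R / q ^ m <= d y ((T ^^ k) x')" using dy \<rho>(2) by simp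
  have ex: "exact (T ^^ n) y (\<kappa> * (1 / S n y) * g y) (S n y * g ((T ^^ n) y) / g y)"
   by (rule reg_exact[OF ry]) (use Sn n(2) in "simp_all add: field_simps")
  have "(T ^^ k) x' \<in> mcball y (\<kappa> * (1 / S n y) * g y)"
   using up x'(1) regD(1)[OF ry] unfolding R_def by (simp add: iter_in_M)
  moreover have "y \<in> mcball y (\<kappa> * (1 / S n y) * g y)"
   using regD(1)[OF ry] \<kappa>(1) Sn gy by simp
  ultimately have "d ((T ^^ n) y) ((T ^^ n) ((T ^^ k) x')) = S n y * g ((T ^^ n) y) / g y * d y ((T ^^ k) x')"
   using exactD(3)[OF ex] by blast
  moreover have "S n y * g ((T ^^ n) y) / g y * (R / q ^ m) <= S n y * g ((T ^^ n) y) / g y * d y ((T ^^ k) x')"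
   using low Sn gy reg_g_pos[OF ry, of n] by (intro mult_left_mono) auto
  moreover have "S n y * g ((T ^^ n) y) / g y * (R / q ^ m) = \<kappa> * g ((T ^^ n) y) / q ^ m"
   unfolding R_def using gy Sn by simp
  moreover have "\<kappa> * \<delta> / q ^ m <= \<kappa> * g ((T ^^ n) y) / q ^ m"
   using n(3) \<kappa>(1) q(1) by (simp add: divide_right_mono)
  ultimately have "\<kappa> * \<delta> / q ^ m <= d ((T ^^ n) y) ((T ^^ n) ((T ^^ k) x'))" by linarith
  hence "\<kappa> * \<delta> / q ^ m <= d ((T ^^ (n + k)) x) ((T ^^ (n + k)) x')" unfolding y_def by (simp add: funpow_add)
  moreover have "x' \<in> mcball x e" using x x' \<open>u0 <= e'\<close> e' by simp
  ultimately show "EX y:mcball x e. EX n. \<kappa> * \<delta> / q ^ m <= d ((T ^^ n) x) ((T ^^ n) y)" by blast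
 qed
qed

text \<open>All iterates are similarities on one ball with factors at most
  \<open>B / g x\<close>.\<close>

lemma bounded_Fat:
 assumes x: "reg x" and B: "!!n. S n x <= B"
 shows "x \<in> Fat"
proof -
 have B1: "1 <= B" using B[of 0] by simp
 let ?U = "mcball x (\<kappa> * (1 / B) * g x)"
 have xM: "x \<in> M" and gx: "0 < g x" using regD(1)[OF x] reg_g_pos[OF x, of 0] by auto
 have r: "0 < \<kappa> * (1 / B) * g x" using \<kappa>(1) B1 gx by simp
 have ex: "exact (T ^^ n) x (\<kappa> * (1 / B) * g x) (S n x * g ((T ^^ n) x) / g x)" for n
  by (rule reg_exact[OF x]) (use B B1 in "simp_all add: field_simps")
 have "equi ?U" unfolding equi_def
 proof (intro ballI allI impI)
  fix y and \<epsilon> :: real assume y: "y \<in> ?U" and e: "0 < \<epsilon>"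
  have "d ((T ^^ n) y) ((T ^^ n) y') < \<epsilon>" if y': "y' \<in> ?U" "d y y' < \<epsilon> * g x / B" for y' n
  proof -
   have "d ((T ^^ n) y) ((T ^^ n) y') = S n x * g ((T ^^ n) x) / g x * d y y'"
    using exactD(3)[OF ex y y'(1)] .
   also have "\<dots> <= B * 1 / g x * d y y'"
    using B[of n] B1 g_range(2)[OF regD(2)[OF x, of n]] reg_g_pos[OF x, of n] gx
    by (intro mult_right_mono divide_right_mono mult_mono) auto
   also have "\<dots> < \<epsilon>" using y'(2) B1 gx by (simp add: field_simps)
   finally show ?thesis .
  qed
  moreover have "0 < \<epsilon> * g x / B" using e gx B1 by simp
  ultimately show "EX \<delta>>0. ALL y':?U. d y y' < \<delta> --> (ALL n. d ((T ^^ n) y) ((T ^^ n) y') < \<epsilon>)" by blast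
 qed
 moreover have "x \<in> ?U" using xM r by (auto simp: mult.assoc)
 ultimately show ?thesis unfolding Fat_def using openin_mcball[OF r] xM by blast
qed

lemma Jul_reg:
 assumes "x \<in> Jul" "!!n. (T ^^ n) x ~: Q" shows "reg x" "ALL B. EX n. B < S n x"
proof -
 show r: "reg x" unfolding reg_def
  using assms Jul_forward[OF assms(1)] W_subset_Fat Jul_subset unfolding Jul_def by blast
 show "ALL B. EX n. B < S n x"
 proof (rule ccontr)
  assume "~ ?thesis"
  then obtain B where "!!n. S n x <= B" by (meson not_le)
  thus False using bounded_Fat[OF r] assms(1) unfolding Jul_def by blast
 qed
qed

end

section \<open>Orbits of Fatou points\<close>

context gauged_dyn
begin

text \<open>Take \<open>N\<close> where \<open>S N x\<close> exceeds half of the supremum over all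
  times from \<open>n0\<close> on: afterwards the product can at most double. Waiting for the exit
  from the neighbourhood of \<open>Q\<close> leaves it unchanged. As \<open>n0\<close> is arbitrary
  there are infinitely many such times, as the pigeonhole principle requires.\<close>

lemma good_times:
 assumes x: "reg x" and B: "!!n. S n x <= B"
 shows "EX N>=n0. \<delta> <= g ((T ^^ N) x) & (ALL j. S j ((T ^^ N) x) <= 2)"
proof -
 define m where "m = (SUP n\<in>{n0..}. S n x)"
 have bdd: "bdd_above ((%n. S n x) ` {n0..})" using B by (auto simp: bdd_above_def)
 have le: "S n x <= m" if "n0 <= n" for n unfolding m_def using bdd that by (intro cSUP_upper) auto
 have "0 < m" using le[of n0] S_pos[OF x, of n0] by simp
 hence "m / 2 < (SUP n\<in>{n0..}. S n x)" unfolding m_def[symmetric] by simp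
 hence "EX N:{n0..}. m / 2 < S N x" by (subst (asm) less_cSUP_iff) (use bdd in auto)
 then obtain N where N: "N >= n0" "m / 2 < S N x" by auto
 obtain e where e: "\<delta> <= g ((T ^^ e) ((T ^^ N) x))" "!!i. i <= e ==> S i ((T ^^ N) x) = 1"
  using exit_S[OF reg_iter[OF x]] by blast
 have eq: "(T ^^ e) ((T ^^ N) x) = (T ^^ (N + e)) x" by (simp add: funpow_add add.commute[of N e])
 have "S j ((T ^^ (N + e)) x) <= 2" for j
 proof -
  have "S (N + e + j) x = S N x * S j ((T ^^ (N + e)) x)"
   unfolding S_add[of "N + e" j] S_add[of N e] using e(2)[of e] by simp
  moreover have "S (N + e + j) x <= m" using le N by simp
  ultimately have "S N x * S j ((T ^^ (N + e)) x) < S N x * 2" using N(2) by linarith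
  thus ?thesis using S_pos[OF x, of N] by simp
 qed
 thus ?thesis using e(1) N(1) unfolding eq by (intro exI[of _ "N + e"]) auto
qed

text \<open>For a settled point \<open>S <= 2\<close> and \<open>g >= \<delta>\<close>, so
  \<open>ball_iter\<close> with \<open>V = 1/2\<close> covers all iterates on a ball of this radius,
  which does not depend on the point.\<close>

definition R0 :: real where "R0 = \<kappa> * \<delta> / 2"

definition settled :: "'a => bool" where
 "settled x \<longleftrightarrow> reg x & \<delta> <= g x & (ALL j. S j x <= 2)"

lemma settled_exact:
 assumes "settled x"
 shows "exact (T ^^ n) x R0 (S n x * g ((T ^^ n) x) / g x)"
  and "y \<in> mcball x R0 ==> S n y = S n x & g ((T ^^ n) y) = g ((T ^^ n) x)"
proof -
 have x: "reg x" "\<delta> <= g x" "!!i. 1/2 * S i x <= 1" using assms unfolding settled_def by auto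
 have le: "R0 <= \<kappa> * (1/2) * g x" unfolding R0_def using x(2) \<kappa>(1) by simp
 have xin: "x \<in> mcball x (\<kappa> * (1/2) * g x)" using regD(1)[OF x(1)] x(2) \<delta> \<kappa>(1) by simp
 show "exact (T ^^ n) x R0 (S n x * g ((T ^^ n) x) / g x)"
  by (rule exact_sub[OF reg_exact[OF x(1) _ x(3)] xin le]) simp
 assume "y \<in> mcball x R0"
 hence "y \<in> mcball x (\<kappa> * (1/2) * g x)" using mcball_subset_concentric[OF le] by blast
 thus "S n y = S n x & g ((T ^^ n) y) = g ((T ^^ n) x)"
  using reg_ball[OF x(1) _ x(3), of y n] by simp
qed

lemma R0: "0 < R0" "R0 < 1"
proof -
 show "0 < R0" unfolding R0_def using \<kappa> \<delta> by simp
 have "\<kappa> * \<delta> < 1" using \<kappa>(1,2) \<delta> mult_le_one[of \<delta> \<kappa>] by (smt (verit) mult_left_le)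
 thus "R0 < 1" unfolding R0_def using \<kappa>(1) \<delta> by simp
qed

text \<open>A factor above 1 would let the inverse branch of \<open>T ^^ l\<close> be iterated
  inside the ball; the points obtained have \<open>S (l * k)\<close> equal to the
  \<open>k\<close>-th power of the factor, against the bound 2.\<close>

lemma settled_return:
 assumes x: "settled x" and l: "(T ^^ l) x \<in> mcball x R0"
 shows "exact (T ^^ l) x R0 (S l x)" "S l x <= 1"
proof -
 have rx: "reg x" using x unfolding settled_def by blast
 have "g ((T ^^ l) x) = g x" using settled_exact(2)[OF x l, of 0] by simp
 thus ex: "exact (T ^^ l) x R0 (S l x)"
  using settled_exact(1)[OF x, of l] reg_g_pos[OF rx, of 0] by simp
 show "S l x <= 1"
 proof (rule ccontr)
  assume "~ ?thesis"
  hence s: "1 < S l x" by simp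
  have eq: "mcball ((T ^^ l) x) R0 = mcball x R0" by (rule mcball_eq[OF l])
  have "R0 <= S l x * R0" using s R0(1) by simp
  hence sub: "mcball x R0 \<subseteq> mcball ((T ^^ l) x) (S l x * R0)"
   unfolding eq[symmetric] by (rule mcball_subset_concentric)
  have "EX w:mcball x R0. S (l * k) w = S l x ^ k" for k
  proof (induction k)
   case 0
   thus ?case using regD(1)[OF rx] R0(1) by (intro bexI[of _ x]) auto
  next
   case (Suc k)
   then obtain w where w: "w \<in> mcball x R0" "S (l * k) w = S l x ^ k" by blast
   obtain w' where w': "w' \<in> mcball x R0" "(T ^^ l) w' = w"
    using exact_surj[OF ex, of w] sub w(1) by blast
   have "S (l * Suc k) w' = S l w' * S (l * k) w" using w'(2) by (simp add: S_add)
   also have "S l w' = S l x" using settled_exact(2)[OF x w'(1)] by simp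
   finally show ?case using w w' by (intro bexI[of _ w']) auto
  qed
  hence "S l x ^ k <= 2" for k
   using settled_exact(2)[OF x, of _ "l * k"] x unfolding settled_def by (metis (no_types))
  thus False using real_arch_pow[OF s, of 2] by (meson not_le)
 qed
qed

definition attracting_ball :: "'a => real => nat => bool" where
 "attracting_ball c R l \<longleftrightarrow> c \<in> M & 0 < R & 1 <= l & (T ^^ l) c \<in> mcball c R &
   (EX \<eta><1. ALL x:mcball c R. ALL y:mcball c R. d ((T ^^ l) x) ((T ^^ l) y) <= \<eta> * d x y)"

text \<open>Besides the isometric return, all iterates are required to be similarities on this one
  ball with bounded factors: nearby orbits then stay close for ever, which
  \<open>isometric_cycle\<close> uses.\<close>

definition isometric_ball :: "'a => real => nat => bool" where
 "isometric_ball c R l \<longleftrightarrow> c \<in> M & 0 < R & 1 <= l & (T ^^ l) c \<in> mcball c R & exact (T ^^ l) c R 1 &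
   (EX B. ALL j. EX s<=B. exact (T ^^ j) c R s)"

lemma settled_ball:
 assumes x: "settled x" and l: "1 <= l" "(T ^^ l) x \<in> mcball x R0"
 shows "attracting_ball x R0 l \<or> isometric_ball x R0 l"
proof -
 have rx: "reg x" and gx: "\<delta> <= g x" and S2: "!!j. S j x <= 2" using x unfolding settled_def by auto
 note ret = settled_return[OF x l(2)]
 show ?thesis
 proof (cases "S l x = 1")
  case True
  have "EX s<=2 / \<delta>. exact (T ^^ j) x R0 s" for j
  proof -
   have "S j x * g ((T ^^ j) x) / g x <= 2 * 1 / \<delta>"
    using S2[of j] S_pos[OF rx, of j] gx \<delta> g_range(2)[OF regD(2)[OF rx, of j]] reg_g_pos[OF rx, of j]
    by (intro frac_le mult_mono) auto
   thus ?thesis using settled_exact(1)[OF x, of j] by auto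
  qed
  hence "isometric_ball x R0 l" unfolding isometric_ball_def
   using ret(1) True l R0(1) regD(1)[OF rx] by metis
  thus ?thesis ..
 next
  case False
  hence "S l x < 1" using ret(2) by simp
  hence "attracting_ball x R0 l" unfolding attracting_ball_def
   using exactD(3)[OF ret(1)] l R0(1) regD(1)[OF rx] by (metis order_refl)
  thus ?thesis ..
 qed
qed

text \<open>\<open>S\<close> is multiplied by at most 1 in each period, so its maximum over the
  first period bounds it.\<close>

lemma periodic_settled:
 assumes x: "reg x" and n: "1 <= n" "(T ^^ n) x = x" and "S n x <= 1"
 shows "EX N. settled ((T ^^ N) x)" "x \<in> Fat"
proof -
 define B where "B = Max ((%i. S i x) ` {..n})"
 have B: "S m x <= B" for m
 proof (induction m rule: less_induct)
  case (less m)
  show ?case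
  proof (cases "m <= n")
   case True thus ?thesis unfolding B_def by (intro Max_ge) auto
  next
   case False
   hence "S m x = S n x * S (m - n) x" using S_add[of n "m - n" x] n(2) by simp
   also have "\<dots> <= 1 * S (m - n) x" using assms(4) S_pos[OF x, of "m - n"] by (intro mult_right_mono) auto
   also have "\<dots> <= B" using less[of "m - n"] False n(1) by simp
   finally show ?thesis .
  qed
 qed
 show "EX N. settled ((T ^^ N) x)"
  using good_times[OF x B, of 0] reg_iter[OF x] unfolding settled_def by blast
 show "x \<in> Fat" by (rule bounded_Fat[OF x B])
qed

text \<open>Two visits to the same member of a finite family of balls yield a return map. The family
  consists of the contracting balls if \<open>W\<close> is visited infinitely often. Otherwise the
  tail of the orbit is regular, \<open>S\<close> is bounded along it as \<open>x\<close> is not in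
  the Julia set, and balls of radius \<open>R0\<close> are used at settled times.\<close>

lemma Fat_outcome:
 assumes x: "x \<in> Fat"
 shows "EX N c R l. (T ^^ N) x \<in> mcball c R & (attracting_ball c R l \<or> isometric_ball c R l)"
proof -
 have xM: "x \<in> M" using x unfolding Fat_def by blast
 have nQ: "(T ^^ n) x ~: Q" for n using hits_Q_Jul[OF xM] x unfolding Jul_def by blast
 have iM: "(T ^^ n) x \<in> M" for n by (rule iter_in_M[OF xM])
 show ?thesis
 proof (cases "infinite {n. (T ^^ n) x \<in> W}")
  case True
  have "{n. (T ^^ n) x \<in> W} = (\<Union>c\<in>crit - Q. {n. (T ^^ n) x \<in> mcball c (t c)})"
   unfolding sing_def by blast
  then obtain c where c: "c \<in> crit - Q" "infinite {n. (T ^^ n) x \<in> mcball c (t c)}"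
   using True finite_crit by (metis (no_types, lifting) finite_Diff finite_UN_I)
  obtain i where i: "(T ^^ i) x \<in> mcball c (t c)" using c(2) not_finite_existsD by blast
  obtain j where j: "i < j" "(T ^^ j) x \<in> mcball c (t c)"
   using c(2) unfolding infinite_nat_iff_unbounded by auto
  define l where "l = j - i"
  have l: "1 <= l" "(T ^^ l) ((T ^^ i) x) = (T ^^ j) x"
   unfolding l_def using j(1) funpow_add[of "j - i" i T] by simp_all
  obtain \<eta> where \<eta>: "\<eta> < 1" "ALL n>=1. ALL x:mcball c (t c). ALL y:mcball c (t c).
    d ((T ^^ n) x) ((T ^^ n) y) <= \<eta> * d x y" using contr[OF c(1)] by blast
  let ?y = "(T ^^ i) x"
  have eq: "mcball ?y (t c) = mcball c (t c)" by (rule mcball_eq[OF i])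
  have "attracting_ball ?y (t c) l" unfolding attracting_ball_def eq l(2)
   using iM t_pos[OF c(1)] l j(2) \<eta> by blast
  moreover have "?y \<in> mcball ?y (t c)" using eq i by simp
  ultimately show ?thesis by blast
 next
  case False
  then obtain n0 where n0: "!!n. (T ^^ n) x \<in> W ==> n < n0"
   using finite_nat_set_iff_bounded by auto
  define y where "y = (T ^^ n0) x"
  have iy: "(T ^^ n) y = (T ^^ (n + n0)) x" for n unfolding y_def by (simp add: funpow_add)
  have ry: "reg y" unfolding reg_def iy using nQ n0 iM[of n0] y_def by (metis not_add_less2)
  have "~ (ALL B. EX n. B < S n y)"
   using unbounded_Jul[OF xM, of n0] ry x unfolding y_def Jul_def by blast
  then obtain B where B: "!!n. S n y <= B" by (meson not_le)
  let ?A = "{N. settled ((T ^^ N) y)}"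
  have "ALL n0. EX N>=n0. N \<in> ?A" using good_times[OF ry B] reg_iter[OF ry] unfolding settled_def by blast
  hence "infinite ?A" unfolding infinite_nat_iff_unbounded_le by blast
  then obtain c where c: "c \<in> M" "infinite {N \<in> ?A. (T ^^ N) y \<in> mcball c R0}"
   using infinite_same_ball[OF _ R0(1), of ?A "%N. (T ^^ N) y"] regD(2)[OF ry] by blast
  obtain i where i: "settled ((T ^^ i) y)" "(T ^^ i) y \<in> mcball c R0" using c(2) not_finite_existsD by blast
  obtain j where j: "i < j" "(T ^^ j) y \<in> mcball c R0" using c(2) unfolding infinite_nat_iff_unbounded by auto
  have "(T ^^ (j - i)) ((T ^^ i) y) = (T ^^ j) y"
   using j(1) funpow_add[of "j - i" i T] by simp
  hence "(T ^^ (j - i)) ((T ^^ i) y) \<in> mcball ((T ^^ i) y) R0" using j(2) mcball_eq[OF i(2)] by simp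
  hence "attracting_ball ((T ^^ i) y) R0 (j - i) \<or> isometric_ball ((T ^^ i) y) R0 (j - i)"
   using settled_ball[OF i(1), of "j - i"] j(1) by simp
  moreover have "(T ^^ (i + n0)) x \<in> mcball ((T ^^ i) y) R0"
   unfolding iy[symmetric] using regD(2)[OF ry] R0(1) by simp
  ultimately show ?thesis by blast
 qed
qed

end

section \<open>Non-repelling periodic points and their finiteness\<close>

context ultra_dyn
begin

text \<open>The metric counterpart of a multiplier of absolute value at most 1;
  \<open>nonrep_iff\<close> compares the two.\<close>

definition nonrep :: "'a => bool" where
 "nonrep x \<longleftrightarrow> x \<in> M & (EX n>=1. (T ^^ n) x = x & (EX r>0. ALL y:mcball x r. d x ((T ^^ n) y) <= d x y))"

lemma periodic_mult: "(T ^^ n) x = x ==> (T ^^ (n * k)) x = x"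
 by (induction k) (auto simp: funpow_add)

lemma periodic_returns:
 assumes "(T ^^ n) x = x" "1 <= n" shows "EX j. (T ^^ j) ((T ^^ i) x) = x"
proof -
 have "i <= n * i" using assms(2) by simp
 hence "(T ^^ (n * i - i)) ((T ^^ i) x) = (T ^^ (n * i)) x"
  using funpow_add[of "n * i - i" i T] by simp
 thus ?thesis using periodic_mult[OF assms(1)] by metis
qed

lemma periodic_iter: "(T ^^ n) x = x ==> (T ^^ n) ((T ^^ i) x) = (T ^^ i) x"
 by (metis add.commute funpow_add o_apply)

lemma finite_periodic_orbit:
 assumes "(T ^^ n) x = x" "1 <= n" shows "finite (orbit T x)"
proof -
 have "(T ^^ k) x = (T ^^ (k mod n)) x" for k
 proof -
  have "(T ^^ (k mod n + n * (k div n))) x = (T ^^ (k mod n)) x"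
   using periodic_mult[OF assms(1)] by (simp only: funpow_add o_apply)
  thus ?thesis by simp
 qed
 moreover have "k mod n < n" for k using assms(2) by simp
 ultimately have "orbit T x \<subseteq> (%k. (T ^^ k) x) ` {..<n}" unfolding orbit_def by blast
 thus ?thesis using finite_subset by blast
qed

lemma nonrep_notin_Q: "nonrep x ==> (T ^^ i) x ~: Q"
proof
 assume x: "nonrep x" and "(T ^^ i) x \<in> Q"
 then obtain n r where n: "1 <= n" "(T ^^ n) x = x" "r > 0" "ALL y:mcball x r. d x ((T ^^ n) y) <= d x y" and xM: "x \<in> M"
  unfolding nonrep_def by blast
 have "x \<in> Q" using periodic_returns[OF n(2,1)] iter_Q[OF \<open>(T ^^ i) x \<in> Q\<close>] by metis
 then obtain r' l where r': "r' > 0" "l > 1" "ALL y:mcball x r'. d x ((T ^^ n) y) = l * d x y"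
  using Q_repelling n(1,2) by blast
 obtain y where y: "y \<in> M" "0 < d x y" "d x y <= min r r'"
  using other_point[OF xM, of "min r r'"] n(3) r'(1) by auto
 hence "y \<in> mcball x r" "y \<in> mcball x r'" using xM by auto
 hence "l * d x y <= d x y" using n(4) r'(3) by metis
 thus False using y(2) r'(2) by simp
qed

end

context gauged_dyn
begin

text \<open>The iterate \<open>n * k\<close> fixes both points, yet every positive iterate contracts
  distances in the ball.\<close>

lemma periodic_in_W_unique:
 assumes c: "c \<in> crit - Q" and x: "x \<in> mcball c (t c)" "1 <= n" "(T ^^ n) x = x"
  and y: "y \<in> mcball c (t c)" "1 <= k" "(T ^^ k) y = y"
 shows "x = y"
proof (rule ccontr)
 assume "x ~= y"
 hence p: "0 < d x y" using x(1) y(1) by auto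
 obtain \<eta> where \<eta>: "\<eta> < 1" "ALL n>=1. ALL x:mcball c (t c). ALL y:mcball c (t c).
    d ((T ^^ n) x) ((T ^^ n) y) <= \<eta> * d x y" using contr[OF c] by blast
 have "1 <= n * k" using x(2) y(2) by simp
 hence "d ((T ^^ (n * k)) x) ((T ^^ (n * k)) y) <= \<eta> * d x y" using \<eta>(2) x(1) y(1) by blast
 moreover have "(T ^^ (n * k)) x = x" "(T ^^ (n * k)) y = y"
  using periodic_mult[OF x(3)] periodic_mult[OF y(3), of n] by (simp_all add: mult.commute)
 ultimately have "d x y <= \<eta> * d x y" by simp
 thus False using p \<eta>(1) by simp
qed

text \<open>Over a period the gauge returns to its value, so the scaling factor is
  \<open>S n x\<close>; one nearby point shows that it is at most 1.\<close>

lemma nonrep_S: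
 assumes "nonrep x" "reg x"
 obtains n where "1 <= n" "(T ^^ n) x = x" "S n x <= 1"
proof -
 obtain n r where n: "1 <= n" "(T ^^ n) x = x" "r > 0" "ALL y:mcball x r. d x ((T ^^ n) y) <= d x y"
  using assms(1) unfolding nonrep_def by blast
 have xM: "x \<in> M" and gx: "0 < g x" using regD(1)[OF assms(2)] reg_g_pos[OF assms(2), of 0] by auto
 define B where "B = Max ((%i. S i x) ` {..n})"
 have B: "S i x <= B" if "i <= n" for i unfolding B_def using that by (intro Max_ge) auto
 have Bp: "0 < B" using B[of 0] by simp
 have ex: "exact (T ^^ n) x (\<kappa> * (1 / B) * g x) (S n x * g ((T ^^ n) x) / g x)"
  by (rule reg_exact[OF assms(2)]) (use B Bp in "simp_all add: field_simps")
 obtain y where y: "y \<in> M" "0 < d x y" "d x y <= min r (\<kappa> * (1 / B) * g x)"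
  using other_point[OF xM, of "min r (\<kappa> * (1 / B) * g x)"] n(3) \<kappa>(1) Bp gx by auto
 have "d ((T ^^ n) x) ((T ^^ n) y) = S n x * g ((T ^^ n) x) / g x * d x y"
  by (rule exactD(3)[OF ex]) (use xM y \<kappa>(1) Bp gx in auto)
 hence "d x ((T ^^ n) y) = S n x * d x y" using n(2) gx by simp
 moreover have "d x ((T ^^ n) y) <= d x y" using n(4) y xM by simp
 ultimately have "S n x <= 1" using y(2) by simp
 thus ?thesis using that n by blast
qed

lemma nonrep_Fat: "nonrep x ==> x \<in> Fat"
proof -
 assume x: "nonrep x"
 hence xM: "x \<in> M" unfolding nonrep_def by blast
 show ?thesis
 proof (cases "EX i. (T ^^ i) x \<in> W")
  case True
  then obtain i where "(T ^^ i) x \<in> Fat" using W_subset_Fat by blast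
  thus ?thesis using Jul_forward[of x i] xM unfolding Jul_def by blast
 next
  case False
  hence "reg x" unfolding reg_def using xM nonrep_notin_Q[OF x] by blast
  thus ?thesis using nonrep_S[OF x] periodic_settled(2) by blast
 qed
qed

text \<open>Every such cycle passes through a contracting ball or has a settled point. There are
  finitely many contracting balls and finitely many balls of radius \<open>R0\<close>, and each ball
  that occurs contains only finitely many periodic points.\<close>

lemma finite_nonrep: "finite {x. nonrep x}"
proof -
 define per where "per x \<longleftrightarrow> (EX k>=1. (T ^^ k) x = x)" for x
 define Z1 where "Z1 = (\<Union>c\<in>crit - Q. {x \<in> mcball c (t c). per x})"
 \<comment> \<open>Finiteness is built into the family, so that \<open>Z2\<close> is finite at once;
   that the ball of a settled point belongs to the family is shown for each point below.\<close>
 define GB where "GB = {D \<in> (%c. mcball c R0) ` M. finite {y \<in> D. per y}}"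
 define Z2 where "Z2 = (\<Union>D\<in>GB. {y \<in> D. per y})"
 have "finite {x \<in> mcball c (t c). per x}" if c: "c \<in> crit - Q" for c
 proof (cases "{x \<in> mcball c (t c). per x} = {}")
  case False
  then obtain z where z: "z \<in> mcball c (t c)" "per z" by blast
  hence "{x \<in> mcball c (t c). per x} \<subseteq> {z}" using periodic_in_W_unique[OF c] unfolding per_def by blast
  thus ?thesis using finite_subset by blast
 next
  case True
  thus ?thesis by (simp only: finite.emptyI)
 qed
 hence "finite Z1" unfolding Z1_def using finite_crit by blast
 moreover have "finite Z2" unfolding Z2_def GB_def using finite_mcballs[OF R0(1)] by auto
 moreover have per_Z: "per z" if "z \<in> Z1 \<union> Z2" for z using that unfolding Z1_def Z2_def by blast
 ultimately have fin: "finite (\<Union>z\<in>Z1 \<union> Z2. orbit T z)"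
  using finite_periodic_orbit unfolding per_def by (meson finite_UN_I finite_Un)
 have "{x. nonrep x} \<subseteq> (\<Union>z\<in>Z1 \<union> Z2. orbit T z)"
 proof
  fix x assume "x \<in> {x. nonrep x}"
  hence x: "nonrep x" by simp
  hence xM: "x \<in> M" unfolding nonrep_def by blast
  obtain n where n: "1 <= n" "(T ^^ n) x = x" using x unfolding nonrep_def by blast
  have peri: "per ((T ^^ i) x)" for i using periodic_iter[OF n(2)] n(1) unfolding per_def by blast
  have "EX i. (T ^^ i) x \<in> Z1 \<union> Z2"
  proof (cases "EX i. (T ^^ i) x \<in> W")
   case True
   thus ?thesis using peri unfolding Z1_def sing_def by blast
  next
   case False
   hence rx: "reg x" unfolding reg_def using xM nonrep_notin_Q[OF x] by blast
   obtain k where k: "1 <= k" "(T ^^ k) x = x" "S k x <= 1" using nonrep_S[OF x rx] by blast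
   obtain N where N: "settled ((T ^^ N) x)" using periodic_settled(1)[OF rx k] by blast
   define y where "y = (T ^^ N) x"
   have y: "settled y" "(T ^^ k) y = y" unfolding y_def using N periodic_iter[OF k(2)] by auto
   have yM: "y \<in> M" unfolding y_def by (rule iter_in_M[OF xM])
   have yin: "y \<in> mcball y R0" "(T ^^ k) y \<in> mcball y R0" using yM R0(1) y(2) by auto
   note ret = settled_return[OF y(1) yin(2)]
   have "finite {z \<in> mcball y R0. per z}"
   proof (cases "S k y = 1")
    case True
    thus ?thesis using isometry_periodic[OF yM R0(1) R0(2) k(1) _ yin(2)] ret(1)
     unfolding per_def by simp
   next
    case False
    have "z = y" if z: "z \<in> mcball y R0" "per z" for z
    proof (rule ccontr)
     assume "z ~= y"
     hence p: "0 < d y z" using z(1) by auto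
     obtain i where i: "1 <= i" "(T ^^ i) z = z" using z(2) unfolding per_def by blast
     \<comment> \<open>In the contracting case the distance to \<open>y\<close> is multiplied by
       \<open>S k y < 1\<close> in every \<open>k\<close> steps, so no second periodic point of the
       ball could return.\<close>
     have stay: "(T ^^ (k * j)) z \<in> mcball y R0 & d y ((T ^^ (k * j)) z) = S k y ^ j * d y z" for j
     proof (induction j)
      case 0 thus ?case using z(1) by simp
     next
      case (Suc j)
      let ?w = "(T ^^ (k * j)) z"
      have e: "(T ^^ (k * Suc j)) z = (T ^^ k) ?w" by (simp add: funpow_add)
      have "d ((T ^^ k) y) ((T ^^ k) ?w) = S k y * d y ?w"
       using exactD(3)[OF ret(1) yin(1)] Suc by blast
      hence 1: "d y ((T ^^ k) ?w) = S k y * d y ?w" using y(2) by simp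
      have "S k y * d y ?w <= 1 * d y ?w" using ret(2) by (intro mult_right_mono) auto
      hence "d y ((T ^^ k) ?w) <= R0" using 1 Suc by simp
      hence "(T ^^ k) ?w \<in> mcball y R0" using yM iter_in_M Suc by simp
      thus ?case unfolding e using 1 Suc by simp
     qed
     have "(T ^^ (k * i)) z = z" using periodic_mult[OF i(2), of k] by (simp add: mult.commute)
     hence "d y z = S k y ^ i * d y z" using stay[of i] by metis
     moreover have "d y z ~= 0" using p by linarith
     ultimately have "S k y ^ i = 1" by (metis mult_cancel_right1)
     moreover have "S k y ^ i <= S k y ^ 1"
      using ret(2) exactD(1)[OF ret(1)] i(1) by (intro power_decreasing) auto
     ultimately show False using False ret(2) by simp
    qed
    hence "{z \<in> mcball y R0. per z} \<subseteq> {y}" by blast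
    thus ?thesis using finite_subset by blast
   qed
   hence "mcball y R0 \<in> GB" unfolding GB_def using yM by blast
   hence "y \<in> Z2" unfolding Z2_def using yin(1) peri[of N] unfolding y_def by blast
   thus ?thesis unfolding y_def by blast
  qed
  then obtain i where i: "(T ^^ i) x \<in> Z1 \<union> Z2" by blast
  obtain j where "(T ^^ j) ((T ^^ i) x) = x" using periodic_returns[OF n(2,1)] by blast
  hence "x \<in> orbit T ((T ^^ i) x)" unfolding orbit_def using CollectI by (metis (mono_tags, lifting))
  thus "x \<in> (\<Union>z\<in>Z1 \<union> Z2. orbit T z)" using i by blast
 qed
 thus ?thesis using fin finite_subset by blast
qed

end

section \<open>Minimal pieces\<close>

context ultra_dyn
begin

abbreviation cl :: "'a => 'a set" where "cl x \<equiv> mtopology closure_of (orbit T x)"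

lemma cl_iff: "x \<in> M ==> y \<in> cl x \<longleftrightarrow> y \<in> M & (ALL e>0. EX n. d y ((T ^^ n) x) < e)"
proof -
 assume "x \<in> M"
 hence "(EX z:orbit T x. z \<in> M & d y z < e) \<longleftrightarrow> (EX n. d y ((T ^^ n) x) < e)" for e
  unfolding orbit_def using iter_in_M by blast
 thus ?thesis unfolding closure_of_iff by simp
qed

lemma orbit_subset_cl: "x \<in> M ==> (T ^^ n) x \<in> cl x"
 by (subst cl_iff) (auto simp: iter_in_M intro!: exI[of _ n])

lemma cl_in_M: "y \<in> cl x ==> y \<in> M"
 unfolding closure_of_iff by blast

lemma orbit_subset: "T ` N \<subseteq> N ==> x \<in> N ==> (T ^^ n) x \<in> N"
 by (induction n) auto

lemma cl_subset:
 assumes "closedin mtopology N" "T ` N \<subseteq> N" "x \<in> N" shows "cl x \<subseteq> N"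
 using assms orbit_subset unfolding orbit_def by (intro closure_of_minimal) auto

lemma cl_invariant: assumes "x \<in> M" "y \<in> cl x" shows "T y \<in> cl x"
proof -
 have y: "y \<in> M" using assms(2) cl_in_M by blast
 show ?thesis unfolding cl_iff[OF assms(1)]
 proof (intro conjI allI impI)
  show "T y \<in> M" using maps y by blast
  fix e :: real assume "e > 0"
  then obtain \<delta> where \<delta>: "\<delta> > 0" "!!z. z \<in> M ==> d y z < \<delta> ==> d (T y) (T z) < e" using cont[OF y] by blast
  obtain n where "d y ((T ^^ n) x) < \<delta>" using assms(2) \<delta>(1) unfolding cl_iff[OF assms(1)] by blast
  hence "d (T y) ((T ^^ Suc n) x) < e" using \<delta>(2) iter_in_M[OF assms(1)] by simp
  thus "EX n. d (T y) ((T ^^ n) x) < e" by blast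
 qed
qed

lemma cl_trans: "x \<in> M ==> y \<in> cl x ==> cl y \<subseteq> cl x"
 by (rule cl_subset) (use cl_invariant in "auto simp del: in_mcball")

text \<open>Decomposability into minimal subsystems is encoded as symmetry of the relation
  \<open>y \<in> cl x\<close>; \<open>decomposes_iff\<close> proves the equivalence. In this form
  the property passes to differences.\<close>

definition piece :: "'a set => bool" where
 "piece N \<longleftrightarrow> openin mtopology N & closedin mtopology N & T ` N \<subseteq> N & (ALL x:N. ALL y:cl x. x \<in> cl y)"

lemma minimal_sub:
 assumes "N \<subseteq> M" "Z \<subseteq> N"
 shows "minimal_system (subtopology (subtopology mtopology N) Z) T \<longleftrightarrow>
  (ALL x:Z. Z \<inter> mtopology closure_of (Z \<inter> orbit T x) = Z)"
proof -
 have "N \<inter> Z = Z" "M \<inter> Z = Z" using assms by auto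
 thus ?thesis unfolding minimal_system_def subtopology_subtopology closure_of_subtopology by simp
qed

text \<open>Under symmetry the orbit closures in \<open>N\<close> are equal or disjoint, and each of
  them is minimal. Conversely, a class of the partition contains the closure of each of its orbits,
  and minimality makes every other point of the class a limit of that orbit.\<close>

lemma decomposes_iff:
 assumes N: "closedin mtopology N" "T ` N \<subseteq> N"
 shows "decomposes_into_minimal (subtopology mtopology N) T \<longleftrightarrow> (ALL x:N. ALL y:cl x. x \<in> cl y)"
proof
 have NM: "N \<subseteq> M" using N(1) closedin_metric by blast
 hence top: "topspace (subtopology mtopology N) = N" by auto
 {
  assume "decomposes_into_minimal (subtopology mtopology N) T"
  then obtain \<Z> where \<Z>: "partition_on N \<Z>" "!!Z. Z \<in> \<Z> ==> closedin (subtopology mtopology N) Z"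
   "!!Z. Z \<in> \<Z> ==> T ` Z \<subseteq> Z" "!!Z. Z \<in> \<Z> ==> minimal_system (subtopology (subtopology mtopology N) Z) T"
   unfolding decomposes_into_minimal_def top by blast
  show "ALL x:N. ALL y:cl x. x \<in> cl y"
  proof (intro ballI)
   fix x y assume x: "x \<in> N" and y: "y \<in> cl x"
   obtain Z where Z: "Z \<in> \<Z>" "x \<in> Z" using \<Z>(1) x unfolding partition_on_def by blast
   have ZN: "Z \<subseteq> N" using Z(1) \<Z>(1) unfolding partition_on_def by blast
   have clZ: "closedin mtopology Z" using \<Z>(2)[OF Z(1)] N(1) closedin_trans_full by blast
   have "y \<in> Z" using cl_subset[OF clZ \<Z>(3)[OF Z(1)] Z(2)] y by blast
   moreover have "ALL x:Z. Z \<inter> mtopology closure_of (Z \<inter> orbit T x) = Z"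
    using \<Z>(4)[OF Z(1)] minimal_sub[OF NM ZN] by blast
   ultimately have "x \<in> mtopology closure_of (Z \<inter> orbit T y)" using Z(2) by blast
   thus "x \<in> cl y" using closure_of_mono[of "Z \<inter> orbit T y" "orbit T y"] by blast
  qed
 }
 assume sym: "ALL x:N. ALL y:cl x. x \<in> cl y"
 have clN: "cl x \<subseteq> N" if "x \<in> N" for x using cl_subset[OF N that] .
 have eq: "cl y = cl x" if "x \<in> N" "y \<in> cl x" for x y
  using cl_trans[of x y] cl_trans[of y x] sym that clN NM by blast
 have self: "x \<in> cl x" if "x \<in> N" for x using orbit_subset_cl[of x 0] that NM by auto
 have "partition_on N (cl ` N)" unfolding partition_on_def disjoint_def
 proof (intro conjI ballI impI)
  show "\<Union>(cl ` N) = N" using clN self by blast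
  fix A B assume A: "A \<in> cl ` N" and B: "B \<in> cl ` N" and "A ~= B"
  then obtain x y where xy: "x \<in> N" "A = cl x" "y \<in> N" "B = cl y" by blast
  show "A \<inter> B = {}"
  proof (rule ccontr)
   assume "A \<inter> B ~= {}"
   then obtain z where "z \<in> cl x" "z \<in> cl y" unfolding xy by blast
   hence "cl x = cl y" using eq xy(1,3) by metis
   thus False using \<open>A ~= B\<close> xy by simp
  qed
 next
  show "{} ~: cl ` N" using self by blast
 qed
 moreover have "closedin (subtopology mtopology N) Z & T ` Z \<subseteq> Z &
   minimal_system (subtopology (subtopology mtopology N) Z) T" if Z: "Z \<in> cl ` N" for Z
 proof -
  obtain x where x: "x \<in> N" "Z = cl x" using Z by blast
  have xM: "x \<in> M" using x NM by blast
  have ZN: "Z \<subseteq> N" using clN x by simp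
  have clZ: "closedin mtopology Z" unfolding x by simp
  have inv: "T ` Z \<subseteq> Z" unfolding x(2) using cl_invariant[OF xM] by blast
  have "Z \<inter> mtopology closure_of (Z \<inter> orbit T y) = Z" if y: "y \<in> Z" for y
  proof -
   have "orbit T y \<subseteq> Z" unfolding orbit_def using orbit_subset[OF inv y] by blast
   hence "Z \<inter> orbit T y = orbit T y" by blast
   thus ?thesis using eq[OF x(1)] y unfolding x(2) by auto
  qed
  thus ?thesis using minimal_sub[OF NM ZN] inv closedin_subset_topspace[OF clZ ZN] by blast
 qed
 ultimately show "decomposes_into_minimal (subtopology mtopology N) T"
  unfolding decomposes_into_minimal_def top by blast
qed

lemma pieceD:
 assumes "piece N"
 shows "openin mtopology N" "closedin mtopology N" "T ` N \<subseteq> N" "N \<subseteq> M"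
  "!!x y. x \<in> N ==> y \<in> cl x ==> x \<in> cl y" "!!x n. x \<in> N ==> (T ^^ n) x \<in> N"
  "!!x. x \<in> N ==> cl x \<subseteq> N"
proof -
 show o: "openin mtopology N" and c: "closedin mtopology N" and i: "T ` N \<subseteq> N"
  and s: "!!x y. x \<in> N ==> y \<in> cl x ==> x \<in> cl y"
  using assms unfolding piece_def by blast+
 show "N \<subseteq> M" using closedin_subset[OF c] by simp
 show "!!x n. x \<in> N ==> (T ^^ n) x \<in> N" by (rule orbit_subset[OF i])
 show "!!x. x \<in> N ==> cl x \<subseteq> N" by (rule cl_subset[OF c i])
qed

lemma piece_empty: "piece {}" unfolding piece_def by simp

text \<open>By symmetry \<open>x\<close> lies in the closure of the orbit of \<open>T x\<close>; an
  orbit that enters the closed invariant set \<open>N'\<close> therefore started in it. This is what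
  allows pieces to be made disjoint.\<close>

lemma piece_diff:
 assumes "piece N" "piece N'" shows "piece (N - N')"
proof -
 note D = pieceD[OF assms(1)] and D' = pieceD[OF assms(2)]
 have "T x ~: N'" if x: "x \<in> N" "x ~: N'" for x
 proof
  assume h: "T x \<in> N'"
  have "T x \<in> cl x" using orbit_subset_cl[of x 1] x(1) D(4) by auto
  hence "x \<in> cl (T x)" using D(5) x(1) by blast
  thus False using D'(7)[OF h] x(2) by blast
 qed
 hence "T ` (N - N') \<subseteq> N - N'" using D(3) by blast
 moreover have "openin mtopology (N - N')" "closedin mtopology (N - N')"
  using D(1,2) D'(1,2) by (simp_all add: openin_diff closedin_diff)
 ultimately show ?thesis using D(5) unfolding piece_def by blast
qed

lemma piece_diff_finite:
 assumes "finite F" "piece N" "!!G. G \<in> F ==> piece G" shows "piece (N - \<Union>F)"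
 using assms(1,3)
proof (induction F)
 case (insert G F)
 have "N - \<Union>(insert G F) = (N - \<Union>F) - G" by blast
 thus ?case using insert piece_diff[of "N - \<Union>F" G] by simp
qed (use assms(2) in simp)

text \<open>Stated for an arbitrary self-map \<open>h\<close> of a ball, because it is applied to
  iterates of \<open>T\<close> as well as to inverse branches. A limit point of one orbit exists by
  compactness, and it is fixed since consecutive terms become close.\<close>

lemma contraction_fixed_point:
 assumes c: "c \<in> M" and h: "!!x. x \<in> mcball c R ==> h x \<in> mcball c R" and "0 <= R" and \<eta>: "\<eta> < 1"
  and lip: "!!x y. x \<in> mcball c R ==> y \<in> mcball c R ==> d (h x) (h y) <= \<eta> * d x y"
 obtains y where "y \<in> mcball c R" "h y = y"
  "!!x e. x \<in> mcball c R ==> 0 < e ==> EX N. ALL n>=N. d ((h ^^ n) x) y < e"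
proof -
 \<comment> \<open>\<open>\<eta>\<close> may be negative; powers are taken of its nonnegative
   part.\<close>
 define \<theta> where "\<theta> = max \<eta> 0"
 have \<theta>: "0 <= \<theta>" "\<theta> < 1" using \<eta> unfolding \<theta>_def by auto
 have lip': "d (h x) (h y) <= \<theta> * d x y" if "x \<in> mcball c R" "y \<in> mcball c R" for x y
  using lip[OF that] mult_right_mono[of \<eta> \<theta> "d x y"] unfolding \<theta>_def by simp
 have it: "(h ^^ n) x \<in> mcball c R" if x: "x \<in> mcball c R" for n x
 proof (induction n)
  case 0 thus ?case using x by simp
 next
  case (Suc n) thus ?case using h by (simp del: in_mcball)
 qed
 have iter: "d ((h ^^ n) x) ((h ^^ n) y) <= \<theta> ^ n * d x y" if x: "x \<in> mcball c R" and y: "y \<in> mcball c R" for n x y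
 proof (induction n)
  case (Suc n)
  have "d ((h ^^ Suc n) x) ((h ^^ Suc n) y) <= \<theta> * d ((h ^^ n) x) ((h ^^ n) y)"
   using lip'[OF it[OF x] it[OF y]] by simp
  also have "\<dots> <= \<theta> * (\<theta> ^ n * d x y)" using Suc \<theta>(1) by (rule mult_left_mono)
  finally show ?case by simp
 qed simp
 have cin: "c \<in> mcball c R" using c assms(3) by simp
 have small: "EX N. ALL n>=N. \<theta> ^ n * D < e" if "0 < e" for D e :: real
 proof -
  have "(%n. \<theta> ^ n * D) \<longlonglongrightarrow> 0 * D" using \<theta> by (intro tendsto_mult LIMSEQ_power_zero tendsto_const) auto
  hence "eventually (%n. \<theta> ^ n * D < e) sequentially" using order_tendstoD(2)[of _ "0 * D" sequentially e] that by simp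
  thus ?thesis unfolding eventually_sequentially .
 qed
 obtain y r where y: "y \<in> M" "strict_mono (r::nat=>nat)" "!!e. e > 0 ==> EX N. ALL n>=N. d ((h ^^ (r n)) c) y < e"
  using convergent_subseq[of "%n. (h ^^ n) c"] it[OF cin] by auto
 have yin: "y \<in> mcball c R"
 proof (rule closedin_seq[OF closedin_mcball _ y(1)])
  fix e :: real assume "e > 0"
  then obtain N where "d ((h ^^ (r N)) c) y < e" using y(3) by blast
  thus "EX z:mcball c R. d y z < e" using it[OF cin] commute by metis
 qed
 have fixed: "h y = y"
 proof (rule ccontr)
  assume ne: "h y ~= y"
  have hyM: "h y \<in> M" using h[OF yin] by simp
  define e where "e = d (h y) y"
  have e: "0 < e" unfolding e_def using ne hyM y(1) by simp
  obtain N1 where N1: "ALL n>=N1. d ((h ^^ (r n)) c) y < e" using y(3)[OF e] by blast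
  obtain N2 where N2: "ALL n>=N2. \<theta> ^ n * d c (h c) < e" using small[OF e] by blast
  define n where "n = max N1 N2"
  define w where "w = (h ^^ (r n)) c"
  have w: "w \<in> mcball c R" "w \<in> M" "h w \<in> M" unfolding w_def using it[OF cin] h[OF it[OF cin]] by auto
  have "d w y < e" using N1 unfolding w_def n_def by simp
  moreover have "r n >= N2" using seq_suble[OF y(2), of n] unfolding n_def by simp
  hence "d w (h w) < e"
   using iter[OF cin h[OF cin], of "r n"] N2 unfolding w_def by (smt (verit) funpow_swap1)
  moreover have "d (h w) (h y) <= \<theta> * d w y" by (rule lip'[OF w(1) yin])
  moreover have "\<theta> * d w y <= 1 * d w y" using \<theta> by (intro mult_right_mono) auto
  moreover have "d (h y) y <= max (d (h y) (h w)) (d (h w) y)" "d (h w) y <= max (d (h w) w) (d w y)"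
   using ultra hyM w y(1) by auto
  ultimately show False unfolding e_def by (simp add: commute)
 qed
 have "EX N. ALL n>=N. d ((h ^^ n) x) y < e" if x: "x \<in> mcball c R" and "0 < e" for x and e :: real
 proof -
  have "(h ^^ n) y = y" for n by (induction n) (use fixed in auto)
  hence "d ((h ^^ n) x) y <= \<theta> ^ n * d x y" for n using iter[OF x yin, of n] by simp
  thus ?thesis using small[OF \<open>0 < e\<close>, of "d x y"] by (meson order_le_less_trans)
 qed
 thus ?thesis using that yin fixed by blast
qed

lemma cl_periodic:
 assumes "x \<in> M" "(T ^^ n) x = x" "1 <= n" shows "cl x = orbit T x"
proof -
 have "finite (orbit T x)" by (rule finite_periodic_orbit[OF assms(2,3)])
 moreover have "orbit T x \<subseteq> M" unfolding orbit_def using iter_in_M[OF assms(1)] by blast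
 ultimately have "closedin mtopology (orbit T x)"
  by (metis t1_space_closedin_finite t1_space_mtopology topspace_mtopology)
 thus ?thesis by (rule closure_of_closedin)
qed

text \<open>A point whose backward or forward orbit converges to a periodic point cannot lie in a
 piece: its orbit closure would contain the periodic orbit but be different from it.\<close>

lemma piece_no_attractor:
 assumes N: "piece N" and p: "p \<in> N" "(T ^^ l) p = p" "1 <= l" and "0 < R" "\<eta> < 1"
  and lip: "!!x y. x \<in> mcball p R ==> y \<in> mcball p R ==> d ((T ^^ l) x) ((T ^^ l) y) <= \<eta> * d x y"
 shows False
proof -
 have pM: "p \<in> M" using p(1) pieceD(4)[OF N] by blast
 obtain r where r: "0 < r" "mcball p r \<subseteq> N" using pieceD(1)[OF N] p(1) unfolding openin_mtopology_mcball by blast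
 define R' where "R' = min r R"
 have R': "0 < R'" "mcball p R' \<subseteq> N" "mcball p R' \<subseteq> mcball p R"
  using r assms(5) mcball_subset_concentric[of R' r p] mcball_subset_concentric[of R' R p] unfolding R'_def by auto
 have pin: "p \<in> mcball p R'" using pM R'(1) by simp
 have self: "(T ^^ l) x \<in> mcball p R'" if x: "x \<in> mcball p R'" for x
 proof -
  have "d ((T ^^ l) p) ((T ^^ l) x) <= \<eta> * d p x" using lip R'(3) x pin by blast
  also have "\<dots> <= 1 * d p x" using assms(6) by (intro mult_right_mono) auto
  finally show ?thesis using p(2) x pM iter_in_M by auto
 qed
 have lip': "d ((T ^^ l) x) ((T ^^ l) y) <= \<eta> * d x y" if "x \<in> mcball p R'" "y \<in> mcball p R'" for x y
  using lip R'(3) that by blast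
 obtain y where y: "y \<in> mcball p R'" "(T ^^ l) y = y"
  "!!x e. x \<in> mcball p R' ==> 0 < e ==> EX N. ALL n>=N. d ((((T ^^ l)) ^^ n) x) y < e"
  using contraction_fixed_point[OF pM self less_imp_le[OF R'(1)] assms(6) lip'] by blast
 \<comment> \<open>The ball is infinite and the orbit of \<open>y\<close> finite, so some point
   attracted to \<open>y\<close> is not on that orbit.\<close>
 have "infinite (mcball p R')" by (rule infinite_mcball[OF pM R'(1)])
 then obtain w where w: "w \<in> mcball p R'" "w ~: orbit T y"
  using finite_periodic_orbit[OF y(2) p(3)] by (meson finite_subset subsetI)
 have wN: "w \<in> N" using w(1) R'(2) by blast
 have wM: "w \<in> M" using w(1) by simp
 have "y \<in> cl w" unfolding cl_iff[OF wM]
 proof (intro conjI allI impI)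
  show "y \<in> M" using y(1) by simp
  fix e :: real assume "e > 0"
  then obtain n where "d ((((T ^^ l)) ^^ n) w) y < e" using y(3)[OF w(1)] by blast
  thus "EX n. d y ((T ^^ n) w) < e" by (metis commute funpow_mult)
 qed
 hence "w \<in> cl y" using pieceD(5)[OF N wN] by blast
 thus False using cl_periodic[OF _ y(2) p(3)] y(1) w(2) by simp
qed

lemma piece_no_expansion:
 assumes N: "piece N" and y0: "y0 \<in> M" "0 < \<rho>" "1 < s" "1 <= k" and ex: "exact (T ^^ k) y0 \<rho> s"
  and sub: "mcball y0 \<rho> \<subseteq> mcball ((T ^^ k) y0) (s * \<rho>)" "mcball y0 \<rho> \<subseteq> N"
 shows False
proof -
 let ?E = "mcball y0 \<rho>" and ?F = "T ^^ k"
 \<comment> \<open>The inverse branch of the expanding return map, a contraction of the ball into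
   itself.\<close>
 define h where "h = inv_into ?E ?F"
 have h: "h x \<in> ?E" "?F (h x) = x" if "x \<in> ?E" for x
 proof -
  have "x \<in> ?F ` ?E" using exactD(5)[OF ex] sub(1) that by blast
  thus "h x \<in> ?E" "?F (h x) = x" unfolding h_def by (rule inv_into_into, rule f_inv_into_f)
 qed
 have lip: "d (h x) (h y) <= 1 / s * d x y" if "x \<in> ?E" "y \<in> ?E" for x y
  using exactD(3)[OF ex h(1)[OF that(1)] h(1)[OF that(2)]] h(2)[OF that(1)] h(2)[OF that(2)] y0(3)
  by (simp add: field_simps)
 obtain y where y: "y \<in> ?E" "h y = y" "!!x e. x \<in> ?E ==> 0 < e ==> EX N. ALL n>=N. d ((h ^^ n) x) y < e"
  using contraction_fixed_point[OF y0(1) h(1) less_imp_le[OF y0(2)] _ lip] y0(3) by auto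
 have fy: "?F y = y" using h(2)[OF y(1)] y(2) by simp
 have "infinite ?E" by (rule infinite_mcball[OF y0(1,2)])
 then obtain w where w: "w \<in> ?E" "w ~: orbit T y"
  using finite_periodic_orbit[OF fy y0(4)] by (meson finite_subset subsetI)
 have hn: "(h ^^ n) w \<in> ?E & (T ^^ (k * n)) ((h ^^ n) w) = w" for n
 proof (induction n)
  case 0 thus ?case using w(1) by simp
 next
  case (Suc n)
  have "(T ^^ (k * Suc n)) ((h ^^ Suc n) w) = (T ^^ (k * n)) (?F (h ((h ^^ n) w)))"
   by (simp add: funpow_add add.commute[of k] del: in_mcball)
  thus ?case using Suc h by (simp del: in_mcball)
 qed
 have wN: "w \<in> N" and wM: "w \<in> M" using w(1) sub(2) by auto
 have "y \<in> cl w"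
 proof (rule closedin_seq)
  show "closedin mtopology (cl w)" by simp
  show "y \<in> M" using y(1) by simp
  fix e :: real assume "e > 0"
  then obtain n where n: "d ((h ^^ n) w) y < e" using y(3)[OF w(1)] by blast
  have z: "(h ^^ n) w \<in> N" "(h ^^ n) w \<in> M" using hn[of n] sub(2) by auto
  \<comment> \<open>\<open>w\<close> is on the forward orbit of its preimage; symmetry turns this
    into the preimage lying in \<open>cl w\<close>, and then so does the limit \<open>y\<close> of
    the preimages.\<close>
  have "w \<in> cl ((h ^^ n) w)" using hn[of n] orbit_subset_cl[OF z(2), of "k * n"] by simp
  hence "(h ^^ n) w \<in> cl w" using pieceD(5)[OF N z(1)] by blast
  thus "EX z:cl w. d y z < e" using n commute by metis
 qed
 hence "w \<in> cl y" using pieceD(5)[OF N wN] by blast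
 thus False using cl_periodic[OF _ fy y0(4)] y(1) w(2) by simp
qed

end

context gauged_dyn
begin

lemma isometric_power:
 assumes "isometric_ball c R l"
 shows "exact (T ^^ (l * n)) c R 1 & (T ^^ (l * n)) c \<in> mcball c R"
proof (induction n)
 case 0
 show ?case using assms exact_id(2)[of c R] unfolding isometric_ball_def by simp
next
 case (Suc n)
 have ex: "exact (T ^^ l) c R 1" "(T ^^ l) c \<in> mcball c R" using assms unfolding isometric_ball_def by auto
 let ?y = "(T ^^ (l * n)) c"
 have "exact (T ^^ l) ?y (1 * R) 1" using exact_sub[OF ex(1)] Suc by simp
 from exact_comp[OF conjunct1[OF Suc] this] have "exact (T ^^ l \<circ> T ^^ (l * n)) c R 1" by simp
 moreover have "T ^^ (l * Suc n) = T ^^ l \<circ> T ^^ (l * n)" by (simp add: funpow_add)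
 moreover have "(T ^^ l) ?y \<in> mcball ((T ^^ l) c) (1 * R)" using exactD(4)[OF ex(1)] Suc by blast
 hence "(T ^^ l) ?y \<in> mcball c R" using mcball_eq[OF ex(2)] by simp
 ultimately show ?case by (metis o_apply)
qed

text \<open>Two terms of a convergent subsequence are close. The earlier iterate is an isometry and
  can be cancelled, so the difference of the two times brings \<open>x\<close> back close to
  itself.\<close>

lemma isometric_recurrent:
 assumes D: "isometric_ball c R l" and x: "x \<in> mcball c R" and "0 < e"
 shows "EX n>=n0. d ((T ^^ (l * n)) x) x < e"
proof -
 have xM: "x \<in> M" using x by simp
 obtain y r where y: "y \<in> M" "strict_mono (r::nat=>nat)" "!!e. e > 0 ==> EX N. ALL n>=N. d ((T ^^ (l * r n)) x) y < e"
  using convergent_subseq[of "%n. (T ^^ (l * n)) x"] iter_in_M[OF xM] by blast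
 obtain N where N: "!!n. n >= N ==> d ((T ^^ (l * r n)) x) y < e" using y(3)[OF assms(3)] by blast
 define i where "i = r N"
 define k where "k = r (N + i + n0)"
 have k: "k >= i + n0" unfolding k_def using seq_suble[OF y(2), of "N + i + n0"] by simp
 have "d ((T ^^ (l * i)) x) y < e" "d ((T ^^ (l * k)) x) y < e" unfolding i_def k_def using N by auto
 hence "d ((T ^^ (l * i)) x) ((T ^^ (l * k)) x) < e"
  using ultra[of "(T ^^ (l * i)) x" y "(T ^^ (l * k)) x"] iter_in_M[OF xM] y(1) by (auto simp: commute)
 moreover have "(T ^^ (l * k)) x = (T ^^ (l * i)) ((T ^^ (l * (k - i))) x)"
  using k by (simp add: funpow_add[symmetric] o_apply[of "T ^^ _", symmetric] distrib_left[symmetric] del: o_apply)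
 moreover have "(T ^^ (l * (k - i))) x \<in> mcball c R"
  using exactD(4)[OF conjunct1[OF isometric_power[OF D]] x] mcball_eq[OF conjunct2[OF isometric_power[OF D]]]
  by (simp del: in_mcball)
 ultimately have "d x ((T ^^ (l * (k - i))) x) < e"
  using exactD(3)[OF conjunct1[OF isometric_power[OF D]] x, of "(T ^^ (l * (k - i))) x" i] by simp
 thus ?thesis using k by (intro exI[of _ "k - i"]) (auto simp: commute)
qed

text \<open>If \<open>T ^^ n\<close> brings \<open>x\<close> near \<open>y\<close>, the two orbits
  stay close, as the iterates of the ball have bounded factors; and \<open>x\<close> recurs at some
  time \<open>l * k >= n\<close>. Hence \<open>y\<close> comes near \<open>x\<close> after
  \<open>l * k - n\<close> steps, which is the symmetry required of a piece.\<close>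

lemma isometric_cycle:
 assumes D: "isometric_ball c R l"
 shows "piece (\<Union>j<l. (T ^^ j) ` mcball c R)" "mcball c R \<subseteq> (\<Union>j<l. (T ^^ j) ` mcball c R)"
proof -
 define N where "N = (\<Union>j<l. (T ^^ j) ` mcball c R)"
 have c: "c \<in> M" "0 < R" "1 <= l" "(T ^^ l) c \<in> mcball c R" "exact (T ^^ l) c R 1"
  using D unfolding isometric_ball_def by auto
 obtain B s where s: "!!j. s j <= B" "!!j. exact (T ^^ j) c R (s j)"
  using D unfolding isometric_ball_def by metis
 have spos: "0 < s j" for j using exactD(1)[OF s(2)] .
 have Bpos: "0 < B" using s(1)[of 0] spos[of 0] by simp
 have img: "(T ^^ j) ` mcball c R = mcball ((T ^^ j) c) (s j * R)" for j using exactD(5)[OF s(2)] .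
 have imgl: "(T ^^ l) ` mcball c R = mcball c R" using exactD(5)[OF c(5)] mcball_eq[OF c(4)] by simp
 have "mcball c R = (T ^^ 0) ` mcball c R" by (simp del: in_mcball)
 moreover have "0 \<in> {..<l}" using c(3) by simp
 ultimately have 0: "mcball c R \<subseteq> N" unfolding N_def by blast
 have op: "openin mtopology N" unfolding N_def img using openin_mcball spos c(2) by auto
 have clo: "closedin mtopology N" unfolding N_def img by (intro closedin_Union) auto
 have NM: "N \<subseteq> M" using closedin_subset[OF clo] by simp
 have inv: "T ` N \<subseteq> N"
 proof
  fix y assume "y \<in> T ` N"
  then obtain j z where j: "j < l" "z \<in> mcball c R" "y = (T ^^ Suc j) z" unfolding N_def by auto
  show "y \<in> N"
  proof (cases "Suc j < l")
   case True thus ?thesis unfolding N_def using j by blast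
  next
   case False
   hence "Suc j = l" using j(1) by simp
   hence "y \<in> mcball c R" using imgl j by blast
   thus ?thesis using 0 by blast
  qed
 qed
 have sym: "x \<in> cl y" if x: "x \<in> N" and y: "y \<in> cl x" for x y
 proof -
  have xM: "x \<in> M" and yM: "y \<in> M" using x NM y cl_in_M by blast+
  have yN: "y \<in> N" using cl_subset[OF clo inv x] y by blast
  obtain j where j: "y \<in> mcball ((T ^^ j) c) (s j * R)" using yN unfolding N_def img by blast
  obtain i x0 where i: "x0 \<in> mcball c R" "x = (T ^^ i) x0" using x unfolding N_def by blast
  show ?thesis unfolding cl_iff[OF yM]
  proof (intro conjI allI impI)
   fix e :: real assume e: "e > 0"
   \<comment> \<open>The first bound keeps the iterate in the image ball that contains
     \<open>y\<close>; the second gives closeness \<open>e / B\<close> of the preimages in the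
     original ball.\<close>
   define \<delta>' where "\<delta>' = min (s j * R) (e * s j / B)"
   have "0 < \<delta>'" unfolding \<delta>'_def using spos[of j] c(2) e Bpos by simp
   then obtain n where n: "d y ((T ^^ n) x) < \<delta>'" using y unfolding cl_iff[OF xM] by blast
   let ?w = "(T ^^ n) x"
   have "?w \<in> mcball y (s j * R)" using n yM iter_in_M[OF xM] unfolding \<delta>'_def by simp
   hence w: "?w \<in> mcball ((T ^^ j) c) (s j * R)" using mcball_eq[OF j] by blast
   obtain y0 w0 where yw: "y0 \<in> mcball c R" "(T ^^ j) y0 = y" "w0 \<in> mcball c R" "(T ^^ j) w0 = ?w"
    using exact_surj[OF s(2) j] exact_surj[OF s(2) w] by metis
   have close: "d ((T ^^ m) y) ((T ^^ m) ?w) < e" for m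
   proof -
    have "d ((T ^^ (m + j)) y0) ((T ^^ (m + j)) w0) = s (m + j) * d y0 w0"
     using exactD(3)[OF s(2) yw(1,3)] .
    hence 1: "d ((T ^^ m) y) ((T ^^ m) ?w) = s (m + j) * d y0 w0" using yw(2,4) by (simp add: funpow_add)
    have "d y ?w = s j * d y0 w0" using exactD(3)[OF s(2) yw(1,3), of j] yw(2,4) by simp
    hence "s j * d y0 w0 < e * s j / B" using n unfolding \<delta>'_def by simp
    hence "d y0 w0 < e / B" using spos[of j] Bpos by (simp add: field_simps)
    moreover have "s (m + j) * d y0 w0 <= B * d y0 w0" using s(1) by (intro mult_right_mono) auto
    ultimately show ?thesis unfolding 1 using Bpos by (simp add: field_simps)
   qed
   obtain k where k: "k >= n" "d ((T ^^ (l * k)) x0) x0 < e / B"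
    using isometric_recurrent[OF D i(1), of "e / B" n] e Bpos by auto
   have "(T ^^ (l * k)) x0 \<in> mcball c R"
    using exactD(4)[OF conjunct1[OF isometric_power[OF D]] i(1)] mcball_eq[OF conjunct2[OF isometric_power[OF D]]]
    by (simp del: in_mcball)
   hence "d ((T ^^ i) ((T ^^ (l * k)) x0)) ((T ^^ i) x0) = s i * d ((T ^^ (l * k)) x0) x0"
    using exactD(3)[OF s(2)] i(1) by blast
   also have "\<dots> <= B * d ((T ^^ (l * k)) x0) x0" using s(1) by (intro mult_right_mono) auto
   also have "\<dots> < e" using k(2) Bpos by (simp add: field_simps)
   also have "(T ^^ i) ((T ^^ (l * k)) x0) = (T ^^ (l * k)) x"
    unfolding i(2) by (metis add.commute funpow_add o_apply)
   finally have rec: "d ((T ^^ (l * k)) x) x < e" using i(2) by simp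
   define m where "m = l * k - n"
   have "n <= l * k" using k(1) c(3) by (metis le_trans mult.commute mult_le_mono2 mult.right_neutral)
   hence "(T ^^ m) ?w = (T ^^ (l * k)) x" unfolding m_def using funpow_add[of "l * k - n" n T] by simp
   hence "d x ((T ^^ m) y) < e"
    using rec close[of m] ultra[of x "(T ^^ (l * k)) x" "(T ^^ m) y"] iter_in_M xM yM by (auto simp: commute)
   thus "EX n. d x ((T ^^ n) y) < e" by blast
  qed (rule xM)
 qed
 show "piece (\<Union>j<l. (T ^^ j) ` mcball c R)" unfolding piece_def N_def[symmetric] using op clo inv sym by blast
 show "mcball c R \<subseteq> (\<Union>j<l. (T ^^ j) ` mcball c R)" using 0 unfolding N_def .
qed

text \<open>A Julia point in a piece would produce an expanding return of a small ball inside the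
  piece, which \<open>piece_no_expansion\<close> forbids: at a repelling cycle if its orbit meets
  \<open>Q\<close>, and otherwise between two record times at which the orbit is in the same ball
  and \<open>S\<close> has grown.\<close>

lemma piece_Jul:
 assumes N: "piece N" shows "N \<inter> Jul = {}"
proof (rule ccontr)
 assume "N \<inter> Jul ~= {}"
 then obtain x where x: "x \<in> N" "x \<in> Jul" by blast
 have xM: "x \<in> M" using x(2) Jul_subset by blast
 have opN: "!!z. z \<in> N ==> EX r>0. mcball z r \<subseteq> N" using pieceD(1)[OF N] unfolding openin_mtopology_mcball by blast
 show False
 proof (cases "EX n. (T ^^ n) x \<in> Q")
  case True
  then obtain i where i: "(T ^^ i) x \<in> Q" by blast
  obtain k n where n: "1 <= n" "(T ^^ n) ((T ^^ k) ((T ^^ i) x)) = (T ^^ k) ((T ^^ i) x)"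
   using Q_eventually_periodic[OF i] by metis
  define y where "y = (T ^^ k) ((T ^^ i) x)"
  have y: "y \<in> Q" "y \<in> N" "y \<in> M" "(T ^^ n) y = y" unfolding y_def using iter_Q i pieceD(6)[OF N] x(1) n iter_in_M xM by auto
  have nc: "(T ^^ j) y ~: crit" for j
   using Q_noncrit[OF iter_Q[OF y(1)] n(1) periodic_iter[OF y(4)]] .
  have "EX r>0. EX s. exact (T ^^ j) y r s" for j
  proof (induction j)
   case 0 thus ?case using exact_id(2)[OF y(3)] by (intro exI[of _ 1]) auto
  next
   case (Suc j)
   then obtain r s where r: "0 < r" "exact (T ^^ j) y r s" by blast
   obtain r' where r': "0 < r'" "exact T ((T ^^ j) y) r' (der ((T ^^ j) y))"
    using noncrit_exact[OF iter_in_M[OF y(3)] nc] by blast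
   have s: "0 < s" using exactD(1)[OF r(2)] .
   define r0 where "r0 = min r (r' / s)"
   have r0: "0 < r0" "r0 <= r" "s * r0 <= r'" unfolding r0_def using r(1) r'(1) s by (auto simp: field_simps min_def)
   have "exact (T ^^ j) y r0 s" using exact_sub[OF r(2), of y r0] y(3) r0 r(1) by simp
   moreover have "exact T ((T ^^ j) y) (s * r0) (der ((T ^^ j) y))"
    using exact_sub[OF r'(2), of "(T ^^ j) y" "s * r0"] r0 iter_in_M[OF y(3)] r'(1) by simp
   ultimately have "exact (T ^^ Suc j) y r0 (der ((T ^^ j) y) * s)" using exact_comp by fastforce
   thus ?case using r0(1) by blast
  qed
  then obtain r s where r: "0 < r" "exact (T ^^ n) y r s" by blast
  obtain r' l where r': "r' > 0" "l > 1" "ALL x:mcball y r'. d y ((T ^^ n) x) = l * d y x"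
   using Q_repelling[OF y(1) n(1) y(4)] by blast
  \<comment> \<open>One point near \<open>y\<close> identifies the factor \<open>s\<close> of the
    similarity with the repelling factor \<open>l\<close>.\<close>
  obtain w where w: "w \<in> M" "w ~= y" "0 < d y w" "d y w <= min r r'" using other_point[OF y(3), of "min r r'"] r(1) r'(1) by auto
  have "d ((T ^^ n) y) ((T ^^ n) w) = s * d y w" by (rule exactD(3)[OF r(2)]) (use y(3) r(1) w in auto)
  moreover have "d y ((T ^^ n) w) = l * d y w" using r'(3) w y(3) by simp
  ultimately have "s = l" using y(4) w(3) by simp
  obtain r1 where r1: "0 < r1" "mcball y r1 \<subseteq> N" using opN y(2) by blast
  define \<rho> where "\<rho> = min r r1"
  have \<rho>: "0 < \<rho>" "\<rho> <= r" "\<rho> <= r1" unfolding \<rho>_def using r(1) r1(1) by auto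
  have ex: "exact (T ^^ n) y \<rho> s" using exact_sub[OF r(2), of y \<rho>] y(3) \<rho> r(1) by simp
  show False
  proof (rule piece_no_expansion[OF N y(3) \<rho>(1) _ n(1) ex])
   show "1 < s" using r'(2) \<open>s = l\<close> by simp
   hence "\<rho> <= s * \<rho>" using \<rho>(1) by simp
   thus "mcball y \<rho> \<subseteq> mcball ((T ^^ n) y) (s * \<rho>)" unfolding y(4) by (rule mcball_subset_concentric)
   show "mcball y \<rho> \<subseteq> N" using mcball_subset_concentric[OF \<rho>(3)] r1(2) by blast
  qed
 next
  case False
  hence nQ: "!!n. (T ^^ n) x ~: Q" by blast
  have rx: "reg x" and unb: "ALL B. EX n. B < S n x" using Jul_reg[OF x(2) nQ] by auto
  have gx: "0 < g x" using reg_g_pos[OF rx, of 0] by simp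
  obtain r where r: "0 < r" "mcball x r \<subseteq> N" using opN x(1) by blast
  define R where "R = \<kappa> * \<delta>"
  have R: "0 < R" unfolding R_def using \<kappa> \<delta> by simp
  \<comment> \<open>Record times with large gauge. The last condition makes the ball about
    \<open>x\<close> that is blown up to radius at least \<open>\<kappa> * \<delta>\<close> so small
    that it lies in \<open>N\<close>; its image then lies in \<open>N\<close> by invariance.\<close>
  define A where "A = {n. (ALL i<=n. S i x <= S n x) & \<delta> <= g ((T ^^ n) x) & \<kappa> * g x / r < S n x}"
  have unbA: "EX n:A. B < S n x" for B
  proof -
   obtain n where "max B (\<kappa> * g x / r) < S n x" "!!i. i <= n ==> S i x <= S n x" "\<delta> <= g ((T ^^ n) x)"
    using S_record[OF rx unb] by metis
   thus ?thesis unfolding A_def by auto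
  qed
  have infA: "infinite A'" if "A' \<subseteq> A" "!!B. EX n:A'. B < S n x" for A'
  proof
   assume "finite A'"
   hence "ALL n:A'. S n x <= Max ((%n. S n x) ` A')" by simp
   thus False using that(2) by (meson not_le)
  qed
  obtain c where c: "c \<in> M" "infinite {n \<in> A. (T ^^ n) x \<in> mcball c R}"
   using infinite_same_ball[OF infA[OF order_refl unbA] R, of "%n. (T ^^ n) x"] iter_in_M[OF xM] by metis
  let ?A = "{n \<in> A. (T ^^ n) x \<in> mcball c R}"
  show False
  proof (cases "EX i:?A. EX j:?A. i < j & S i x < S j x")
   case True
   then obtain i j where ij: "i \<in> ?A" "j \<in> ?A" "i < j" "S i x < S j x" by blast
   define k where "k = j - i"
   define y where "y = (T ^^ i) x"
   have k: "1 <= k" "(T ^^ k) y = (T ^^ j) x" unfolding k_def y_def using ij(3) funpow_add[of "j - i" i T] by simp_all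
   have ry: "reg y" unfolding y_def by (rule reg_iter[OF rx])
   have yM: "y \<in> M" by (rule regD(1)[OF ry])
   have Si: "0 < S i x" "0 < S j x" using S_pos[OF rx] by auto
   have Sy: "S n y = S (i + n) x / S i x" for n unfolding y_def using S_add[of i n x] Si by simp
   \<comment> \<open>As \<open>j\<close> is a record time, \<open>V * S n y <= 1\<close> for all
     \<open>n <= k\<close>; on the ball with this relative radius \<open>T ^^ k\<close> expands by
     exactly \<open>1 / V\<close>.\<close>
   define V where "V = S i x / S j x"
   have V: "0 < V" "V < 1" unfolding V_def using Si ij(4) by auto
   have TS: "V * S n y <= 1" if n: "n <= k" for n
   proof -
    have "i + n <= j" using n ij(3) unfolding k_def by simp
    hence "S (i + n) x <= S j x" using ij(2) unfolding A_def by simp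
    thus ?thesis unfolding Sy V_def using Si by simp
   qed
   have gy: "\<delta> <= g y" using ij(1) unfolding A_def y_def by simp
   have "mcball y R = mcball c R" using ij(1) mcball_eq unfolding y_def by blast
   moreover have "mcball ((T ^^ k) y) R = mcball c R" using ij(2) mcball_eq unfolding k(2) by blast
   ultimately have same: "mcball ((T ^^ k) y) R = mcball y R" by simp
   have "R <= \<kappa> * g y" unfolding R_def using gy \<kappa>(1) by simp
   hence "mcball y R \<subseteq> mcball y (\<kappa> * g y)" by (rule mcball_subset_concentric)
   moreover have "(T ^^ k) y \<in> mcball y R" using same[symmetric] iter_in_M[OF yM, of k] R by simp
   ultimately have gk: "g ((T ^^ k) y) = g y" using g_const by blast
   have ex0: "exact (T ^^ k) y (\<kappa> * V * g y) (S k y * g ((T ^^ k) y) / g y)" by (rule reg_exact[OF ry V(1) TS])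
   have gy0: "0 < g y" using gy \<delta> by simp
   have Sk: "S k y = 1 / V" unfolding Sy V_def k_def using ij(3) by simp
   have ex1: "exact (T ^^ k) y (\<kappa> * V * g y) (1 / V)" using ex0 gk gy0 Sk by simp
   have Rle: "R * V <= \<kappa> * V * g y" unfolding R_def using gy \<kappa>(1) V(1) by simp
   have "y \<in> mcball y (\<kappa> * V * g y)" using yM gy0 \<kappa>(1) V(1) by simp
   hence ex: "exact (T ^^ k) y (R * V) (1 / V)" using exact_sub[OF ex1 _ Rle] by simp
   have big: "mcball y R \<subseteq> N"
   proof
    fix w assume w: "w \<in> mcball y R"
    have exi: "exact (T ^^ i) x (\<kappa> * (1 / S i x) * g x) (S i x * g y / g x)"
     unfolding y_def by (rule reg_exact[OF rx]) (use Si ij(1) in "auto simp: A_def field_simps")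
    have "S i x * g y / g x * (\<kappa> * (1 / S i x) * g x) = \<kappa> * g y" using Si gx by simp
    hence "w \<in> mcball ((T ^^ i) x) (S i x * g y / g x * (\<kappa> * (1 / S i x) * g x))"
     using w \<open>mcball y R \<subseteq> mcball y (\<kappa> * g y)\<close> unfolding y_def by auto
    then obtain u where u: "u \<in> mcball x (\<kappa> * (1 / S i x) * g x)" "(T ^^ i) u = w" using exact_surj[OF exi] by blast
    have "\<kappa> * g x / r < S i x" using ij(1) unfolding A_def by simp
    hence "\<kappa> * (1 / S i x) * g x <= r" using Si r(1) by (simp add: field_simps)
    hence "u \<in> mcball x r" using u(1) mcball_subset_concentric by blast
    hence "u \<in> N" using r(2) by blast
    thus "w \<in> N" using pieceD(6)[OF N] u(2) by blast
   qed
   have "mcball y (R * V) \<subseteq> mcball y R" by (rule mcball_subset_concentric) (use R V in simp)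
   show False
   proof (rule piece_no_expansion[OF N yM _ _ k(1) ex])
    show "0 < R * V" "1 < 1 / V" using R V by simp_all
    have "1 / V * (R * V) = R" using V by simp
    thus "mcball y (R * V) \<subseteq> mcball ((T ^^ k) y) (1 / V * (R * V))"
     using same \<open>mcball y (R * V) \<subseteq> mcball y R\<close> by (simp del: in_mcball)
    show "mcball y (R * V) \<subseteq> N" using \<open>mcball y (R * V) \<subseteq> mcball y R\<close> big by blast
   qed
  next
   case False
   \<comment> \<open>Without two such times \<open>S\<close> would be bounded on the infinite set
     \<open>?A\<close> of record times, and hence along the times in \<open>A\<close>.\<close>
   obtain i where i: "i \<in> ?A" using c(2) not_finite_existsD by blast
   have const: "S j x <= S i x" if "j \<in> ?A" for j
   proof (cases "i < j")
    case True thus ?thesis using False i that by (meson not_le)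
   next
    case False
    thus ?thesis using i unfolding A_def by simp
   qed
   obtain n where n: "n \<in> A" "S i x < S n x" using unbA by blast
   obtain j where j: "n < j" "j \<in> ?A" using c(2) unfolding infinite_nat_iff_unbounded by blast
   have "S n x <= S j x" using j unfolding A_def by simp
   thus False using const[OF j(2)] n(2) by simp
  qed
 qed
qed

end

section \<open>Basins and the decomposition of the space\<close>

context ultra_dyn
begin

definition basin :: "'a => 'a => bool" where
 "basin y x \<longleftrightarrow> (ALL \<epsilon>>0. \<forall>\<^sub>F n in sequentially. EX z:orbit T y. d ((T ^^ n) x) z < \<epsilon>)"

end

context gauged_dyn
begin

text \<open>By \<open>piece_no_attractor\<close> a piece contains no attracting cycle. This excludes
  visits to contracting balls and a factor below 1 over the period, so the factor is exactly
  1.\<close>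

lemma nonrep_isometric:
 assumes N: "piece N" and p: "p \<in> N" "nonrep p"
 obtains n R where "1 <= n" "(T ^^ n) p = p" "0 < R" "!!r. 0 < r ==> r <= R ==> isometric_ball p r n"
proof -
 have pM: "p \<in> M" using p(2) unfolding nonrep_def by blast
 obtain n0 where n0: "1 <= n0" "(T ^^ n0) p = p" using p(2) unfolding nonrep_def by blast
 have nW: "(T ^^ i) p ~: W" for i
 proof
  assume "(T ^^ i) p \<in> W"
  then obtain c where c: "c \<in> crit - Q" "(T ^^ i) p \<in> mcball c (t c)" unfolding sing_def by blast
  obtain \<eta> where \<eta>: "\<eta> < 1" "ALL n>=1. ALL x:mcball c (t c). ALL y:mcball c (t c).
    d ((T ^^ n) x) ((T ^^ n) y) <= \<eta> * d x y" using contr[OF c(1)] by blast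
  show False
  proof (rule piece_no_attractor[OF N pieceD(6)[OF N p(1)] periodic_iter[OF n0(2)] n0(1) t_pos[OF c(1)] \<eta>(1)])
   fix x y assume "x \<in> mcball ((T ^^ i) p) (t c)" "y \<in> mcball ((T ^^ i) p) (t c)"
   thus "d ((T ^^ n0) x) ((T ^^ n0) y) <= \<eta> * d x y" using \<eta>(2) n0(1) mcball_eq[OF c(2)] by blast
  qed
 qed
 hence rp: "reg p" unfolding reg_def using pM nonrep_notin_Q[OF p(2)] by blast
 have gp: "0 < g p" using reg_g_pos[OF rp, of 0] by simp
 obtain n where n: "1 <= n" "(T ^^ n) p = p" "S n p <= 1" using nonrep_S[OF p(2) rp] by blast
 have "~ (ALL B. EX n. B < S n p)" using unbounded_Jul[OF pM, of 0] rp nonrep_Fat[OF p(2)] unfolding Jul_def by auto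
 then obtain B where B: "!!n. S n p <= B" by (meson not_le)
 have Bp: "0 < B" using B[of 0] by simp
 define R where "R = \<kappa> * (1 / B) * g p"
 have R: "0 < R" unfolding R_def using \<kappa>(1) Bp gp by simp
 have ex: "exact (T ^^ j) p R (S j p * g ((T ^^ j) p) / g p)" for j
  unfolding R_def by (rule reg_exact[OF rp]) (use B Bp in "simp_all add: field_simps")
 have exn: "exact (T ^^ n) p R (S n p)" using ex[of n] n(2) gp by simp
 have "S n p = 1"
 proof (rule ccontr)
  assume "S n p ~= 1"
  hence "S n p < 1" using n(3) by simp
  thus False
   using piece_no_attractor[OF N p(1) n(2,1) R, of "S n p"] exactD(3)[OF exn] by (metis order_refl)
 qed
 have "isometric_ball p r n" if r: "0 < r" "r <= R" for r
 proof -
  have pin: "p \<in> mcball p R" using pM R by simp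
  have "EX s<=B / g p. exact (T ^^ j) p r s" for j
  proof -
   have "S j p * g ((T ^^ j) p) / g p <= B * 1 / g p"
    using B[of j] Bp gp g_range(2)[OF regD(2)[OF rp, of j]] reg_g_pos[OF rp, of j]
    by (intro divide_right_mono mult_mono) auto
   thus ?thesis using exact_sub[OF ex[of j] pin r(2)] by auto
  qed
  moreover have "exact (T ^^ n) p r 1" using exact_sub[OF exn pin r(2)] \<open>S n p = 1\<close> by simp
  ultimately show ?thesis unfolding isometric_ball_def using pM r n(1,2) by auto
 qed
 thus ?thesis using that n R by blast
qed

lemma nonrep_iter_in_piece:
 assumes N: "piece N" and p: "p \<in> N" "nonrep p" shows "nonrep ((T ^^ j) p)"
proof -
 obtain n R where n: "1 <= n" "(T ^^ n) p = p" "0 < R" "!!r. 0 < r ==> r <= R ==> isometric_ball p r n"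
  using nonrep_isometric[OF assms] by blast
 have iso: "isometric_ball p R n" using n(3,4) by simp
 then obtain s where s: "exact (T ^^ j) p R s" and ex: "exact (T ^^ n) p R 1" and pM: "p \<in> M"
  unfolding isometric_ball_def by blast
 have pin: "p \<in> mcball p R" using pM n(3) by simp
 have "d ((T ^^ j) p) ((T ^^ n) y) <= d ((T ^^ j) p) y" if y: "y \<in> mcball ((T ^^ j) p) (s * R)" for y
 proof -
  obtain v where v: "v \<in> mcball p R" "(T ^^ j) v = y" using exact_surj[OF s y] by blast
  have nv: "(T ^^ n) v \<in> mcball p R" using exactD(4)[OF ex v(1)] n(2) by simp
  have "(T ^^ n) y = (T ^^ j) ((T ^^ n) v)" using v(2) by (metis add.commute funpow_add o_apply)
  hence "d ((T ^^ j) p) ((T ^^ n) y) = s * d p ((T ^^ n) v)" using exactD(3)[OF s pin nv] by simp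
  also have "d p ((T ^^ n) v) = d p v" using exactD(3)[OF ex pin v(1)] n(2) by simp
  also have "s * d p v = d ((T ^^ j) p) y" using exactD(3)[OF s pin v(1)] v(2) by simp
  finally show ?thesis by simp
 qed
 moreover have "0 < s * R" using exactD(1)[OF s] n(3) by simp
 ultimately show ?thesis unfolding nonrep_def using iter_in_M[OF pM] periodic_iter[OF n(2)] n(1) by blast
qed

text \<open>The cycle of a ball of radius \<open>r\<close> about \<open>p\<close> stays within
  \<open>B * r\<close> of the orbit of \<open>p\<close>; \<open>r\<close> is so small that this is
  less than the distance from \<open>x\<close> to that finite orbit.\<close>

lemma small_piece_around:
 assumes N: "piece N" and p: "p \<in> N" "nonrep p" and x: "x \<in> M" "!!j. x ~= (T ^^ j) p"
 obtains G where "piece G" "p \<in> G" "x ~: G"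
proof -
 obtain n R where n: "1 <= n" "(T ^^ n) p = p" "0 < R" "!!r. 0 < r ==> r <= R ==> isometric_ball p r n"
  using nonrep_isometric[OF N p] by blast
 have iso: "isometric_ball p R n" using n(3,4) by simp
 then obtain B s where s: "!!j. s j <= B" "!!j. exact (T ^^ j) p R (s j)" and pM: "p \<in> M"
  unfolding isometric_ball_def by metis
 have Bp: "0 < B" using s(1)[of 0] exactD(1)[OF s(2), of 0] by simp
 have pin: "p \<in> mcball p R" using pM n(3) by simp
 define e where "e = Min (insert 1 ((%j. d ((T ^^ j) p) x) ` {..<n}))"
 have e: "0 < e" unfolding e_def using x iter_in_M[OF pM] by (subst Min_gr_iff) auto
 have el: "e <= d ((T ^^ j) p) x" if "j < n" for j unfolding e_def using that by (intro Min_le) auto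
 define r where "r = min R (e / (2 * B))"
 have r: "0 < r" "r <= R" "r <= e / (2 * B)" unfolding r_def using n(3) e Bp by auto
 have D: "isometric_ball p r n" by (rule n(4)[OF r(1,2)])
 define G where "G = (\<Union>j<n. (T ^^ j) ` mcball p r)"
 have "x ~: G"
 proof
  assume "x \<in> G"
  then obtain j v where j: "j < n" "v \<in> mcball p r" "x = (T ^^ j) v" unfolding G_def by blast
  have "v \<in> mcball p R" using j(2) mcball_subset_concentric[OF r(2)] by blast
  hence "d ((T ^^ j) p) x = s j * d p v" using exactD(3)[OF s(2) pin] j(3) by simp
  also have "\<dots> <= B * (e / (2 * B))" using s(1)[of j] j(2) r(3) Bp by (intro mult_mono) auto
  also have "\<dots> < e" using Bp e by simp
  finally show False using el[OF j(1)] by simp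
 qed
 moreover have "p \<in> mcball p r" using pM r(1) by simp
 hence "p \<in> G" using isometric_cycle(2)[OF D] unfolding G_def by blast
 ultimately show ?thesis using that isometric_cycle(1)[OF D] unfolding G_def by blast
qed

text \<open>Only finitely many non-repelling periodic points lie in \<open>N\<close>, and each has a
  small piece around it that misses \<open>x\<close>; subtracting these from \<open>N\<close> leaves
  a piece. It reconciles disjointness of P and M with the maximality of their union.\<close>

lemma piece_avoiding_nonrep:
 assumes N: "piece N" and x: "x \<in> N" "~ nonrep x"
 obtains N' where "piece N'" "x \<in> N'" "N' \<inter> {p. nonrep p} = {}"
proof -
 have xM: "x \<in> M" using x(1) pieceD(4)[OF N] by blast
 have "EX G. piece G & p \<in> G & x ~: G" if p: "p \<in> N \<inter> {p. nonrep p}" for p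
 proof -
  have "x ~= (T ^^ j) p" for j using nonrep_iter_in_piece[OF N, of p j] p x(2) by auto
  thus ?thesis using small_piece_around[OF N, of p x] p xM by blast
 qed
 then obtain G where G: "!!p. p \<in> N \<inter> {p. nonrep p} ==> piece (G p) & p \<in> G p & x ~: G p" by metis
 have "finite (N \<inter> {p. nonrep p})" using finite_nonrep by simp
 hence "piece (N - \<Union>(G ` (N \<inter> {p. nonrep p})))" using N G by (intro piece_diff_finite) auto
 moreover have "x \<in> N - \<Union>(G ` (N \<inter> {p. nonrep p}))" using x(1) G by blast
 moreover have "(N - \<Union>(G ` (N \<inter> {p. nonrep p}))) \<inter> {p. nonrep p} = {}" using G by blast
 ultimately show ?thesis using that by blast
qed

lemma nonrep_orbit_Fat: assumes "nonrep y" "z \<in> orbit T y" shows "z \<in> Fat"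
proof (rule ccontr)
 assume "z ~: Fat"
 obtain i where i: "z = (T ^^ i) y" using assms(2) unfolding orbit_def by blast
 have yM: "y \<in> M" using assms(1) unfolding nonrep_def by blast
 have "z \<in> Jul" unfolding Jul_def using \<open>z ~: Fat\<close> iter_in_M[OF yM] i by blast
 moreover obtain n where "1 <= n" "(T ^^ n) y = y" using assms(1) unfolding nonrep_def by blast
 then obtain j where "(T ^^ j) z = y" using periodic_returns i by blast
 ultimately have "y \<in> Jul" using Jul_forward by metis
 thus False using nonrep_Fat[OF assms(1)] unfolding Jul_def by blast
qed

text \<open>The limit cycle has a neighbourhood in the open Fatou set, which the orbit would enter,
  while the Julia set is forward invariant.\<close>

lemma basin_Fat:
 assumes y: "nonrep y" and b: "basin y x" shows "x ~: Jul"
proof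
 assume x: "x \<in> Jul"
 obtain n where n: "1 <= n" "(T ^^ n) y = y" using y unfolding nonrep_def by blast
 have fin: "finite (orbit T y)" by (rule finite_periodic_orbit[OF n(2,1)])
 have "ALL z:orbit T y. EX r>0. mball z r \<subseteq> Fat"
  using nonrep_orbit_Fat[OF y] openin_Fat unfolding openin_mtopology by blast
 then obtain r where r: "!!z. z \<in> orbit T y ==> 0 < r z & mball z (r z) \<subseteq> Fat" by metis
 define e where "e = Min (r ` orbit T y)"
 have ne: "orbit T y ~= {}" unfolding orbit_def by blast
 have "0 < e" unfolding e_def using fin ne r by (subst Min_gr_iff) auto
 then obtain m z where z: "z \<in> orbit T y" "d ((T ^^ m) x) z < e"
  using b unfolding basin_def eventually_sequentially by (metis order_refl)
 have "e <= r z" unfolding e_def using fin z(1) by (intro Min_le) auto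
 moreover have "z \<in> Fat" by (rule nonrep_orbit_Fat[OF y z(1)])
 moreover have "(T ^^ m) x \<in> Jul" by (rule Jul_forward[OF x])
 ultimately have "(T ^^ m) x \<in> mball z (r z)" using z(2) Jul_subset unfolding Fat_def by (auto simp: commute)
 thus False using r[OF z(1)] \<open>(T ^^ m) x \<in> Jul\<close> unfolding Jul_def by blast
qed

text \<open>The contraction gives convergence along multiples of \<open>l\<close> only;
  equicontinuity near the limit \<open>y\<close>, a Fatou point by \<open>nonrep_Fat\<close>,
  extends it to all times.\<close>

lemma attracting_basin:
 assumes D: "attracting_ball c R l" and x: "(T ^^ N) x \<in> mcball c R"
 obtains y where "nonrep y" "basin y x"
proof -
 obtain \<eta> where c: "c \<in> M" "0 < R" "1 <= l" "(T ^^ l) c \<in> mcball c R" "\<eta> < 1"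
  and lip: "!!x y. x \<in> mcball c R ==> y \<in> mcball c R ==> d ((T ^^ l) x) ((T ^^ l) y) <= \<eta> * d x y"
  using D unfolding attracting_ball_def by blast
 have self: "(T ^^ l) w \<in> mcball c R" if w: "w \<in> mcball c R" for w
 proof -
  have "d ((T ^^ l) c) ((T ^^ l) w) <= \<eta> * d c w" using lip[of c w] c(1,2) w by simp
  also have "\<dots> <= 1 * d c w" using c(5) by (intro mult_right_mono) auto
  finally have "(T ^^ l) w \<in> mcball ((T ^^ l) c) R" using w iter_in_M c(1) by auto
  thus ?thesis using mcball_eq[OF c(4)] by blast
 qed
 obtain y where y: "y \<in> mcball c R" "(T ^^ l) y = y"
  "!!x e. x \<in> mcball c R ==> 0 < e ==> EX N. ALL n>=N. d (((T ^^ l) ^^ n) x) y < e"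
  using contraction_fixed_point[OF c(1) self less_imp_le[OF c(2)] c(5) lip] by blast
 have yM: "y \<in> M" using y(1) by simp
 have "d y ((T ^^ l) w) <= d y w" if w: "w \<in> mcball y R" for w
 proof -
  have "w \<in> mcball c R" using w mcball_eq[OF y(1)] by blast
  hence "d ((T ^^ l) y) ((T ^^ l) w) <= \<eta> * d y w" using lip y(1) by blast
  also have "\<dots> <= 1 * d y w" using c(5) by (intro mult_right_mono) auto
  finally show ?thesis using y(2) by simp
 qed
 hence nr: "nonrep y" unfolding nonrep_def using yM c(2,3) y(2) by blast
 have yF: "y \<in> Fat" by (rule nonrep_Fat[OF nr])
 then obtain U where U: "openin mtopology U" "y \<in> U" "equi U" unfolding Fat_def by blast
 obtain r where r: "0 < r" "mball y r \<subseteq> U" using U(1,2) unfolding openin_mtopology by blast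
 have "basin y x" unfolding basin_def
 proof (intro allI impI)
  fix e :: real assume "0 < e"
  then obtain \<delta>' where \<delta>': "0 < \<delta>'" "!!w. w \<in> U ==> d y w < \<delta>' ==> (ALL n. d ((T ^^ n) y) ((T ^^ n) w) < e)"
   using U(2,3) unfolding equi_def by blast
  obtain k where k: "d (((T ^^ l) ^^ k) ((T ^^ N) x)) y < min r \<delta>'" using y(3)[OF x, of "min r \<delta>'"] r \<delta>' by auto
  let ?w = "(T ^^ (l * k + N)) x"
  have kw: "((T ^^ l) ^^ k) ((T ^^ N) x) = ?w" by (simp add: funpow_mult funpow_add)
  have wM: "?w \<in> M"
  proof -
   have "(T ^^ N) x \<in> M" using x by simp
   thus ?thesis using iter_in_M[of "(T ^^ N) x" "l * k"] by (simp add: funpow_add)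
  qed
  have "d y ?w < r" "d y ?w < \<delta>'" using k unfolding kw by (simp_all add: commute)
  hence near: "d ((T ^^ n) y) ((T ^^ n) ?w) < e" for n using \<delta>'(2)[of ?w] r(2) wM yM by auto
  have "EX z:orbit T y. d ((T ^^ n) x) z < e" if n: "n >= l * k + N" for n
  proof -
   have "(T ^^ n) x = (T ^^ (n - (l * k + N))) ?w" using n funpow_add[of "n - (l * k + N)" "l * k + N" T] by simp
   moreover have "(T ^^ (n - (l * k + N))) y \<in> orbit T y" unfolding orbit_def by blast
   ultimately show ?thesis using near[of "n - (l * k + N)"] commute by metis
  qed
  thus "\<forall>\<^sub>F n in sequentially. EX z:orbit T y. d ((T ^^ n) x) z < e"
   unfolding eventually_sequentially by blast
 qed
 thus ?thesis using that nr by blast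
qed

text \<open>All pieces without non-repelling periodic points are clopen, hence countably many;
  subtracting the earlier ones in an enumeration makes them disjoint without changing the union, and
  differences of pieces are pieces.\<close>

lemma decomposition_gauged:
 "EX \<M>. countable \<M> & disjoint \<M> & (ALL N:\<M>. piece N) & (ALL N. piece N --> N \<subseteq> {p. nonrep p} \<union> \<Union>\<M>) &
   {p. nonrep p} \<inter> \<Union>\<M> = {} & \<Union>\<M> \<inter> Jul = {} & {p. nonrep p} \<inter> Jul = {} & finite {p. nonrep p} &
   (ALL x:Fat. x \<in> {p. nonrep p} \<union> \<Union>\<M> \<or> (EX y. nonrep y & basin y x) \<or> (EX N:\<M>. EX n. (T ^^ n) x \<in> N)) &
   (ALL x:Jul. ~ (EX y. nonrep y & basin y x) & ~ (EX N:\<M>. EX n. (T ^^ n) x \<in> N))"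
proof -
 let ?P = "{p. nonrep p}"
 define \<A> where "\<A> = {N. piece N & N \<inter> ?P = {}}"
 have "\<A> \<subseteq> {N. openin mtopology N & closedin mtopology N}" unfolding \<A>_def piece_def by blast
 hence cA: "countable \<A>" using countable_clopen countable_subset by blast
 have neA: "\<A> ~= {}" using piece_empty unfolding \<A>_def by blast
 define A where "A = from_nat_into \<A>"
 have rangeA: "range A = \<A>" unfolding A_def using cA neA by (rule range_from_nat_into[rotated])
 define \<M> where "\<M> = range (disjointed A)"
 have UM: "\<Union>\<M> = \<Union>\<A>" unfolding \<M>_def using UN_disjointed_eq[of A] rangeA by simp
 have An: "piece (A n)" for n using rangeA unfolding \<A>_def by blast
 have pM: "ALL N:\<M>. piece N"
 proof
  fix N assume "N \<in> \<M>"
  then obtain n where n: "N = A n - (\<Union>i\<in>{0..<n}. A i)" unfolding \<M>_def disjointed_def by blast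
  show "piece N" unfolding n by (rule piece_diff_finite) (use An in auto)
 qed
 have cover: "N \<subseteq> ?P \<union> \<Union>\<M>" if N: "piece N" for N
 proof
  fix x assume x: "x \<in> N"
  show "x \<in> ?P \<union> \<Union>\<M>"
  proof (cases "nonrep x")
   case False
   then obtain N' where "piece N'" "x \<in> N'" "N' \<inter> ?P = {}" using piece_avoiding_nonrep[OF N x] by blast
   thus ?thesis unfolding UM \<A>_def by blast
  qed simp
 qed
 have MJ: "\<Union>\<M> \<inter> Jul = {}" unfolding UM \<A>_def using piece_Jul by blast
 have Fat: "x \<in> ?P \<union> \<Union>\<M> \<or> (EX y. nonrep y & basin y x) \<or> (EX N:\<M>. EX n. (T ^^ n) x \<in> N)" if x: "x \<in> Fat" for x
 proof -
  obtain n c R l where D: "(T ^^ n) x \<in> mcball c R" "attracting_ball c R l \<or> isometric_ball c R l"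
   using Fat_outcome[OF x] by blast
  show ?thesis
  proof (cases "attracting_ball c R l")
   case True
   thus ?thesis using attracting_basin[OF _ D(1)] by metis
  next
   case False
   hence iso: "isometric_ball c R l" using D(2) by blast
   let ?y = "(T ^^ n) x"
   have "?y \<in> ?P \<union> \<Union>\<M>" using cover[OF isometric_cycle(1)[OF iso]] isometric_cycle(2)[OF iso] D(1) by blast
   thus ?thesis
   proof
    assume "?y \<in> ?P"
    hence ny: "nonrep ?y" by simp
    have xM: "x \<in> M" using x unfolding Fat_def by blast
    \<comment> \<open>An orbit that lands exactly on a non-repelling cycle belongs to its basin, at
      distance 0 from then on.\<close>
    have "basin ?y x" unfolding basin_def eventually_sequentially
    proof (intro allI impI exI)
     fix e :: real and k assume "0 < e" "n <= k"
     hence "(T ^^ k) x = (T ^^ (k - n)) ?y" using funpow_add[of "k - n" n T] by simp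
     hence "(T ^^ k) x \<in> orbit T ?y" unfolding orbit_def by blast
     thus "EX z:orbit T ?y. d ((T ^^ k) x) z < e" using \<open>0 < e\<close> iter_in_M[OF xM, of k] by (intro bexI[of _ "(T ^^ k) x"]) simp_all
    qed
    thus ?thesis using ny by blast
   qed blast
  qed
 qed
 have PJ: "?P \<inter> Jul = {}" using nonrep_Fat unfolding Jul_def by blast
 have Jul: "ALL x:Jul. ~ (EX y. nonrep y & basin y x) & ~ (EX N:\<M>. EX n. (T ^^ n) x \<in> N)"
 proof
  fix x assume x: "x \<in> Jul"
  have "~ (EX y. nonrep y & basin y x)" using basin_Fat x by blast
  moreover have "~ (EX N:\<M>. EX n. (T ^^ n) x \<in> N)" using Jul_forward[OF x] MJ by blast
  ultimately show "~ (EX y. nonrep y & basin y x) & ~ (EX N:\<M>. EX n. (T ^^ n) x \<in> N)" ..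
 qed
 have c: "countable \<M>" unfolding \<M>_def by simp
 have dis: "disjoint \<M>" unfolding \<M>_def
  by (rule disjoint_family_on_disjoint_image[OF disjoint_family_disjointed])
 have PM: "?P \<inter> \<Union>\<M> = {}" unfolding UM \<A>_def by blast
 show ?thesis
  by (intro exI[of _ \<M>] conjI c dis pM PM MJ PJ finite_nonrep Jul ballI Fat allI impI cover)
qed

end

section \<open>Coding of the Julia set\<close>

context ultra_dyn
begin

definition Reg :: "'a set" where "Reg = {x \<in> Jul. ALL n. (T ^^ n) x ~: Q}"

lemma countable_hits_Q: "countable {x \<in> M. EX n. (T ^^ n) x \<in> Q}"
proof -
 have "finite {x \<in> M. (T ^^ n) x \<in> Q}" for n
 proof (induction n)
  case 0 thus ?case using finite_Q by simp
 next
  case (Suc n)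
  have "{x \<in> M. (T ^^ Suc n) x \<in> Q} \<subseteq> (\<Union>q\<in>{x \<in> M. (T ^^ n) x \<in> Q}. {x \<in> M. T x = q})"
   using maps by (auto simp: funpow_swap1)
  moreover have "finite (\<Union>q\<in>{x \<in> M. (T ^^ n) x \<in> Q}. {x \<in> M. T x = q})" using Suc finite_fiber by blast
  ultimately show ?case using finite_subset by blast
 qed
 hence "countable (\<Union>n. {x \<in> M. (T ^^ n) x \<in> Q})" by (intro countable_UN) (auto intro: countable_finite)
 moreover have "{x \<in> M. EX n. (T ^^ n) x \<in> Q} = (\<Union>n. {x \<in> M. (T ^^ n) x \<in> Q})" by blast
 ultimately show ?thesis by simp
qed

lemma Reg_iter: "x \<in> Reg ==> (T ^^ n) x \<in> Reg"
 unfolding Reg_def using Jul_forward by (auto simp: funpow_add[symmetric] o_apply[of "T ^^ _" "T ^^ _", symmetric] simp del: o_apply)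

lemma iter_cont:
 assumes "x \<in> M" "0 < e" shows "EX r>0. ALL y:mcball x r. d ((T ^^ n) x) ((T ^^ n) y) < e"
 using assms(2)
proof (induction n arbitrary: e)
 case 0
 thus ?case by (intro exI[of _ "e/2"]) auto
next
 case (Suc n)
 obtain \<delta> where \<delta>: "\<delta> > 0" "!!y. y \<in> M ==> d ((T ^^ n) x) y < \<delta> ==> d (T ((T ^^ n) x)) (T y) < e"
  using cont[OF iter_in_M[OF assms(1)] Suc.prems] by blast
 obtain r where r: "r > 0" "!!y. y \<in> mcball x r ==> d ((T ^^ n) x) ((T ^^ n) y) < \<delta>" using Suc.IH[OF \<delta>(1)] by blast
 have "d ((T ^^ Suc n) x) ((T ^^ Suc n) y) < e" if y: "y \<in> mcball x r" for y
  using \<delta>(2)[OF _ r(2)[OF y]] iter_in_M[of y n] y by simp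
 thus ?case using r(1) by blast
qed

end

context gauged_dyn
begin

lemma RegD: "x \<in> Reg ==> reg x" "x \<in> Reg ==> ALL B. EX n. B < S n x" "x \<in> Reg ==> x \<in> M" "x \<in> Reg ==> x \<in> Jul"
 unfolding Reg_def using Jul_reg Jul_subset by blast+

text \<open>Membership of \<open>x\<close> in the Julia set is derived from growth:
  \<open>unbounded_Jul\<close> with a prefix of length 1.\<close>

lemma Reg_back:
 assumes "x \<in> M" "x ~: Q" "T x \<in> Reg" shows "x \<in> Reg"
proof -
 have "x \<in> Jul" using unbounded_Jul[of x 1] assms RegD[OF assms(3)] by simp
 moreover have "(T ^^ n) x ~: Q" for n
  using assms(2,3) unfolding Reg_def by (cases n) (auto simp: funpow_swap1)
 ultimately show ?thesis unfolding Reg_def by blast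
qed

lemma partial_S_pos:
 assumes "x \<in> M" "!!i. i <= n ==> (T ^^ i) x ~: Q" "!!i. i < n ==> (T ^^ i) x ~: W"
 shows "0 < S n x"
 unfolding S_def
proof (rule prod_pos)
 fix i assume i: "i \<in> {..<n}"
 hence "T ((T ^^ i) x) ~: Q" using assms(2)[of "Suc i"] by simp
 thus "0 < sder g ((T ^^ i) x)" using sder_pos[OF iter_in_M[OF assms(1)]] assms(2)[of i] assms(3)[of i] i by simp
qed

text \<open>Expansion in blocks, locally uniform. Near a point of \<open>Q\<close> the premise
  \<open>\<delta> <= g x\<close> fails. If \<open>z\<close> reaches \<open>Q\<close> later, the step
  into \<open>Q\<close> contributes, by \<open>blow_up\<close>, a factor that compensates all
  earlier ones. If it never does, \<open>S\<close> is unbounded at \<open>z\<close>, and finitely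
  many of its values are locally constant.\<close>

lemma local_block:
 assumes z: "z \<in> Jul"
 shows "EX r>0. EX c>0. ALL x:mcball z r. x \<in> Reg --> \<delta> <= g x --> (EX n>=1. 1 <= S n x & (ALL j<=n. c <= S j x))"
proof -
 have zM: "z \<in> M" using z Jul_subset by blast
 have nW: "(T ^^ i) z ~: W" for i using Jul_forward[OF z] W_subset_Fat unfolding Jul_def by blast
 show ?thesis
 proof (cases "EX k. (T ^^ k) z \<in> Q")
  case True
  define k where "k = (LEAST k. (T ^^ k) z \<in> Q)"
  have k: "(T ^^ k) z \<in> Q" unfolding k_def using True by (rule LeastI_ex)
  have lt: "(T ^^ i) z ~: Q" if "i < k" for i using not_less_Least that unfolding k_def by blast
  show ?thesis
  proof (cases k)
   case 0
   then obtain r where "r > 0" "ALL x:mcball z r. g x < \<delta>" using g_small[of z] k by auto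
   thus ?thesis by (meson not_le zero_less_one)
  next
   case (Suc n)
   define y where "y = (T ^^ n) z"
   have y: "y \<in> M" "y ~: Q" "y ~: W" "T y \<in> Q"
    unfolding y_def using iter_in_M[OF zM] lt[of n] nW k Suc by auto
   have nQ: "(T ^^ i) z ~: Q" if "i <= n" for i using lt that Suc by simp
   have Sp: "0 < S i z" if "i <= n" for i using partial_S_pos[OF zM, of i] nQ nW that by simp
   define B where "B = Max ((%i. S i z) ` {..n})"
   have B: "S i z <= B" if "i <= n" for i unfolding B_def using that by (intro Max_ge) auto
   have Bp: "0 < B" using B[of 0] by simp
   define c where "c = min 1 (Min ((%i. S i z) ` {..n}))"
   have cp: "0 < c" unfolding c_def using Sp by (subst min_less_iff_conj) (auto simp: Min_gr_iff)
   have cl: "c <= S i z" if "i <= n" for i unfolding c_def using that by (intro min.coboundedI2 Min_le) auto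
   have gz: "0 < g z" using g_pos[OF zM] nQ[of 0] by simp
   \<comment> \<open>The factor demanded of the last step is the reciprocal of the product
     accumulated before it.\<close>
   obtain r1 where r1: "r1 > 0" "!!x. x \<in> mcball y r1 ==> T x ~: Q ==> 1 / S n z <= sder g x"
    using blow_up[OF y, of "1 / S n z"] by blast
   obtain r2 where r2: "r2 > 0" "!!x. x \<in> mcball z r2 ==> d y ((T ^^ n) x) < r1"
    using iter_cont[OF zM r1(1), of n] unfolding y_def by blast
   define r where "r = min r2 (\<kappa> * (1 / B) * g z)"
   have "0 < r" unfolding r_def using r2(1) \<kappa>(1) Bp gz by simp
   moreover have "EX m>=1. 1 <= S m x & (ALL j<=m. c <= S j x)" if x: "x \<in> mcball z r" "x \<in> Reg" for x
   proof -
    have x2: "x \<in> mcball z r2" "x \<in> mcball z (\<kappa> * (1 / B) * g z)" using x(1) unfolding r_def by auto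
    have eq: "S i x = S i z" if "i <= n" for i
     by (rule ball_iter'(1)[OF zM nQ nW _ _ x2(2) that]) (use B Bp in "simp_all add: field_simps")
    have "(T ^^ n) x \<in> mcball y r1" using r2(2)[OF x2(1)] y(1) iter_in_M x(1) by auto
    moreover have "T ((T ^^ n) x) ~: Q" using regD(3)[OF RegD(1)[OF x(2)], of "Suc n"] by simp
    ultimately have "1 / S n z <= sder g ((T ^^ n) x)" using r1(2) by blast
    hence "S n z * (1 / S n z) <= S n z * sder g ((T ^^ n) x)" using Sp[of n] by (intro mult_left_mono) auto
    hence "1 <= S (Suc n) x" unfolding S_Suc eq[OF order_refl] using Sp[of n] by simp
    moreover have "c <= S j x" if "j <= Suc n" for j
     using cl[of j] eq[of j] calculation that by (cases "j = Suc n") (auto simp: c_def)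
    ultimately show ?thesis by (intro exI[of _ "Suc n"]) auto
   qed
   ultimately show ?thesis using cp by blast
  qed
 next
  case False
  hence zR: "z \<in> Reg" unfolding Reg_def using z by blast
  note rz = RegD(1)[OF zR]
  obtain n where n: "1 < S n z" using RegD(2)[OF zR] by blast
  hence n1: "1 <= n" by (cases n) auto
  define B where "B = Max ((%i. S i z) ` {..n})"
  have B: "S i z <= B" if "i <= n" for i unfolding B_def using that by (intro Max_ge) auto
  have Bp: "0 < B" using B[of 0] by simp
  define c where "c = Min ((%i. S i z) ` {..n})"
  have cp: "0 < c" unfolding c_def using S_pos[OF rz] by (subst Min_gr_iff) auto
  have cl: "c <= S i z" if "i <= n" for i unfolding c_def using that by (intro Min_le) auto
  have gz: "0 < g z" using reg_g_pos[OF rz, of 0] by simp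
  have "S i x = S i z" if "x \<in> mcball z (\<kappa> * (1 / B) * g z)" "i <= n" for x i
   by (rule reg_ball(1)[OF rz _ _ that(1)]) (use B Bp that(2) in "simp_all add: field_simps")
  hence "ALL x:mcball z (\<kappa> * (1 / B) * g z). EX m>=1. 1 <= S m x & (ALL j<=m. c <= S j x)"
   using n n1 cl by (metis less_imp_le order_refl)
  moreover have "0 < \<kappa> * (1 / B) * g z" using \<kappa>(1) Bp gz by simp
  ultimately show ?thesis using cp by blast
 qed
qed

text \<open>Blocks can be chained, since each ends with \<open>S >= 1\<close> and inside a block the
  value is at least \<open>v\<close>. A block needs gauge at least \<open>\<delta>\<close> at its
  start; the waiting time before contributes factors 1.\<close>

lemma S_lower: "EX v>0. v <= 1 & (ALL x:Reg. ALL j. v <= S j x)"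
proof -
 have "EX c>0. ALL x:Jul. x \<in> Reg --> \<delta> <= g x --> (EX n>=1. 1 <= S n x & (ALL j<=n. c <= S j x))"
  by (rule uniform_bound[OF closedin_Jul local_block]) (blast intro: order_trans)+
 then obtain c where c: "0 < c" "!!x. x \<in> Reg ==> \<delta> <= g x ==> EX n>=1. 1 <= S n x & (ALL j<=n. c <= S j x)"
  using RegD(4) by blast
 define v where "v = min 1 c"
 have block: "EX n>=1. 1 <= S n x & (ALL j<=n. v <= S j x)" if x: "x \<in> Reg" for x
 proof -
  obtain e where e: "\<delta> <= g ((T ^^ e) x)" "!!i. i <= e ==> S i x = 1" using exit_S[OF RegD(1)[OF x]] by blast
  obtain n where n: "n >= 1" "1 <= S n ((T ^^ e) x)" "ALL j<=n. c <= S j ((T ^^ e) x)"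
   using c(2)[OF Reg_iter[OF x] e(1)] by blast
  have "v <= S j x" if j: "j <= e + n" for j
  proof (cases "j <= e")
   case True thus ?thesis using e(2) unfolding v_def by simp
  next
   case False
   hence "S j x = S (j - e) ((T ^^ e) x)" using S_add[of e "j - e" x] e(2)[of e] by simp
   thus ?thesis using n(3) j False unfolding v_def by (simp add: min.coboundedI2)
  qed
  moreover have "1 <= S (e + n) x" unfolding S_add using e(2)[of e] n(2) by simp
  ultimately show ?thesis using n(1) by (intro exI[of _ "e + n"]) auto
 qed
 have "v <= S j x" if "x \<in> Reg" for x j
  using that
 proof (induction j arbitrary: x rule: less_induct)
  case (less j)
  obtain n where n: "n >= 1" "1 <= S n x" "ALL j<=n. v <= S j x" using block[OF less.prems] by blast
  show ?case
  proof (cases "j <= n")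
   case False
   hence "v <= S (j - n) ((T ^^ n) x)" using less.IH[of "j - n" "(T ^^ n) x"] n(1) Reg_iter[OF less.prems] by simp
   moreover have "S j x = S n x * S (j - n) ((T ^^ n) x)" using S_add[of n "j - n" x] False by simp
   moreover have "1 * S (j - n) ((T ^^ n) x) <= S n x * S (j - n) ((T ^^ n) x)"
    using n(2) S_pos[OF reg_iter[OF RegD(1)[OF less.prems]], of "j - n" n] by (intro mult_right_mono) auto
   ultimately show ?thesis by simp
  qed (use n in simp)
 qed
 thus ?thesis using c(1) unfolding v_def by (intro exI[of _ "min 1 c"]) auto
qed

end

section \<open>A Markov partition of the regular Julia points\<close>

locale coded_dyn = gauged_dyn M d T Q t g \<kappa> \<delta>
 for M :: "'a set" and d :: "'a => 'a => real" and T Q t g \<kappa> \<delta> +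
 fixes v :: real
 assumes v: "0 < v" "v <= 1" "x \<in> Reg ==> v <= S j x"
begin

text \<open>Once \<open>S\<close> exceeds \<open>B / v\<close> it stays above \<open>B\<close>,
  because the later factors multiply to at least \<open>v\<close>.\<close>

lemma S_tends: assumes "x \<in> Reg" shows "EX n0. ALL n>=n0. B <= S n x"
proof -
 obtain n0 where n0: "max B 0 / v < S n0 x" using RegD(2)[OF assms] by blast
 have "B <= S n x" if n: "n >= n0" for n
 proof -
  have "max B 0 / v * v <= S n0 x * S (n - n0) ((T ^^ n0) x)"
   using n0 v S_pos[OF RegD(1)[OF assms], of n0] Reg_iter[OF assms] by (intro mult_mono) auto
  also have "\<dots> = S n x" using S_add[of n0 "n - n0" x] n by simp
  finally show ?thesis using v(1) by simp
 qed
 thus ?thesis by blast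
qed

text \<open>The minimum of the scaled derivatives of all iterates; the infimum is attained because
  \<open>S\<close> tends to infinity.\<close>

definition w :: "'a => real" where "w x = (INF j. S j x)"

lemma w_attained: assumes x: "x \<in> Reg" shows "EX i. S i x = w x" "w x <= S j x" "v <= w x" "w x <= 1"
proof -
 obtain n0 where n0: "!!n. n >= n0 ==> 1 <= S n x" using S_tends[OF x] by blast
 define m where "m = Min ((%i. S i x) ` {..n0})"
 have m1: "m <= S i x" if "i <= n0" for i unfolding m_def using that by (intro Min_le) auto
 have "m \<in> (%i. S i x) ` {..n0}" unfolding m_def by (intro Min_in) auto
 then obtain i where i: "S i x = m" by auto
 have le: "m <= S j x" for j
 proof (cases "j <= n0")
  case False
  thus ?thesis using n0[of j] m1[of 0] by simp
 qed (use m1 in simp)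
 have "w x = m" unfolding w_def by (rule cInf_eq_minimum) (use i le in auto)
 thus "EX i. S i x = w x" "w x <= S j x" "w x <= 1" using i le[of j] le[of 0] by auto
 show "v <= w x" using v(3)[OF x] i \<open>w x = m\<close> by metis
qed

text \<open>Let \<open>n\<close> be the first time with \<open>S n x > w x / v\<close>. Before
  \<open>n\<close> the products agree at \<open>x\<close> and \<open>y\<close>; from
  \<open>n\<close> on they exceed \<open>w x\<close> at both points, since later factors multiply to
  at least \<open>v\<close>. So both minima are taken over the same values.\<close>

lemma w_const:
 assumes x: "x \<in> Reg" and y: "y \<in> Reg" and yx: "y \<in> mcball x (\<kappa> * (v / w x) * g x)"
 shows "w y = w x"
proof -
 define V where "V = v / w x"
 have wx: "0 < w x" using w_attained(3)[OF x] v(1) by simp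
 have V: "0 < V" "V <= 1" unfolding V_def using v(1) wx w_attained(3)[OF x] by auto
 have rx: "reg x" and ry: "reg y" using RegD x y by blast+
 define n where "n = (LEAST n. 1 < V * S n x)"
 obtain n' where "1 / V < S n' x" using RegD(2)[OF x] by blast
 hence "1 < V * S n' x" using V(1) by (simp add: field_simps)
 hence n: "1 < V * S n x" unfolding n_def by (rule LeastI)
 have lt: "V * S i x <= 1" if "i < n" for i using not_less_Least[of i] that unfolding n_def by force
 have n0: "0 < n" using n V(2) by (cases n) auto
 have ball: "y \<in> mcball x (\<kappa> * V * g x)" using yx unfolding V_def .
 have gg: "g y = g x" using reg_ball(2)[OF rx V(1) _ ball, of 0] lt[OF n0] by simp
 have ball': "x \<in> mcball y (\<kappa> * V * g y)" using ball unfolding gg by (auto simp: commute)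
 have eq: "S i y = S i x" if "i < n" for i using reg_ball(1)[OF rx V(1) _ ball, of i] lt that by simp
 have ny: "1 < V * S n y"
 proof (rule ccontr)
  \<comment> \<open>Exchanging the roles: the ball about \<open>y\<close> would carry the products
    up to \<open>n\<close> inclusive and force \<open>S n x = S n y\<close>.\<close>
  assume c: "~ 1 < V * S n y"
  hence "V * S i y <= 1" if "i <= n" for i using eq[of i] lt[of i] that by (cases "i = n") auto
  hence "S n x = S n y" using reg_ball(1)[OF ry V(1) _ ball', of n] by simp
  thus False using n c by simp
 qed
 have big: "w x < S j z" if "z \<in> Reg" "1 < V * S n z" "n <= j" for z j
 proof -
  have "w x = 1 / V * v" unfolding V_def using v(1) by simp
  also have "\<dots> < S n z * v" using that(2) V(1) v(1) by (simp add: field_simps)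
  also have "\<dots> <= S n z * S (j - n) ((T ^^ n) z)"
   using v(3)[OF Reg_iter[OF that(1)]] S_pos[OF RegD(1)[OF that(1)], of n] by (intro mult_left_mono) auto
  also have "\<dots> = S j z" using S_add[of n "j - n" z] that(3) by simp
  finally show ?thesis .
 qed
 obtain i where i: "S i x = w x" using w_attained(1)[OF x] by blast
 have "i < n"
 proof (rule ccontr)
  assume "~ i < n"
  thus False using big[OF x n, of i] i by simp
 qed
 hence "w y <= w x" using w_attained(2)[OF y, of i] eq i by simp
 moreover obtain k where k: "S k y = w y" using w_attained(1)[OF y] by blast
 have "w x <= w y"
 proof (cases "k < n")
  case True thus ?thesis using eq k w_attained(2)[OF x, of k] by simp
 next
  case False thus ?thesis using big[OF y ny, of k] k by simp
 qed
 ultimately show ?thesis by simp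
qed

text \<open>Relative radius of a partition element: the first term makes \<open>w\<close> constant
  on its regular points, the second keeps its image within the relative radius 1.\<close>

definition tt :: "'a => real" where "tt x = min (v / w x) (1 / sder g x)"

definition U :: "'a => 'a set" where "U x = mcball x (\<kappa> * tt x * g x)"

lemma S_1: "S 1 x = sder g x" using S_Suc[of 0 x] by simp

lemma tt:
 assumes x: "x \<in> Reg" shows "0 < tt x" "tt x <= 1" "tt x * sder g x <= 1" "tt x <= v / w x" "0 < sder g x"
proof -
 have wx: "0 < w x" "v <= w x" using w_attained(3)[OF x] v(1) by simp_all
 show s: "0 < sder g x" using S_pos[OF RegD(1)[OF x], of 1] S_1 by simp
 show "0 < tt x" unfolding tt_def using wx v(1) s by simp
 have "v / w x <= 1" using wx by simp
 thus "tt x <= 1" unfolding tt_def by (simp add: min.coboundedI1)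
 have "tt x <= 1 / sder g x" unfolding tt_def by simp
 thus "tt x * sder g x <= 1" using s by (simp add: field_simps)
 show "tt x <= v / w x" unfolding tt_def by simp
qed

lemma U_self: assumes "x \<in> Reg" shows "x \<in> U x" "0 < \<kappa> * tt x * g x"
proof -
 show p: "0 < \<kappa> * tt x * g x" using tt(1)[OF assms] \<kappa>(1) reg_g_pos[OF RegD(1)[OF assms], of 0] by simp
 show "x \<in> U x" unfolding U_def using RegD(3)[OF assms] p by simp
qed

lemma U_exact:
 assumes x: "x \<in> Reg"
 shows "exact T x (\<kappa> * tt x * g x) (sder g x * g (T x) / g x)"
  "T ` U x = mcball (T x) (\<kappa> * (tt x * sder g x) * g (T x))"
  "!!y. y \<in> U x ==> g y = g x & sder g y = sder g x & y ~: Q"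
proof -
 have V: "tt x * S i x <= 1" if "i <= 1" for i
  using that tt(2,3)[OF x] by (cases i) (auto simp: S_1[unfolded One_nat_def])
 show ex: "exact T x (\<kappa> * tt x * g x) (sder g x * g (T x) / g x)"
 proof -
  have "exact (T ^^ 1) x (\<kappa> * tt x * g x) (S 1 x * g ((T ^^ 1) x) / g x)"
   by (rule reg_exact[OF RegD(1)[OF x] tt(1)[OF x]]) (rule V)
  thus ?thesis unfolding S_1 by simp
 qed
 have "0 < g x" using reg_g_pos[OF RegD(1)[OF x], of 0] by simp
 thus "T ` U x = mcball (T x) (\<kappa> * (tt x * sder g x) * g (T x))"
  unfolding U_def exactD(5)[OF ex] by (simp add: field_simps)
 fix y assume "y \<in> U x"
 hence y: "y \<in> mcball x (\<kappa> * tt x * g x)" unfolding U_def .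
 have "tt x * S i x <= 1" if "i <= 0" for i using tt(2)[OF x] that by simp
 hence "g ((T ^^ 0) y) = g ((T ^^ 0) x)" "(T ^^ 0) y ~: Q"
  using reg_ball(2,3)[OF RegD(1)[OF x] tt(1)[OF x] _ y, of 0] by auto
 moreover have "S 1 y = S 1 x" by (rule reg_ball(1)[OF RegD(1)[OF x] tt(1)[OF x] _ y]) (rule V)
 ultimately show "g y = g x & sder g y = sder g x & y ~: Q" unfolding S_1 by simp
qed

lemma U_const:
 assumes x: "x \<in> Reg" and y: "y \<in> Reg" "y \<in> U x"
 shows "tt y = tt x" "U y = U x" "g y = g x" "sder g y = sder g x"
proof -
 show gg: "g y = g x" and ss: "sder g y = sder g x" using U_exact(3)[OF x y(2)] by auto
 have gx: "0 < g x" using reg_g_pos[OF RegD(1)[OF x], of 0] by simp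
 have "\<kappa> * tt x * g x <= \<kappa> * (v / w x) * g x"
  using tt(4)[OF x] \<kappa>(1) gx by (intro mult_right_mono mult_left_mono) auto
 hence "y \<in> mcball x (\<kappa> * (v / w x) * g x)" using y(2) mcball_subset_concentric unfolding U_def by blast
 hence "w y = w x" by (rule w_const[OF x y(1)])
 thus tt: "tt y = tt x" unfolding tt_def using ss by simp
 show "U y = U x" using y(2) mcball_eq unfolding U_def tt gg by blast
qed

text \<open>The Markov property. From \<open>w u <= sder g u * w (T u)\<close> the image of
  \<open>U u\<close> has relative radius \<open>tt u * sder g u >= tt (T u)\<close>, so it contains
  the partition element of every regular point in it.\<close>

lemma U_image_Reg:
 assumes x: "x \<in> Reg" and b: "b \<in> Reg" "b \<in> T ` U x" shows "U b \<subseteq> T ` U x"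
proof -
 obtain u where u: "u \<in> U x" "T u = b" using b(2) by blast
 have uM: "u \<in> M" using u(1) unfolding U_def by simp
 have uR: "u \<in> Reg" using Reg_back[OF uM] U_exact(3)[OF x u(1)] u(2) b(1) by blast
 note c = U_const[OF x uR u(1)]
 have gb: "0 < g b" using reg_g_pos[OF RegD(1)[OF b(1)], of 0] by simp
 have "tt b <= tt u * sder g u"
 proof -
  have s: "0 < sder g u" by (rule tt(5)[OF uR])
  have wu: "0 < w u" and wb: "0 < w b" using w_attained(3)[OF uR] w_attained(3)[OF b(1)] v(1) by auto
  obtain j where j: "S j b = w b" using w_attained(1)[OF b(1)] by blast
  have "w u <= S (1 + j) u" by (rule w_attained(2)[OF uR])
  also have "\<dots> = sder g u * w b" unfolding S_add S_1 using u(2) j by simp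
  finally have "v * w u <= v * (sder g u * w b)" using v(1) by simp
  hence "v / w b <= v / w u * sder g u" using wu wb by (simp add: field_simps)
  moreover have "tt b <= v / w b" by (rule tt(4)[OF b(1)])
  moreover have "tt b <= 1" by (rule tt(2)[OF b(1)])
  ultimately show ?thesis unfolding tt_def[of u] using s by (simp add: min_def)
 qed
 hence "\<kappa> * tt b * g b <= \<kappa> * (tt u * sder g u) * g b"
  using \<kappa>(1) gb by (intro mult_right_mono mult_left_mono) auto
 hence "U b \<subseteq> mcball (T u) (\<kappa> * (tt u * sder g u) * g (T u))"
  unfolding U_def u(2) by (rule mcball_subset_concentric)
 thus ?thesis unfolding U_exact(2)[OF uR, symmetric] c(2) .
qed

lemma U_step: "x \<in> Reg ==> U (T x) \<subseteq> T ` U x"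
 using U_image_Reg[of x "T x"] Reg_iter[of x 1] U_self(1) by auto

lemma U_lift:
 assumes x: "x \<in> Reg" and y: "y \<in> Reg" "y \<in> T ` U x"
 obtains u where "u \<in> Reg" "u \<in> U x" "T u = y"
proof -
 obtain u where u: "u \<in> U x" "T u = y" using y(2) by blast
 moreover have "u \<in> M" using u(1) unfolding U_def by simp
 ultimately have "u \<in> Reg" using Reg_back U_exact(3)[OF x u(1)] y(1) by blast
 thus ?thesis using that u by blast
qed

text \<open>Pulling back along the first \<open>n\<close> letters gives points \<open>X n\<close>.
  The orbit of a limit point of these lies in the prescribed closed balls and avoids
  \<open>Q\<close> because they do; the limit point is in the closed Julia set.\<close>

lemma itinerary_exists:
 assumes a: "!!i. a i \<in> U ` Reg" "!!i. a (Suc i) \<subseteq> T ` a i"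
 obtains x where "x \<in> Reg" "!!i. U ((T ^^ i) x) = a i"
proof -
 have "ALL i. EX b. b \<in> Reg & a i = U b" using a(1) by blast
 then obtain b where b: "!!i. b i \<in> Reg" "!!i. a i = U (b i)" by metis
 have pull: "EX x:Reg. (T ^^ n) x = y & (ALL i<=n. (T ^^ i) x \<in> a i)" if "y \<in> Reg" "y \<in> a n" for n y
  using that
 proof (induction n arbitrary: y)
  case (Suc n)
  hence "y \<in> T ` U (b n)" using a(2)[of n] b(2) by blast
  then obtain u where u: "u \<in> Reg" "u \<in> U (b n)" "T u = y" using U_lift[OF b(1) Suc.prems(1)] by blast
  then obtain x where "x \<in> Reg" "(T ^^ n) x = u" "ALL i<=n. (T ^^ i) x \<in> a i" using Suc.IH[of u] b(2) by blast
  thus ?case using u(3) Suc.prems(2) by (intro bexI[of _ x]) (auto simp: le_Suc_eq)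
 qed auto
 have "EX x:Reg. ALL i<=n. (T ^^ i) x \<in> a i" for n using pull[of "b n" n] b U_self(1) by auto
 then obtain X where X: "!!n. X n \<in> Reg" "!!n i. i <= n ==> (T ^^ i) (X n) \<in> a i" by metis
 obtain x r where x: "x \<in> M" "strict_mono (r::nat=>nat)" "!!e. e > 0 ==> EX N. ALL n>=N. d (X (r n)) x < e"
  using convergent_subseq[of X] X(1) RegD(3) by blast
 have approx: "EX n>=i. d ((T ^^ i) x) ((T ^^ i) (X n)) < e" if e: "0 < e" for i and e :: real
 proof -
  obtain \<rho> where \<rho>: "\<rho> > 0" "!!y. y \<in> mcball x \<rho> ==> d ((T ^^ i) x) ((T ^^ i) y) < e" using iter_cont[OF x(1) e] by blast
  obtain N where N: "!!n. n >= N ==> d (X (r n)) x < \<rho>" using x(3)[OF \<rho>(1)] by blast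
  \<comment> \<open>An index at least \<open>i\<close> ensures that the approximating point already
    follows the \<open>i\<close>-th letter.\<close>
  have "X (r (max N i)) \<in> mcball x \<rho>" using N[of "max N i"] x(1) RegD(3)[OF X(1)] by (auto simp: commute)
  moreover have "i <= r (max N i)" using seq_suble[OF x(2), of "max N i"] by simp
  ultimately show ?thesis using \<rho>(2) by blast
 qed
 have ina: "(T ^^ i) x \<in> a i" for i
 proof (rule closedin_seq)
  show "closedin mtopology (a i)" unfolding b(2) U_def by simp
  show "(T ^^ i) x \<in> M" by (rule iter_in_M[OF x(1)])
  fix e :: real assume "0 < e"
  thus "EX y:a i. d ((T ^^ i) x) y < e" using approx[of e i] X(2) by blast
 qed
 have "x \<in> Jul"
 proof (rule closedin_seq[OF closedin_Jul _ x(1)])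
  fix e :: real assume "0 < e"
  thus "EX y:Jul. d x y < e" using approx[of e 0] RegD(4)[OF X(1)] by auto
 qed
 moreover have "(T ^^ i) x ~: Q" for i using U_exact(3)[OF b(1)] ina[of i] unfolding b(2) by blast
 ultimately have xR: "x \<in> Reg" unfolding Reg_def by blast
 have "U ((T ^^ i) x) = a i" for i
  using U_const(2)[OF b(1) Reg_iter[OF xR]] ina unfolding b(2) by blast
 thus ?thesis using that xR by blast
qed

text \<open>Equal letters let the similarities on the partition elements be composed: the distance
  grows by the full factor of \<open>T ^^ n\<close>, yet at time \<open>n\<close> both points lie in
  a ball of radius at most \<open>g\<close> there.\<close>

lemma itinerary_close:
 assumes x: "x \<in> Reg" and y: "y \<in> Reg" and eq: "!!i. i <= n ==> U ((T ^^ i) y) = U ((T ^^ i) x)"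
 shows "d x y <= g x / S n x"
proof -
 have rx: "reg x" by (rule RegD(1)[OF x])
 have gx: "0 < g x" using reg_g_pos[OF rx, of 0] by simp
 have "d ((T ^^ j) x) ((T ^^ j) y) = S j x * g ((T ^^ j) x) / g x * d x y" if "j <= n" for j
  using that
 proof (induction j)
  case 0 thus ?case using gx by simp
 next
  case (Suc j)
  let ?x = "(T ^^ j) x" and ?y = "(T ^^ j) y"
  have xR: "?x \<in> Reg" and yR: "?y \<in> Reg" using Reg_iter x y by blast+
  have "?y \<in> U ?x" using U_self(1)[OF yR] eq[of j] Suc.prems by simp
  hence "d (T ?x) (T ?y) = sder g ?x * g (T ?x) / g ?x * d ?x ?y"
   using exactD(3)[OF U_exact(1)[OF xR]] U_self(1)[OF xR] unfolding U_def by blast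
  moreover have "0 < g ?x" by (rule reg_g_pos[OF rx])
  ultimately show ?case using Suc by (simp add: S_Suc)
 qed
 hence e: "d ((T ^^ n) x) ((T ^^ n) y) = S n x * g ((T ^^ n) x) / g x * d x y" by simp
 let ?x = "(T ^^ n) x" and ?y = "(T ^^ n) y"
 have xR: "?x \<in> Reg" and yR: "?y \<in> Reg" using Reg_iter x y by blast+
 have gn: "0 < g ?x" by (rule reg_g_pos[OF rx])
 have "?y \<in> U ?x" using U_self(1)[OF yR] eq[of n] by simp
 hence "d ?x ?y <= \<kappa> * tt ?x * g ?x" unfolding U_def by simp
 also have "\<dots> <= 1 * 1 * g ?x" using \<kappa>(1,2) tt(1,2)[OF xR] gn by (intro mult_mono) auto
 finally have "S n x * g ?x / g x * d x y <= g ?x" unfolding e by simp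
 hence "S n x * d x y / g x * g ?x <= 1 * g ?x" by (simp add: field_simps)
 hence "S n x * d x y / g x <= 1" using gn by (simp only: mult_le_cancel_right_pos)
 thus ?thesis using gx S_pos[OF rx, of n] by (simp add: field_simps)
qed

lemma itinerary_inj:
 assumes x: "x \<in> Reg" and y: "y \<in> Reg" and eq: "!!i. U ((T ^^ i) y) = U ((T ^^ i) x)"
 shows "x = y"
proof (rule ccontr)
 assume "x ~= y"
 hence p: "0 < d x y" using RegD(3) x y by simp
 have gx: "0 < g x" using reg_g_pos[OF RegD(1)[OF x], of 0] by simp
 obtain n where n: "2 * g x / d x y <= S n x" using S_tends[OF x] by blast
 have "d x y <= g x / S n x" by (rule itinerary_close[OF x y eq])
 moreover have "g x / S n x < d x y" using n p gx S_pos[OF RegD(1)[OF x], of n] by (simp add: field_simps)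
 ultimately show False by simp
qed

lemma itinerary_locally_constant:
 assumes x: "x \<in> Reg" shows "EX r>0. ALL y:mcball x r \<inter> Reg. U ((T ^^ i) y) = U ((T ^^ i) x)"
proof -
 let ?x = "(T ^^ i) x"
 have xR: "?x \<in> Reg" by (rule Reg_iter[OF x])
 obtain r where r: "r > 0" "!!y. y \<in> mcball x r ==> d ?x ((T ^^ i) y) < \<kappa> * tt ?x * g ?x"
  using iter_cont[OF RegD(3)[OF x] U_self(2)[OF xR]] by blast
 have "U ((T ^^ i) y) = U ?x" if y: "y \<in> mcball x r" "y \<in> Reg" for y
 proof (rule U_const(2)[OF xR Reg_iter[OF y(2)]])
  show "(T ^^ i) y \<in> U ?x" unfolding U_def using r(2)[OF y(1)] RegD(3)[OF Reg_iter[OF x]] RegD(3)[OF Reg_iter[OF y(2)]] by simp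
 qed
 thus ?thesis using r(1) by blast
qed

end

section \<open>The Markov shift and its conjugacy\<close>

context ultra_dyn
begin

text \<open>Partition elements are numbered by even numbers, Julia points that reach
  \<open>Q\<close> by odd ones. The latter are coded by constant sequences of a letter whose only
  transition is to itself; this makes \<open>h\<close> bijective and does not touch the regular
  part.\<close>

theorem coding:
 "EX L A h. zero_one_matrix L A & bij_betw h Jul (markov_shift L A) &
   conjugate_via (subtopology mtopology Reg) T (subtopology (markov_topology L A) (h ` Reg)) left_shift h"
proof -
 obtain t g \<kappa> \<delta> where "gauged_dyn M d T Q t g \<kappa> \<delta>" using gauge_exists by blast
 then interpret G: gauged_dyn M d T Q t g \<kappa> \<delta> .
 obtain v where v: "0 < v" "v <= 1" "!!x j. x \<in> Reg ==> v <= G.S j x" using G.S_lower by blast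
 interpret C: coded_dyn M d T Q t g \<kappa> \<delta> v by unfold_locales (use v in auto)
 define E where "E = Jul - Reg"
 have E: "countable E"
 proof (rule countable_subset[OF _ countable_hits_Q])
  show "E \<subseteq> {x \<in> M. EX n. (T ^^ n) x \<in> Q}" unfolding E_def Reg_def using Jul_subset by blast
 qed
 have cU: "countable (C.U ` Reg)"
 proof (rule countable_subset[OF _ countable_clopen])
  show "C.U ` Reg \<subseteq> {N. openin mtopology N & closedin mtopology N}"
   unfolding C.U_def using openin_mcball C.U_self(2) by auto
 qed
 define eU where "eU u = 2 * to_nat_on (C.U ` Reg) u" for u
 define eE where "eE x = 2 * to_nat_on E x + 1" for x
 have eU_inj: "inj_on eU (C.U ` Reg)" using inj_on_to_nat_on[OF cU] unfolding eU_def inj_on_def by auto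
 have eE_inj: "inj_on eE E" using inj_on_to_nat_on[OF E] unfolding eE_def inj_on_def by auto
 have disj: "eU u ~= eE x" for u x unfolding eU_def eE_def by presburger
 define L where "L = eU ` (C.U ` Reg) \<union> eE ` E"
 \<comment> \<open>Inclusion in the image is demanded rather than mere intersection, so that every
   admissible sequence can be pulled back.\<close>
 define Tr where "Tr a b \<longleftrightarrow> (EX u:C.U ` Reg. EX u':C.U ` Reg. a = eU u & b = eU u' & u' \<subseteq> T ` u) \<or> (a = b & a \<in> eE ` E)" for a b
 define A where "A a b = (if Tr a b then 1 else 0 :: nat)" for a b
 define h where "h x = (if x \<in> Reg then (%i. eU (C.U ((T ^^ i) x))) else (%i. eE x))" for x
 have A1: "A a b = 1 \<longleftrightarrow> Tr a b" for a b unfolding A_def by simp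
 have hL: "h x i \<in> L" if "x \<in> Jul" for x i
  unfolding h_def L_def E_def using that Reg_iter by auto
 have h_shift: "h x \<in> markov_shift L A" if x: "x \<in> Jul" for x
 proof -
  have "Tr (h x i) (h x (Suc i))" for i
  proof (cases "x \<in> Reg")
   case True
   have "C.U (T ((T ^^ i) x)) \<subseteq> T ` C.U ((T ^^ i) x)" by (rule C.U_step[OF Reg_iter[OF True]])
   thus ?thesis unfolding Tr_def h_def using True Reg_iter[OF True, of i] Reg_iter[OF True, of "Suc i"] by auto
  next
   case False
   thus ?thesis unfolding Tr_def h_def E_def using x by auto
  qed
  thus ?thesis unfolding markov_shift_def A1 using hL[OF x] by blast
 qed
 have inj: "inj_on h Jul"
 proof (rule inj_onI)
  fix x y assume x: "x \<in> Jul" and y: "y \<in> Jul" and e: "h x = h y"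
  have ei: "h x i = h y i" for i using e by simp
  show "x = y"
  proof (cases "x \<in> Reg")
   case xR: True
   hence yR: "y \<in> Reg" using ei[of 0] disj unfolding h_def by (auto split: if_splits)
   have "C.U ((T ^^ i) y) = C.U ((T ^^ i) x)" for i
    using ei[of i] eU_inj Reg_iter[OF xR, of i] Reg_iter[OF yR, of i] xR yR
    unfolding h_def inj_on_def by auto
   thus ?thesis by (rule C.itinerary_inj[OF xR yR])
  next
   case xR: False
   have yR: "y ~: Reg"
   proof
    assume "y \<in> Reg"
    hence "eE x = eU (C.U y)" using ei[of 0] xR unfolding h_def by simp
    thus False using disj by metis
   qed
   have "eE x = eE y" using ei[of 0] xR yR unfolding h_def by simp
   thus ?thesis using eE_inj x y xR yR unfolding inj_on_def E_def by blast
  qed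
 qed
 have surj: "a \<in> h ` Jul" if a: "a \<in> markov_shift L A" for a
 proof -
  have aT: "Tr (a i) (a (Suc i))" and aL: "a i \<in> L" for i using a unfolding markov_shift_def A1 by auto
  show ?thesis
  proof (cases "a 0 \<in> eE ` E")
   case True
   then obtain x where x: "x \<in> E" "a 0 = eE x" by blast
   have "a i = eE x" for i
   proof (induction i)
    case (Suc i)
    thus ?case using aT[of i] disj unfolding Tr_def by metis
   qed (rule x(2))
   hence "a = h x" unfolding h_def using x(1) by (auto simp: E_def)
   thus ?thesis using x(1) unfolding E_def by blast
  next
   case False
   have "a i \<in> eU ` (C.U ` Reg)" for i
   proof (induction i)
    case 0
    thus ?case using aL[of 0] False unfolding L_def by blast
   next
    case (Suc i)
    hence "a i ~: eE ` E" using disj by (metis imageE)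
    thus ?case using aT[of i] unfolding Tr_def by blast
   qed
   hence "ALL i. EX u. u \<in> C.U ` Reg & a i = eU u" by blast
   then obtain u where u: "!!i. u i \<in> C.U ` Reg" "!!i. a i = eU (u i)" by metis
   have "u (Suc i) \<subseteq> T ` u i" for i
   proof -
    have "a i ~: eE ` E" using u(2)[of i] disj by (metis imageE)
    then obtain u1 u2 where "u1 \<in> C.U ` Reg" "u2 \<in> C.U ` Reg" "a i = eU u1" "a (Suc i) = eU u2" "u2 \<subseteq> T ` u1"
     using aT[of i] unfolding Tr_def by blast
    thus ?thesis using eU_inj u unfolding inj_on_def by metis
   qed
   then obtain x where x: "x \<in> Reg" "!!i. C.U ((T ^^ i) x) = u i" using C.itinerary_exists[of u] u(1) by metis
   have "a = h x" unfolding h_def using x u(2) by auto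
   thus ?thesis using x(1) unfolding Reg_def by blast
  qed
 qed
 have bij: "bij_betw h Jul (markov_shift L A)"
  unfolding bij_betw_def using inj surj h_shift by blast
 let ?X = "subtopology mtopology Reg"
 let ?Y = "subtopology (markov_topology L A) (h ` Reg)"
 have RJ: "Reg \<subseteq> Jul" unfolding Reg_def by blast
 have RM: "Reg \<subseteq> M" using RJ Jul_subset by blast
 have topX: "topspace ?X = Reg" using RM by auto
 have hsub: "h ` Reg \<subseteq> markov_shift L A" using h_shift RJ by blast
 have shift_top: "markov_shift L A \<subseteq> topspace (product_topology (%_. discrete_topology L) UNIV)"
  unfolding markov_shift_def by auto
 have topY: "topspace ?Y = h ` Reg" unfolding markov_topology_def using hsub shift_top by auto
 have Ysub: "?Y = subtopology (product_topology (%_. discrete_topology L) UNIV) (h ` Reg)"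
  unfolding markov_topology_def subtopology_subtopology using hsub by (simp add: Int_absorb1)
 have "continuous_map ?X (product_topology (%_. discrete_topology L) UNIV) h"
  unfolding continuous_map_componentwise_UNIV
 proof
  fix i
  show "continuous_map ?X (discrete_topology L) (%x. h x i)" unfolding continuous_map_def
  proof (intro conjI allI impI)
   show "(%x. h x i) \<in> topspace ?X \<rightarrow> topspace (discrete_topology L)" using hL RJ topX by auto
   fix V
   show "openin ?X {x \<in> topspace ?X. h x i \<in> V}"
   proof (subst openin_subopen, intro ballI)
    fix x assume "x \<in> {x \<in> topspace ?X. h x i \<in> V}"
    hence x: "x \<in> Reg" "h x i \<in> V" using topX by auto
    obtain r where r: "r > 0" "!!y. y \<in> mcball x r \<inter> Reg ==> C.U ((T ^^ i) y) = C.U ((T ^^ i) x)"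
     using C.itinerary_locally_constant[OF x(1)] by blast
    have "openin ?X (mcball x r \<inter> Reg)" using openin_mcball[OF r(1)] by (auto simp: openin_subtopology)
    moreover have "x \<in> mcball x r \<inter> Reg" using x(1) RM r(1) by auto
    moreover have "h y i = h x i" if "y \<in> mcball x r \<inter> Reg" for y using r(2)[OF that] that x(1) unfolding h_def by simp
    hence "mcball x r \<inter> Reg \<subseteq> {x \<in> topspace ?X. h x i \<in> V}" using x(2) topX by auto
    ultimately show "EX W. openin ?X W & x \<in> W & W \<subseteq> {x \<in> topspace ?X. h x i \<in> V}" by blast
   qed
  qed
 qed
 hence cont: "continuous_map ?X ?Y h" unfolding Ysub by (simp add: continuous_map_in_subtopology topX image_subset_iff_funcset)
 have proj: "continuous_map ?Y (discrete_topology L) (%a. a i)" for i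
  unfolding Ysub by (intro continuous_map_from_subtopology continuous_map_product_projection) simp
 have op: "open_map ?X ?Y h" unfolding open_map_def
 proof (intro allI impI)
  fix O' assume "openin ?X O'"
  then obtain O1 where O1: "openin mtopology O1" "O' = O1 \<inter> Reg" by (auto simp: openin_subtopology)
  show "openin ?Y (h ` O')"
  proof (subst openin_subopen, intro ballI)
   fix a assume "a \<in> h ` O'"
   then obtain x where x: "x \<in> O1" "x \<in> Reg" "a = h x" using O1(2) by blast
   obtain r where r: "r > 0" "mcball x r \<subseteq> O1" using O1(1) x(1) unfolding openin_mtopology_mcball by blast
   have gx: "0 < g x" using G.reg_g_pos[OF G.RegD(1)[OF x(2)], of 0] by simp
   \<comment> \<open>By \<open>itinerary_close\<close>, agreement in the letters 0 to
     \<open>n\<close> forces distance at most \<open>r\<close>; the corresponding cylinder witnesses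
     that \<open>h\<close> is open.\<close>
   obtain n where n: "g x / r <= G.S n x" using C.S_tends[OF x(2)] by blast
   define V' where "V' = (\<Inter>i\<in>{..n}. {b \<in> topspace ?Y. b i \<in> {a i}})"
   have "openin ?Y {b \<in> topspace ?Y. b i \<in> {a i}}" for i
    using openin_continuous_map_preimage[OF proj, of "{a i}" i] hL[of x i] x(2,3) RJ by auto
   hence "openin ?Y V'" unfolding V'_def by (intro openin_INT2) auto
   moreover have "a \<in> V'" unfolding V'_def topY using x by auto
   moreover have "V' \<subseteq> h ` O'"
   proof
    fix b assume "b \<in> V'"
    then obtain y where y: "y \<in> Reg" "b = h y" "!!i. i <= n ==> h y i = h x i" unfolding V'_def topY x(3) by auto
    have "C.U ((T ^^ i) y) = C.U ((T ^^ i) x)" if "i <= n" for i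
     using y(3)[OF that] eU_inj Reg_iter[OF x(2), of i] Reg_iter[OF y(1), of i] x(2) y(1)
     unfolding h_def inj_on_def by auto
    hence "d x y <= g x / G.S n x" using C.itinerary_close[OF x(2) y(1)] by blast
    also have "\<dots> <= r" using n r(1) G.S_pos[OF G.RegD(1)[OF x(2)], of n] by (simp add: field_simps)
    finally have "y \<in> mcball x r" using x(2) y(1) RM by auto
    thus "b \<in> h ` O'" using r(2) y(1,2) O1(2) by blast
   qed
   ultimately show "EX V. openin ?Y V & a \<in> V & V \<subseteq> h ` O'" by blast
  qed
 qed
 have "homeomorphic_map ?X ?Y h"
  by (rule bijective_open_imp_homeomorphic_map[OF cont op]) (use topX topY inj_on_subset[OF inj RJ] in auto)
 moreover have "h (T x) = left_shift (h x)" if x: "x \<in> Reg" for x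
  using x Reg_iter[OF x, of 1] unfolding h_def left_shift_def by (auto simp: funpow_swap1)
 ultimately have "conjugate_via ?X T ?Y left_shift h" unfolding conjugate_via_def topX by blast
 moreover have "zero_one_matrix L A" unfolding zero_one_matrix_def A_def by simp
 ultimately show ?thesis using bij by blast
qed

theorem decomposition:
 "EX \<M>. countable \<M> & disjoint \<M> & (ALL N:\<M>. piece N) & (ALL N. piece N --> N \<subseteq> {p. nonrep p} \<union> \<Union>\<M>) &
   {p. nonrep p} \<inter> \<Union>\<M> = {} & \<Union>\<M> \<inter> Jul = {} & {p. nonrep p} \<inter> Jul = {} & finite {p. nonrep p} &
   (ALL x:Fat. x \<in> {p. nonrep p} \<union> \<Union>\<M> \<or> (EX y. nonrep y & basin y x) \<or> (EX N:\<M>. EX n. (T ^^ n) x \<in> N)) &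
   (ALL x:Jul. ~ (EX y. nonrep y & basin y x) & ~ (EX N:\<M>. EX n. (T ^^ n) x \<in> N))"
proof -
 obtain t g \<kappa> \<delta> where "gauged_dyn M d T Q t g \<kappa> \<delta>" using gauge_exists by blast
 then interpret G: gauged_dyn M d T Q t g \<kappa> \<delta> .
 show ?thesis by (rule G.decomposition_gauged)
qed

end

section \<open>Non-archimedean absolute values\<close>

locale nonarch =
 fixes v :: "'c::field_char_0 => real"
 assumes nonarch_abs: "nonarch_abs v"
begin

lemma v_nonneg [simp]: "0 <= v x"
 and v_eq_0 [simp]: "v x = 0 \<longleftrightarrow> x = 0"
 and v_mult: "v (x * y) = v x * v y"
 and v_add: "v (x + y) <= max (v x) (v y)"
 using nonarch_abs unfolding nonarch_abs_def by auto

lemma v_pos [simp]: "0 < v x \<longleftrightarrow> x ~= 0"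
 using v_nonneg[of x] v_eq_0[of x] by linarith

lemma v_0 [simp]: "v 0 = 0" by simp

lemma v_1 [simp]: "v 1 = 1"
proof -
 have "v 1 * v 1 = v 1" using v_mult[of 1 1] by simp
 thus ?thesis by simp
qed

lemma v_power: "v (x ^ n) = v x ^ n"
 by (induction n) (auto simp: v_mult)

lemma v_minus [simp]: "v (- x) = v x"
proof -
 have "v (-1) ^ 2 = 1" using v_mult[of "-1" "-1"] by (simp add: power2_eq_square)
 hence "v (-1) = 1" using v_nonneg[of "-1"] by (simp add: power2_eq_1_iff)
 thus ?thesis using v_mult[of "-1" x] by simp
qed

lemma v_diff: "v (x - y) <= max (v x) (v y)"
 using v_add[of x "- y"] by simp

lemma v_diff_commute: "v (x - y) = v (y - x)"
 using v_minus[of "x - y"] by simp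

lemma v_inverse: "v (inverse x) = inverse (v x)"
proof (cases "x = 0")
 case False
 hence "v x * v (inverse x) = 1" using v_mult[of x "inverse x"] by simp
 thus ?thesis by (metis inverse_unique)
qed simp

lemma v_divide: "v (x / y) = v x / v y"
 by (simp add: divide_inverse v_mult v_inverse)

lemma v_add_less: "v x < r ==> v y < r ==> v (x + y) < r"
 using v_add[of x y] by linarith

lemma v_add_le: "v x <= r ==> v y <= r ==> v (x + y) <= r"
 using v_add[of x y] by linarith

lemma v_diff_less: "v x < r ==> v y < r ==> v (x - y) < r"
 using v_diff[of x y] by linarith

lemma v_diff_le: "v x <= r ==> v y <= r ==> v (x - y) <= r"
 using v_diff[of x y] by linarith

lemma v_dominant: "v y < v x ==> v (x + y) = v x"
 using v_add[of x y] v_diff[of "x + y" y] by simp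

lemma v_close: "v (x - y) < v x ==> v y = v x"
 using v_dominant[of "y - x" x] by (simp add: v_diff_commute)

lemma v_trans: "v (x - z) <= max (v (x - y)) (v (y - z))"
 using v_add[of "x - y" "y - z"] by simp

lemma v_sum_le: "(!!i. i \<in> I ==> v (f i) <= r) ==> 0 <= r ==> v (sum f I) <= r"
 by (induction I rule: infinite_finite_induct) (auto intro!: v_add_le)

lemma v_of_nat_le: "v (of_nat n) <= 1"
 by (induction n) (auto intro!: v_add_le)

lemma v_of_int_le: "v (of_int n) <= 1"
 by (cases n) (auto simp: v_of_nat_le simp del: of_nat_Suc)

sublocale ms: Metric_space UNIV "abs_dist v"
proof
 show "v (x - y) = v (y - x)" for x y by (rule v_diff_commute)
 show "v (x - z) <= v (x - y) + v (y - z)" for x y z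
  using v_trans[of x z y] v_nonneg[of "x - y"] v_nonneg[of "y - z"] by linarith
qed auto

section \<open>Lipschitz divided differences of rational functions\<close>

text \<open>Bounded Lipschitz functions of two variables, with one constant for both properties. The
  class is closed under sums, products and inverses of functions bounded away from 0, so divided
  differences of rational functions belong to it.\<close>

definition lip2 :: "('c \<times> 'c) set => ('c \<times> 'c => 'c) => bool" where
 "lip2 S F \<longleftrightarrow> (EX C>=1. (ALL z:S. v (F z) <= C) &
   (ALL z:S. ALL w:S. v (F z - F w) <= C * max (v (fst z - fst w)) (v (snd z - snd w))))"

lemma lip2I:
 assumes "0 <= B" "!!z. z \<in> S ==> v (F z) <= B" "0 <= C"
  "!!z w. z \<in> S ==> w \<in> S ==> v (F z - F w) <= C * max (v (fst z - fst w)) (v (snd z - snd w))"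
 shows "lip2 S F"
proof -
 have "v (F z - F w) <= (B + C + 1) * max (v (fst z - fst w)) (v (snd z - snd w))" if "z \<in> S" "w \<in> S" for z w
  using assms(1,3) by (intro order_trans[OF assms(4)[OF that]] mult_right_mono) (auto simp: le_max_iff_disj)
 moreover have "v (F z) <= B + C + 1" if "z \<in> S" for z using assms(2)[OF that] assms(3) by linarith
 ultimately show ?thesis unfolding lip2_def using assms(1,3) by (intro exI[of _ "B + C + 1"]) simp
qed

lemma lip2_const: "lip2 S (%_. c)"
 by (rule lip2I[of "v c" _ _ 0]) auto

lemma lip2_proj: assumes "!!x. x \<in> D ==> v x <= B" shows "lip2 (D \<times> D) fst" "lip2 (D \<times> D) snd"
 by (rule lip2I[of "max 0 B" _ _ 1]; use assms in "force simp: le_max_iff_disj")+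

lemma lip2_add: assumes "lip2 S F" "lip2 S G" shows "lip2 S (%z. F z + G z)"
proof -
 let ?e = "%z w :: 'c \<times> 'c. max (v (fst z - fst w)) (v (snd z - snd w))"
 obtain C where C: "1 <= C" "!!z. z \<in> S ==> v (F z) <= C" "!!z w. z \<in> S ==> w \<in> S ==> v (F z - F w) <= C * ?e z w"
  using assms(1) unfolding lip2_def by blast
 obtain B where B: "1 <= B" "!!z. z \<in> S ==> v (G z) <= B" "!!z w. z \<in> S ==> w \<in> S ==> v (G z - G w) <= B * ?e z w"
  using assms(2) unfolding lip2_def by blast
 have l: "C * ?e z w <= (C + B) * ?e z w" "B * ?e z w <= (C + B) * ?e z w" for z w
  using B C by (auto intro!: mult_right_mono simp: le_max_iff_disj)
 show ?thesis
 proof (rule lip2I[of "C + B" _ _ "C + B"])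
  show "v (F z + G z) <= C + B" if "z \<in> S" for z using C(1) C(2)[OF that] B(1) B(2)[OF that] by (intro v_add_le) auto
  show "v (F z + G z - (F w + G w)) <= (C + B) * ?e z w" if "z \<in> S" "w \<in> S" for z w
   using v_add_le[OF order_trans[OF C(3)[OF that] l(1)] order_trans[OF B(3)[OF that] l(2)]] by (simp add: algebra_simps)
 qed (use C B in auto)
qed

lemma lip2_mult: assumes "lip2 S F" "lip2 S G" shows "lip2 S (%z. F z * G z)"
proof -
 let ?e = "%z w :: 'c \<times> 'c. max (v (fst z - fst w)) (v (snd z - snd w))"
 obtain C where C: "1 <= C" "!!z. z \<in> S ==> v (F z) <= C" "!!z w. z \<in> S ==> w \<in> S ==> v (F z - F w) <= C * ?e z w"
  using assms(1) unfolding lip2_def by blast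
 obtain B where B: "1 <= B" "!!z. z \<in> S ==> v (G z) <= B" "!!z w. z \<in> S ==> w \<in> S ==> v (G z - G w) <= B * ?e z w"
  using assms(2) unfolding lip2_def by blast
 show ?thesis
 proof (rule lip2I[of "C * B" _ _ "C * B"])
  show "v (F z * G z) <= C * B" if "z \<in> S" for z
   unfolding v_mult using C(1) C(2)[OF that] B(1) B(2)[OF that] by (intro mult_mono) auto
  show "v (F z * G z - F w * G w) <= C * B * ?e z w" if "z \<in> S" "w \<in> S" for z w
  proof -
   have "v (F z) * v (G z - G w) <= C * (B * ?e z w)" "v (G w) * v (F z - F w) <= B * (C * ?e z w)"
    using C B that by (intro mult_mono; simp)+
   hence "v (F z * (G z - G w) + G w * (F z - F w)) <= C * B * ?e z w"
    by (intro v_add_le) (simp_all only: v_mult mult.assoc mult.left_commute)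
   thus ?thesis by (simp add: algebra_simps)
  qed
 qed (use C B in auto)
qed

lemma lip2_inverse: assumes "lip2 S F" "0 < b" "!!z. z \<in> S ==> b <= v (F z)" shows "lip2 S (%z. inverse (F z))"
proof -
 let ?e = "%z w :: 'c \<times> 'c. max (v (fst z - fst w)) (v (snd z - snd w))"
 obtain C where C: "1 <= C" "!!z w. z \<in> S ==> w \<in> S ==> v (F z - F w) <= C * ?e z w"
  using assms(1) unfolding lip2_def by blast
 have i: "v (inverse (F z)) <= inverse b" if "z \<in> S" for z
  unfolding v_inverse using assms(2) assms(3)[OF that] by (intro le_imp_inverse_le)
 have nz: "F z ~= 0" if "z \<in> S" for z using assms(2) assms(3)[OF that] by auto
 show ?thesis
 proof (rule lip2I[OF _ i])
  show "v (inverse (F z) - inverse (F w)) <= inverse b * inverse b * C * ?e z w" if z: "z \<in> S" "w \<in> S" for z w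
  proof -
   have "inverse (F z) - inverse (F w) = inverse (F z) * inverse (F w) * (F w - F z)"
    using nz[OF z(1)] nz[OF z(2)] by (simp add: field_simps)
   hence "v (inverse (F z) - inverse (F w)) = v (inverse (F z)) * v (inverse (F w)) * v (F z - F w)"
    by (simp only: v_mult v_diff_commute[of "F w"])
   also have "\<dots> <= inverse b * inverse b * (C * ?e z w)"
    using i[OF z(1)] i[OF z(2)] C(2)[OF z] assms(2) by (intro mult_mono) auto
   finally show ?thesis by (simp only: mult.assoc)
  qed
 qed (use C(1) assms(2) in auto)
qed

text \<open>Horner recursion: if \<Psi>(x, y) is the divided difference of q, that of a + z q is
  q(x) + y \<Psi>(x, y). It is defined on the diagonal too, where a quotient would not be.\<close>

lemma lip2_poly:
 assumes "!!x. x \<in> D ==> v x <= B"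
 shows "lip2 (D \<times> D) (%z. poly q (fst z))" "lip2 (D \<times> D) (%z. poly q (snd z))"
  "EX \<Psi>. lip2 (D \<times> D) \<Psi> & (ALL x y. poly q x - poly q y = \<Psi> (x, y) * (x - y))"
proof -
 note L = lip2_add lip2_mult lip2_const lip2_proj[of D B, OF assms]
 show 1: "lip2 (D \<times> D) (%z. poly q (fst z))" and 2: "lip2 (D \<times> D) (%z. poly q (snd z))" for q
  by (induction q) (use lip2_const[of _ 0] in simp, use L in simp)+
 show "EX \<Psi>. lip2 (D \<times> D) \<Psi> & (ALL x y. poly q x - poly q y = \<Psi> (x, y) * (x - y))"
 proof (induction q)
  case 0
  thus ?case by (intro exI[of _ "%_. 0"] conjI lip2_const) simp
 next
  case (pCons a q)
  then obtain \<Psi> where \<Psi>: "lip2 (D \<times> D) \<Psi>" "!!x y. poly q x - poly q y = \<Psi> (x, y) * (x - y)" by blast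
  have "poly (pCons a q) x - poly (pCons a q) y = (poly q x + y * \<Psi> (x, y)) * (x - y)" for x y
  proof -
   have "poly (pCons a q) x - poly (pCons a q) y = poly q x * (x - y) + y * (poly q x - poly q y)"
    by (simp add: algebra_simps)
   thus ?thesis unfolding \<Psi>(2) by (simp add: algebra_simps)
  qed
  moreover have "lip2 (D \<times> D) (%z. poly q (fst z) + snd z * \<Psi> z)" by (intro L 1 \<Psi>(1))
  ultimately show ?case by (intro exI[of _ "%z. poly q (fst z) + snd z * \<Psi> z"]) simp
 qed
qed

text \<open>The quotient rule for divided differences. The Lipschitz bound in both variables later
  measures how difference quotients vary.\<close>

lemma divided_difference:
 assumes B: "!!x. x \<in> D ==> v x <= B" and b: "0 < b" "!!x. x \<in> D ==> b <= v (poly q x)"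
 obtains C \<Psi> where "1 <= C"
  "!!x y. x \<in> D ==> y \<in> D ==> poly n x / poly q x - poly n y / poly q y = \<Psi> x y * (x - y) & v (\<Psi> x y) <= C"
  "!!x y x' y'. x \<in> D ==> y \<in> D ==> x' \<in> D ==> y' \<in> D ==> v (\<Psi> x y - \<Psi> x' y') <= C * max (v (x - x')) (v (y - y'))"
proof -
 obtain N where N: "lip2 (D \<times> D) N" "!!x y. poly n x - poly n y = N (x, y) * (x - y)" using lip2_poly(3)[OF B] by blast
 obtain M where M: "lip2 (D \<times> D) M" "!!x y. poly q x - poly q y = M (x, y) * (x - y)" using lip2_poly(3)[OF B] by blast
 define \<Psi> where "\<Psi> = (%z. (N z * poly q (snd z) + (- 1) * (poly n (snd z) * M z)) * (inverse (poly q (fst z)) * inverse (poly q (snd z))))"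
 have "lip2 (D \<times> D) \<Psi>" unfolding \<Psi>_def
  using b(2) by (intro lip2_mult lip2_add lip2_const N(1) M(1) lip2_inverse[OF _ b(1)] lip2_poly(1,2)[of D B, OF B]) auto
 then obtain C where C: "1 <= C" "!!z. z \<in> D \<times> D ==> v (\<Psi> z) <= C"
   "!!z w. z \<in> D \<times> D ==> w \<in> D \<times> D ==> v (\<Psi> z - \<Psi> w) <= C * max (v (fst z - fst w)) (v (snd z - snd w))"
  unfolding lip2_def by blast
 show ?thesis
 proof (rule that[of C "%x y. \<Psi> (x, y)"])
  fix x y assume D: "x \<in> D" "y \<in> D"
  have nz: "poly q x ~= 0" "poly q y ~= 0" using b(1) b(2)[OF D(1)] b(2)[OF D(2)] by auto
  have "poly n x / poly q x - poly n y / poly q y =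
    ((poly n x - poly n y) * poly q y - poly n y * (poly q x - poly q y)) / (poly q x * poly q y)"
   using nz by (simp add: field_simps)
  also have "\<dots> = \<Psi> (x, y) * (x - y)" unfolding N M \<Psi>_def using nz by (simp add: field_simps)
  finally show "poly n x / poly q x - poly n y / poly q y = \<Psi> (x, y) * (x - y) & v (\<Psi> (x, y)) <= C" using C(2)[of "(x, y)"] D by simp
 next
  fix x y x' y' assume "x \<in> D" "y \<in> D" "x' \<in> D" "y' \<in> D"
  thus "v (\<Psi> (x, y) - \<Psi> (x', y')) <= C * max (v (x - x')) (v (y - y'))" using C(3)[of "(x, y)" "(x', y')"] by simp
 qed (rule C(1))
qed

lemma disk_bounded: "v (x - a) <= r ==> v x <= max r (v a)"
 using v_add_le[of "x - a" "max r (v a)" a] by simp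

lemma poly_near:
 assumes "0 < e" shows "EX r>0. ALL x. v (x - a) <= r --> v (poly q x - poly q a) <= e"
proof -
 obtain \<Psi> where \<Psi>: "lip2 ({x. v (x - a) <= 1} \<times> {x. v (x - a) <= 1}) \<Psi>" "!!x y. poly q x - poly q y = \<Psi> (x, y) * (x - y)"
  using lip2_poly(3)[of "{x. v (x - a) <= 1}", OF disk_bounded] by blast
 then obtain C where C: "1 <= C" "!!x y. v (x - a) <= 1 ==> v (y - a) <= 1 ==> v (\<Psi> (x, y)) <= C"
  unfolding lip2_def by auto
 have "v (poly q x - poly q a) <= e" if "v (x - a) <= min 1 (e / C)" for x
 proof -
  have "v (poly q x - poly q a) <= C * v (x - a)" using that C(2)[of x a] unfolding \<Psi>(2) v_mult by (intro mult_right_mono) auto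
  also have "\<dots> <= e" using that C(1) by (simp add: field_simps)
  finally show ?thesis .
 qed
 thus ?thesis using assms C(1) by (intro exI[of _ "min 1 (e / C)"]) auto
qed

lemma poly_nonzero_near:
 assumes "poly q a ~= 0" shows "EX r>0. ALL x. v (x - a) <= r --> v (poly q x) = v (poly q a)"
proof -
 obtain r where r: "r > 0" "!!x. v (x - a) <= r ==> v (poly q x - poly q a) <= v (poly q a) / 2"
  using poly_near[of "v (poly q a) / 2" a q] assms by auto
 have "v (poly q x) = v (poly q a)" if "v (x - a) <= r" for x
 proof (rule v_close)
  have "0 < v (poly q a)" using assms by simp
  thus "v (poly q a - poly q x) < v (poly q a)" using r(2)[OF that] by (subst v_diff_commute) linarith
 qed
 thus ?thesis using r(1) by blast
qed

end

section \<open>Algebraic closedness and local compactness\<close>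

lemma is_subfieldD:
 assumes "is_subfield F"
 shows "0 \<in> F" "1 \<in> F" "x \<in> F ==> y \<in> F ==> x + y \<in> F" "x \<in> F ==> y \<in> F ==> x * y \<in> F"
  "x \<in> F ==> - x \<in> F" "x \<in> F ==> inverse x \<in> F" "x \<in> F ==> y \<in> F ==> x - y \<in> F" "x \<in> F ==> y \<in> F ==> x / y \<in> F"
  "x \<in> F ==> x ^ n \<in> F"
proof -
 show b: "0 \<in> F" "1 \<in> F" "!!x y. x \<in> F ==> y \<in> F ==> x + y \<in> F" "!!x y. x \<in> F ==> y \<in> F ==> x * y \<in> F"
  "!!x. x \<in> F ==> - x \<in> F" "!!x. x \<in> F ==> inverse x \<in> F"
  using assms unfolding is_subfield_def by blast+
 show "x \<in> F ==> y \<in> F ==> x - y \<in> F" using b(3)[of x "- y"] b(5) by simp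
 show "x \<in> F ==> y \<in> F ==> x / y \<in> F" using b(4)[of x "inverse y"] b(6) by (simp add: divide_inverse)
 show "x \<in> F ==> x ^ n \<in> F" by (induction n) (use b in auto)
qed

lemma subfield_coeffs_pCons: "is_subfield F ==> set (coeffs (pCons a p)) \<subseteq> F \<longleftrightarrow> a \<in> F & set (coeffs p) \<subseteq> F"
 by (auto simp: coeffs_pCons_eq_cCons cCons_def is_subfieldD(1) split: if_splits)

lemma poly_in_subfield:
 fixes p :: "'c::field poly"
 assumes "is_subfield F" "x \<in> F"
 shows "set (coeffs p) \<subseteq> F ==> poly p x \<in> F"
proof (induction p)
 case (pCons a p)
 hence "a \<in> F" "set (coeffs p) \<subseteq> F" using subfield_coeffs_pCons[OF assms(1), of a p] by auto
 thus ?case using pCons.IH is_subfieldD(3,4)[OF assms(1)] assms(2) by simp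
qed (simp add: is_subfieldD(1)[OF assms(1)])

lemma coeff_in_subfield:
 fixes p :: "'c::field poly"
 assumes "is_subfield F" "set (coeffs p) \<subseteq> F" shows "coeff p n \<in> F"
proof -
 have "coeff p n \<in> insert 0 (set (coeffs p))" unfolding range_coeff[symmetric] by simp
 thus ?thesis using assms(2) is_subfieldD(1)[OF assms(1)] by auto
qed

lemma synthetic_div_subfield:
 fixes p :: "'c::field poly"
 assumes "is_subfield F" "x \<in> F"
 shows "set (coeffs p) \<subseteq> F ==> set (coeffs (synthetic_div p x)) \<subseteq> F"
proof (induction p)
 case (pCons a p)
 hence "set (coeffs p) \<subseteq> F" using subfield_coeffs_pCons[OF assms(1), of a p] by auto
 thus ?case using pCons.IH poly_in_subfield[OF assms]
  by (simp add: subfield_coeffs_pCons[OF assms(1)] del: coeffs_pCons_eq_cCons)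
qed simp

lemma split_root: "poly p (x :: 'c::field) = 0 ==> p = [:- x, 1:] * synthetic_div p x"
 using synthetic_div_correct'[of x p] by simp

context nonarch
begin

text \<open>The value of a monic polynomial is the product of the distances to its roots, so some
  root is as close as the geometric mean. Roots are split off one at a time: if \<open>a\<close> is
  not close enough, the quotient has a better one.\<close>

lemma root_near:
 assumes A: "is_subfield A" "!!q. set (coeffs q) \<subseteq> A ==> 0 < degree q ==> EX x:A. poly q x = 0"
  and p: "set (coeffs p) \<subseteq> A" "lead_coeff p = 1" "0 < degree p"
 shows "EX b:A. poly p b = 0 & v (x - b) ^ degree p <= v (poly p x)"
 using p
proof (induction "degree p" arbitrary: p)
 case (Suc n)
 then obtain a where a: "a \<in> A" "poly p a = 0" using A(2)[OF Suc.prems(1,3)] by blast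
 define q where "q = synthetic_div p a"
 have pq: "p = [:- a, 1:] * q" unfolding q_def by (rule split_root[OF a(2)])
 have px: "v (poly p x) = v (x - a) * v (poly q x)" unfolding pq by (simp add: v_mult[symmetric] algebra_simps)
 show ?case
 proof (cases "v (x - a) ^ degree p <= v (poly p x)")
  case True thus ?thesis using a by blast
 next
  case False
  have q0: "q ~= 0" using pq Suc.prems(3) by auto
  have dp: "degree p = Suc (degree q)" unfolding q_def using Suc.prems(3) by (simp add: degree_synthetic_div)
  have lq: "lead_coeff q = 1" using Suc.prems(2) unfolding pq lead_coeff_mult by simp
  have xa: "0 < v (x - a)" using False px dp by (cases "x = a") auto
  have lt: "v (poly q x) < v (x - a) ^ degree q" using False xa unfolding px dp by simp
  have "0 < degree q"
  proof (rule ccontr)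
   assume "~ 0 < degree q"
   then obtain c where "q = [:c:]" using degree_eq_zeroE by blast
   thus False using lt lq by simp
  qed
  then obtain b where b: "b \<in> A" "poly q b = 0" "v (x - b) ^ degree q <= v (poly q x)"
   using Suc.hyps(1)[of q] Suc.hyps(2) dp lq synthetic_div_subfield[OF A(1) a(1) Suc.prems(1)] unfolding q_def by auto
  have "v (x - b) ^ degree q < v (x - a) ^ degree q" using b(3) lt by simp
  hence "v (x - b) <= v (x - a)" using power_less_imp_less_base by (metis less_imp_le v_nonneg)
  hence "v (x - b) * v (x - b) ^ degree q <= v (x - a) * v (poly q x)" using b(3) by (intro mult_mono) auto
  moreover have "poly p b = 0" using b(2) pq by simp
  ultimately show ?thesis using b(1) px dp by auto
 qed
qed simp

lemma v_poly_bound: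
 assumes "!!i. v (coeff p i) <= e" "v x <= R" "1 <= R" "degree p <= n"
 shows "v (poly p x) <= e * R ^ n"
proof -
 have e: "0 <= e" using assms(1)[of 0] v_nonneg[of "coeff p 0"] by linarith
 show ?thesis unfolding poly_altdef
 proof (rule v_sum_le)
  fix i assume i: "i \<in> {..degree p}"
  have "v x ^ i <= R ^ i" using assms(2) by (intro power_mono) auto
  also have "\<dots> <= R ^ n" using assms(3,4) i by (intro power_increasing) auto
  finally show "v (coeff p i * x ^ i) <= e * R ^ n" unfolding v_mult v_power using assms(1) e by (intro mult_mono) auto
 qed (use e assms in simp)
qed

lemma monic_root_bound:
 assumes "lead_coeff p = 1" "0 < degree p" "!!i. v (coeff p i) <= R" "1 <= R" "poly p x = 0"
 shows "v x <= R"
proof (rule ccontr)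
 assume "~ v x <= R"
 hence x: "R < v x" "1 < v x" using assms(4) by auto
 obtain n where n: "degree p = Suc n" using assms(2) by (cases "degree p") auto
 have "poly p x = (\<Sum>i\<le>n. coeff p i * x ^ i) + x ^ Suc n" unfolding poly_altdef n using assms(1) n by simp
 hence "v (x ^ Suc n) = v (\<Sum>i\<le>n. coeff p i * x ^ i)" using assms(5) by (metis add_eq_0_iff v_minus)
 also have "\<dots> <= R * v x ^ n"
 proof (rule v_sum_le)
  fix i assume "i \<in> {..n}"
  hence "v x ^ i <= v x ^ n" using x by (intro power_increasing) auto
  thus "v (coeff p i * x ^ i) <= R * v x ^ n" unfolding v_mult v_power using assms(3,4) by (intro mult_mono) auto
 qed (use assms(4) in simp)
 also have "\<dots> < v x * v x ^ n"
 proof (rule mult_strict_right_mono[OF x(1)])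
  have "0 < v x" using x(2) by linarith
  thus "0 < v x ^ n" by (rule zero_less_power)
 qed
 finally show False unfolding v_power by simp
qed

lemma complete_Cauchy:
 assumes "ms.mcomplete" "!!n. v (\<sigma> (Suc n) - \<sigma> n) <= (1/2) ^ n"
 obtains l where "!!e. 0 < e ==> EX N. ALL n>=N. v (\<sigma> n - l) < e"
proof -
 have tail: "v (\<sigma> (n + k) - \<sigma> n) <= (1/2) ^ n" for n k
 proof (induction k)
  case (Suc k)
  have "v (\<sigma> (Suc (n + k)) - \<sigma> (n + k)) <= (1/2) ^ n"
   by (rule order_trans[OF assms(2)[of "n + k"]]) (rule power_decreasing, auto)
  thus ?case using Suc v_trans[of "\<sigma> (n + Suc k)" "\<sigma> n" "\<sigma> (n + k)"] by simp
 qed simp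
 have "ms.MCauchy \<sigma>" unfolding ms.MCauchy_def
 proof (intro conjI allI impI)
  fix e :: real assume "0 < e"
  then obtain N where N: "(1/2 :: real) ^ N < e" using real_arch_pow_inv[of e "1/2"] by auto
  show "EX N. ALL n n'. N <= n --> N <= n' --> v (\<sigma> n - \<sigma> n') < e"
  proof (intro exI allI impI)
   fix n n' assume "N <= n" "N <= n'"
   hence "v (\<sigma> n - \<sigma> N) <= (1/2)^N" "v (\<sigma> n' - \<sigma> N) <= (1/2)^N" using tail[of N] by (metis le_add_diff_inverse)+
   thus "v (\<sigma> n - \<sigma> n') < e" using N v_trans[of "\<sigma> n" "\<sigma> n'" "\<sigma> N"] v_diff_commute[of "\<sigma> N" "\<sigma> n'"] by simp
  qed
 qed simp
 then obtain l where "limitin ms.mtopology \<sigma> l sequentially" using assms(1) unfolding ms.mcomplete_def by blast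
 thus ?thesis using that unfolding ms.limit_metric_sequentially by auto
qed

text \<open>Roots of polynomials over the dense algebraically closed subfield that approximate a given
 polynomial can be chosen to form a Cauchy sequence.\<close>

lemma algebraically_closed:
 assumes compl: "ms.mcomplete" and A: "is_algebraic_closure_of A F" and dense: "abs_topology v closure_of A = UNIV"
  and deg: "0 < degree (p :: 'c poly)"
 shows "EX x. poly p x = 0"
proof -
 have Asub: "is_subfield A" and Aroot: "!!q. set (coeffs q) \<subseteq> A ==> 0 < degree q ==> EX x:A. poly q x = 0"
  using A unfolding is_algebraic_closure_of_def by blast+
 have approx: "EX a:A. v (x - a) < e" if "0 < e" for x and e :: real
 proof -
  have "x \<in> abs_topology v closure_of A" using dense by blast
  thus ?thesis unfolding ms.metric_closure_of using that by auto
 qed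
 define f where "f = smult (inverse (lead_coeff p)) p"
 have lp: "lead_coeff p ~= 0" using deg by auto
 define D where "D = degree p"
 have f: "lead_coeff f = 1" "degree f = D" unfolding f_def D_def using lp by auto
 have D0: "0 < D" unfolding D_def by (rule deg)
 define R where "R = Max (insert 1 ((%i. v (coeff f i)) ` {..D}))"
 have R: "1 <= R" "v (coeff f i) <= R" for i
 proof -
  show "1 <= R" unfolding R_def by (intro Max_ge) auto
  show "v (coeff f i) <= R"
  proof (cases "i <= D")
   case True thus ?thesis unfolding R_def by (intro Max_ge) auto
  next
   case False thus ?thesis using \<open>1 <= R\<close> f(2) by (simp add: coeff_eq_0)
  qed
 qed
 \<comment> \<open>Chosen so that \<open>e n * R ^ D\<close> is the \<open>D\<close>-th power of
   \<open>(1/2) ^ n\<close>: passing to the next polynomial, \<open>root_near\<close> then moves the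
   root by at most \<open>(1/2) ^ n\<close>.\<close>
 define e where "e n = ((1/2) ^ n / R) ^ D" for n :: nat
 have e: "0 < e n" "e n <= 1" "e (Suc n) <= e n" for n
 proof -
  show "0 < e n" unfolding e_def using R(1) by simp
  have "(1/2 :: real) ^ n <= 1" by (rule power_le_one) auto
  hence "(1/2) ^ n <= R" using R(1) by linarith
  hence "(1/2) ^ n / R <= 1" using R(1) by (simp only: divide_le_eq_1_pos)
  thus "e n <= 1" unfolding e_def using R(1) by (intro power_le_one) auto
  show "e (Suc n) <= e n" unfolding e_def using R(1) by (intro power_mono divide_right_mono) auto
 qed
 have eR: "e n * R ^ D = ((1/2) ^ n) ^ D" for n
  unfolding e_def power_mult_distrib[symmetric] using R(1) by simp
 have "EX q. set (coeffs q) \<subseteq> A & lead_coeff q = 1 & degree q = D & (ALL i. v (coeff (f - q) i) <= e n)" for n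
 proof -
  have "ALL i. EX a. a \<in> A & v (coeff f i - a) < e n" using approx[OF e(1)] by blast
  then obtain c where c: "!!i. c i \<in> A" "!!i. v (coeff f i - c i) < e n" by metis
  define q where "q = monom 1 D + (\<Sum>i<D. monom (c i) i)"
  have cq: "coeff q i = (if i = D then 1 else if i < D then c i else 0)" for i
   unfolding q_def by (simp add: coeff_sum)
  have dq: "degree q = D"
  proof (rule antisym)
   show "degree q <= D" by (rule degree_le) (simp add: cq)
   show "D <= degree q" by (rule le_degree) (simp add: cq)
  qed
  have "set (coeffs q) \<subseteq> A"
  proof
   fix a assume "a \<in> set (coeffs q)"
   then obtain i where "a = coeff q i" by (auto simp: coeffs_def split: if_splits)
   thus "a \<in> A" using c(1) is_subfieldD(1,2)[OF Asub] cq by auto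
  qed
  moreover have "v (coeff (f - q) i) <= e n" for i
  proof -
   consider "i = D" | "i < D" | "i > D" by linarith
   thus ?thesis
   proof cases
    case 1 thus ?thesis using f e(1)[of n] by (simp add: cq)
   next
    case 2 thus ?thesis using c(2)[of i] by (simp add: cq)
   next
    case 3 thus ?thesis using f e(1)[of n] by (simp add: cq coeff_eq_0)
   qed
  qed
  ultimately show ?thesis using dq by (intro exI[of _ q]) (simp add: cq)
 qed
 then obtain q where q: "!!n. set (coeffs (q n)) \<subseteq> A" "!!n. lead_coeff (q n) = 1" "!!n. degree (q n) = D"
  "!!n i. v (coeff (f - q n) i) <= e n" by metis
 have qR: "v (coeff (q n) i) <= R" for n i
 proof -
  have "v (coeff f i - coeff (f - q n) i) <= R"
   using R(2)[of i] q(4)[of n i] e(2)[of n] R(1) by (intro v_diff_le) auto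
  thus ?thesis by simp
 qed
 define good where "good n b \<longleftrightarrow> b \<in> A & poly (q n) b = 0" for n b
 have step: "EX b'. good (Suc n) b' & v (b' - b) <= (1/2) ^ n" if b: "good n b" for n b
 proof -
  have vb: "v b <= R"
   by (rule monic_root_bound[OF q(2) _ qR R(1)]) (use b q(3) D0 in "auto simp: good_def")
  obtain b' where b': "b' \<in> A" "poly (q (Suc n)) b' = 0" "v (b - b') ^ D <= v (poly (q (Suc n)) b)"
   using root_near[OF Asub Aroot q(1) q(2), of "Suc n" b] q(3) D0 by auto
  \<comment> \<open>\<open>b\<close> is a root of \<open>q n\<close>, whose coefficients differ from
    those of \<open>q (Suc n)\<close> by at most \<open>e n\<close>; so \<open>b\<close> nearly
    annihilates the next polynomial.\<close>
  have "poly (q (Suc n)) b = poly ((f - q n) - (f - q (Suc n))) b" using b unfolding good_def by simp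
  moreover have "v (coeff ((f - q n) - (f - q (Suc n))) i) <= e n" for i
   using v_diff_le[OF q(4)[of n i] order_trans[OF q(4)[of "Suc n" i] e(3)]] by simp
  moreover have "degree ((f - q n) - (f - q (Suc n))) <= D" using f(2) q(3) by (intro degree_diff_le) auto
  ultimately have "v (poly (q (Suc n)) b) <= e n * R ^ D" using v_poly_bound[OF _ vb R(1)] by metis
  hence "v (b - b') ^ D <= ((1/2) ^ n) ^ D" using b'(3) unfolding eR by linarith
  hence "v (b - b') <= (1/2) ^ n" using D0 by (simp add: power_mono_iff)
  thus ?thesis using b' unfolding good_def by (auto simp: v_diff_commute)
 qed
 obtain b0 where "good 0 b0" using Aroot[OF q(1), of 0] q(3) D0 unfolding good_def by auto
 then obtain b where b: "!!n. good n (b n)" "!!n. v (b (Suc n) - b n) <= (1/2) ^ n"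
  using dependent_nat_choice[of "good" "%n b b'. v (b' - b) <= (1/2) ^ n"] step by metis
 obtain l where l: "!!\<epsilon>. 0 < \<epsilon> ==> EX N. ALL n>=N. v (b n - l) < \<epsilon>" using complete_Cauchy[OF compl b(2)] by blast
 have "poly f l = 0"
 proof (rule ccontr)
  assume ne: "poly f l ~= 0"
  obtain r where r: "r > 0" "!!x. v (x - l) <= r ==> v (poly f x) = v (poly f l)" using poly_nonzero_near[OF ne] by blast
  obtain N where N: "!!n. n >= N ==> v (b n - l) < r" using l[OF r(1)] by blast
  obtain N' where N': "(1/2 :: real) ^ N' < v (poly f l)" using real_arch_pow_inv[of "v (poly f l)" "1/2"] ne by auto
  define n where "n = max N N'"
  have vb: "v (b n) <= R"
   by (rule monic_root_bound[OF q(2) _ qR R(1)]) (use b(1)[of n] q(3) D0 in "auto simp: good_def")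
  have "poly f (b n) = poly (f - q n) (b n)" using b(1)[of n] unfolding good_def by simp
  hence "v (poly f (b n)) <= e n * R ^ D"
   using v_poly_bound[OF q(4) vb R(1), of n D] f(2) q(3) by (simp add: degree_diff_le)
  also have "\<dots> = ((1/2) ^ n) ^ D" by (rule eR)
  also have "\<dots> <= (1/2) ^ n" using D0 power_decreasing[of 1 D "(1/2 :: real) ^ n"] by (simp add: power_le_one)
  also have "\<dots> <= (1/2) ^ N'" unfolding n_def by (intro power_decreasing) auto
  finally show False using N' r(2)[of "b n"] N[of n] unfolding n_def by simp
 qed
 thus ?thesis unfolding f_def using lp by auto
qed

end

locale cp_field = nonarch v for v :: "'c::field_char_0 => real" +
 fixes p :: nat
 assumes prime_p: "prime p" and is_Cp: "is_Cp p v"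
begin

lemma v_of_rat: "v (of_rat q) = padic_abs p q"
 and complete: "ms.mcomplete"
 using is_Cp unfolding is_Cp_def by blast+

lemma root_exists: "0 < degree (q :: 'c poly) ==> EX x. poly q x = 0"
proof -
 assume q: "0 < degree q"
 obtain A where "is_algebraic_closure_of A (Qp v)" "abs_topology v closure_of A = UNIV"
  using is_Cp unfolding is_Cp_def by blast
 thus ?thesis by (rule algebraically_closed[OF complete _ _ q])
qed

lemma p_gt_1: "1 < p" using prime_p prime_gt_1_nat by blast

lemma v_of_int: "a ~= 0 ==> v (of_int a) = (1 / real p) ^ multiplicity (int p) a"
proof -
 assume "a ~= 0"
 have "v (of_int a) = v (of_rat (of_int a))" by simp
 also have "\<dots> = real p powi (- int (multiplicity (int p) a))"
  unfolding v_of_rat padic_abs_def using \<open>a ~= 0\<close> by (simp add: quotient_of_int)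
 finally show ?thesis by (simp add: power_int_minus power_one_over inverse_eq_divide)
qed

lemma v_p: "v (of_nat p) = 1 / real p"
 using v_of_int[of "int p"] p_gt_1 prime_p by (simp add: multiplicity_prime)

lemma v_p_less: "v (of_nat p) < 1" "0 < v (of_nat p)"
 unfolding v_p using p_gt_1 by auto

lemma v_of_nat_coprime: "~ p dvd n ==> v (of_nat n) = 1"
proof -
 assume n: "~ p dvd n"
 hence "n ~= 0" by (metis dvd_0_right)
 moreover have "multiplicity (int p) (int n) = 0" using n by (simp add: not_dvd_imp_multiplicity_0)
 ultimately show ?thesis using v_of_int[of "int n"] by simp
qed

lemma small_element:
 assumes "0 < e" obtains n where "v (of_nat p ^ n) < e"
 using real_arch_pow_inv[OF assms v_p_less(1)] by (auto simp: v_power)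

lemma Qp_iff: "x \<in> Qp v \<longleftrightarrow> (ALL e>0. EX q. v (x - of_rat q) < e)"
 unfolding Qp_def ms.metric_closure_of by (auto simp: Rats_def)

lemma Qp_of_rat: "of_rat q \<in> Qp v" unfolding Qp_iff by (metis v_0 diff_self)

lemma Qp_subfield: "is_subfield (Qp v)"
 unfolding is_subfield_def
proof (intro conjI ballI)
 show "0 \<in> Qp v" "1 \<in> Qp v" using Qp_of_rat[of 0] Qp_of_rat[of 1] by simp_all
 fix x assume x: "x \<in> Qp v"
 show "- x \<in> Qp v" unfolding Qp_iff
 proof (intro allI impI)
  fix e :: real assume "0 < e"
  then obtain q where "v (x - of_rat q) < e" using x unfolding Qp_iff by blast
  hence "v (- x - of_rat (- q)) < e" by (simp add: of_rat_minus v_diff_commute)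
  thus "EX q. v (- x - of_rat q) < e" by blast
 qed
 show "inverse x \<in> Qp v"
 proof (cases "x = 0")
  case False
  show ?thesis unfolding Qp_iff
  proof (intro allI impI)
   fix e :: real assume e: "0 < e"
   have vx: "0 < v x" using False by simp
   have "0 < min (v x) (e * v x * v x)" using vx e by simp
   then obtain q where q: "v (x - of_rat q) < min (v x) (e * v x * v x)" using x unfolding Qp_iff by blast
   hence vq: "v (of_rat q :: 'c) = v x" by (intro v_close) simp
   hence q0: "(of_rat q :: 'c) ~= 0" using vx by auto
   have "inverse x - inverse (of_rat q) = - (x - of_rat q) / (x * of_rat q)" using False q0 by (simp add: field_simps)
   hence "v (inverse x - inverse (of_rat q)) = v (x - of_rat q) / (v x * v x)" by (simp add: v_divide v_mult vq del: minus_diff_eq)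
   also have "\<dots> < e" using q vx by (simp add: divide_less_eq mult.assoc)
   finally have "v (inverse x - of_rat (inverse q)) < e" by (simp add: of_rat_inverse)
   thus "EX q. v (inverse x - of_rat q) < e" by blast
  qed
 qed (use x in simp)
 fix y assume y: "y \<in> Qp v"
 show "x + y \<in> Qp v" unfolding Qp_iff
 proof (intro allI impI)
  fix e :: real assume "0 < e"
  then obtain q q' where "v (x - of_rat q) < e" "v (y - of_rat q') < e" using x y unfolding Qp_iff by metis
  hence "v ((x - of_rat q) + (y - of_rat q')) < e" by (rule v_add_less)
  hence "v (x + y - of_rat (q + q')) < e" by (simp add: of_rat_add algebra_simps)
  thus "EX q. v (x + y - of_rat q) < e" by blast
 qed
 show "x * y \<in> Qp v" unfolding Qp_iff
 proof (intro allI impI)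
  fix e :: real assume e: "0 < e"
  obtain q' where q': "v (y - of_rat q') < e / (v x + 1)" using y e unfolding Qp_iff
   by (meson divide_pos_pos add_nonneg_pos v_nonneg zero_less_one)
  obtain q where q: "v (x - of_rat q) < e / (v (of_rat q' :: 'c) + 1)" using x e unfolding Qp_iff
   by (meson divide_pos_pos add_nonneg_pos v_nonneg zero_less_one)
  have 1: "v (x * (y - of_rat q')) < e"
  proof -
   have "v (x * (y - of_rat q')) <= (v x + 1) * v (y - of_rat q')" unfolding v_mult by (intro mult_right_mono) auto
   also have "\<dots> < e" using q' by (simp add: pos_less_divide_eq add_nonneg_pos mult.commute)
   finally show ?thesis .
  qed
  have 2: "v ((x - of_rat q) * of_rat q') < e"
  proof -
   have "v ((x - of_rat q) * of_rat q') <= v (x - of_rat q) * (v (of_rat q' :: 'c) + 1)" unfolding v_mult by (intro mult_left_mono) auto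
   also have "\<dots> < e" using q by (simp add: pos_less_divide_eq add_nonneg_pos)
   finally show ?thesis .
  qed
  have "v (x * (y - of_rat q') + (x - of_rat q) * of_rat q') < e" by (rule v_add_less[OF 1 2])
  hence "v (x * y - of_rat (q * q')) < e" by (simp add: of_rat_mult algebra_simps)
  thus "EX q. v (x * y - of_rat q) < e" by blast
 qed
qed

text \<open>A rational approximation of \<open>x\<close> has denominator prime to \<open>p\<close>,
  which Bezout inverts modulo \<open>p ^ k\<close>. The numbers below \<open>p ^ k\<close> thus form
  a finite net of the unit ball.\<close>

lemma integral_approx:
 assumes x: "x \<in> Qp v" "v x <= 1"
 shows "EX c<p ^ k. v (x - of_nat c) <= (1 / real p) ^ k"
proof -
 have pk: "0 < (1 / real p) ^ k" "(1 / real p) ^ k <= 1" using p_gt_1 by (auto simp: power_le_one)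
 obtain q where q: "v (x - of_rat q) < (1 / real p) ^ k" using x(1) pk unfolding Qp_iff by blast
 have vq: "v (of_rat q :: 'c) <= 1" using v_diff_le[of x 1 "x - of_rat q"] x(2) q pk by simp
 obtain a b where ab: "quotient_of q = (a, b)" by fastforce
 have b: "0 < b" "coprime a b" "q = of_int a / of_int b"
  using quotient_of_denom_pos[OF ab] quotient_of_coprime[OF ab] quotient_of_div[OF ab] by auto
 have pb: "~ int p dvd b"
 proof
  assume d: "int p dvd b"
  hence "~ int p dvd a" using b(2) prime_p by (metis coprime_common_divisor not_prime_unit prime_nat_int_transfer)
  hence a0: "a ~= 0" and "multiplicity (int p) a = 0" by (auto simp: not_dvd_imp_multiplicity_0)
  hence va: "v (of_int a :: 'c) = 1" using v_of_int by simp
  have "~ is_unit (int p)" using p_gt_1 by simp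
  hence "multiplicity (int p) b ~= 0" using d b(1) by (simp add: multiplicity_eq_zero_iff)
  hence "v (of_int b :: 'c) < 1" using v_of_int[of b] b(1) p_gt_1 by (simp add: power_less_one_iff)
  moreover have "v (of_rat q :: 'c) = 1 / v (of_int b :: 'c)" using b(3) va by (simp add: of_rat_divide v_divide)
  moreover have "0 < v (of_int b :: 'c)" using b(1) by simp
  ultimately show False using vq by (simp add: divide_le_eq)
 qed
 hence "coprime b (int p ^ k)" using prime_p by (metis coprime_commute coprime_power_left_iff prime_imp_coprime prime_nat_int_transfer)
 then obtain u w where uw: "u * b + w * int p ^ k = 1" using bezout_int[of b "int p ^ k"] by (auto simp: coprime_iff_gcd_eq_1)
 define c where "c = nat ((a * u) mod int p ^ k)"
 have P: "0 < int p ^ k" using p_gt_1 by simp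
 have c: "int c = (a * u) mod int p ^ k" unfolding c_def using P by simp
 have "int c < int p ^ k" unfolding c using P by simp
 hence clt: "c < p ^ k" by (metis of_nat_less_iff of_nat_power)
 have "int p ^ k dvd a - b * int c"
 proof -
  have "int p ^ k dvd a * u - int c" unfolding c by (simp add: minus_mod_eq_mult_div)
  hence "int p ^ k dvd b * (a * u - int c)" by simp
  moreover have "b * (a * u - int c) = a - b * int c - a * w * int p ^ k"
  proof -
   have "b * (a * u) = a * (u * b)" by simp
   also have "u * b = 1 - w * int p ^ k" using uw by simp
   finally show ?thesis by (simp add: algebra_simps)
  qed
  ultimately show ?thesis by (metis dvd_diff_left_iff dvd_triv_right)
 qed
 then obtain m where m: "a - b * int c = int p ^ k * m" by blast
 have vb: "v (of_int b :: 'c) = 1" using v_of_int[of b] b(1) pb by (simp add: not_dvd_imp_multiplicity_0)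
 have b0: "(of_int b :: 'c) ~= 0" using b(1) by simp
 have "of_rat q - of_nat c = (of_int (a - b * int c) :: 'c) / of_int b"
  using b0 unfolding b(3) by (simp add: of_rat_divide field_simps)
 hence "v (of_rat q - of_nat c :: 'c) = v (of_nat p ^ k * of_int m :: 'c)" unfolding m by (simp add: v_divide vb)
 also have "\<dots> <= (1 / real p) ^ k" using mult_left_mono[OF v_of_int_le[of m], of "(1 / real p) ^ k"] pk
  by (simp add: v_mult v_power v_p)
 finally have "v ((x - of_rat q) + (of_rat q - of_nat c)) <= (1 / real p) ^ k" using q by (intro v_add_le) auto
 thus ?thesis using clt by auto
qed

section \<open>Local compactness of finite extensions\<close>

text \<open>Sequential local compactness together with closedness of \<open>V\<close>, in a form
  suited to induction over spanning sets.\<close>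

definition bseq_compact :: "'c set => bool" where
 "bseq_compact V \<longleftrightarrow> (ALL \<sigma> B. (ALL n. \<sigma> n \<in> V & v (\<sigma> n) <= B) -->
   (EX l:V. EX r::nat=>nat. strict_mono r & (ALL e>0. EX N. ALL n>=N. v (\<sigma> (r n) - l) < e)))"

lemma bseq_compactD:
 assumes "bseq_compact V" "!!n. \<sigma> n \<in> V" "!!n. v (\<sigma> n) <= B"
 obtains l r where "l \<in> V" "strict_mono (r::nat=>nat)" "!!e. 0 < e ==> EX N. ALL n>=N. v (\<sigma> (r n) - l) < e"
proof -
 have "EX l:V. EX r::nat=>nat. strict_mono r & (ALL e>0. EX N. ALL n>=N. v (\<sigma> (r n) - l) < e)"
  using assms(1)[unfolded bseq_compact_def, rule_format, of \<sigma> B] assms(2,3) by blast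
 thus ?thesis using that by blast
qed

text \<open>Multiplication by a power of \<open>p\<close> moves a bounded sequence into the unit
  ball of \<open>Qp v\<close>, which is totally bounded by \<open>integral_approx\<close>;
  completeness supplies the limit.\<close>

lemma bseq_compact_Qp: "bseq_compact (Qp v)"
 unfolding bseq_compact_def
proof (intro allI impI)
 fix \<sigma> :: "nat => 'c" and B assume \<sigma>: "ALL n. \<sigma> n \<in> Qp v & v (\<sigma> n) <= B"
 have b1: "0 < \<bar>B\<bar> + 1" by linarith
 hence "0 < 1 / (\<bar>B\<bar> + 1)" by simp
 then obtain k where k: "v (of_nat p ^ k :: 'c) < 1 / (\<bar>B\<bar> + 1)" using small_element by blast
 define \<pi> where "\<pi> = (of_nat p ^ k :: 'c)"
 have \<pi>: "\<pi> ~= 0" "\<pi> \<in> Qp v"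
  unfolding \<pi>_def using p_gt_1 Qp_of_rat[of "of_nat p ^ k"] by (auto simp: of_rat_power)
 let ?S = "{x \<in> Qp v. v x <= 1}"
 have tb: "ms.mtotally_bounded ?S" unfolding ms.mtotally_bounded_def
 proof (intro allI impI)
  fix e :: real assume "0 < e"
  then obtain j where j: "v (of_nat p ^ j :: 'c) < e" using small_element by blast
  let ?K = "(of_nat :: nat => 'c) ` {..<p ^ j}"
  have "of_nat c \<in> ?S" for c using Qp_of_rat[of "of_nat c"] v_of_nat_le[of c] by simp
  moreover have "?S \<subseteq> (\<Union>x\<in>?K. ms.mball x e)"
  proof
   fix x assume x: "x \<in> ?S"
   then obtain c where "c < p ^ j" "v (x - of_nat c) <= (1 / real p) ^ j" using integral_approx by blast
   hence "x \<in> ms.mball (of_nat c) e" using j by (simp add: v_diff_commute v_power v_p)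
   thus "x \<in> (\<Union>x\<in>?K. ms.mball x e)" using \<open>c < p ^ j\<close> by blast
  qed
  ultimately show "EX K. finite K & K \<subseteq> ?S & ?S \<subseteq> (\<Union>x\<in>K. ms.mball x e)" by (intro exI[of _ ?K]) auto
 qed
 have inS: "\<pi> * \<sigma> n \<in> ?S" for n
 proof -
  have "v \<pi> * v (\<sigma> n) <= 1 / (\<bar>B\<bar> + 1) * (\<bar>B\<bar> + 1)"
   using k \<sigma> unfolding \<pi>_def[symmetric] by (intro mult_mono) (auto intro: order_trans)
  moreover have "1 / (\<bar>B\<bar> + 1) * (\<bar>B\<bar> + 1) = 1" using b1 by simp
  ultimately show ?thesis using is_subfieldD(4)[OF Qp_subfield \<pi>(2)] \<sigma> by (simp only: v_mult mem_Collect_eq)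
 qed
 hence rng: "range (%n. \<pi> * \<sigma> n) \<subseteq> ?S" by blast
 have "ALL \<sigma>::nat => 'c. range \<sigma> \<subseteq> ?S --> (EX r. strict_mono r & ms.MCauchy (\<sigma> \<circ> r))"
  using tb unfolding ms.mtotally_bounded_sequentially by (rule conjunct2)
 from this[rule_format, OF rng] obtain r where r: "strict_mono (r::nat=>nat)" "ms.MCauchy ((%n. \<pi> * \<sigma> n) \<circ> r)"
  by blast
 then obtain l where l: "limitin ms.mtopology ((%n. \<pi> * \<sigma> n) \<circ> r) l sequentially" using complete unfolding ms.mcomplete_def by blast
 have lim: "EX N. ALL n>=N. v (\<pi> * \<sigma> (r n) - l) < e" if "0 < e" for e
 proof -
  have "ALL e>0. EX N. ALL n>=N. v (\<pi> * \<sigma> (r n) - l) < e" using l unfolding ms.limit_metric_sequentially by simp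
  thus ?thesis using that by blast
 qed
 have lim2: "EX N. ALL n>=N. v (\<sigma> (r n) - l / \<pi>) < e" if e: "0 < e" for e
 proof -
  have vp: "0 < v \<pi>" using \<pi>(1) by simp
  obtain N where N: "ALL n>=N. v (\<pi> * \<sigma> (r n) - l) < e * v \<pi>" using lim[of "e * v \<pi>"] e vp by auto
  have "v (\<sigma> (r n) - l / \<pi>) < e" if "n >= N" for n
  proof -
   have "\<pi> * \<sigma> (r n) - l = \<pi> * (\<sigma> (r n) - l / \<pi>)" using \<pi>(1) by (simp add: algebra_simps)
   hence "v \<pi> * v (\<sigma> (r n) - l / \<pi>) < e * v \<pi>" using N that by (metis v_mult)
   thus ?thesis using vp by (simp add: mult.commute)
  qed
  thus ?thesis by blast
 qed
 have "l / \<pi> \<in> Qp v" unfolding Qp_iff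
 proof (intro allI impI)
  fix e :: real assume e: "0 < e"
  then obtain N where N: "v (\<sigma> (r N) - l / \<pi>) < e" using lim2 by blast
  obtain q where "v (\<sigma> (r N) - of_rat q) < e" using \<sigma> e unfolding Qp_iff by metis
  hence "v (l / \<pi> - of_rat q) < e" using N v_trans[of "l / \<pi>" "of_rat q" "\<sigma> (r N)"] v_diff_commute[of "l / \<pi>" "\<sigma> (r N)"] by simp
  thus "EX q. v (l / \<pi> - of_rat q) < e" by blast
 qed
 thus "EX l:Qp v. EX r::nat=>nat. strict_mono r & (ALL e>0. EX N. ALL n>=N. v (\<sigma> (r n) - l) < e)"
 proof
  show "EX r::nat=>nat. strict_mono r & (ALL e>0. EX N. ALL n>=N. v (\<sigma> (r n) - l / \<pi>) < e)"
   by (rule exI[of _ r]) (use r(1) lim2 in blast)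
 qed
qed

text \<open>The point is that the coefficients of \<open>b\<close> stay bounded. If not, dividing by
  them gives elements of \<open>V\<close> that converge to \<open>-b\<close>, and as limits stay in
  \<open>V\<close>, \<open>b\<close> would lie in it.\<close>

lemma bseq_compact_extend:
 assumes V: "bseq_compact V" "0 \<in> V" "!!x y. x \<in> V ==> y \<in> V ==> x + y \<in> V" "!!c x. c \<in> Qp v ==> x \<in> V ==> c * x \<in> V"
 shows "bseq_compact {x + c * b |x c. x \<in> V & c \<in> Qp v}"
proof (cases "b \<in> V")
 case True
 have "{x + c * b |x c. x \<in> V & c \<in> Qp v} = V"
 proof
  show "{x + c * b |x c. x \<in> V & c \<in> Qp v} \<subseteq> V" using V(3,4) True by auto
  show "V \<subseteq> {x + c * b |x c. x \<in> V & c \<in> Qp v}"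
  proof
   fix x assume "x \<in> V"
   moreover have "x = x + 0 * b" by simp
   ultimately show "x \<in> {x + c * b |x c. x \<in> V & c \<in> Qp v}" using is_subfieldD(1)[OF Qp_subfield] by blast
  qed
 qed
 thus ?thesis using V(1) by simp
next
 case False
 show ?thesis unfolding bseq_compact_def
 proof (intro allI impI)
  fix \<sigma> :: "nat => 'c" and B assume \<sigma>: "ALL n. \<sigma> n \<in> {x + c * b |x c. x \<in> V & c \<in> Qp v} & v (\<sigma> n) <= B"
  hence "ALL n. EX x c. x \<in> V & c \<in> Qp v & \<sigma> n = x + c * b" by blast
  then obtain x c where xc: "!!n. x n \<in> V" "!!n. c n \<in> Qp v" "!!n. \<sigma> n = x n + c n * b" by metis
  have "EX L. ALL n. v (c n) <= L"
  proof (rule ccontr)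
   assume "~ ?thesis"
   hence unb: "EX n. L < v (c n)" for L by (meson not_le)
   have "EX n. real k + 1 < v (c n)" for k using unb by blast
   then obtain s where s: "!!k. real k + 1 < v (c (s k))" by metis
   define y where "y k = inverse (c (s k)) * x (s k)" for k
   have cne: "c (s k) ~= 0" for k using s[of k] by auto
   have yV: "y k \<in> V" for k unfolding y_def using xc V(4) is_subfieldD(6)[OF Qp_subfield] by blast
   have close: "v (y k + b) <= \<bar>B\<bar> / (real k + 1)" for k
   proof -
    have "y k + b = \<sigma> (s k) / c (s k)" unfolding y_def xc(3) using cne by (simp add: field_simps)
    hence "v (y k + b) = v (\<sigma> (s k)) / v (c (s k))" by (simp add: v_divide)
    also have "\<dots> <= \<bar>B\<bar> / (real k + 1)" using \<sigma> s[of k] by (intro frac_le) (auto intro: order_trans)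
    finally show ?thesis .
   qed
   have "v (y k) <= max \<bar>B\<bar> (v b)" for k
   proof -
    have "\<bar>B\<bar> / (real k + 1) <= \<bar>B\<bar>" by (simp add: divide_le_eq mult_le_cancel_left1)
    hence "v ((y k + b) - b) <= max \<bar>B\<bar> (v b)" using close[of k] by (intro v_diff_le) auto
    thus ?thesis by simp
   qed
   then obtain l r where l: "l \<in> V" "strict_mono (r :: nat => nat)" "!!e. 0 < e ==> EX N. ALL n>=N. v (y (r n) - l) < e"
    using V(1) yV unfolding bseq_compact_def by metis
   have "v (l + b) = 0"
   proof (rule ccontr)
    assume "v (l + b) ~= 0"
    hence p: "0 < v (l + b)" by (metis less_le v_nonneg)
    obtain N where N: "ALL n>=N. v (y (r n) - l) < v (l + b)" using l(3)[OF p] by blast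
    obtain N' where N': "\<bar>B\<bar> / v (l + b) < real N'" using reals_Archimedean2 by blast
    define n where "n = max N N'"
    have "N' <= r n" using seq_suble[OF l(2), of n] unfolding n_def by simp
    have "\<bar>B\<bar> < v (l + b) * real N'" using N' p by (simp add: field_simps)
    also have "\<dots> <= v (l + b) * (real (r n) + 1)" using \<open>N' <= r n\<close> p by simp
    finally have "\<bar>B\<bar> / (real (r n) + 1) < v (l + b)" by (simp add: divide_less_eq mult.commute)
    hence "v (y (r n) + b) < v (l + b)" using close[of "r n"] by linarith
    moreover have "v (y (r n) - l) < v (l + b)" using N unfolding n_def by simp
    ultimately have "v ((y (r n) + b) - (y (r n) - l)) < v (l + b)" by (rule v_diff_less)
    thus False by (simp add: algebra_simps)
   qed
   hence "b = (-1) * l" by (simp add: add_eq_0_iff)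
   moreover have "- 1 \<in> Qp v" using is_subfieldD(2,5)[OF Qp_subfield] by blast
   ultimately show False using V(4) l(1) False by blast
  qed
  then obtain L where L: "!!n. v (c n) <= L" by blast
  obtain lc r where r: "lc \<in> Qp v" "strict_mono (r :: nat => nat)" "!!e. 0 < e ==> EX N. ALL n>=N. v (c (r n) - lc) < e"
   using bseq_compact_Qp xc(2) L unfolding bseq_compact_def by metis
  have "v (x (r n)) <= max B (L * v b)" for n
  proof -
   have "v (c (r n) * b) <= L * v b" using L by (simp add: v_mult mult_right_mono)
   hence "v (\<sigma> (r n) - c (r n) * b) <= max B (L * v b)" using \<sigma> by (intro v_diff_le) (auto simp: le_max_iff_disj)
   thus ?thesis unfolding xc(3) by simp
  qed
  then obtain lx s where s: "lx \<in> V" "strict_mono (s :: nat => nat)" "!!e. 0 < e ==> EX N. ALL n>=N. v (x (r (s n)) - lx) < e"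
   by (rule bseq_compactD[OF V(1), of "%n. x (r n)", OF xc(1)]) blast
  have "EX N. ALL n>=N. v (\<sigma> ((r \<circ> s) n) - (lx + lc * b)) < e" if e: "0 < e" for e
  proof -
   obtain N1 where N1: "ALL n>=N1. v (x (r (s n)) - lx) < e" using s(3)[OF e] by blast
   have b1: "0 < v b + 1" by (simp add: add_nonneg_pos)
   obtain N2 where N2: "ALL n>=N2. v (c (r n) - lc) < e / (v b + 1)" using r(3)[of "e / (v b + 1)"] e b1 by auto
   have "v (\<sigma> ((r \<circ> s) n) - (lx + lc * b)) < e" if n: "n >= max N1 N2" for n
   proof -
    have "s n >= N2" using seq_suble[OF s(2), of n] n by simp
    hence "v (c (r (s n)) - lc) * (v b + 1) < e" using N2 b1 by (simp add: pos_less_divide_eq)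
    moreover have "v ((c (r (s n)) - lc) * b) <= v (c (r (s n)) - lc) * (v b + 1)" unfolding v_mult by (intro mult_left_mono) auto
    ultimately have "v ((c (r (s n)) - lc) * b) < e" by simp
    moreover have "v (x (r (s n)) - lx) < e" using N1 n by simp
    ultimately have "v ((x (r (s n)) - lx) + (c (r (s n)) - lc) * b) < e" by (intro v_add_less)
    thus ?thesis unfolding xc(3) by (simp add: algebra_simps)
   qed
   thus ?thesis by blast
  qed
  note lim = this
  have mono: "strict_mono (r \<circ> s)" using r(2) s(2) by (simp add: strict_mono_o)
  have "lx + lc * b \<in> {x + c * b |x c. x \<in> V & c \<in> Qp v}" using s(1) r(1) by blast
  thus "EX l:{x + c * b |x c. x \<in> V & c \<in> Qp v}. EX r::nat=>nat. strict_mono r & (ALL e>0. EX N. ALL n>=N. v (\<sigma> (r n) - l) < e)"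
  proof (rule rev_bexI)
   show "EX r::nat=>nat. strict_mono r & (ALL e>0. EX N. ALL n>=N. v (\<sigma> (r n) - (lx + lc * b)) < e)"
    by (rule exI[of _ "r \<circ> s"]) (use mono lim in blast)
  qed
 qed
qed

lemma bseq_compact_finite_extension:
 assumes "is_finite_extension_of K (Qp v)" shows "bseq_compact K"
proof -
 note F = is_subfieldD[OF Qp_subfield]
 define sp where "sp B = {\<Sum>b\<in>B. c b * b |c. ALL b:B. c b \<in> Qp v}" for B
 have spI: "(\<Sum>b\<in>B. c b * b) \<in> sp B" if "ALL b:B. c b \<in> Qp v" for B c
  unfolding sp_def using that by blast
 have sp_sub: "0 \<in> sp B" "x \<in> sp B ==> y \<in> sp B ==> x + y \<in> sp B" "a \<in> Qp v ==> x \<in> sp B ==> a * x \<in> sp B" for B x y a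
 proof -
  show "0 \<in> sp B" unfolding sp_def using F(1) by (auto intro!: exI[of _ "%_. 0"])
  {
   assume "x \<in> sp B" "y \<in> sp B"
   then obtain c c' where c: "ALL b:B. c b \<in> Qp v" "x = (\<Sum>b\<in>B. c b * b)" "ALL b:B. c' b \<in> Qp v" "y = (\<Sum>b\<in>B. c' b * b)"
    unfolding sp_def by blast
   have "x + y = (\<Sum>b\<in>B. (c b + c' b) * b)" unfolding c by (simp add: sum.distrib distrib_right)
   moreover have "ALL b:B. c b + c' b \<in> Qp v" using c F(3) by blast
   ultimately show "x + y \<in> sp B" using spI[of B "%b. c b + c' b"] by simp
  }
  assume a: "a \<in> Qp v" and "x \<in> sp B"
  then obtain c where c: "ALL b:B. c b \<in> Qp v" "x = (\<Sum>b\<in>B. c b * b)" unfolding sp_def by blast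
  have "a * x = (\<Sum>b\<in>B. (a * c b) * b)" unfolding c by (simp add: sum_distrib_left mult.assoc)
  moreover have "ALL b:B. a * c b \<in> Qp v" using c F(4) a by blast
  ultimately show "a * x \<in> sp B" using spI[of B "%b. a * c b"] by simp
 qed
 have "bseq_compact (sp B)" if "finite B" for B
  using that
 proof (induction B)
  case empty
  have "sp {} = {0}" unfolding sp_def by simp
  thus ?case unfolding bseq_compact_def by (auto intro!: exI[of _ id] strict_mono_id)
 next
  case (insert b B)
  have "sp (insert b B) = {x + c * b |x c. x \<in> sp B & c \<in> Qp v}"
  proof
   show "sp (insert b B) \<subseteq> {x + c * b |x c. x \<in> sp B & c \<in> Qp v}"
   proof
    fix z assume "z \<in> sp (insert b B)"
    then obtain c where c: "ALL b':insert b B. c b' \<in> Qp v" "z = (\<Sum>b'\<in>insert b B. c b' * b')" unfolding sp_def by blast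
    hence "z = (\<Sum>b'\<in>B. c b' * b') + c b * b" using insert by simp
    moreover have "(\<Sum>b'\<in>B. c b' * b') \<in> sp B" unfolding sp_def using c by blast
    ultimately show "z \<in> {x + c * b |x c. x \<in> sp B & c \<in> Qp v}" using c by blast
   qed
   show "{x + c * b |x c. x \<in> sp B & c \<in> Qp v} \<subseteq> sp (insert b B)"
   proof
    fix z assume "z \<in> {x + c * b |x c. x \<in> sp B & c \<in> Qp v}"
    then obtain c a where c: "ALL b':B. c b' \<in> Qp v" "z = (\<Sum>b'\<in>B. c b' * b') + a * b" "a \<in> Qp v" unfolding sp_def by blast
    have "(\<Sum>b'\<in>B. (c(b := a)) b' * b') = (\<Sum>b'\<in>B. c b' * b')"
     by (rule sum.cong) (use insert in auto)
    hence "z = (\<Sum>b'\<in>insert b B. (c(b := a)) b' * b')"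
     using insert c(2) by (simp add: add.commute)
    moreover have "ALL b':insert b B. (c(b := a)) b' \<in> Qp v" using c by simp
    ultimately show "z \<in> sp (insert b B)" using spI by metis
   qed
  qed
  thus ?case using bseq_compact_extend[OF insert.IH sp_sub] by simp
 qed
 moreover obtain B where "finite B" "K = sp B" using assms unfolding is_finite_extension_of_def sp_def by blast
 ultimately show ?thesis by simp
qed

end

section \<open>The spherical metric\<close>

text \<open>Representatives for which the chordal formula, wedge divided by the product of norms,
  gives the spherical metric, infinity included.\<close>

fun hom :: "'c::field P1 => 'c \<times> 'c" where
 "hom (Fin x) = (x, 1)"
| "hom Infty = (1, 0)"

context nonarch
begin

definition nrm :: "'c \<times> 'c => real" where "nrm z = max (v (fst z)) (v (snd z))"

definition wedge :: "'c \<times> 'c => 'c \<times> 'c => real" where "wedge z w = v (fst z * snd w - fst w * snd z)"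

lemma nrm_hom_pos: "0 < nrm (hom P)"
 by (cases P) (auto simp: nrm_def less_max_iff_disj)

lemma spherical_hom: "spherical v P Q = wedge (hom P) (hom Q) / (nrm (hom P) * nrm (hom Q))"
 by (cases P; cases Q) (auto simp: wedge_def nrm_def max_def)

text \<open>Pluecker identity: a coordinate of \<open>y\<close> times the wedge of \<open>x\<close>
  and \<open>z\<close> is a combination of the other two wedges. The larger coordinate of
  \<open>y\<close> gives its norm.\<close>

lemma wedge_trans: "wedge x z * nrm y <= max (wedge x y * nrm z) (wedge y z * nrm x)"
proof -
 have key: "wedge x z * v c <= max (wedge x y * nrm z) (wedge y z * nrm x)"
  if c: "(c, c1, c2) = (fst y, fst z, fst x) \<or> (c, c1, c2) = (snd y, snd z, snd x)" for c c1 c2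
 proof -
  have e: "(fst x * snd z - fst z * snd x) * c = (fst x * snd y - fst y * snd x) * c1 + (fst y * snd z - fst z * snd y) * c2"
   using c by (auto simp: algebra_simps)
  have "wedge x z * v c = v ((fst x * snd y - fst y * snd x) * c1 + (fst y * snd z - fst z * snd y) * c2)"
   unfolding wedge_def v_mult[symmetric] e ..
  also have "\<dots> <= max (wedge x y * v c1) (wedge y z * v c2)" unfolding wedge_def v_mult[symmetric] by (rule v_add)
  also have "\<dots> <= max (wedge x y * nrm z) (wedge y z * nrm x)"
   using c by (intro max.mono mult_left_mono) (auto simp: nrm_def wedge_def)
  finally show ?thesis .
 qed
 show ?thesis
 proof (cases "v (fst y) <= v (snd y)")
  case True
  hence "nrm y = v (snd y)" unfolding nrm_def by simp
  thus ?thesis using key[of "snd y" "snd z" "snd x"] by simp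
 next
  case False
  hence "nrm y = v (fst y)" unfolding nrm_def by simp
  thus ?thesis using key[of "fst y" "fst z" "fst x"] by simp
 qed
qed

lemma spherical_ultra: "spherical v P R <= max (spherical v P Q) (spherical v Q R)"
proof -
 let ?p = "hom P" and ?q = "hom Q" and ?r = "hom R"
 have pos: "0 < nrm ?p" "0 < nrm ?q" "0 < nrm ?r" by (rule nrm_hom_pos)+
 have "wedge ?p ?r = wedge ?p ?r * nrm ?q / nrm ?q" using pos by simp
 also have "\<dots> <= max (wedge ?p ?q * nrm ?r) (wedge ?q ?r * nrm ?p) / nrm ?q"
  using wedge_trans[of ?p ?r ?q] pos by (intro divide_right_mono) auto
 finally have "wedge ?p ?r / (nrm ?p * nrm ?r) <= max (wedge ?p ?q * nrm ?r) (wedge ?q ?r * nrm ?p) / nrm ?q / (nrm ?p * nrm ?r)"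
  using pos by (intro divide_right_mono) auto
 also have "\<dots> = max (wedge ?p ?q / (nrm ?p * nrm ?q)) (wedge ?q ?r / (nrm ?q * nrm ?r))"
  using pos by (simp add: max_def field_simps)
 finally show ?thesis unfolding spherical_hom .
qed

lemma spherical_nonneg [simp]: "0 <= spherical v P Q"
 unfolding spherical_hom wedge_def using nrm_hom_pos by (simp add: less_imp_le)

lemma spherical_commute: "spherical v P Q = spherical v Q P"
 unfolding spherical_hom wedge_def using v_diff_commute by (simp add: mult.commute)

lemma spherical_eq_0 [simp]: "spherical v P Q = 0 \<longleftrightarrow> P = Q"
proof -
 have m: "max (v x) 1 ~= 0" for x
 proof -
  have "1 <= max (v x) 1" by simp
  thus ?thesis by linarith
 qed
 show ?thesis
 proof (cases P; cases Q)
  fix x y assume "P = Fin x" "Q = Fin y"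
  thus ?thesis using m[of x] m[of y] by simp
 qed (auto, (metis not_one_le_zero order_refl v_0 zero_le_one)?)
qed

lemma spherical_le_1: "spherical v P Q <= 1"
proof -
 let ?p = "hom P" and ?q = "hom Q"
 have "v (fst ?p * snd ?q) <= nrm ?p * nrm ?q" "v (fst ?q * snd ?p) <= nrm ?p * nrm ?q"
 proof -
  have h: "v (fst z) <= nrm z" "v (snd z) <= nrm z" for z unfolding nrm_def by auto
  have nn: "0 <= nrm z" for z using h(1)[of z] v_nonneg[of "fst z"] by linarith
  show "v (fst ?p * snd ?q) <= nrm ?p * nrm ?q" unfolding v_mult by (intro mult_mono h v_nonneg nn)
  have "v (snd ?p) * v (fst ?q) <= nrm ?p * nrm ?q" by (intro mult_mono h v_nonneg nn)
  thus "v (fst ?q * snd ?p) <= nrm ?p * nrm ?q" unfolding v_mult by (simp only: mult.commute)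
 qed
 hence "wedge ?p ?q <= nrm ?p * nrm ?q" unfolding wedge_def by (rule v_diff_le)
 thus ?thesis unfolding spherical_hom using nrm_hom_pos[of P] nrm_hom_pos[of Q] by (simp add: divide_le_eq)
qed

sublocale P1: Metric_space "P1_of L" "spherical v" for L
proof
 show "spherical v x z <= spherical v x y + spherical v y z" for x y z
  using spherical_ultra[of x z y] spherical_nonneg[of x y] spherical_nonneg[of y z] by linarith
qed (auto simp: spherical_commute)

text \<open>On the disk of radius \<open>rad a\<close> about \<open>ctr a\<close> in the chart at
  \<open>a\<close>, the spherical metric is exactly \<open>scl a\<close> times the absolute value.
  The chart at a finite point is the plain coordinate, not recentred at 0.\<close>

definition rad :: "'c P1 => real" where
 "rad a = (case a of Fin x => max (v x) 1 | Infty => 1)"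

definition scl :: "'c P1 => real" where "scl a = 1 / (rad a * rad a)"

abbreviation "ctr a \<equiv> coord_at a a"

lemma rad_ge_1: "1 <= rad a" unfolding rad_def by (cases a) auto

lemma scl_pos: "0 < scl a" unfolding scl_def using rad_ge_1[of a] by simp

lemma coord_param [simp]: "coord_at a (param_at a t) = t"
 by (cases a) auto

lemma param_ctr [simp]: "param_at a (ctr a) = a"
 by (cases a) auto

text \<open>In a finite chart \<open>max (v t) 1\<close> is constant on the disk; at infinity,
  inversion cancels the denominators of the metric.\<close>

lemma spherical_param:
 assumes "v (t - ctr a) < rad a" "v (t' - ctr a) < rad a"
 shows "spherical v (param_at a t) (param_at a t') = scl a * v (t - t')"
proof (cases a)
 case (Fin x)
 have "max (v t) 1 = max (v x) 1" if "v (t - x) < max (v x) 1" for t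
 proof (cases "v x <= 1")
  case True
  hence "v ((t - x) + x) <= 1" using that by (intro v_add_le) auto
  thus ?thesis using True by simp
 next
  case False
  hence "v t = v x" using that v_close[of x t] by (simp add: v_diff_commute max_def split: if_splits)
  thus ?thesis by simp
 qed
 from this[of t] this[of t'] show ?thesis using assms unfolding Fin rad_def scl_def by simp
next
 case Infty
 have lt: "v t < 1" "v t' < 1" using assms unfolding Infty rad_def by auto
 have vi: "1 < 1 / v s" "v (inverse s) = 1 / v s" if "s ~= 0" "v s < 1" for s
  using that unfolding v_inverse by (simp_all add: inverse_eq_divide)
 have inv: "max (v (inverse s)) 1 = 1 / v s" if "s ~= 0" "v s < 1" for s
  using vi[OF that] by simp
 have big: "~ v (inverse s) <= 1" if "s ~= 0" "v s < 1" for s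
  using vi[OF that] by simp
 consider "t = 0" "t' = 0" | "t = 0" "t' ~= 0" | "t ~= 0" "t' = 0" | "t ~= 0" "t' ~= 0" by blast
 thus ?thesis
 proof cases
  case 4
  have "v (inverse t - inverse t') = v (t - t') / (v t * v t')"
  proof -
   have "inverse t - inverse t' = (t' - t) / (t * t')" using 4 by (simp add: field_simps)
   thus ?thesis by (simp add: v_divide v_mult v_diff_commute)
  qed
  thus ?thesis using 4 lt inv unfolding Infty scl_def rad_def by simp
 next
  case 1
  thus ?thesis unfolding Infty by simp
 next
  case 2
  hence "spherical v (param_at a t) (param_at a t') = v t'" using vi[of t'] lt unfolding Infty by simp
  thus ?thesis using 2 unfolding Infty scl_def rad_def by simp
 next
  case 3
  hence "spherical v (param_at a t) (param_at a t') = v t" using vi[of t] lt unfolding Infty by simp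
  thus ?thesis using 3 unfolding Infty scl_def rad_def by simp
 qed
qed

text \<open>Surjectivity of the chart: a finite point of absolute value above
  \<open>m = rad a\<close> is at distance \<open>1 / m\<close> from a finite centre, too far away to
  be considered.\<close>

lemma param_near:
 assumes "spherical v a x < scl a * rad a"
 shows "param_at a (coord_at a x) = x" "v (coord_at a x - ctr a) < rad a"
proof -
 have "param_at a (coord_at a x) = x & v (coord_at a x - ctr a) < rad a"
 proof (cases a)
  case (Fin y)
  define m where "m = max (v y) 1"
  have m: "1 <= m" "v y <= m" unfolding m_def by auto
  have lt: "spherical v (Fin y) x < 1 / m" using assms m unfolding Fin rad_def scl_def m_def by simp
  show ?thesis
  proof (cases x)
   case Infty
   have "1 / m <= spherical v (Fin y) x" unfolding Infty m_def by (simp add: max_def)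
   thus ?thesis using lt by simp
  next
   case (Fin z)
   have "v (y - z) / (m * max (v z) 1) < 1 / m" using lt unfolding Fin m_def by simp
   hence d: "v (y - z) < max (v z) 1" using m by (simp add: field_simps less_max_iff_disj)
   have "v (y - z) < m"
   proof (cases "v z <= m")
    case True
    thus ?thesis using d m by simp
   next
    case False
    hence "v z = v (y - z)" using v_dominant[of "-y" z] m v_diff_commute[of y z] v_dominant[of y "-z"]
     by (metis diff_conv_add_uminus le_less_trans not_le v_minus add.commute)
    thus ?thesis using d m False by simp
   qed
   thus ?thesis using \<open>a = Fin y\<close> Fin by (simp add: rad_def m_def v_diff_commute)
  qed
 next
  case Infty
  hence lt: "spherical v Infty x < 1" using assms by (simp add: rad_def scl_def)
  show ?thesis
  proof (cases x)
   case (Fin z)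
   hence "1 < v z" using lt by (simp split: if_splits)
   thus ?thesis using Infty Fin by (auto simp: rad_def v_inverse inverse_less_1_iff)
  qed (simp add: Infty rad_def)
 qed
 thus "param_at a (coord_at a x) = x" "v (coord_at a x - ctr a) < rad a" by auto
qed

lemma spherical_param_lt:
 assumes "v (t - ctr a) < rad a" shows "spherical v a (param_at a t) < scl a * rad a"
 using spherical_param[of "ctr a" a t] assms rad_ge_1[of a] scl_pos[of a] by (simp add: v_diff_commute)

lemma param_in_P1: "is_subfield K ==> a \<in> P1_of K ==> param_at a t \<in> P1_of K \<longleftrightarrow> t \<in> K"
proof -
 assume K: "is_subfield K" "a \<in> P1_of K"
 have "inverse t \<in> K \<longleftrightarrow> t \<in> K" using is_subfieldD(6)[OF K(1), of t] is_subfieldD(6)[OF K(1), of "inverse t"] by auto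
 thus ?thesis using is_subfieldD(1)[OF K(1)] by (cases a) (simp_all add: P1_of_def image_iff)
qed

lemma ctr_in: "is_subfield K ==> a \<in> P1_of K ==> ctr a \<in> K"
 by (cases a) (auto simp: P1_of_def is_subfieldD(1))

end

context cp_field
begin

text \<open>Either infinitely many terms lie in the closed unit disk or infinitely many in its
  complement; in the matching chart they form a bounded sequence of \<open>K\<close>.\<close>

lemma compact_P1:
 assumes K: "is_subfield K" "bseq_compact K"
 shows "compact_space (P1_topology v K)"
 unfolding P1.compact_space_sequentially
proof (intro allI impI)
 fix \<sigma> :: "nat => 'c P1" assume \<sigma>: "range \<sigma> \<subseteq> P1_of K"
 have sub: "EX l r. l \<in> P1_of K & strict_mono r & limitin (P1_topology v K) (\<sigma> \<circ> r) l sequentially"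
  if s: "strict_mono (s :: nat => nat)" and sn: "!!n. \<sigma> (s n) = param_at a (\<tau> n)"
   and tau: "!!n. \<tau> n \<in> K" "!!n. v (\<tau> n) <= 1"
   and close: "!!t l. l \<in> K ==> v t <= 1 ==> v l <= 1 ==> v (t - l) < 1 ==> spherical v (param_at a t) (param_at a l) = v (t - l)"
   and aK: "a \<in> P1_of K" for s a \<tau>
 proof -
  obtain l r where l: "l \<in> K" "strict_mono (r :: nat => nat)" "!!e. 0 < e ==> EX N. ALL n>=N. v (\<tau> (r n) - l) < e"
   using bseq_compactD[OF K(2), of \<tau> 1] tau by blast
  obtain N where "ALL n>=N. v (\<tau> (r n) - l) < 1" using l(3)[of 1] by auto
  hence "v (\<tau> (r N) - l) <= 1" by (meson less_imp_le order_refl)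
  hence "v (\<tau> (r N) - (\<tau> (r N) - l)) <= 1" by (rule v_diff_le[OF tau(2)])
  hence vl: "v l <= 1" by simp
  have "limitin (P1_topology v K) (\<sigma> \<circ> (s \<circ> r)) (param_at a l) sequentially"
   unfolding P1.limit_metric_sequentially
  proof (intro conjI allI impI)
   show "param_at a l \<in> P1_of K" using param_in_P1[OF K(1) aK] l(1) by simp
   fix e :: real assume "0 < e"
   then obtain N where N: "ALL n>=N. v (\<tau> (r n) - l) < min e 1" using l(3)[of "min e 1"] by auto
   have "(\<sigma> \<circ> (s \<circ> r)) n \<in> P1_of K & spherical v ((\<sigma> \<circ> (s \<circ> r)) n) (param_at a l) < e" if n: "n >= N" for n
   proof -
    have "v (\<tau> (r n) - l) < 1" "v (\<tau> (r n) - l) < e" using N n by auto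
    moreover have "\<sigma> (s (r n)) \<in> P1_of K" using \<sigma> by blast
    ultimately show ?thesis using close[OF l(1) tau(2) vl, of "r n"] sn by simp
   qed
   thus "EX N. ALL n>=N. (\<sigma> \<circ> (s \<circ> r)) n \<in> P1_of K & spherical v ((\<sigma> \<circ> (s \<circ> r)) n) (param_at a l) < e" by blast
  qed
  moreover have "strict_mono (s \<circ> r)" using s l(2) by (simp add: strict_mono_o)
  moreover have "param_at a l \<in> P1_of K" using param_in_P1[OF K(1) aK] l(1) by simp
  ultimately show ?thesis by blast
 qed
 let ?A = "{n. EX z. \<sigma> n = Fin z & v z <= 1}"
 show "EX l r. l \<in> P1_of K & strict_mono r & limitin (P1_topology v K) (\<sigma> \<circ> r) l sequentially"
 proof (cases "infinite ?A")
  case True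
  define s where "s = enumerate ?A"
  have s: "strict_mono s" "!!n. s n \<in> ?A" unfolding s_def using True strict_mono_enumerate enumerate_in_set by blast+
  hence "ALL n. EX z. \<sigma> (s n) = Fin z & v z <= 1" by blast
  then obtain \<tau> where \<tau>: "!!n. \<sigma> (s n) = Fin (\<tau> n)" "!!n. v (\<tau> n) <= 1" by metis
  show ?thesis
  proof (rule sub[OF s(1), of "Fin 0" \<tau>])
   show "\<tau> n \<in> K" for n using range_subsetD[OF \<sigma>, of "s n"] \<tau>(1) by (auto simp: P1_of_def)
   show "spherical v (param_at (Fin 0) t) (param_at (Fin 0) l) = v (t - l)" if "v t <= 1" "v l <= 1" for t l
    using that by (simp add: max_def)
  qed (use \<tau> K(1) in "auto simp: P1_of_def is_subfieldD(1)")
 next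
  case False
  hence inf: "infinite (- ?A)" using finite_compl by blast
  define s where "s = enumerate (- ?A)"
  have s: "strict_mono s" "!!n. s n \<in> - ?A" unfolding s_def using inf strict_mono_enumerate enumerate_in_set by blast+
  have near: "spherical v Infty (\<sigma> (s n)) < scl Infty * rad Infty" for n
  proof (cases "\<sigma> (s n)")
   case (Fin z)
   hence "1 < v z" using s(2)[of n] by auto
   thus ?thesis using Fin by (simp add: scl_def rad_def divide_less_eq)
  qed (simp add: scl_def rad_def)
  show ?thesis
  proof (rule sub[OF s(1), of Infty "%n. coord_at Infty (\<sigma> (s n))"])
   show e: "\<sigma> (s n) = param_at Infty (coord_at Infty (\<sigma> (s n)))" for n using param_near(1)[OF near] by simp
   show "coord_at Infty (\<sigma> (s n)) \<in> K" for n
    using range_subsetD[OF \<sigma>, of "s n"] param_in_P1[OF K(1), of Infty "coord_at Infty (\<sigma> (s n))"] e[of n] by (simp add: P1_of_def)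
   show le: "v (coord_at Infty (\<sigma> (s n))) <= 1" for n using param_near(2)[OF near, of n] by (simp add: rad_def)
   \<comment> \<open>The case \<open>v t = 1\<close> is outside the range of
     \<open>spherical_param\<close> and is computed directly.\<close>
   show "spherical v (param_at Infty t) (param_at Infty l) = v (t - l)" if "v t <= 1" "v l <= 1" "v (t - l) < 1" for t l
   proof (cases "v t < 1")
    case True
    hence "v (t - (t - l)) < 1" using that(3) by (rule v_diff_less)
    thus ?thesis using spherical_param[of t Infty l] True by (simp add: rad_def scl_def)
   next
    case False
    hence t: "v t = 1" using that(1) by simp
    hence l: "v l = 1" using v_close[of t l] that(3) by simp
    hence "t ~= 0" "l ~= 0" using t by auto
    moreover have "inverse t - inverse l = (l - t) / (t * l)" using calculation by (simp add: field_simps)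
    ultimately show ?thesis using t l by (simp add: v_inverse v_divide v_mult v_diff_commute)
   qed
  qed (simp add: P1_of_def)
 qed
qed

lemma of_nat_in_subfield: "is_subfield K ==> of_nat n \<in> K"
 by (induction n) (auto simp: is_subfieldD)

lemma normalized_chart:
 assumes "is_subfield K" "x \<in> P1_of K"
 obtains a where "a \<in> P1_of K" "scl a = 1" "rad a = 1" "spherical v a x < 1"
proof (cases "EX y. x = Fin y & v y <= 1")
 case True
 thus ?thesis using that[of x] assms(2) by (auto simp: scl_def rad_def)
next
 case False
 hence "spherical v Infty x < 1" by (cases x) (auto simp: divide_less_eq)
 thus ?thesis using that[of Infty] by (simp add: scl_def rad_def P1_of_def)
qed

text \<open>Translation by \<open>p ^ k\<close> in a chart of scale 1 realises the distance
  \<open>(1 / p) ^ k\<close>; consecutive ones differ by the factor \<open>p\<close>.\<close>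

lemma P1_perfect:
 assumes K: "is_subfield K" and x: "x \<in> P1_of K" and r: "0 < r" "r <= 1"
 shows "EX y:P1_of K. r / real p <= spherical v x y & spherical v x y <= r"
proof -
 obtain a where a: "a \<in> P1_of K" "scl a = 1" "rad a = 1" "spherical v a x < 1" using normalized_chart[OF K x] by blast
 define w where "w = coord_at a x"
 have w: "param_at a w = x" "v (w - ctr a) < 1" using param_near[of a x] a unfolding w_def by auto
 have wK: "w \<in> K" using param_in_P1[OF K a(1), of w] w(1) x by simp
 have v0: "v (of_nat p ^ n :: 'c) = (1 / real p) ^ n" for n by (simp add: v_power v_p)
 define n where "n = (LEAST n. (1 / real p) ^ n <= r)"
 have ex: "EX n. (1 / real p) ^ n <= r" using real_arch_pow_inv[OF r(1), of "1 / real p"] p_gt_1 by (auto intro: less_imp_le)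
 have n: "(1 / real p) ^ n <= r" unfolding n_def by (rule LeastI_ex[OF ex])
 \<comment> \<open>At least 1, so that the translate stays in the open unit disk of the chart; for
   \<open>r <= 1\<close> the lower bound survives this.\<close>
 define k where "k = max n 1"
 have k: "(1 / real p) ^ k <= r" "r / real p <= (1 / real p) ^ k" "1 <= k"
 proof -
  have "(1 / real p) ^ k <= (1 / real p) ^ n" unfolding k_def using p_gt_1 by (intro power_decreasing) auto
  thus "(1 / real p) ^ k <= r" using n by simp
  show "r / real p <= (1 / real p) ^ k"
  proof (cases "n <= 1")
   case True
   thus ?thesis unfolding k_def using r p_gt_1 by (simp add: divide_right_mono)
  next
   case False
   then obtain j where j: "n = Suc j" by (cases n) auto
   have "r < (1 / real p) ^ j" using not_less_Least[of j "%n. (1 / real p) ^ n <= r"] j unfolding n_def[symmetric] by simp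
   hence "r / real p <= (1 / real p) ^ j / real p" using p_gt_1 by (intro divide_right_mono) auto
   thus ?thesis using False j unfolding k_def by simp
  qed
  show "1 <= k" unfolding k_def by simp
 qed
 have "v (of_nat p ^ k :: 'c) < 1" unfolding v0 using k(3) p_gt_1 by (simp add: power_less_one_iff)
 hence "v ((w - ctr a) + of_nat p ^ k) < 1" using w(2) by (intro v_add_less)
 hence w': "v (w + of_nat p ^ k - ctr a) < 1" by (simp add: algebra_simps)
 let ?y = "param_at a (w + of_nat p ^ k)"
 have "spherical v x ?y = (1 / real p) ^ k"
  using spherical_param[of w a "w + of_nat p ^ k"] w w' a unfolding v0[symmetric] by simp
 moreover have "?y \<in> P1_of K"
  using param_in_P1[OF K a(1)] is_subfieldD(3,9)[OF K] wK of_nat_in_subfield[OF K] by simp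
 ultimately show ?thesis using k by (intro bexI[of _ ?y]) auto
qed

end

section \<open>Rational maps\<close>

text \<open>Homogenisation in degree \<open>d\<close>. Pairs of forms without common zero serve as
  reduced fractions: infinity needs no special treatment, and composition preserves the
  property.\<close>

definition hm :: "nat => 'c::field poly => 'c => 'c => 'c" where
 "hm d f x y = (\<Sum>i\<le>d. coeff f i * x ^ i * y ^ (d - i))"

definition hp :: "nat => 'c::field poly => 'c poly => 'c poly => 'c poly" where
 "hp d f P Q = (\<Sum>i\<le>d. smult (coeff f i) (P ^ i * Q ^ (d - i)))"

definition pt :: "'c::field => 'c => 'c P1" where
 "pt x y = (if y = 0 then Infty else Fin (x / y))"

definition form :: "nat => 'c::field poly => 'c poly => bool" where
 "form d f g \<longleftrightarrow> degree f <= d & degree g <= d & (ALL x y. hm d f x y = 0 & hm d g x y = 0 --> x = 0 & y = 0)"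

definition rmap :: "nat => 'c::field poly => 'c poly => 'c P1 => 'c P1" where
 "rmap d f g X = pt (hm d f (fst (hom X)) (snd (hom X))) (hm d g (fst (hom X)) (snd (hom X)))"

lemma hm_1: assumes "degree f <= d" shows "hm d f x 1 = poly f x"
proof -
 have "hm d f x 1 = (\<Sum>i\<le>degree f. coeff f i * x ^ i)"
  unfolding hm_def using assms by (intro sum.mono_neutral_cong_right) (auto simp: coeff_eq_0)
 thus ?thesis by (simp add: poly_altdef)
qed

lemma hm_0: "hm d f x 0 = coeff f d * x ^ d"
proof -
 have "hm d f x 0 = (\<Sum>i\<in>{d}. coeff f i * x ^ i)"
  unfolding hm_def by (rule sum.mono_neutral_cong_right) auto
 thus ?thesis by simp
qed

lemma hm_scale: "hm d f (c * x) (c * y) = c ^ d * hm d f x y"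
proof -
 have "c ^ i * c ^ (d - i) = c ^ d" if "i <= d" for i using that by (simp add: power_add[symmetric])
 hence "coeff f i * (c * x) ^ i * (c * y) ^ (d - i) = c ^ d * (coeff f i * x ^ i * y ^ (d - i))" if "i <= d" for i
  using that by (simp add: power_mult_distrib algebra_simps)
 thus ?thesis unfolding hm_def sum_distrib_left by (intro sum.cong) auto
qed

lemma hm_divide: "y ~= 0 ==> hm d f x y = y ^ d * hm d f (x / y) 1"
 using hm_scale[of d f y "x / y" 1] by simp

lemma poly_hp: "poly (hp d f P Q) t = hm d f (poly P t) (poly Q t)"
 unfolding hp_def hm_def by (simp add: poly_sum mult.assoc)

lemma coeff_mult_top:
 fixes P Q :: "'c::field poly"
 assumes "degree P <= m" "degree Q <= n" shows "coeff (P * Q) (m + n) = coeff P m * coeff Q n"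
proof (cases "degree P = m & degree Q = n")
 case True
 thus ?thesis by (metis coeff_mult_degree_sum)
next
 case False
 hence "degree P < m \<or> degree Q < n" using assms by linarith
 hence "coeff P m * coeff Q n = 0" by (auto simp: coeff_eq_0)
 moreover have "degree (P * Q) < m + n" using degree_mult_le[of P Q] assms False by linarith
 ultimately show ?thesis by (simp add: coeff_eq_0)
qed

lemma coeff_power_top:
 fixes P :: "'c::field poly"
 assumes "degree P <= m" shows "degree (P ^ i) <= i * m & coeff (P ^ i) (i * m) = coeff P m ^ i"
proof (induction i)
 case (Suc i)
 have "degree (P * P ^ i) <= m + i * m" using degree_mult_le[of P "P ^ i"] assms Suc by linarith
 moreover have "coeff (P * P ^ i) (m + i * m) = coeff P m * coeff (P ^ i) (i * m)"
  using Suc assms by (intro coeff_mult_top) auto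
 ultimately show ?case using Suc by simp
qed simp

text \<open>Degree bounds are used instead of degrees: the coefficient at \<open>d * m\<close> may
  vanish, and it decides the value of the composite at infinity.\<close>

lemma hp_top:
 fixes P Q :: "'c::field poly"
 assumes "degree P <= m" "degree Q <= m"
 shows "degree (hp d f P Q) <= d * m" "coeff (hp d f P Q) (d * m) = hm d f (coeff P m) (coeff Q m)"
proof -
 have t: "degree (P ^ i * Q ^ (d - i)) <= d * m & coeff (P ^ i * Q ^ (d - i)) (d * m) = coeff P m ^ i * coeff Q m ^ (d - i)"
  if "i <= d" for i
 proof -
  have e: "i * m + (d - i) * m = d * m" using that by (simp add: distrib_right[symmetric])
  note cp = coeff_power_top[OF assms(1), of i] coeff_power_top[OF assms(2), of "d - i"]
  have "degree (P ^ i * Q ^ (d - i)) <= i * m + (d - i) * m"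
   using degree_mult_le[of "P ^ i" "Q ^ (d - i)"] cp by linarith
  moreover have "coeff (P ^ i * Q ^ (d - i)) (i * m + (d - i) * m) = coeff P m ^ i * coeff Q m ^ (d - i)"
   using coeff_mult_top[of "P ^ i" "i * m" "Q ^ (d - i)" "(d - i) * m"] cp by simp
  ultimately show ?thesis unfolding e by blast
 qed
 show "degree (hp d f P Q) <= d * m" unfolding hp_def
  using t by (intro degree_sum_le) (auto intro: order_trans[OF degree_smult_le])
 show "coeff (hp d f P Q) (d * m) = hm d f (coeff P m) (coeff Q m)"
  unfolding hp_def hm_def by (simp add: coeff_sum t mult.assoc)
qed

lemma hm_hp:
 fixes P Q :: "'c::field poly"
 assumes "degree P <= m" "degree Q <= m"
 shows "hm (d * m) (hp d f P Q) x y = hm d f (hm m P x y) (hm m Q x y)"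
proof (cases "y = 0")
 case True
 thus ?thesis using hm_scale[of d f "x ^ m" "coeff P m" "coeff Q m"]
  by (simp add: hm_0 hp_top[OF assms] power_mult[symmetric] mult.commute)
next
 case False
 have "hm (d * m) (hp d f P Q) x y = y ^ (d * m) * hm d f (poly P (x / y)) (poly Q (x / y))"
  using False hm_1[OF hp_top(1)[OF assms]] by (simp add: hm_divide[OF False] poly_hp)
 also have "\<dots> = hm d f (y ^ m * poly P (x / y)) (y ^ m * poly Q (x / y))"
  by (simp add: hm_scale power_mult[symmetric] mult.commute)
 finally show ?thesis using False assms by (simp add: hm_divide[OF False, of m] hm_1)
qed

lemma pt_eq: "x ~= 0 \<or> y ~= 0 ==> x' ~= 0 \<or> y' ~= 0 ==> pt x y = pt x' y' \<longleftrightarrow> x * y' = x' * y"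
 unfolding pt_def by (auto simp: frac_eq_eq)

lemma pt_scale: "c ~= 0 ==> pt (c * x) (c * y) = pt x y"
 unfolding pt_def by simp

lemma formD: "form d f g ==> x ~= 0 \<or> y ~= 0 ==> hm d f x y ~= 0 \<or> hm d g x y ~= 0"
 unfolding form_def by blast

lemma rmap_pt:
 assumes "x ~= 0 \<or> y ~= 0" shows "rmap d f g (pt x y) = pt (hm d f x y) (hm d g x y)"
proof -
 define c where "c = (if y = 0 then x else y)"
 have c: "c ~= 0" unfolding c_def using assms by auto
 obtain x' y' where h: "hom (pt x y) = (x', y')" by fastforce
 have "c * x' = x" "c * y' = y" using h unfolding pt_def c_def by (auto split: if_splits)
 hence "pt (hm d f x y) (hm d g x y) = pt (c ^ d * hm d f x' y') (c ^ d * hm d g x' y')"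
  by (simp only: hm_scale[symmetric])
 also have "\<dots> = pt (hm d f x' y') (hm d g x' y')" using c by (intro pt_scale) simp
 finally have "pt (hm d f x y) (hm d g x y) = pt (hm d f x' y') (hm d g x' y')" .
 thus ?thesis unfolding rmap_def h by simp
qed

lemma rmap_comp:
 fixes f g :: "'c::field poly"
 assumes fg: "form d f g" and fg': "form m f' g'"
 shows "form (d * m) (hp d f f' g') (hp d g f' g')"
  and "rmap (d * m) (hp d f f' g') (hp d g f' g') = rmap d f g \<circ> rmap m f' g'"
proof -
 have dg: "degree f' <= m" "degree g' <= m" using fg' unfolding form_def by auto
 show "form (d * m) (hp d f f' g') (hp d g f' g')"
  unfolding form_def
 proof (intro conjI allI impI hp_top(1)[OF dg])
  fix x y assume "hm (d * m) (hp d f f' g') x y = 0 & hm (d * m) (hp d g f' g') x y = 0"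
  hence "hm m f' x y = 0 & hm m g' x y = 0" unfolding hm_hp[OF dg] using formD[OF fg] by blast
  thus "x = 0" "y = 0" using formD[OF fg', of x y] by blast+
 qed
 show "rmap (d * m) (hp d f f' g') (hp d g f' g') = rmap d f g \<circ> rmap m f' g'"
 proof
  fix X :: "'c P1"
  obtain x y where h: "hom X = (x, y)" by fastforce
  have "x ~= 0 \<or> y ~= 0" using h by (cases X) auto
  hence nz: "hm m f' x y ~= 0 \<or> hm m g' x y ~= 0" using formD[OF fg'] by blast
  have "rmap m f' g' X = pt (hm m f' x y) (hm m g' x y)" unfolding rmap_def h by simp
  thus "rmap (d * m) (hp d f f' g') (hp d g f' g') X = (rmap d f g \<circ> rmap m f' g') X"
   using rmap_pt[OF nz, of d f g] by (simp add: rmap_def h hm_hp[OF dg])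
 qed
qed

lemma rmap_iterate:
 fixes f g :: "'c::field poly"
 assumes fg: "form d f g"
 shows "EX F G. form (d ^ n) F G & rmap d f g ^^ n = rmap (d ^ n) F G"
proof (induction n)
 case 0
 have h: "hm 1 [:0, 1:] x y = x" "hm 1 1 x y = y" for x y :: 'c
  unfolding hm_def by (simp_all add: numeral_eq_Suc)
 have "rmap 1 [:0, 1:] (1 :: 'c poly) = id"
 proof
  fix X :: "'c P1" show "rmap 1 [:0, 1:] 1 X = id X" unfolding rmap_def h by (cases X) (auto simp: pt_def)
 qed
 moreover have "form 1 [:0, 1:] (1 :: 'c poly)" unfolding form_def h by simp
 ultimately show ?case by (metis funpow_0 power_0 eq_id_iff)
next
 case (Suc n)
 then obtain F G where "form (d ^ n) F G" "rmap d f g ^^ n = rmap (d ^ n) F G" by blast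
 thus ?case using rmap_comp[OF fg] by (metis funpow.simps(2) power_Suc)
qed

lemma rat_map_eq_rmap:
 fixes f g :: "'c::field poly"
 shows "rat_map f g = rmap (rat_degree f g) f g"
proof
 fix X :: "'c P1"
 have d: "degree f <= rat_degree f g" "degree g <= rat_degree f g" unfolding rat_degree_def by auto
 show "rat_map f g X = rmap (rat_degree f g) f g X"
  by (cases X) (auto simp: rmap_def hm_0 hm_1[OF d(1)] hm_1[OF d(2)] pt_def Let_def)
qed

lemma rational_form:
 fixes f g :: "'c::field poly"
 assumes "g ~= 0" "coprime f g" shows "form (rat_degree f g) f g"
proof -
 let ?d = "rat_degree f g"
 have d: "degree f <= ?d" "degree g <= ?d" unfolding rat_degree_def by auto
 have "x = 0 & y = 0" if h: "hm ?d f x y = 0" "hm ?d g x y = 0" for x y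
 proof (cases "y = 0")
  case True
  have "coeff f ?d ~= 0 \<or> coeff g ?d ~= 0"
  proof (cases "degree g = ?d")
   case True
   hence "coeff g ?d = lead_coeff g" by simp
   thus ?thesis using assms(1) by simp
  next
   case False
   hence *: "degree f = ?d" "degree g < degree f" unfolding rat_degree_def by (auto simp: max_def split: if_splits)
   hence "coeff f ?d = lead_coeff f" "f ~= 0" by auto
   thus ?thesis by simp
  qed
  thus ?thesis using h True by (auto simp: hm_0)
 next
  case False
  hence "poly f (x / y) = 0" "poly g (x / y) = 0" using h d by (auto simp: hm_divide[OF False] hm_1)
  hence "[:- (x / y), 1:] dvd f" "[:- (x / y), 1:] dvd g" by (simp_all add: poly_eq_0_iff_dvd)
  hence "is_unit [:- (x / y), 1:]" using assms(2) by (simp add: coprime_common_divisor)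
  thus ?thesis by (simp add: is_unit_pCons_iff)
 qed
 thus ?thesis unfolding form_def using d by blast
qed

lemma param_pt: "EX P Q. (ALL t. param_at a t = pt (poly P t) (poly Q t)) & (ALL t. poly P t ~= 0 \<or> poly Q (t::'c::field) ~= 0)"
proof (cases a)
 case (Fin x)
 show ?thesis by (rule exI[of _ "[:0, 1:]"], rule exI[of _ 1]) (simp add: Fin pt_def)
next
 case Infty
 show ?thesis by (rule exI[of _ 1], rule exI[of _ "[:0, 1:]"]) (simp add: Infty pt_def inverse_eq_divide)
qed

lemma rmap_param:
 fixes f g :: "'c::field poly"
 assumes "form d f g"
 obtains N E where "!!t. rmap d f g (param_at a t) = pt (poly N t) (poly E t)" "!!t. poly N t ~= 0 \<or> poly E t ~= 0"
proof -
 obtain P Q where "!!t. param_at a t = pt (poly P t) (poly Q t)" "!!t. poly P t ~= 0 \<or> poly Q (t::'c) ~= 0"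
  using param_pt[of a] by blast
 thus ?thesis using that[of "hp d f P Q" "hp d g P Q"] formD[OF assms] by (simp add: rmap_pt poly_hp)
qed

context nonarch
begin

lemma spherical_pt:
 assumes "x ~= 0 \<or> y ~= 0" "x' ~= 0 \<or> y' ~= 0"
 shows "spherical v (pt x y) (pt x' y') = v (x * y' - x' * y) / (max (v x) (v y) * max (v x') (v y'))"
proof -
 have ex: "EX c. c ~= 0 & x = c * fst (hom (pt x y)) & y = c * snd (hom (pt x y))" if "x ~= 0 \<or> y ~= 0" for x y
  using that by (intro exI[of _ "if y = 0 then x else y"]) (auto simp: pt_def)
 obtain c where c: "c ~= 0" "x = c * fst (hom (pt x y))" "y = c * snd (hom (pt x y))" using ex[OF assms(1)] by blast
 obtain e where e: "e ~= 0" "x' = e * fst (hom (pt x' y'))" "y' = e * snd (hom (pt x' y'))" using ex[OF assms(2)] by blast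
 define X X' where "X = hom (pt x y)" and "X' = hom (pt x' y')"
 have "x * y' - x' * y = (c * e) * (fst X * snd X' - fst X' * snd X)"
  unfolding X_def X'_def by (subst c(2), subst e(3), subst e(2), subst c(3)) (simp add: algebra_simps)
 hence w: "v (x * y' - x' * y) = v c * v e * wedge X X'" unfolding wedge_def by (simp add: v_mult)
 have m: "max (v x) (v y) = v c * nrm X" "max (v x') (v y') = v e * nrm X'"
  unfolding nrm_def X_def X'_def by (subst c(2), subst c(3), simp add: v_mult max_mult_distrib_left)
   (subst e(2), subst e(3), simp add: v_mult max_mult_distrib_left)
 show ?thesis unfolding spherical_hom X_def[symmetric] X'_def[symmetric] w m using c(1) e(1) by simp
qed

end

context cp_field
begin

text \<open>A form of positive degree has a root in the algebraically closed field, or vanishes at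
  infinity when the degree of the polynomial drops.\<close>

lemma hm_zero_exists:
 assumes "degree f <= d" "1 <= d" shows "EX x y. (x ~= 0 \<or> y ~= 0) & hm d f x (y::'c) = 0"
proof (cases "degree f = d")
 case True
 then obtain x where "poly f x = 0" using root_exists[of f] assms by auto
 thus ?thesis using hm_1[OF assms(1), of x] by (intro exI[of _ x] exI[of _ 1]) simp
next
 case False
 hence "coeff f d = 0" using assms by (simp add: coeff_eq_0)
 thus ?thesis by (intro exI[of _ 1] exI[of _ 0]) (simp add: hm_0)
qed

text \<open>Proportional forms would share a zero, against \<open>form\<close>.\<close>

lemma fibre_poly_nonzero:
 assumes fg: "form d f g" "1 <= d" and ab: "a ~= 0 \<or> b ~= 0"
 shows "smult b f - smult a g ~= (0 :: 'c poly)"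
proof
 assume z: "smult b f - smult a g = 0"
 have dg: "degree f <= d" "degree g <= d" using fg unfolding form_def by auto
 have h: "b * hm d f x y = a * hm d g x y" for x y
 proof -
  have "b * coeff f i = a * coeff g i" for i
   using arg_cong[OF z, of "%p. coeff p i"] by simp
  thus ?thesis unfolding hm_def sum_distrib_left mult.assoc[symmetric] by simp
 qed
 show False
 proof (cases "b = 0")
  case True
  obtain x y where "x ~= 0 \<or> y ~= 0" "hm d f x y = 0" using hm_zero_exists[OF dg(1) fg(2)] by blast
  moreover have "hm d g x y = 0" using h[of x y] ab True by simp
  ultimately show False using formD[OF fg(1)] by blast
 next
  case False
  obtain x y where "x ~= 0 \<or> y ~= 0" "hm d g x y = 0" using hm_zero_exists[OF dg(2) fg(2)] by blast
  moreover have "hm d f x y = 0" using h[of x y] False \<open>hm d g x y = 0\<close> by simp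
  ultimately show False using formD[OF fg(1)] by blast
 qed
qed

lemma finite_fibre:
 assumes fg: "form d f g" "1 <= d" shows "finite {X :: 'c P1. rmap d f g X = Y}"
proof -
 obtain a b where Y: "Y = pt a b" "a ~= 0 \<or> b ~= 0"
 proof (cases Y)
  case (Fin y) thus ?thesis using that[of y 1] by (simp add: pt_def)
 next
  case Infty thus ?thesis using that[of 1 0] by (simp add: pt_def)
 qed
 have dg: "degree f <= d" "degree g <= d" using fg unfolding form_def by auto
 have "{X. rmap d f g X = Y} \<subseteq> insert Infty (Fin ` {x. poly (smult b f - smult a g) x = 0})"
 proof
  fix X assume "X \<in> {X. rmap d f g X = Y}"
  thus "X \<in> insert Infty (Fin ` {x. poly (smult b f - smult a g) x = 0})"
  proof (cases X)
   case (Fin x)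
   have "poly f x ~= 0 \<or> poly g x ~= 0" using formD[OF fg(1), of x 1] dg by (simp add: hm_1)
   hence "poly f x * b = a * poly g x"
    using \<open>X \<in> _\<close> Y pt_eq[of "poly f x" "poly g x" a b] dg by (simp add: Fin rmap_def hm_1)
   thus ?thesis using Fin by (simp add: mult.commute)
  qed simp
 qed
 moreover have "finite {x. poly (smult b f - smult a g) x = 0}"
  by (rule poly_roots_finite[OF fibre_poly_nonzero[OF fg Y(2)]])
 ultimately show ?thesis by (meson finite_imageI finite_insert finite_subset)
qed

text \<open>Finite fixed points are zeros of f - z g. If this polynomial vanished, the two forms
  would be x h and y h with a form h of degree \<open>d - 1 >= 1\<close>, whose zero they would
  share.\<close>

lemma finite_fixed:
 assumes fg: "form d f g" "2 <= d" shows "finite {X :: 'c P1. rmap d f g X = X}"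
proof -
 have dg: "degree f <= d" "degree g <= d" using fg unfolding form_def by auto
 have nz: "f - pCons 0 g ~= 0"
 proof
  assume "f - pCons 0 g = 0"
  hence f: "f = pCons 0 g" by simp
  obtain k where k: "d = Suc k" "1 <= k" using fg(2) by (cases d) auto
  have gk: "degree g <= k" using dg(1) k f by (cases "g = 0") auto
  obtain x y where xy: "x ~= 0 \<or> y ~= 0" "hm k g x y = 0" using hm_zero_exists[OF gk k(2)] by blast
  have "hm d f x y = x * hm k g x y"
   unfolding hm_def k(1) f sum.atMost_Suc_shift sum_distrib_left by (simp add: algebra_simps)
  moreover have "hm d g x y = y * hm k g x y"
  proof -
   have "coeff g (Suc k) = 0" using gk by (simp add: coeff_eq_0)
   hence "hm d g x y = (\<Sum>i\<le>k. coeff g i * x ^ i * y ^ (Suc k - i))" unfolding hm_def k(1) by simp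
   also have "\<dots> = (\<Sum>i\<le>k. y * (coeff g i * x ^ i * y ^ (k - i)))"
    by (rule sum.cong) (auto simp: Suc_diff_le)
   finally show ?thesis unfolding hm_def sum_distrib_left .
  qed
  ultimately show False using formD[OF fg(1) xy(1)] xy(2) by simp
 qed
 have "{X. rmap d f g X = X} \<subseteq> insert Infty (Fin ` {x. poly (f - pCons 0 g) x = 0})"
 proof
  fix X assume "X \<in> {X. rmap d f g X = X}"
  thus "X \<in> insert Infty (Fin ` {x. poly (f - pCons 0 g) x = 0})"
  proof (cases X)
   case (Fin x)
   hence "poly g x ~= 0 & poly f x / poly g x = x"
    using \<open>X \<in> _\<close> dg by (auto simp: rmap_def hm_1 pt_def split: if_splits)
   thus ?thesis using Fin by (auto simp: divide_eq_eq)
  qed simp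
 qed
 thus ?thesis using poly_roots_finite[OF nz] by (meson finite_imageI finite_insert finite_subset)
qed

lemma rat_map_in_P1:
 assumes "is_subfield K" "rational_over K f g" "X \<in> P1_of K" shows "rat_map f g X \<in> P1_of K"
proof -
 have K: "set (coeffs f) \<subseteq> K" "set (coeffs g) \<subseteq> K" using assms(2) unfolding rational_over_def by auto
 show ?thesis
 proof (cases X)
  case (Fin x)
  hence "x \<in> K" using assms(3) by (auto simp: P1_of_def)
  hence "poly f x / poly g x \<in> K" using poly_in_subfield[OF assms(1)] K is_subfieldD(8)[OF assms(1)] by blast
  thus ?thesis unfolding Fin P1_of_def by simp
 next
  case Infty
  have "coeff f i / coeff g i \<in> K" for i using coeff_in_subfield[OF assms(1)] K is_subfieldD(8)[OF assms(1)] by blast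
  thus ?thesis unfolding Infty P1_of_def by (simp add: Let_def)
 qed
qed

end

section \<open>Local behaviour of rational maps\<close>

definition ratl :: "nat => ('c::field P1 => 'c P1) => bool" where
 "ratl d F \<longleftrightarrow> (EX f g. form d f g & F = rmap d f g)"

lemma ratl_iterate: "ratl d F ==> ratl (d ^ n) (F ^^ n)"
 unfolding ratl_def using rmap_iterate by blast

context nonarch
begin

definition psum :: "nat => 'c => 'c => 'c" where
 "psum m x y = (\<Sum>i<m. y ^ (m - Suc i) * x ^ i)"

lemma psum_diff: "x ^ m - y ^ m = (x - y) * psum m x y"
 unfolding psum_def by (rule power_diff_sumr2)

lemma psum_le:
 assumes "v x <= s" "v y <= s" shows "v (psum m x y) <= s ^ (m - 1)"
proof -
 have s: "0 <= s" using assms(1) v_nonneg[of x] by linarith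
 have "v (y ^ (m - Suc i) * x ^ i) <= s ^ (m - 1)" if "i < m" for i
 proof -
  have "v y ^ (m - Suc i) * v x ^ i <= s ^ (m - Suc i) * s ^ i"
   using assms s by (intro mult_mono power_mono) auto
  also have "\<dots> = s ^ (m - 1)" using that by (simp add: power_add[symmetric])
  finally show ?thesis by (simp add: v_mult v_power)
 qed
 thus ?thesis unfolding psum_def using s by (intro v_sum_le) auto
qed

lemma power_close:
 assumes "v w0 = u" "v (w - w0) <= k * u" "0 <= k" "k <= 1" shows "v w <= u" "v (w ^ i - w0 ^ i) <= k * u ^ i"
proof -
 have u: "0 <= u" using assms(1) v_nonneg[of w0] by simp
 have "k * u <= u" using mult_right_mono[OF assms(4) u] by simp
 hence "v ((w - w0) + w0) <= u" using assms by (intro v_add_le) auto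
 thus w: "v w <= u" by simp
 show "v (w ^ i - w0 ^ i) <= k * u ^ i"
 proof (cases i)
  case 0 thus ?thesis using assms by simp
 next
  case (Suc j)
  have "v (w - w0) * v (psum i w w0) <= (k * u) * u ^ (i - 1)"
   using psum_le[OF w, of w0 i] assms u by (intro mult_mono) auto
  thus ?thesis unfolding psum_diff v_mult Suc by (simp add: mult.assoc)
 qed
qed

text \<open>On a ball of relative radius \<open>k\<close> about \<open>w0\<close> the divided
  difference of the \<open>m\<close>-th power is almost constant. Its value carries the integer
  \<open>m\<close>, which may have absolute value below 1; so \<open>k\<close> will have to be
  chosen below that.\<close>

lemma psum_close:
 assumes w0: "v w0 = u" and w: "v (w - w0) <= k * u" and w': "v (w' - w0) <= k * u" and k: "0 <= k" "k <= 1"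
 shows "v (psum m w w' - of_nat m * w0 ^ (m - 1)) <= k * u ^ (m - 1)"
proof -
 have u: "0 <= u" using assms(1) v_nonneg[of w0] by simp
 have t: "v (w' ^ (m - Suc i) * w ^ i - w0 ^ (m - 1)) <= k * u ^ (m - 1)" if "i < m" for i
 proof -
  let ?j = "m - Suc i"
  have e: "?j + i = m - 1" using that by simp
  have "v (w' ^ ?j - w0 ^ ?j) * v w ^ i <= (k * u ^ ?j) * u ^ i"
   using power_close(2)[OF w0 w' k] power_close(1)[OF w0 w k] k u by (intro mult_mono power_mono) auto
  hence 1: "v ((w' ^ ?j - w0 ^ ?j) * w ^ i) <= k * u ^ (m - 1)"
   unfolding v_mult v_power e[symmetric] power_add by (simp add: mult.assoc)
  have "v w0 ^ ?j * v (w ^ i - w0 ^ i) <= u ^ ?j * (k * u ^ i)"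
   using power_close(2)[OF w0 w k] w0 u by (intro mult_mono) auto
  hence 2: "v (w0 ^ ?j * (w ^ i - w0 ^ i)) <= k * u ^ (m - 1)"
   unfolding v_mult v_power e[symmetric] power_add by (simp add: mult.left_commute)
  have "w' ^ ?j * w ^ i - w0 ^ (m - 1) = (w' ^ ?j - w0 ^ ?j) * w ^ i + w0 ^ ?j * (w ^ i - w0 ^ i)"
   unfolding e[symmetric] power_add by (simp add: algebra_simps)
  thus ?thesis using v_add_le[OF 1 2] by simp
 qed
 have "psum m w w' - of_nat m * w0 ^ (m - 1) = (\<Sum>i<m. w' ^ (m - Suc i) * w ^ i - w0 ^ (m - 1))"
  unfolding psum_def by (simp add: sum_subtractf)
 thus ?thesis using t u k by (simp only:) (intro v_sum_le, auto)
qed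

text \<open>Numerator and denominator have no common zero, so one of N / E and E / N is finite at
  the centre; the second is the coordinate when the image is infinity.\<close>

lemma local_chart:
 assumes fg: "form d f g"
 obtains N E r where "poly E (ctr a) ~= 0" "0 < r" "!!t. v (t - ctr a) <= r ==> poly E t ~= 0"
  "!!t. v (t - ctr a) <= r ==> rmap d f g (param_at a t) = param_at (rmap d f g a) (poly N t / poly E t)"
proof -
 obtain N E where NE: "!!t. rmap d f g (param_at a t) = pt (poly N t) (poly E t)" "!!t. poly N t ~= 0 \<or> poly E t ~= 0"
  using rmap_param[OF fg, of a] by blast
 have b: "rmap d f g a = pt (poly N (ctr a)) (poly E (ctr a))" using NE(1)[of "ctr a"] by simp
 show ?thesis
 proof (cases "poly E (ctr a) = 0")
  case False
  obtain r where r: "0 < r" "!!t. v (t - ctr a) <= r ==> v (poly E t) = v (poly E (ctr a))" using poly_nonzero_near[OF False] by blast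
  have nz: "poly E t ~= 0" if "v (t - ctr a) <= r" for t using r(2)[OF that] False by (metis v_eq_0)
  show ?thesis
   by (rule that[of E r N]) (use False r(1) nz NE(1) b in "auto simp: pt_def")
 next
  case True
  hence n: "poly N (ctr a) ~= 0" using NE(2)[of "ctr a"] by simp
  obtain r where r: "0 < r" "!!t. v (t - ctr a) <= r ==> v (poly N t) = v (poly N (ctr a))" using poly_nonzero_near[OF n] by blast
  have nz: "poly N t ~= 0" if "v (t - ctr a) <= r" for t using r(2)[OF that] n by (metis v_eq_0)
  show ?thesis
   by (rule that[of N r E]) (use True n r(1) nz NE(1) b in "auto simp: pt_def")
 qed
qed

end

context cp_field
begin

lemma infinite_disk: assumes "0 < r" shows "infinite {t. v (t - a) <= r}"
proof -
 obtain n where n: "v (of_nat p ^ n :: 'c) < r" using small_element[OF assms] by blast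
 let ?F = "%k. a + of_nat p ^ (n + k)"
 have "inj ?F"
 proof (rule injI)
  fix i j assume "?F i = ?F j"
  hence "v (of_nat p ^ (n + i) :: 'c) = v (of_nat p ^ (n + j))" by simp
  hence "(1 / real p) ^ (n + i) = (1 / real p) ^ (n + j)" by (simp only: v_power v_p)
  hence "n + i = n + j" using p_gt_1 by (subst (asm) power_inject_exp') auto
  thus "i = j" by simp
 qed
 moreover have "range ?F \<subseteq> {t. v (t - a) <= r}"
 proof safe
  fix k
  have "v (of_nat p ^ (n + k) :: 'c) <= v (of_nat p ^ n :: 'c)"
   unfolding v_power v_p using p_gt_1 by (intro power_decreasing) auto
  thus "v (a + of_nat p ^ (n + k) - a) <= r" using n by simp
 qed
 ultimately show ?thesis using finite_imageD infinite_UNIV_nat finite_subset by blast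
qed

text \<open>
 In the charts at \<open>a\<close> and at its image the map is \<open>G (t) = G (t\<^sub>0) + (t - t\<^sub>0)\<^sup>m H (t)\<close> with
 \<open>H\<close> rational and \<open>H (t\<^sub>0) ~= 0\<close>.
\<close>

lemma local_factor:
 assumes fg: "form d f g" and d: "1 <= d"
 obtains G H m C \<Psi> r where "1 <= (m::nat)" "0 < r" "r <= 1" "1 <= C" "H (ctr a) ~= 0"
  "!!t. v (t - ctr a) <= r ==> rmap d f g (param_at a t) = param_at (rmap d f g a) (G t)"
  "!!t. v (t - ctr a) <= r ==> G t - G (ctr a) = (t - ctr a) ^ m * H t"
  "!!t. v (t - ctr a) <= r ==> v (H t) = v (H (ctr a))" "v (H (ctr a)) <= C"
  "!!t t'. v (t - ctr a) <= r ==> v (t' - ctr a) <= r ==> H t - H t' = \<Psi> t t' * (t - t') & v (\<Psi> t t') <= C"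
proof -
 let ?t0 = "ctr a"
 obtain N E r0 where NE: "poly E ?t0 ~= 0" "0 < r0" "!!t. v (t - ?t0) <= r0 ==> poly E t ~= 0"
  "!!t. v (t - ?t0) <= r0 ==> rmap d f g (param_at a t) = param_at (rmap d f g a) (poly N t / poly E t)"
  by (rule local_chart[OF fg, of a]) (rule that; assumption)
 define P where "P = smult (poly E ?t0) N - smult (poly N ?t0) E"
 \<comment> \<open>Otherwise the map would be constant on an infinite disk, against finiteness of
   the fibres.\<close>
 have "P ~= 0"
 proof
  assume P: "P = 0"
  have "rmap d f g (param_at a t) = rmap d f g a" if t: "v (t - ?t0) <= r0" for t
  proof -
   have "poly P t = 0" using P by simp
   hence "poly N t / poly E t = poly N ?t0 / poly E ?t0" using NE(1) NE(3)[OF t] unfolding P_def by (simp add: frac_eq_eq mult.commute)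
   thus ?thesis using NE(4)[OF t] NE(4)[of ?t0] NE(2) by simp
  qed
  hence "param_at a ` {t. v (t - ?t0) <= r0} \<subseteq> {X. rmap d f g X = rmap d f g a}" by blast
  hence "finite (param_at a ` {t. v (t - ?t0) <= r0})" using finite_fibre[OF fg d] finite_subset by blast
  moreover have "inj_on (param_at a) {t. v (t - ?t0) <= r0}" by (rule inj_onI) (metis coord_param)
  ultimately show False using infinite_disk[OF NE(2)] finite_imageD by blast
 qed
 then obtain R where R: "P = [:- ?t0, 1:] ^ order ?t0 P * R" "~ [:- ?t0, 1:] dvd R" using order_decomp by blast
 \<comment> \<open>The order of vanishing of \<open>P\<close> is the local degree at
   \<open>a\<close>.\<close>
 define m where "m = order ?t0 P"
 have "poly P ?t0 = 0" unfolding P_def by simp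
 hence m: "1 <= m" unfolding m_def using \<open>P ~= 0\<close> order_root[of P ?t0] by auto
 have R0: "poly R ?t0 ~= 0" using R(2) by (simp add: poly_eq_0_iff_dvd)
 let ?q = "smult (poly E ?t0) E"
 have q0: "poly ?q ?t0 ~= 0" using NE(1) by simp
 obtain r1 where r1: "0 < r1" "!!t. v (t - ?t0) <= r1 ==> v (poly ?q t) = v (poly ?q ?t0)"
  using poly_nonzero_near[OF q0] by blast
 obtain r2 where r2: "0 < r2" "!!t. v (t - ?t0) <= r2 ==> v (poly R t) = v (poly R ?t0)" using poly_nonzero_near[OF R0] by blast
 define H where "H t = poly R t / poly ?q t" for t
 define G where "G t = poly N t / poly E t" for t
 obtain C0 \<Psi> where C0: "1 <= C0"
  "!!x y. v (x - ?t0) <= r1 ==> v (y - ?t0) <= r1 ==> H x - H y = \<Psi> x y * (x - y) & v (\<Psi> x y) <= C0"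
 proof -
  have b: "0 < v (poly ?q ?t0)" "!!x. x \<in> {x. v (x - ?t0) <= r1} ==> v (poly ?q ?t0) <= v (poly ?q x)" using q0 r1(2) by auto
  have B: "v x <= max r1 (v ?t0)" if "x \<in> {x. v (x - ?t0) <= r1}" for x using disk_bounded that by blast
  show ?thesis by (rule divided_difference[where D = "{x. v (x - ?t0) <= r1}" and n = R, OF B b]) (assumption, assumption, rule that, auto simp: H_def)
 qed
 define C where "C = max C0 (v (H ?t0))"
 have C: "1 <= C" "v (H ?t0) <= C" "C0 <= C" unfolding C_def using C0(1) by auto
 define r where "r = min (min r0 r1) (min r2 1)"
 have r: "r <= r0" "r <= r1" "r <= r2" "r <= 1" "0 < r" unfolding r_def using NE(2) r1(1) r2(1) by auto
 show ?thesis
 proof (rule that[of m r C H G \<Psi>])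
  show "H ?t0 ~= 0" unfolding H_def using R0 q0 by simp
  show "rmap d f g (param_at a t) = param_at (rmap d f g a) (G t)" if "v (t - ?t0) <= r" for t
   using NE(4)[of t] that r unfolding G_def by simp
  show "G t - G ?t0 = (t - ?t0) ^ m * H t" if "v (t - ?t0) <= r" for t
  proof -
   have nz: "poly E t ~= 0" using NE(3)[of t] that r by simp
   have "G t - G ?t0 = poly P t / poly ?q t" unfolding G_def P_def using nz NE(1) by (simp add: field_simps)
   also have "poly P t = (t - ?t0) ^ m * poly R t" by (subst R(1)) (simp add: m_def poly_power)
   finally show ?thesis unfolding H_def by simp
  qed
  show "v (H t) = v (H ?t0)" if "v (t - ?t0) <= r" for t
   using r1(2)[of t] r2(2)[of t] that r unfolding H_def v_divide by simp
  show "H t - H t' = \<Psi> t t' * (t - t') & v (\<Psi> t t') <= C" if "v (t - ?t0) <= r" "v (t' - ?t0) <= r" for t t'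
   using C0(2)[of t t'] that r C(3) by simp
 qed (use m r C in auto)
qed

text \<open>\<open>G\<close> is \<open>c\<close> times the identity up to a relative error of one
  half. This is stronger than scaling distances by \<open>s\<close>, and it drives the Newton
  iteration for surjectivity.\<close>

definition lin :: "'c set => ('c => 'c) => real => bool" where
 "lin D G s \<longleftrightarrow> (EX c. v c = s & (ALL t:D. ALL t':D. v (G t - G t' - c * (t - t')) <= s / 2 * v (t - t')))"

text \<open>G(t) - G(t') is t - t' times a divided difference in which the power and
  \<open>H\<close> contribute separately. At distance u from the centre the leading term has size
  |m| h u^(m-1), so on a ball of radius |m| / 2 times u all errors are at most half of it.\<close>

lemma local_expansion:
 assumes F: "ratl d F" and d: "1 <= d"
 obtains G m h k L r where "1 <= (m::nat)" "0 < r" "r < rad a" "r <= 1" "r * h < 1" "0 < h" "0 < k" "k < 1" "0 <= L"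
  "G (ctr a) = ctr (F a)"
  "!!t. v (t - ctr a) <= r ==> F (param_at a t) = param_at (F a) (G t)"
  "!!t. v (t - ctr a) <= r ==> v (G t - ctr (F a)) < rad (F a)"
  "!!t. v (t - ctr a) <= r ==> v (G t - ctr (F a)) = h * v (t - ctr a) ^ m"
  "!!s t t'. s <= r ==> v (t - ctr a) <= s ==> v (t' - ctr a) <= s ==> v (G t - G t') <= L * s ^ (m - 1) * v (t - t')"
  "!!t. v (t - ctr a) <= r ==> t ~= ctr a ==>
    lin {t'. v (t' - t) <= k * v (t - ctr a)} G (v (of_nat m) * h * v (t - ctr a) ^ (m - 1))"
  "m = 1 ==> lin {t'. v (t' - ctr a) <= r} G h"
  "EX l. v l = (if m = 1 then h else 0) & (ALL \<epsilon>>0. EX \<delta>>0. ALL t. t ~= ctr a & v (t - ctr a) < \<delta> -->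
    v ((G t - ctr (F a)) / (t - ctr a) - l) < \<epsilon>)"
proof -
 let ?t0 = "ctr a" and ?b = "F a"
 obtain f g where fg: "form d f g" and Ff: "F = rmap d f g" using F unfolding ratl_def by blast
 obtain G H m C \<Psi> r0 where
  m: "1 <= (m::nat)" and r0: "0 < r0" "r0 <= 1" and C: "1 <= C" and H0: "H ?t0 ~= 0"
  and G: "!!t. v (t - ?t0) <= r0 ==> F (param_at a t) = param_at ?b (G t)"
  and GH: "!!t. v (t - ?t0) <= r0 ==> G t - G ?t0 = (t - ?t0) ^ m * H t"
  and H: "!!t. v (t - ?t0) <= r0 ==> v (H t) = v (H ?t0)" and HC: "v (H ?t0) <= C"
  and \<Psi>: "!!t t'. v (t - ?t0) <= r0 ==> v (t' - ?t0) <= r0 ==> H t - H t' = \<Psi> t t' * (t - t') & v (\<Psi> t t') <= C"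
  by (rule local_factor[OF fg d, of a, folded Ff]) (rule that; assumption)
 define h where "h = v (H ?t0)"
 define q where "q = v (of_nat m)"
 have h: "0 < h" unfolding h_def using H0 by simp
 have q: "0 < q" "q <= 1" unfolding q_def using m v_of_nat_le by auto
 \<comment> \<open>\<open>r * C <= q * h / 2\<close> makes the variation of \<open>H\<close> small
   against the derivative of the power, and \<open>r * h < 1\<close> keeps the image inside the
   chart at \<open>F a\<close>.\<close>
 define r where "r = min (min r0 (rad a / 2)) (min (q * h / (2 * C)) (1 / (2 * h)))"
 have r: "r <= r0" "r < rad a" "r * C <= q * h / 2" "r * h < 1" "0 < r" "r <= 1"
 proof -
  have "r <= rad a / 2" "r <= q * h / (2 * C)" "r <= 1 / (2 * h)" unfolding r_def by auto
  thus "r < rad a" "r * C <= q * h / 2" "r * h < 1" using rad_ge_1[of a] C h by (auto simp: field_simps)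
  show "0 < r" unfolding r_def using r0 rad_ge_1[of a] q h C by simp
  show "r <= r0" unfolding r_def by simp
  thus "r <= 1" using r0 by simp
 qed
 have Gb: "G ?t0 = ctr ?b"
 proof -
  have "param_at ?b (G ?t0) = ?b" using G[of ?t0] r0 by simp
  thus ?thesis using coord_param[of ?b "G ?t0"] by simp
 qed
 have vG: "v (G t - ctr ?b) = h * v (t - ?t0) ^ m" if "v (t - ?t0) <= r" for t
  using GH[of t] H[of t] that r unfolding Gb by (simp add: v_mult v_power h_def mult.commute)
 have diff: "G t - G t' = (t - t') * (psum m (t - ?t0) (t' - ?t0) * H t + (t' - ?t0) ^ m * \<Psi> t t')"
  if "v (t - ?t0) <= r" "v (t' - ?t0) <= r" for t t'
 proof -
  have l: "v (t - ?t0) <= r0" "v (t' - ?t0) <= r0" using that r by auto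
  have "G t - G t' = (G t - G ?t0) - (G t' - G ?t0)" by simp
  also have "\<dots> = ((t - ?t0) ^ m - (t' - ?t0) ^ m) * H t + (t' - ?t0) ^ m * (H t - H t')"
   unfolding GH[OF l(1)] GH[OF l(2)] by (simp add: algebra_simps)
  also have "\<dots> = (((t - ?t0) - (t' - ?t0)) * psum m (t - ?t0) (t' - ?t0)) * H t + (t' - ?t0) ^ m * (\<Psi> t t' * (t - t'))"
   unfolding psum_diff using \<Psi>[OF l] by simp
  finally show ?thesis by (simp add: algebra_simps)
 qed
 have pmul: "s ^ m = s * s ^ (m - 1)" for s :: real using m by (cases m) auto
 have low: "v (w ^ m * \<Psi> t t') <= s * C * s ^ (m - 1)"
  if "v w <= s" "v (t - ?t0) <= r" "v (t' - ?t0) <= r" for w s t t'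
 proof -
  have "v w ^ m * v (\<Psi> t t') <= s ^ m * C"
  proof (intro mult_mono power_mono)
   show "v (\<Psi> t t') <= C" using \<Psi>[of t t'] that r by simp
   show "0 <= s ^ m" using that(1) v_nonneg[of w] by (intro zero_le_power) linarith
  qed (use that in auto)
  thus ?thesis unfolding v_mult v_power pmul[of s] by (simp add: algebra_simps)
 qed
 show ?thesis
 proof (rule that[of m r h "q / 2" C G])
  show "v (G t - ctr ?b) < rad ?b" if t: "v (t - ?t0) <= r" for t
  proof -
   have "v (t - ?t0) ^ (m - 1) <= 1" using t r by (intro power_le_one) auto
   hence "v (t - ?t0) ^ m <= r" unfolding pmul using t by (intro order_trans[OF mult_right_le_one_le]) auto
   hence "h * v (t - ?t0) ^ m <= h * r" using h by simp
   thus ?thesis using vG[OF t] r(4) rad_ge_1[of ?b] by (simp add: mult.commute)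
  qed
  show "v (G t - G t') <= C * s ^ (m - 1) * v (t - t')" if s: "s <= r" "v (t - ?t0) <= s" "v (t' - ?t0) <= s" for s t t'
  proof -
   have l: "v (t - ?t0) <= r" "v (t' - ?t0) <= r" using s by auto
   have s0: "0 <= s" using s(2) v_nonneg[of "t - ?t0"] by linarith
   have "v (psum m (t - ?t0) (t' - ?t0) * H t) <= s ^ (m - 1) * C"
    unfolding v_mult using psum_le[OF s(2,3), of m] H[of t] HC l r s0 by (intro mult_mono) auto
   moreover have "v ((t' - ?t0) ^ m * \<Psi> t t') <= s ^ (m - 1) * C"
   proof -
    have "s * C * s ^ (m - 1) <= 1 * C * s ^ (m - 1)" using s(1) r C s0 by (intro mult_right_mono) auto
    thus ?thesis using low[OF s(3) l] by (simp add: mult.commute)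
   qed
   ultimately have "v (psum m (t - ?t0) (t' - ?t0) * H t + (t' - ?t0) ^ m * \<Psi> t t') <= C * s ^ (m - 1)"
    by (intro v_add_le) (simp_all add: mult.commute)
   thus ?thesis unfolding diff[OF l] v_mult[of "t - t'"] by (subst mult.commute) (rule mult_right_mono, auto)
  qed
  show "lin {t'. v (t' - t) <= q / 2 * v (t - ?t0)} G (v (of_nat m) * h * v (t - ?t0) ^ (m - 1))"
   if t: "v (t - ?t0) <= r" "t ~= ?t0" for t
  proof -
   define u where "u = v (t - ?t0)"
   have u: "0 < u" "u <= r" unfolding u_def using t by auto
   define c where "c = of_nat m * (t - ?t0) ^ (m - 1) * H t"
   have vc: "v c = q * h * u ^ (m - 1)" unfolding c_def u_def q_def h_def v_mult v_power using H[of t] t r by simp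
   have "v (G x - G y - c * (x - y)) <= v c / 2 * v (x - y)"
    if x: "v (x - t) <= q / 2 * u" and y: "v (y - t) <= q / 2 * u" for x y
   proof -
    have k: "0 <= q / 2" "q / 2 <= 1" using q by auto
    have x': "v ((x - ?t0) - (t - ?t0)) <= q / 2 * u" and y': "v ((y - ?t0) - (t - ?t0)) <= q / 2 * u" using x y by simp_all
    have xu: "v (x - ?t0) <= u" and yu: "v (y - ?t0) <= u"
     using power_close(1)[OF u_def[symmetric] x' k] power_close(1)[OF u_def[symmetric] y' k] by auto
    have l: "v (x - ?t0) <= r" "v (y - ?t0) <= r" using xu yu u by auto
    have 1: "v ((psum m (x - ?t0) (y - ?t0) - of_nat m * (t - ?t0) ^ (m - 1)) * H x) <= v c / 2"
    proof -
     have "v (psum m (x - ?t0) (y - ?t0) - of_nat m * (t - ?t0) ^ (m - 1)) * h <= q / 2 * u ^ (m - 1) * h"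
      using psum_close[OF u_def[symmetric] x' y' k, of m] h by (intro mult_right_mono) auto
     thus ?thesis unfolding v_mult vc using H[of x] l r by (simp add: h_def algebra_simps)
    qed
    have 2: "v (of_nat m * (t - ?t0) ^ (m - 1) * (H x - H t)) <= v c / 2"
    proof -
     have "H x - H t = \<Psi> x t * (x - t)" "v (\<Psi> x t) <= C" using \<Psi>[of x t] l t r by auto
     hence "v (H x - H t) <= C * (q / 2 * u)" unfolding v_mult using x C by (simp only: v_mult) (intro mult_mono, auto)
     also have "\<dots> <= q / 2 * (r * C)" using u C q by (simp add: algebra_simps)
     also have "\<dots> <= q / 2 * (q * h / 2)" using r(3) q by (intro mult_left_mono) auto
     also have "\<dots> <= 1 * (1 * h / 2)" using q h by (intro mult_mono divide_right_mono) auto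
     finally have "v (H x - H t) <= h / 2" by simp
     hence "q * u ^ (m - 1) * v (H x - H t) <= q * u ^ (m - 1) * (h / 2)" using q u by (intro mult_left_mono) auto
     thus ?thesis unfolding v_mult v_power vc u_def q_def by (simp add: algebra_simps)
    qed
    have 3: "v ((y - ?t0) ^ m * \<Psi> x y) <= v c / 2"
    proof -
     have "u * C <= r * C" using u(2) C by (intro mult_right_mono) auto
     hence "u * C <= q * h / 2" using r(3) by linarith
     hence "u * C * u ^ (m - 1) <= (q * h / 2) * u ^ (m - 1)"
      using u by (intro mult_right_mono) auto
     thus ?thesis using low[OF yu l] unfolding vc by simp
    qed
    have "G x - G y - c * (x - y) = (x - y) * (((psum m (x - ?t0) (y - ?t0) - of_nat m * (t - ?t0) ^ (m - 1)) * H x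
      + of_nat m * (t - ?t0) ^ (m - 1) * (H x - H t)) + (y - ?t0) ^ m * \<Psi> x y)"
     unfolding diff[OF l] c_def by (simp add: algebra_simps)
    hence "v (G x - G y - c * (x - y)) = v (x - y) * v (((psum m (x - ?t0) (y - ?t0) - of_nat m * (t - ?t0) ^ (m - 1)) * H x
      + of_nat m * (t - ?t0) ^ (m - 1) * (H x - H t)) + (y - ?t0) ^ m * \<Psi> x y)" by (simp only: v_mult)
    also have "\<dots> <= v (x - y) * (v c / 2)" using v_add_le[OF v_add_le[OF 1 2] 3] by (intro mult_left_mono) auto
    finally show ?thesis by (simp add: mult.commute)
   qed
   thus ?thesis unfolding lin_def q_def[symmetric] u_def[symmetric] using vc by (intro exI[of _ c]) auto
  qed
  show "lin {t'. v (t' - ?t0) <= r} G h" if m1: "m = 1"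
  proof -
   have "v (G x - G y - H ?t0 * (x - y)) <= h / 2 * v (x - y)" if l: "v (x - ?t0) <= r" "v (y - ?t0) <= r" for x y
   proof -
    have "H x - H ?t0 = \<Psi> x ?t0 * (x - ?t0)" "v (\<Psi> x ?t0) <= C" using \<Psi>[of x ?t0] l r by auto
    hence "v (H x - H ?t0) <= C * r" using l C by (simp only: v_mult) (intro mult_mono, auto)
    moreover have "v ((y - ?t0) ^ m * \<Psi> x y) <= C * r" using low[OF l(2) l] m1 by (simp add: mult.commute)
    moreover have "C * r <= h / 2"
    proof -
     have "q * h <= 1 * h" using q h by (intro mult_right_mono) auto
     thus ?thesis using r(3) by (simp add: mult.commute)
    qed
    ultimately have b: "v ((H x - H ?t0) + (y - ?t0) ^ m * \<Psi> x y) <= h / 2" by (intro v_add_le) auto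
    have "G x - G y - H ?t0 * (x - y) = ((H x - H ?t0) + (y - ?t0) ^ m * \<Psi> x y) * (x - y)"
     unfolding diff[OF l] by (simp add: m1 psum_def algebra_simps)
    thus ?thesis using mult_right_mono[OF b v_nonneg[of "x - y"]] by (simp only: v_mult)
   qed
   thus ?thesis unfolding lin_def h_def by (intro exI[of _ "H ?t0"]) auto
  qed
  show "EX l. v l = (if m = 1 then h else 0) & (ALL \<epsilon>>0. EX \<delta>>0. ALL t. t ~= ?t0 & v (t - ?t0) < \<delta> -->
    v ((G t - ctr ?b) / (t - ?t0) - l) < \<epsilon>)"
  proof -
   define l where "l = (if m = 1 then H ?t0 else 0)"
   have est: "v ((G t - ctr ?b) / (t - ?t0) - l) <= C * v (t - ?t0)" if t: "t ~= ?t0" "v (t - ?t0) <= r" for t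
   proof (cases "m = 1")
    case True
    have "(G t - ctr ?b) / (t - ?t0) = H t" using GH[of t] t r True unfolding Gb by simp
    moreover have "H t - H ?t0 = \<Psi> t ?t0 * (t - ?t0)" "v (\<Psi> t ?t0) <= C" using \<Psi>[of t ?t0] t r by auto
    ultimately show ?thesis using True unfolding l_def by (simp add: v_mult mult_right_mono)
   next
    case False
    then obtain j where j: "m = Suc (Suc j)" using m by (metis One_nat_def Suc_le_D not0_implies_Suc)
    have "v (t - ?t0) ^ j <= 1" using t r by (intro power_le_one) auto
    hence "h * v (t - ?t0) ^ j <= C * 1" using HC C unfolding h_def by (intro mult_mono) auto
    hence "h * v (t - ?t0) ^ j * v (t - ?t0) <= C * v (t - ?t0)" by (intro mult_right_mono) auto
    moreover have "v ((G t - ctr ?b) / (t - ?t0) - l) = h * v (t - ?t0) ^ j * v (t - ?t0)"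
     using vG[OF t(2)] t(1) unfolding l_def by (simp add: j v_divide mult.commute)
    ultimately show ?thesis by simp
   qed
   show ?thesis
   proof (intro exI[of _ l] conjI allI impI)
    show "v l = (if m = 1 then h else 0)" unfolding l_def h_def by simp
    fix e :: real assume e: "0 < e"
    have "v ((G t - ctr ?b) / (t - ?t0) - l) < e" if "t ~= ?t0" "v (t - ?t0) < min r (e / C)" for t
    proof -
     have "C * v (t - ?t0) < e" using that(2) C by (simp add: field_simps)
     thus ?thesis using est[of t] that by simp
    qed
    thus "EX \<delta>>0. ALL t. t ~= ?t0 & v (t - ?t0) < \<delta> --> v ((G t - ctr ?b) / (t - ?t0) - l) < e"
     using r(5) e C by (intro exI[of _ "min r (e / C)"]) auto
   qed
  qed
 qed (use m r h q C Gb G vG in auto)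
qed

lemma has_P1_derivative_iff:
 "has_P1_derivative v F a l \<longleftrightarrow> (ALL e>0. EX \<delta>>0. ALL t. t ~= ctr a & v (t - ctr a) < \<delta> -->
   v ((coord_at (F a) (F (param_at a t)) - ctr (F a)) / (t - ctr a) - l) < e)"
 unfolding has_P1_derivative_def Let_def ms.limitin_metric ms.eventually_atin_metric by simp

lemma lin_D:
 assumes "lin D G s" "t \<in> D" "t' \<in> D" shows "v (G t - G t') = s * v (t - t')"
proof (cases "t = t'")
 case False
 obtain c where c: "v c = s" "v (G t - G t' - c * (t - t')) <= s / 2 * v (t - t')" using assms unfolding lin_def by blast
 show ?thesis
 proof (cases "s = 0")
  case True
  hence "v (G t - G t' - c * (t - t')) <= 0" "c = 0" using c by auto
  hence "v (G t - G t') <= 0" by simp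
  hence "v (G t - G t') = 0" by (simp only: order_antisym[OF _ v_nonneg])
  thus ?thesis using True by simp
 next
  case False
  hence "0 < s * v (t - t')" using c(1) v_nonneg[of c] \<open>t ~= t'\<close> by (simp add: less_le)
  hence "v (G t - G t' - c * (t - t')) < v (c * (t - t'))" using c by (simp add: v_mult)
  hence "v (c * (t - t') + (G t - G t' - c * (t - t'))) = v (c * (t - t'))" by (rule v_dominant)
  thus ?thesis using c(1) by (simp add: v_mult)
 qed
qed simp

text \<open>Newton iteration carried out inside \<open>K\<close>: every step halves the bound on the
  error of the value, and a limit point of the iterates solves the equation.\<close>

lemma lin_onto:
 assumes K: "is_subfield K" "bseq_compact K" and x: "x \<in> K" and r: "0 < r" and s: "0 < s"
  and G: "lin {t. v (t - x) <= r} G s" "!!t. t \<in> K ==> v (t - x) <= r ==> G t \<in> K"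
  and y: "y \<in> K" "v (y - G x) <= s * r"
 shows "EX t:K. v (t - x) <= r & G t = y"
proof -
 obtain c where c: "v c = s" "!!t t'. v (t - x) <= r ==> v (t' - x) <= r ==> v (G t - G t' - c * (t - t')) <= s / 2 * v (t - t')"
  using G(1) unfolding lin_def by blast
 obtain n where n: "v (of_nat p ^ n :: 'c) < r" using small_element[OF r] by blast
 define t1 where "t1 = x + of_nat p ^ n"
 have t1: "t1 \<in> K" "t1 ~= x" "v (t1 - x) <= r"
  unfolding t1_def using is_subfieldD(3,9)[OF K(1)] x of_nat_in_subfield[OF K(1)] n p_gt_1 by auto
 \<comment> \<open>A difference quotient in \<open>K\<close> replaces the coefficient
   \<open>c\<close>, which need not lie in \<open>K\<close>; the two differ by at most
   \<open>s / 2\<close>.\<close>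
 define e where "e = (G t1 - G x) / (t1 - x)"
 have Gx: "G x \<in> K" using G(2)[OF x] r by simp
 have eK: "e \<in> K" unfolding e_def using is_subfieldD(7,8)[OF K(1)] t1 x G(2)[OF t1(1,3)] Gx by simp
 have "e - c = (G t1 - G x - c * (t1 - x)) / (t1 - x)" unfolding e_def using t1 by (simp add: field_simps)
 hence "v (e - c) * v (t1 - x) = v (G t1 - G x - c * (t1 - x))" using t1(2) by (simp add: v_divide)
 also have "\<dots> <= s / 2 * v (t1 - x)" using c(2)[OF t1(3)] r by simp
 finally have ec: "v (e - c) <= s / 2" using t1(2) by (simp add: mult_le_cancel_right)
 have ve: "v e = s"
 proof -
  have "v (c - e) < v c" using ec c(1) s v_diff_commute[of c e] by simp
  thus ?thesis using v_close c(1) by blast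
 qed
 have e0: "e ~= 0" using ve s by auto
 have Ge: "v (G t - G t' - e * (t - t')) <= s / 2 * v (t - t')" if "v (t - x) <= r" "v (t' - x) <= r" for t t'
 proof -
  have "v ((e - c) * (t - t')) <= s / 2 * v (t - t')" using ec by (simp only: v_mult) (intro mult_right_mono, auto)
  hence "v ((G t - G t' - c * (t - t')) - (e - c) * (t - t')) <= s / 2 * v (t - t')" by (rule v_diff_le[OF c(2)[OF that]])
  thus ?thesis by (simp add: algebra_simps)
 qed
 define J where "J t = t + (y - G t) / e" for t
 define \<tau> where "\<tau> n = (J ^^ n) x" for n
 have step: "\<tau> (Suc n) - \<tau> n = (y - G (\<tau> n)) / e" for n unfolding \<tau>_def J_def by simp
 have inv: "\<tau> n \<in> K & v (\<tau> n - x) <= r & v (y - G (\<tau> n)) <= s * r * (1/2) ^ n" for n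
 proof (induction n)
  case 0 thus ?case using x r y unfolding \<tau>_def by simp
 next
  case (Suc n)
  have d: "v (\<tau> (Suc n) - \<tau> n) <= r * (1/2) ^ n"
   unfolding step v_divide ve using Suc s by (simp add: divide_le_eq mult.commute mult.left_commute)
  have "(1/2::real) ^ n <= 1" by (rule power_le_one) auto
  hence "r * (1/2) ^ n <= r * 1" using r by (intro mult_left_mono) auto
  hence "v (\<tau> (Suc n) - \<tau> n) <= r" using d by linarith
  hence "v ((\<tau> (Suc n) - \<tau> n) + (\<tau> n - x)) <= r" using Suc by (intro v_add_le) auto
  hence in': "v (\<tau> (Suc n) - x) <= r" by simp
  have "G (\<tau> n) \<in> K" using G(2) Suc by blast
  hence "\<tau> n + (y - G (\<tau> n)) / e \<in> K" using Suc y(1) eK is_subfieldD(3,7,8)[OF K(1)] by simp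
  hence inK: "\<tau> (Suc n) \<in> K" unfolding \<tau>_def J_def by simp
  have "y - G (\<tau> (Suc n)) = - (G (\<tau> (Suc n)) - G (\<tau> n) - e * (\<tau> (Suc n) - \<tau> n))"
   unfolding step using e0 by simp
  hence "v (y - G (\<tau> (Suc n))) <= s / 2 * v (\<tau> (Suc n) - \<tau> n)" using Ge[OF in'] Suc by (simp only: v_minus)
  also have "\<dots> <= s / 2 * (r * (1/2) ^ n)" using d s by (intro mult_left_mono) auto
  finally show ?case using inK in' by (simp add: mult.assoc)
 qed
 have "v (\<tau> n) <= max r (v x)" for n using disk_bounded inv[of n] by blast
 then obtain l q where l: "l \<in> K" "strict_mono (q :: nat => nat)" "!!e. 0 < e ==> EX N. ALL n>=N. v (\<tau> (q n) - l) < e"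
  using bseq_compactD[OF K(2), of \<tau>] inv by blast
 have lx: "v (l - x) <= r"
 proof -
  obtain N where "ALL n>=N. v (\<tau> (q n) - l) < r" using l(3)[OF r] by blast
  hence "v (\<tau> (q N) - l) < r" by simp
  hence "v ((\<tau> (q N) - x) - (\<tau> (q N) - l)) <= r" using inv[of "q N"] by (intro v_diff_le[of "\<tau> (q N) - x" r "\<tau> (q N) - l"]) auto
  thus ?thesis by simp
 qed
 have "v (y - G l) = 0"
 proof (rule ccontr)
  assume "v (y - G l) ~= 0"
  hence pos: "0 < v (y - G l)" by (metis less_le v_nonneg)
  then obtain N where N: "ALL n>=N. v (\<tau> (q n) - l) < v (y - G l) / s" using l(3)[of "v (y - G l) / s"] s by auto
  obtain M where M: "(1/2::real) ^ M < v (y - G l) / (s * r)" using real_arch_pow_inv[of "v (y - G l) / (s * r)" "1/2"] pos s r by auto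
  define n where "n = max N M"
  have "q n >= M" using seq_suble[OF l(2), of n] unfolding n_def by simp
  hence "(1/2::real) ^ q n <= (1/2) ^ M" by (intro power_decreasing) auto
  hence "(1/2::real) ^ q n < v (y - G l) / (s * r)" using M by linarith
  hence "s * r * (1/2) ^ q n < v (y - G l)" using s r by (simp add: pos_less_divide_eq mult.commute)
  hence 1: "v (y - G (\<tau> (q n))) < v (y - G l)" using inv[of "q n"] by linarith
  have "v (G (\<tau> (q n)) - G l) = s * v (\<tau> (q n) - l)" using lin_D[OF G(1)] inv lx by simp
  also have "\<dots> < v (y - G l)" using N s unfolding n_def by (simp add: pos_less_divide_eq mult.commute)
  finally have "v ((y - G (\<tau> (q n))) + (G (\<tau> (q n)) - G l)) < v (y - G l)" using 1 by (intro v_add_less)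
  thus False by simp
 qed
 thus ?thesis using l(1) lx by (intro bexI[of _ l]) auto
qed

end

locale rat_dyn = cp_field v p for v :: "'c::field_char_0 => real" and p +
 fixes K :: "'c set" and f g :: "'c poly"
 assumes K_ext: "is_finite_extension_of K (Qp v)"
  and rat: "rational_over K f g" and deg: "2 <= rat_degree f g"
begin

abbreviation "T \<equiv> rat_map f g"
abbreviation "X \<equiv> P1_of K"
abbreviation "\<rho> \<equiv> spherical v"
abbreviation "bal \<equiv> Metric_space.mcball X \<rho>"

lemma K_sub: "is_subfield K" using K_ext unfolding is_finite_extension_of_def by blast

lemma K_compact: "bseq_compact K" by (rule bseq_compact_finite_extension[OF K_ext])

lemma ratl_T: "ratl (rat_degree f g) T"
 unfolding ratl_def rat_map_eq_rmap using rational_form rat unfolding rational_over_def by blast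

lemma ratl_iter: obtains d where "1 <= d" "ratl d (T ^^ n)" "1 <= n ==> 2 <= d"
proof (rule that[of "rat_degree f g ^ n"])
 show "1 <= rat_degree f g ^ n" using deg by (intro one_le_power) simp
 show "ratl (rat_degree f g ^ n) (T ^^ n)" by (rule ratl_iterate[OF ratl_T])
 show "2 <= rat_degree f g ^ n" if "1 <= n" using power_increasing[OF that, of "rat_degree f g"] deg by simp
qed

lemma T_X: "x \<in> X ==> T x \<in> X" by (rule rat_map_in_P1[OF K_sub rat])

lemma iter_X: "x \<in> X ==> (T ^^ n) x \<in> X" by (induction n) (auto simp: T_X)

sublocale U: ultra_space X \<rho>
proof
 show "\<rho> x z <= max (\<rho> x y) (\<rho> y z)" for x y z by (rule spherical_ultra)
 show "compact_space (P1_topology v K)" by (rule compact_P1[OF K_sub K_compact])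
qed

lemma mcball_param:
 assumes "a \<in> X" "t \<in> K" "v (t - ctr a) < rad a" "r < rad a"
 shows "bal (param_at a t) (scl a * r) = param_at a ` {t' \<in> K. v (t' - t) <= r}"
proof
 have xX: "param_at a t \<in> X" using param_in_P1[OF K_sub assms(1)] assms(2) by blast
 have ch: "v (t' - ctr a) < rad a" if "v (t' - t) <= r" for t'
 proof -
  have "v ((t' - t) + (t - ctr a)) < rad a" using that assms by (intro v_add_less) auto
  thus ?thesis by simp
 qed
 show "bal (param_at a t) (scl a * r) \<subseteq> param_at a ` {t' \<in> K. v (t' - t) <= r}"
 proof
  fix y assume y: "y \<in> bal (param_at a t) (scl a * r)"
  have "scl a * r < scl a * rad a" using assms(4) scl_pos[of a] by (rule mult_strict_left_mono)
  moreover have "\<rho> (param_at a t) y <= scl a * r" using y by simp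
  ultimately have "\<rho> (param_at a t) y < scl a * rad a" by linarith
  hence "\<rho> a y < scl a * rad a" using spherical_param_lt[OF assms(3)] spherical_ultra[of a y "param_at a t"] by simp
  note n = param_near[OF this]
  have "scl a * v (t - coord_at a y) <= scl a * r" using y spherical_param[OF assms(3) n(2)] n(1) by simp
  hence "v (coord_at a y - t) <= r" using scl_pos[of a] v_diff_commute[of t] by simp
  moreover have "coord_at a y \<in> K" using param_in_P1[OF K_sub assms(1), of "coord_at a y"] n(1) y by simp
  ultimately show "y \<in> param_at a ` {t' \<in> K. v (t' - t) <= r}" using n(1) by (intro image_eqI[of _ _ "coord_at a y"]) auto
 qed
 show "param_at a ` {t' \<in> K. v (t' - t) <= r} \<subseteq> bal (param_at a t) (scl a * r)"
 proof
  fix y assume "y \<in> param_at a ` {t' \<in> K. v (t' - t) <= r}"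
  then obtain t' where t': "t' \<in> K" "v (t' - t) <= r" "y = param_at a t'" by blast
  have "\<rho> (param_at a t) y = scl a * v (t - t')" using spherical_param[OF assms(3) ch[OF t'(2)]] t'(3) by simp
  hence "\<rho> (param_at a t) y <= scl a * r" using t'(2) scl_pos[of a] v_diff_commute[of t t'] by simp
  moreover have "y \<in> X" using param_in_P1[OF K_sub assms(1)] t' by simp
  ultimately show "y \<in> bal (param_at a t) (scl a * r)" using xX by simp
 qed
qed

lemma exact_param:
 assumes ab: "a \<in> X" "b \<in> X" and t: "t \<in> K" "v (t - ctr a) < rad a" and r: "0 < r" "r < rad a"
  and F: "!!x. x \<in> X ==> F x \<in> X"
  and FG: "!!t'. v (t' - t) <= r ==> F (param_at a t') = param_at b (G t')"
   "!!t'. v (t' - t) <= r ==> v (G t' - ctr b) < rad b"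
  and G: "lin {t'. v (t' - t) <= r} G s" and s: "0 < s" "s * r < rad b"
 shows "U.exact F (param_at a t) (scl a * r) (s * scl b / scl a)"
proof -
 have GK: "G t' \<in> K" if "t' \<in> K" "v (t' - t) <= r" for t'
 proof -
  have "param_at b (G t') \<in> X" using F[of "param_at a t'"] FG(1)[OF that(2)] param_in_P1[OF K_sub ab(1)] that(1) by metis
  thus ?thesis using param_in_P1[OF K_sub ab(2)] by blast
 qed
 have tt: "v (t - t) <= r" using r by simp
 have Ft: "F (param_at a t) = param_at b (G t)" by (rule FG(1)[OF tt])
 note mc = mcball_param[OF ab(1) t r(2)]
 have mc': "bal (param_at b (G t)) (scl b * (s * r)) = param_at b ` {t' \<in> K. v (t' - G t) <= s * r}"
  by (rule mcball_param[OF ab(2) GK[OF t(1) tt] FG(2)[OF tt] s(2)])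
 have e: "s * scl b / scl a * (scl a * r) = scl b * (s * r)" using scl_pos[of a] by simp
 have D: "v (G t' - G t'') = s * v (t' - t'')" if "v (t' - t) <= r" "v (t'' - t) <= r" for t' t''
  using lin_D[OF G] that by simp
 show ?thesis unfolding U.exact_def
 proof (intro conjI ballI)
  show "0 < s * scl b / scl a" using s scl_pos by simp
  show "F (param_at a t) \<in> X" using F param_in_P1[OF K_sub ab(1)] t(1) by blast
  fix y y' assume "y \<in> bal (param_at a t) (scl a * r)" "y' \<in> bal (param_at a t) (scl a * r)"
  then obtain w w' where w: "v (w - t) <= r" "y = param_at a w" "v (w' - t) <= r" "y' = param_at a w'" unfolding mc by blast
  have "v ((w - t) + (t - ctr a)) < rad a" "v ((w' - t) + (t - ctr a)) < rad a" using w t r by (intro v_add_less; simp)+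
  hence "\<rho> y y' = scl a * v (w - w')" using spherical_param[of w a w'] w by simp
  moreover have "\<rho> (F y) (F y') = scl b * (s * v (w - w'))"
   using spherical_param[OF FG(2)[OF w(1)] FG(2)[OF w(3)]] FG(1)[OF w(1)] FG(1)[OF w(3)] D[OF w(1,3)] w by simp
  ultimately show "\<rho> (F y) (F y') = s * scl b / scl a * \<rho> y y'" using scl_pos[of a] by simp
 next
  show "F ` bal (param_at a t) (scl a * r) = bal (F (param_at a t)) (s * scl b / scl a * (scl a * r))"
   unfolding e Ft mc mc'
  proof
   show "F ` param_at a ` {t' \<in> K. v (t' - t) <= r} \<subseteq> param_at b ` {t' \<in> K. v (t' - G t) <= s * r}"
   proof
    fix y assume "y \<in> F ` param_at a ` {t' \<in> K. v (t' - t) <= r}"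
    then obtain w where w: "w \<in> K" "v (w - t) <= r" "y = F (param_at a w)" by blast
    hence "y = param_at b (G w)" "G w \<in> K" "v (G w - G t) <= s * r" using FG(1) GK D[OF w(2) tt] s by auto
    thus "y \<in> param_at b ` {t' \<in> K. v (t' - G t) <= s * r}" by blast
   qed
   show "param_at b ` {t' \<in> K. v (t' - G t) <= s * r} \<subseteq> F ` param_at a ` {t' \<in> K. v (t' - t) <= r}"
   proof
    fix y assume "y \<in> param_at b ` {t' \<in> K. v (t' - G t) <= s * r}"
    then obtain z where z: "z \<in> K" "v (z - G t) <= s * r" "y = param_at b z" by blast
    then obtain w where "w \<in> K" "v (w - t) <= r" "G w = z"
     using lin_onto[OF K_sub K_compact t(1) r(1) s(1) G GK z(1,2)] by blast
    hence "y = F (param_at a w)" using z FG(1) by simp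
    thus "y \<in> F ` param_at a ` {t' \<in> K. v (t' - t) <= r}" using \<open>w \<in> K\<close> \<open>v (w - t) <= r\<close> by blast
   qed
  qed
 qed
qed

text \<open>All metric information on \<open>F\<close> at \<open>a\<close> in spherical distances.
  The estimates hold over the whole field; the two clauses on \<open>U.exact\<close> refer to
  \<open>K\<close>, hence their premises.\<close>

lemma local_structure:
 assumes F: "ratl d F" "1 <= d"
 obtains r A m L k mu l where "0 < r" "0 < A" "1 <= (m::nat)" "0 <= L" "0 < k" "k < 1" "0 < mu"
  "!!x. \<rho> a x <= r ==> \<rho> (F a) (F x) = A * \<rho> a x ^ m"
  "!!s x y. s <= r ==> \<rho> a x <= s ==> \<rho> a y <= s ==> \<rho> (F x) (F y) <= L * s ^ (m - 1) * \<rho> x y"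
  "!!x y. m = 1 ==> \<rho> a x <= r ==> \<rho> a y <= r ==> \<rho> (F x) (F y) = A * \<rho> x y"
  "!!l'. has_P1_derivative v F a l' \<longleftrightarrow> l' = l" "v l = (if m = 1 then A * scl a / scl (F a) else 0)"
  "!!x. a \<in> X ==> F ` X \<subseteq> X ==> x \<in> X ==> 0 < \<rho> a x ==> \<rho> a x <= r ==> U.exact F x (k * \<rho> a x) (mu * A * \<rho> a x ^ (m - 1))"
  "a \<in> X ==> F ` X \<subseteq> X ==> m = 1 ==> mu = 1 & U.exact F a r A"
proof -
 let ?t0 = "ctr a" and ?b = "F a"
 obtain G m h k L r where m: "1 <= (m::nat)" and r: "0 < r" "r < rad a" "r <= 1" "r * h < 1" and h: "0 < h" and k: "0 < k" "k < 1" and L: "0 <= L"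
  and G0: "G ?t0 = ctr ?b"
  and FG: "!!t. v (t - ?t0) <= r ==> F (param_at a t) = param_at ?b (G t)"
  and Gb: "!!t. v (t - ?t0) <= r ==> v (G t - ctr ?b) < rad ?b"
  and Gh: "!!t. v (t - ?t0) <= r ==> v (G t - ctr ?b) = h * v (t - ?t0) ^ m"
  and GL: "!!s t t'. s <= r ==> v (t - ?t0) <= s ==> v (t' - ?t0) <= s ==> v (G t - G t') <= L * s ^ (m - 1) * v (t - t')"
  and Gk: "!!t. v (t - ?t0) <= r ==> t ~= ?t0 ==>
    lin {t'. v (t' - t) <= k * v (t - ?t0)} G (v (of_nat m) * h * v (t - ?t0) ^ (m - 1))"
  and G1: "m = 1 ==> lin {t'. v (t' - ?t0) <= r} G h"
  and der: "EX l. v l = (if m = 1 then h else 0) & (ALL \<epsilon>>0. EX \<delta>>0. ALL t. t ~= ?t0 & v (t - ?t0) < \<delta> -->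
    v ((G t - ctr ?b) / (t - ?t0) - l) < \<epsilon>)"
  by (rule local_expansion[OF F, of a]) (rule that; assumption)
 have sa: "0 < scl a" and sb: "0 < scl ?b" by (rule scl_pos)+
 define A where "A = scl ?b * h / scl a ^ m"
 define R where "R = scl a * r"
 have crd: "EX t. x = param_at a t & \<rho> a x = scl a * v (t - ?t0) & v (t - ?t0) <= s" if x: "\<rho> a x <= scl a * s" "s <= r" for x s
 proof -
  have "scl a * s < scl a * rad a" using x(2) r(2) sa by simp
  hence lt: "\<rho> a x < scl a * rad a" using x(1) by linarith
  note n = param_near[OF lt]
  have e: "\<rho> a x = scl a * v (coord_at a x - ?t0)"
   using spherical_param[of ?t0 a "coord_at a x"] n rad_ge_1[of a] v_diff_commute[of ?t0] by simp
  hence "v (coord_at a x - ?t0) <= s" using x(1) sa by simp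
  thus ?thesis using n(1) e by (intro exI[of _ "coord_at a x"]) simp
 qed
 have crd2: "\<rho> (param_at a t) (param_at a t') = scl a * v (t - t')" "\<rho> (F (param_at a t)) (F (param_at a t')) = scl ?b * v (G t - G t')"
  if "v (t - ?t0) <= r" "v (t' - ?t0) <= r" for t t'
  using that r(2) spherical_param[of t a t'] spherical_param[OF Gb[OF that(1)] Gb[OF that(2)]] FG by auto
 have pm: "scl a ^ m = scl a * scl a ^ (m - 1)" using m by (cases m) auto
 obtain l where l: "v l = (if m = 1 then h else 0)" "!!\<epsilon>. 0 < \<epsilon> ==> EX \<delta>>0. ALL t. t ~= ?t0 & v (t - ?t0) < \<delta> -->
    v ((G t - ctr ?b) / (t - ?t0) - l) < \<epsilon>"
  using der by blast
 show ?thesis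
 proof (rule that[of R A m "L * scl ?b / scl a ^ m" k "v (of_nat m)" l])
  show "0 < R" "0 < A" "1 <= m" "0 <= L * scl ?b / scl a ^ m" "0 < k" "k < 1" "0 < v (of_nat m)"
   unfolding R_def A_def using sa sb r h L k m by auto
  show "\<rho> (F a) (F x) = A * \<rho> a x ^ m" if x: "\<rho> a x <= R" for x
  proof -
   obtain t where t: "x = param_at a t" "\<rho> a x = scl a * v (t - ?t0)" "v (t - ?t0) <= r" using crd[of x r] x unfolding R_def by auto
   have "\<rho> (F a) (F x) = scl ?b * v (G t - G ?t0)"
    using crd2(2)[of ?t0 t] t r v_diff_commute[of "G ?t0"] by simp
   also have "\<dots> = scl ?b * (h * v (t - ?t0) ^ m)" using Gh[OF t(3)] G0 by simp
   also have "\<dots> = A * \<rho> a x ^ m" unfolding t(2) A_def using sa by (simp add: power_mult_distrib)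
   finally show ?thesis .
  qed
  show "\<rho> (F x) (F y) <= L * scl ?b / scl a ^ m * s ^ (m - 1) * \<rho> x y" if s: "s <= R" "\<rho> a x <= s" "\<rho> a y <= s" for s x y
  proof -
   define s' where "s' = s / scl a"
   have s': "s = scl a * s'" "s' <= r" unfolding s'_def using sa s(1) unfolding R_def by (auto simp: field_simps)
   obtain t where t: "x = param_at a t" "v (t - ?t0) <= s'" using crd[of x s'] s s' by auto
   obtain t' where t': "y = param_at a t'" "v (t' - ?t0) <= s'" using crd[of y s'] s s' by auto
   have "\<rho> (F x) (F y) = scl ?b * v (G t - G t')" "\<rho> x y = scl a * v (t - t')" using crd2[of t t'] t t' s' by auto
   moreover have "scl ?b * v (G t - G t') <= scl ?b * (L * s' ^ (m - 1) * v (t - t'))" using GL[OF s'(2) t(2) t'(2)] sb by simp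
   ultimately show ?thesis unfolding s'(1) pm using sa by (simp add: power_mult_distrib field_simps)
  qed
  show "\<rho> (F x) (F y) = A * \<rho> x y" if s: "m = 1" "\<rho> a x <= R" "\<rho> a y <= R" for x y
  proof -
   obtain t where t: "x = param_at a t" "v (t - ?t0) <= r" using crd[of x r] s unfolding R_def by auto
   obtain t' where t': "y = param_at a t'" "v (t' - ?t0) <= r" using crd[of y r] s unfolding R_def by auto
   have "\<rho> (F x) (F y) = scl ?b * v (G t - G t')" "\<rho> x y = scl a * v (t - t')" using crd2[of t t'] t t' by auto
   moreover have "v (G t - G t') = h * v (t - t')" using lin_D[OF G1[OF s(1)], of t t'] t t' by simp
   ultimately show ?thesis using s(1) sa unfolding A_def by simp
  qed
  show "has_P1_derivative v F a l' \<longleftrightarrow> l' = l" for l'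
  proof
   have P: "EX \<delta>>0. ALL t. t ~= ?t0 & v (t - ?t0) < \<delta> -->
    v ((coord_at ?b (F (param_at a t)) - ctr ?b) / (t - ?t0) - l) < e" if e: "0 < e" for e
   proof -
    obtain \<delta> where \<delta>: "\<delta> > 0" "!!t. t ~= ?t0 ==> v (t - ?t0) < \<delta> ==> v ((G t - ctr ?b) / (t - ?t0) - l) < e"
     using l(2)[OF e] by blast
    show ?thesis by (intro exI[of _ "min \<delta> r"]) (use \<delta> r FG in auto)
   qed
   assume "has_P1_derivative v F a l'"
   note Q = this[unfolded has_P1_derivative_iff]
   show "l' = l"
   proof (rule ccontr)
    assume "l' ~= l"
    hence e: "0 < v (l' - l)" by simp
    obtain \<delta> where \<delta>: "\<delta> > 0" "!!t. t ~= ?t0 ==> v (t - ?t0) < \<delta> ==> v ((coord_at ?b (F (param_at a t)) - ctr ?b) / (t - ?t0) - l) < v (l' - l)"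
     using P[OF e] by blast
    obtain \<delta>' where \<delta>': "\<delta>' > 0" "!!t. t ~= ?t0 ==> v (t - ?t0) < \<delta>' ==> v ((coord_at ?b (F (param_at a t)) - ctr ?b) / (t - ?t0) - l') < v (l' - l)"
     using Q e by blast
    obtain n where n: "v (of_nat p ^ n :: 'c) < min \<delta> \<delta>'" using small_element[of "min \<delta> \<delta>'"] \<delta> \<delta>' by auto
    define t where "t = ?t0 + of_nat p ^ n"
    have t: "t ~= ?t0" "v (t - ?t0) < \<delta>" "v (t - ?t0) < \<delta>'" unfolding t_def using n p_gt_1 by auto
    have "v (((coord_at ?b (F (param_at a t)) - ctr ?b) / (t - ?t0) - l) - ((coord_at ?b (F (param_at a t)) - ctr ?b) / (t - ?t0) - l')) < v (l' - l)"
     by (rule v_diff_less[OF \<delta>(2)[OF t(1,2)] \<delta>'(2)[OF t(1,3)]])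
    thus False by simp
   qed
  next
   assume l': "l' = l"
   show "has_P1_derivative v F a l'" unfolding has_P1_derivative_iff l'
   proof (intro allI impI)
    fix e :: real assume e: "0 < e"
    obtain \<delta> where \<delta>: "\<delta> > 0" "!!t. t ~= ?t0 ==> v (t - ?t0) < \<delta> ==> v ((G t - ctr ?b) / (t - ?t0) - l) < e"
     using l(2)[OF e] by blast
    show "EX \<delta>>0. ALL t. t ~= ?t0 & v (t - ?t0) < \<delta> -->
      v ((coord_at ?b (F (param_at a t)) - ctr ?b) / (t - ?t0) - l) < e"
     by (intro exI[of _ "min \<delta> r"]) (use \<delta> r FG in auto)
   qed
  qed
  show "v l = (if m = 1 then A * scl a / scl (F a) else 0)" unfolding l(1) A_def using sa sb by simp
  show "U.exact F x (k * \<rho> a x) (v (of_nat m) * A * \<rho> a x ^ (m - 1))"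
   if a: "a \<in> X" and FX: "F ` X \<subseteq> X" and x: "x \<in> X" "0 < \<rho> a x" "\<rho> a x <= R" for x
  proof -
   obtain t where t: "x = param_at a t" "\<rho> a x = scl a * v (t - ?t0)" "v (t - ?t0) <= r" using crd[of x r] x unfolding R_def by auto
   define u where "u = v (t - ?t0)"
   have u: "0 < u" "u <= r" "t ~= ?t0" using x(2) t sa unfolding u_def by (auto simp: zero_less_mult_iff)
   have tK: "t \<in> K" using param_in_P1[OF K_sub a] x(1) t(1) by simp
   let ?s = "v (of_nat m) * h * u ^ (m - 1)"
   have near: "v (t' - ?t0) <= r" if "v (t' - t) <= k * u" for t'
   proof -
    have "k * u <= 1 * u" using k u by (intro mult_right_mono) auto
    hence "v (t' - t) <= r" using that u by linarith
    hence "v ((t' - t) + (t - ?t0)) <= r" by (rule v_add_le[OF _ t(3)])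
    thus ?thesis by simp
   qed
   have "U.exact F (param_at a t) (scl a * (k * u)) (?s * scl ?b / scl a)"
   proof (rule exact_param[OF a _ tK])
    show "F a \<in> X" using FX a by blast
    show "v (t - ?t0) < rad a" using t r by simp
    show "0 < k * u" using k u by simp
    have "k * u <= 1 * u" using k u by (intro mult_right_mono) auto
    thus "k * u < rad a" using u(2) r(2) by linarith
    show "lin {t'. v (t' - t) <= k * u} G ?s" using Gk[OF t(3) u(3)] unfolding u_def .
    show "0 < ?s" using m h u by simp
    have "v (of_nat m) * k * (h * u ^ m) <= 1 * 1 * (h * u ^ m)"
     using v_of_nat_le[of m] k h u by (intro mult_right_mono mult_mono) auto
    hence "?s * (k * u) <= h * u ^ m" using m by (cases m) (auto simp: algebra_simps)
    thus "?s * (k * u) < rad ?b" using Gb[OF t(3)] Gh[OF t(3)] unfolding u_def by simp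
   qed (use FX near FG Gb in auto)
   moreover have "scl a * (k * u) = k * \<rho> a x" unfolding t(2) u_def by simp
   moreover have "?s * scl ?b / scl a = v (of_nat m) * A * \<rho> a x ^ (m - 1)"
    unfolding t(2) u_def A_def pm using sa by (simp add: power_mult_distrib field_simps)
   ultimately show ?thesis using t(1) by simp
  qed
  show "v (of_nat m) = 1 & U.exact F a R A" if a: "a \<in> X" and FX: "F ` X \<subseteq> X" and m1: "m = 1"
  proof -
   have "U.exact F (param_at a ?t0) (scl a * r) (h * scl ?b / scl a)"
   proof (rule exact_param[OF a _ ctr_in[OF K_sub a]])
    show "F a \<in> X" using FX a by blast
    show "v (?t0 - ?t0) < rad a" using r by simp
    show "h * r < rad ?b" using r(4) rad_ge_1[of ?b] by (simp add: mult.commute)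
   qed (use FX r FG Gb G1 m1 h in auto)
   thus ?thesis using m1 unfolding R_def A_def by (simp add: mult.commute)
  qed
 qed
qed

end

section \<open>Fatou and Julia sets of rational maps\<close>

lemma finite_orbit:
 assumes "eventually_periodic T x" shows "finite (orbit T x)"
proof -
 obtain m n where mn: "n >= 1" "(T ^^ (m + n)) x = (T ^^ m) x" using assms unfolding eventually_periodic_def by blast
 have "EX j<m + n. (T ^^ k) x = (T ^^ j) x" for k
 proof (induction k rule: less_induct)
  case (less k)
  show ?case
  proof (cases "k < m + n")
   case False
   then obtain i where k: "k = i + (m + n)" using le_Suc_ex by (metis add.commute not_less)
   have "(T ^^ k) x = (T ^^ (i + m)) x" unfolding k funpow_add o_apply[of "T ^^ i"] using mn(2) by (simp add: funpow_add)
   thus ?thesis using less[of "i + m"] k mn(1) by auto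
  qed blast
 qed
 hence "orbit T x \<subseteq> (%j. (T ^^ j) x) ` {..<m + n}" unfolding orbit_def by fastforce
 thus ?thesis using finite_subset by blast
qed

context rat_dyn
begin

lemma P1_UNIV: "P1_of UNIV = (UNIV :: 'c P1 set)"
proof -
 have "y \<in> P1_of UNIV" for y :: "'c P1" unfolding P1_of_def by (cases y) auto
 thus ?thesis by blast
qed

lemma \<rho>_self [simp]: "\<rho> x x = 0" by simp

abbreviation "disc \<equiv> Metric_space.mball (P1_of UNIV) (spherical v)"

lemma in_disc: "x \<in> disc a r \<longleftrightarrow> \<rho> a x < r"
 using P1.in_mball[of x UNIV a r] unfolding P1_UNIV by simp

lemma near_point: assumes "0 < e" shows "EX x. 0 < \<rho> a x & \<rho> a x <= e"
proof -
 have "is_subfield (UNIV :: 'c set)" unfolding is_subfield_def by simp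
 from P1_perfect[OF this, of a "min e 1"] obtain y where "min e 1 / real p <= \<rho> a y" "\<rho> a y <= min e 1"
  using assms unfolding P1_UNIV by auto
 moreover have "0 < min e 1 / real p" using assms p_gt_1 by simp
 ultimately show ?thesis by (intro exI[of _ y]) linarith
qed

lemma near_point_X: assumes "a \<in> X" "0 < e" shows "EX x:X. 0 < \<rho> a x & \<rho> a x <= e"
proof -
 from P1_perfect[OF K_sub assms(1), of "min e 1"] obtain y where y: "y \<in> X" "min e 1 / real p <= \<rho> a y" "\<rho> a y <= min e 1"
  using assms by auto
 moreover have "0 < min e 1 / real p" using assms p_gt_1 by simp
 ultimately show ?thesis by (intro bexI[of _ y]) auto
qed

lemma small_power:
 assumes "0 < A" "0 < c" "2 <= (m::nat)" obtains e where "0 < e" "!!u. 0 < u ==> u <= e ==> A * u ^ m < c * (u::real)"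
proof (rule that[of "min 1 (c / (2 * A))"])
 show "0 < min 1 (c / (2 * A))" using assms by simp
 fix u :: real assume u: "0 < u" "u <= min 1 (c / (2 * A))"
 have "u ^ m <= u ^ 2" using u assms(3) by (intro power_decreasing) auto
 hence "A * u ^ m <= A * u * u" using assms(1) by (simp add: power2_eq_square)
 also have "\<dots> <= c / 2 * u"
 proof (rule mult_right_mono)
  have "A * u <= A * (c / (2 * A))" using u assms(1) by (intro mult_left_mono) auto
  thus "A * u <= c / 2" using assms(1) by simp
 qed (use u in simp)
 also have "\<dots> < c * u" using assms(2) u by simp
 finally show "A * u ^ m < c * u" .
qed

lemma one_point_lipschitz:
 assumes "ratl d F" "1 <= d" obtains r C where "0 < r" "0 < C" "!!x. \<rho> a x <= r ==> \<rho> (F a) (F x) <= C * \<rho> a x"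
proof -
 obtain r A m where s: "0 < r" "0 < A" "1 <= (m::nat)" "!!x. \<rho> a x <= r ==> \<rho> (F a) (F x) = A * \<rho> a x ^ m"
  by (rule local_structure[OF assms, of a]) (rule that; assumption)
 have "\<rho> (F a) (F x) <= A * \<rho> a x" if "\<rho> a x <= r" for x
 proof -
  have "\<rho> a x ^ m <= \<rho> a x ^ 1" using s(3) spherical_le_1[of a x] by (intro power_decreasing) auto
  thus ?thesis using s(2) s(4)[OF that] by simp
 qed
 thus ?thesis using that s by blast
qed

lemma continuous_iter: assumes "0 < e" shows "EX \<delta>>0. ALL y. \<rho> a y < \<delta> --> \<rho> ((T ^^ n) a) ((T ^^ n) y) < e"
proof -
 obtain d where d: "1 <= d" "ratl d (T ^^ n)" using ratl_iter by blast
 obtain r C where r: "0 < r" "0 < C" "!!x. \<rho> a x <= r ==> \<rho> ((T ^^ n) a) ((T ^^ n) x) <= C * \<rho> a x"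
  using one_point_lipschitz[OF d(2,1), of a] by blast
 have "\<rho> ((T ^^ n) a) ((T ^^ n) y) < e" if y: "\<rho> a y < min r (e / C)" for y
 proof -
  have "C * \<rho> a y < e" using y r(2) by (simp add: pos_less_divide_eq mult.commute)
  thus ?thesis using r(3)[of y] y by simp
 qed
 thus ?thesis using r assms by (intro exI[of _ "min r (e / C)"]) auto
qed

sublocale W: metric_dyn "P1_of UNIV" \<rho> "rat_map f g"
 by unfold_locales (use P1_UNIV continuous_iter[of _ _ 1] in auto)

lemma julia_forward: "x \<in> julia v UNIV T ==> (T ^^ n) x \<in> julia v UNIV T"
proof -
 have "julia v UNIV T = W.Jul"
  unfolding julia_def fatou_def equicontinuous_iterates_def W.Jul_def W.Fat_def W.equi_def ..
 thus "x \<in> julia v UNIV T ==> (T ^^ n) x \<in> julia v UNIV T" using W.Jul_forward by simp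
qed

lemma lipschitz_iterates:
 "EX s>0. EX C>0. ALL j<n. ALL x y. \<rho> a x <= s --> \<rho> a y <= s --> \<rho> ((T ^^ j) x) ((T ^^ j) y) <= C * \<rho> x y"
proof (induction n)
 case 0
 show ?case by (intro exI[of _ 1] conjI) auto
next
 case (Suc n)
 then obtain s C where s: "s > 0" "C > 0" "!!j x y. j < n ==> \<rho> a x <= s ==> \<rho> a y <= s ==> \<rho> ((T ^^ j) x) ((T ^^ j) y) <= C * \<rho> x y"
  by blast
 obtain d where d: "1 <= d" "ratl d (T ^^ n)" using ratl_iter by blast
 obtain r m L where r: "0 < r" "0 <= L" "!!s x y. s <= r ==> \<rho> a x <= s ==> \<rho> a y <= s ==> \<rho> ((T ^^ n) x) ((T ^^ n) y) <= L * s ^ (m - 1) * \<rho> x y"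
  by (rule local_structure[OF d(2,1), of a]) (rule that; assumption)
 define s' where "s' = min s r"
 define C' where "C' = C + L * s' ^ (m - 1)"
 have s': "0 < s'" "s' <= s" "s' <= r" unfolding s'_def using s r by auto
 have nn: "0 <= L * s' ^ (m - 1)" using r s' by simp
 have "\<rho> ((T ^^ j) x) ((T ^^ j) y) <= C' * \<rho> x y" if j: "j < Suc n" "\<rho> a x <= s'" "\<rho> a y <= s'" for j x y
 proof (cases "j = n")
  case True
  have "L * s' ^ (m - 1) * \<rho> x y <= C' * \<rho> x y" unfolding C'_def using s by (intro mult_right_mono) auto
  thus ?thesis using r(3)[OF s'(3) j(2,3)] unfolding True by linarith
 next
  case False
  have "C * \<rho> x y <= C' * \<rho> x y" unfolding C'_def using nn by (intro mult_right_mono) auto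
  thus ?thesis using s(3)[of j x y] j False s' by auto
 qed
 moreover have "0 < C'" unfolding C'_def using s nn by simp
 ultimately show ?case using s'(1) by blast
qed

text \<open>A non-expanding return map can be iterated at will; the fewer than \<open>n\<close>
  remaining steps cost one Lipschitz constant.\<close>

lemma fatou_nonexpanding:
 assumes n: "1 <= n" "(T ^^ n) a = a" and s: "0 < s"
  and ne: "!!x y. \<rho> a x <= s ==> \<rho> a y <= s ==> \<rho> ((T ^^ n) x) ((T ^^ n) y) <= \<rho> x y"
 shows "a \<in> fatou v UNIV T"
proof -
 obtain s' C where s': "s' > 0" "C > 0"
  "!!j x y. j < n ==> \<rho> a x <= s' ==> \<rho> a y <= s' ==> \<rho> ((T ^^ j) x) ((T ^^ j) y) <= C * \<rho> x y"
  using lipschitz_iterates[of n a] by blast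
 define t where "t = min s s'"
 let ?U = "disc a t"
 have it: "\<rho> a ((T ^^ (q * n)) x) <= t & (\<rho> a y <= t --> \<rho> ((T ^^ (q * n)) x) ((T ^^ (q * n)) y) <= \<rho> x y)"
  if "\<rho> a x <= t" for q x y
  using that
 proof (induction q arbitrary: x y)
  case (Suc q)
  have 1: "\<rho> a ((T ^^ n) z) <= t" if "\<rho> a z <= t" for z
  proof -
   have "\<rho> a z <= s" using that unfolding t_def by simp
   moreover have "\<rho> a a <= s" using s by simp
   ultimately have "\<rho> a ((T ^^ n) z) <= \<rho> a z" using ne[of a z] n(2) by simp
   thus ?thesis using that by linarith
  qed
  have e: "(T ^^ (Suc q * n)) z = (T ^^ (q * n)) ((T ^^ n) z)" for z by (simp add: add.commute[of n] funpow_add)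

  have 3: "\<rho> ((T ^^ (q * n)) ((T ^^ n) x)) ((T ^^ (q * n)) ((T ^^ n) y)) <= \<rho> x y" if "\<rho> a y <= t" for y
  proof -
   have "\<rho> ((T ^^ (q * n)) ((T ^^ n) x)) ((T ^^ (q * n)) ((T ^^ n) y)) <= \<rho> ((T ^^ n) x) ((T ^^ n) y)"
    using Suc.IH[OF 1[OF Suc.prems], of "(T ^^ n) y"] 1[OF that] by simp
   thus ?thesis using ne[of x y] Suc.prems that unfolding t_def by simp
  qed
  show ?case unfolding e using Suc.IH[OF 1[OF Suc.prems]] 3 by simp
 qed simp
 have "equicontinuous_iterates v T ?U" unfolding equicontinuous_iterates_def
 proof (intro ballI allI impI)
  fix x and e :: real assume x: "x \<in> ?U" and e: "0 < e"
  have "\<rho> ((T ^^ k) x) ((T ^^ k) y) < e" if y: "y \<in> ?U" "\<rho> x y < e / C" for y k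
  proof -
   have k: "k = k mod n + (k div n) * n" by simp
   have e': "(T ^^ k) z = (T ^^ (k mod n)) ((T ^^ (k div n * n)) z)" for z by (subst k, subst funpow_add) simp
   have xy: "\<rho> a x <= t" "\<rho> a y <= t" using x y unfolding in_disc by auto
   have l: "\<rho> a ((T ^^ (k div n * n)) x) <= s'" "\<rho> a ((T ^^ (k div n * n)) y) <= s'"
    using it[OF xy(1)] it[OF xy(2)] unfolding t_def by (simp_all add: min_le_iff_disj)
   have "k mod n < n" using n by simp
   have "\<rho> ((T ^^ k) x) ((T ^^ k) y) <= C * \<rho> ((T ^^ (k div n * n)) x) ((T ^^ (k div n * n)) y)"
    unfolding e' by (rule s'(3)[OF \<open>k mod n < n\<close> l])
   also have "\<dots> <= C * \<rho> x y" using it[OF xy(1)] xy(2) s'(2) by (intro mult_left_mono) auto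
   also have "\<dots> < e" using y(2) s'(2) by (simp add: pos_less_divide_eq mult.commute)
   finally show ?thesis .
  qed
  thus "EX \<delta>>0. ALL y:?U. \<rho> x y < \<delta> --> (ALL k. \<rho> ((T ^^ k) x) ((T ^^ k) y) < e)"
   using e s'(2) by (intro exI[of _ "e / C"]) auto
 qed
 moreover have "openin (P1_topology v UNIV) ?U" by (rule P1.openin_mball)
 moreover have "a \<in> ?U" unfolding in_disc t_def using s s' by simp
 ultimately show ?thesis unfolding fatou_def P1_UNIV by auto
qed

text \<open>With local degree at least 2, or with factor at most 1, the return map would be
  non-expanding near \<open>a\<close>, and \<open>a\<close> would be a Fatou point.\<close>

lemma julia_periodic:
 assumes a: "a \<in> julia v UNIV T" and n: "1 <= n" "(T ^^ n) a = a"
 obtains r A where "0 < r" "1 < A" "!!x. \<rho> a x <= r ==> \<rho> a ((T ^^ n) x) = A * \<rho> a x"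
proof -
 obtain d where d: "1 <= d" "ratl d (T ^^ n)" using ratl_iter by blast
 obtain r A m L where r: "0 < r" "0 < A" "1 <= (m::nat)" "0 <= L"
  and A: "!!x. \<rho> a x <= r ==> \<rho> ((T ^^ n) a) ((T ^^ n) x) = A * \<rho> a x ^ m"
  and L: "!!s x y. s <= r ==> \<rho> a x <= s ==> \<rho> a y <= s ==> \<rho> ((T ^^ n) x) ((T ^^ n) y) <= L * s ^ (m - 1) * \<rho> x y"
  and A1: "!!x y. m = 1 ==> \<rho> a x <= r ==> \<rho> a y <= r ==> \<rho> ((T ^^ n) x) ((T ^^ n) y) = A * \<rho> x y"
  by (rule local_structure[OF d(2,1), of a]) (rule that; assumption)
 have nf: "a ~: fatou v UNIV T" using a unfolding julia_def by blast
 have m1: "m = 1"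
 proof (rule ccontr)
  assume "m ~= 1"
  hence m2: "1 <= m - 1" using r(3) by simp
  define s where "s = min (min r 1) (1 / (L + 1))"
  have s: "0 < s" "s <= r" "s <= 1" "s <= 1 / (L + 1)" unfolding s_def using r by auto
  have "s ^ (m - 1) <= s ^ 1" using s m2 by (intro power_decreasing) auto
  hence "L * s ^ (m - 1) <= (L + 1) * (1 / (L + 1))" using s r(4) by (intro mult_mono) auto
  hence "L * s ^ (m - 1) <= 1" using r(4) by simp
  hence "\<rho> ((T ^^ n) x) ((T ^^ n) y) <= \<rho> x y" if "\<rho> a x <= s" "\<rho> a y <= s" for x y
   using L[OF s(2) that] mult_right_mono[of "L * s ^ (m - 1)" 1 "\<rho> x y"] by simp
  thus False using fatou_nonexpanding[OF n s(1)] nf by blast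
 qed
 have "1 < A"
 proof (rule ccontr)
  assume "~ 1 < A"
  hence "\<rho> ((T ^^ n) x) ((T ^^ n) y) <= \<rho> x y" if "\<rho> a x <= r" "\<rho> a y <= r" for x y
   using A1[OF m1 that] mult_right_mono[of A 1 "\<rho> x y"] by simp
  thus False using fatou_nonexpanding[OF n r(1)] nf by blast
 qed
 thus ?thesis using that[of r A] r(1) A m1 n(2) by simp
qed

lemma critical_order:
 assumes "critical_point v T a"
 obtains r A m where "0 < r" "0 < A" "2 <= (m::nat)" "!!x. \<rho> a x <= r ==> \<rho> (T a) (T x) = A * \<rho> a x ^ m"
proof -
 have d: "1 <= rat_degree f g" using deg by simp
 obtain r A m l where r: "0 < r" "0 < A" "1 <= (m::nat)"
  and A: "!!x. \<rho> a x <= r ==> \<rho> (T a) (T x) = A * \<rho> a x ^ m"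
  and l: "!!l'. has_P1_derivative v T a l' \<longleftrightarrow> l' = l" "v l = (if m = 1 then A * scl a / scl (T a) else 0)"
  by (rule local_structure[OF ratl_T d, of a]) (rule that; assumption)
 have "l = 0" using assms l(1) unfolding critical_point_def by simp
 hence "m ~= 1" using l(2) r scl_pos[of a] scl_pos[of "T a"] by (auto split: if_splits)
 thus ?thesis using that[of r A m] r A by simp
qed

lemma critical_iter:
 assumes "critical_point v T a" "1 <= n"
 obtains r C where "0 < r" "0 < C" "!!x. \<rho> a x <= r ==> \<rho> ((T ^^ n) a) ((T ^^ n) x) <= C * \<rho> a x ^ 2"
proof -
 obtain r A m where r: "0 < r" "0 < A" "2 <= (m::nat)" "!!x. \<rho> a x <= r ==> \<rho> (T a) (T x) = A * \<rho> a x ^ m"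
  using critical_order[OF assms(1)] by blast
 obtain k where k: "n = Suc k" using assms(2) by (cases n) auto
 obtain d where d: "1 <= d" "ratl d (T ^^ k)" using ratl_iter by blast
 obtain r' C where r': "0 < r'" "0 < C" "!!x. \<rho> (T a) x <= r' ==> \<rho> ((T ^^ k) (T a)) ((T ^^ k) x) <= C * \<rho> (T a) x"
  using one_point_lipschitz[OF d(2,1), of "T a"] by blast
 have "\<rho> ((T ^^ n) a) ((T ^^ n) x) <= (C * A) * \<rho> a x ^ 2" if x: "\<rho> a x <= min r (r' / A)" for x
 proof -
  have b: "\<rho> (T a) (T x) <= A * \<rho> a x ^ j" if "j <= 2" for j
  proof -
   have "\<rho> a x ^ m <= \<rho> a x ^ j" using that r(3) spherical_le_1[of a x] by (intro power_decreasing) auto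
   thus ?thesis using r(2) r(4)[of x] x by simp
  qed
  have "\<rho> (T a) (T x) <= r'" using b[of 1] x r(2) by (simp add: pos_le_divide_eq mult.commute)
  hence "\<rho> ((T ^^ k) (T a)) ((T ^^ k) (T x)) <= C * \<rho> (T a) (T x)" by (rule r'(3))
  also have "\<dots> <= C * (A * \<rho> a x ^ 2)" using b[of 2] r'(2) by (intro mult_left_mono) auto
  finally show ?thesis unfolding k by (simp add: funpow_swap1)
 qed
 thus ?thesis using that[of "min r (r' / A)" "C * A"] r r' by auto
qed

text \<open>At a critical point the return map is bounded by a quadratic term, against its linear
  growth with a factor above 1.\<close>

lemma julia_periodic_noncritical:
 assumes a: "a \<in> julia v UNIV T" and n: "1 <= n" "(T ^^ n) a = a"
 shows "~ critical_point v T a"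
proof
 assume c: "critical_point v T a"
 obtain r A where r: "0 < r" "1 < A" "!!x. \<rho> a x <= r ==> \<rho> a ((T ^^ n) x) = A * \<rho> a x"
  using julia_periodic[OF a n] by blast
 obtain r' C where r': "0 < r'" "0 < C" "!!x. \<rho> a x <= r' ==> \<rho> ((T ^^ n) a) ((T ^^ n) x) <= C * \<rho> a x ^ 2"
  using critical_iter[OF c n(1)] by blast
 obtain e where e: "0 < e" "!!u. 0 < u ==> u <= e ==> C * u ^ 2 < 1 * (u::real)"
  by (rule small_power[OF r'(2), of 1 2]) auto
 obtain x where x: "0 < \<rho> a x" "\<rho> a x <= min (min r r') e" using near_point[of "min (min r r') e" a] r r' e by auto
 have "A * \<rho> a x <= C * \<rho> a x ^ 2" using r(3)[of x] r'(3)[of x] x n(2) by simp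
 also have "\<dots> < \<rho> a x" using e(2)[OF x(1)] x(2) by simp
 finally show False using r(2) x(1) by simp
qed

text \<open>If the local degree is at least 2, distances from \<open>a\<close> shrink like a power,
  which no positive linear factor matches.\<close>

lemma critset_iff: assumes "a \<in> X" shows "a \<in> U.critset T \<longleftrightarrow> critical_point v T a"
proof -
 have d: "1 <= rat_degree f g" using deg by simp
 have FX: "T ` X \<subseteq> X" using T_X by blast
 obtain r A m mu l where r: "0 < r" "0 < A" "1 <= (m::nat)"
  and A: "!!x. \<rho> a x <= r ==> \<rho> (T a) (T x) = A * \<rho> a x ^ m"
  and l: "!!l'. has_P1_derivative v T a l' \<longleftrightarrow> l' = l" "v l = (if m = 1 then A * scl a / scl (T a) else 0)"
  and ex: "a \<in> X ==> T ` X \<subseteq> X ==> m = 1 ==> mu = 1 & U.exact T a r A"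
  by (rule local_structure[OF ratl_T d, of a]) blast
 show ?thesis
 proof (cases "m = 1")
  case True
  have "l ~= 0" using l(2) r scl_pos[of a] scl_pos[of "T a"] True by auto
  hence "~ critical_point v T a" using l(1) unfolding critical_point_def by simp
  moreover have "a ~: U.critset T" using ex[OF assms FX True] r(1) unfolding U.critset_def by blast
  ultimately show ?thesis by blast
 next
  case False
  hence "critical_point v T a" using l unfolding critical_point_def by simp
  moreover have "~ U.exact T a r' s" if r': "0 < r'" for r' s
  proof
   assume E: "U.exact T a r' s"
   obtain e where e: "0 < e" "!!u. 0 < u ==> u <= e ==> A * u ^ m < s * (u::real)"
    using small_power[OF r(2) U.exactD(1)[OF E], of m] False r(3) by auto
   obtain x where x: "x \<in> X" "0 < \<rho> a x" "\<rho> a x <= min (min r r') e"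
    using near_point_X[OF assms, of "min (min r r') e"] r r' e by auto
   have "\<rho> (T a) (T x) = s * \<rho> a x" using U.exactD(3)[OF E, of a x] x assms r' by simp
   thus False using A[of x] e(2)[OF x(2)] x(3) by simp
  qed
  ultimately show ?thesis using assms unfolding U.critset_def by blast
 qed
qed

lemma finite_critset_T: "finite (U.critset T)"
proof (rule U.finite_critset)
 fix z assume z: "z \<in> X"
 have d: "1 <= rat_degree f g" using deg by simp
 have FX: "T ` X \<subseteq> X" using T_X by blast
 obtain r A m k mu where r: "0 < r" "0 < k"
  and ex: "!!x. z \<in> X ==> T ` X \<subseteq> X ==> x \<in> X ==> 0 < \<rho> z x ==> \<rho> z x <= r ==> U.exact T x (k * \<rho> z x) (mu * A * \<rho> z x ^ (m - 1))"
  by (rule local_structure[OF ratl_T d, of z]) (rule that; assumption)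
 show "EX r>0. ALL x:X. 0 < \<rho> z x & \<rho> z x <= r --> (EX k>0. EX s. U.exact T x k s)"
 proof -
  have "EX k>0. EX s. U.exact T x k s" if "x \<in> X" "0 < \<rho> z x & \<rho> z x <= r" for x
  proof -
   have "U.exact T x (k * \<rho> z x) (mu * A * \<rho> z x ^ (m - 1))" "0 < k * \<rho> z x" using that ex[OF z FX] r by auto
   thus ?thesis by blast
  qed
  thus ?thesis using r(1) by blast
 qed
qed

definition "Q = (\<Union>c\<in>crit_star v K T. orbit T c)"

lemma QE: assumes "z \<in> Q" obtains c k where "c \<in> crit_star v K T" "z = (T ^^ k) c"
 using assms unfolding Q_def orbit_def by blast

lemma QI: "c \<in> crit_star v K T ==> (T ^^ k) c \<in> Q"
 unfolding Q_def orbit_def by blast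

lemma Q_X: "z \<in> Q ==> z \<in> X" and Q_julia: "z \<in> Q ==> z \<in> julia v UNIV T"
 by (auto elim!: QE simp: crit_star_def iter_X julia_forward)

lemma Q_T: "z \<in> Q ==> T z \<in> Q"
 using QI[of _ "Suc _"] by (auto elim!: QE)

lemma finite_Q: assumes "sub_hyperbolic v T" shows "finite Q"
proof -
 have "crit_star v K T \<subseteq> U.critset T" using critset_iff unfolding crit_star_def by blast
 hence "finite (crit_star v K T)" using finite_critset_T finite_subset by blast
 moreover have "finite (orbit T c)" if "c \<in> crit_star v K T" for c
 proof (rule finite_orbit)
  have "critical_point v T c" "c \<in> julia v UNIV T" using that unfolding crit_star_def by auto
  thus "eventually_periodic T c" using assms[unfolded sub_hyperbolic_def, rule_format, of c] by simp
 qed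
 ultimately show ?thesis unfolding Q_def by (rule finite_UN_I)
qed

end

section \<open>The Schwarz lemma\<close>

context nonarch
begin

abbreviation lprod :: "'c list => 'c => 'c" where
 "lprod A t \<equiv> prod_list (map (%a. t - a) A)"

lemma lprod_mono:
 "(!!a. a \<in> set A ==> v (t - a) <= v (t' - a)) ==> v (lprod A t) <= v (lprod A t')"
 by (induction A) (auto simp: v_mult intro!: mult_mono)

lemma lprod_le_1: "(!!a. a \<in> set A ==> v (t - a) <= 1) ==> v (lprod A t) <= 1"
 by (induction A) (auto simp: v_mult intro!: mult_le_one)

lemma lprod_eq_1:
 "(!!a. a \<in> set A ==> v (t - a) <= 1) ==> v (lprod A t) = 1 ==> a \<in> set A ==> v (t - a) = 1"
proof (induction A)
 case (Cons b A)
 have e: "v (t - b) * v (lprod A t) = 1" using Cons.prems(2) by (simp add: v_mult)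
 have l: "v (lprod A t) <= 1" "v (t - b) <= 1" using Cons.prems(1) by (auto intro: lprod_le_1)
 have "v (t - b) * v (lprod A t) <= v (lprod A t)" "v (t - b) * v (lprod A t) <= v (t - b)"
  using l by (simp_all add: mult_left_le_one_le mult_right_le_one_le)
 hence "v (t - b) = 1" "v (lprod A t) = 1" using e l by linarith+
 thus ?case using Cons by auto
qed simp

lemma lprod_gt_1:
 "(!!a. a \<in> set A ==> 1 < v (t - a)) ==> A ~= [] ==> 1 < v (lprod A t)"
proof (induction A)
 case (Cons b A)
 show ?case
 proof (cases "A = []")
  case False
  hence "1 < v (lprod A t)" using Cons by auto
  moreover have "1 < v (t - b)" using Cons.prems by simp
  ultimately have "1 * 1 < v (t - b) * v (lprod A t)" by (intro mult_strict_mono) auto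
  thus ?thesis by (simp add: v_mult)
 qed (use Cons.prems in simp)
qed simp

lemma v_far: "v (t - w) < v (a - w) ==> v (t - a) = v (a - w)"
 using v_dominant[of "t - w" "- (a - w)"] by (simp add: v_diff_commute algebra_simps)

end

context cp_field
begin

lemma factorization: "EX c A. ALL t. poly (R :: 'c poly) t = c * lprod A t"
proof (induction "degree R" arbitrary: R rule: less_induct)
 case less
 show ?case
 proof (cases "degree R = 0")
  case True
  then obtain c where "R = [:c:]" by (rule degree_eq_zeroE)
  thus ?thesis by (intro exI[of _ c] exI[of _ "[]"]) simp
 next
  case False
  then obtain x where x: "poly R x = 0" using root_exists[of R] by auto
  have "degree (synthetic_div R x) < degree R" using False by (simp add: degree_synthetic_div)
  then obtain c A where "!!t. poly (synthetic_div R x) t = c * lprod A t" using less by blast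
  hence "poly R t = c * lprod (x # A) t" for t
   by (subst split_root[OF x]) (simp add: algebra_simps)
  thus ?thesis by blast
 qed
qed

text \<open>
 A point of the sphere of radius \<open>v \<sigma>\<close> at maximal distance from finitely many given points is
 obtained from a solution \<open>z\<close> of \<open>\<Prod>(z - \<beta>) = 1\<close>, where the \<open>\<beta>\<close> are the given points rescaled
 into the unit disk.
\<close>

lemma generic_point:
 assumes "\<sigma> ~= 0"
 shows "EX t. v (t - w) = v \<sigma> & (ALL a:set A. v (a - w) <= v \<sigma> --> v (t - a) = v \<sigma>)"
proof -
 define B where "B = 0 # map (%a. (a - w) / \<sigma>) (filter (%a. v (a - w) <= v \<sigma>) A)"
 have vs: "0 < v \<sigma>" using assms by simp
 have B: "v b <= 1" if "b \<in> set B" for b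
  using that vs unfolding B_def by (auto simp: v_divide divide_le_eq)
 define P where "P = prod_list (map (%b. [:- b, 1:]) B)"
 have P: "poly (prod_list (map (%b. [:- b, 1:]) B)) z = lprod B z" for z and B :: "'c list"
  by (induction B) (auto simp: algebra_simps)
 have dP: "degree (prod_list (map (%b. [:- b, 1 :: 'c:]) B)) = length B & prod_list (map (%b. [:- b, 1:]) B) ~= 0" for B :: "'c list"
  by (induction B) (auto simp: degree_mult_eq simp del: mult_pCons_left)
 have "length B = Suc (length B - 1)" unfolding B_def by simp
 hence "degree P = Suc (length B - 1)" unfolding P_def using dP[of B] by metis
 hence "0 < degree (P - 1)" by (metis degree_1 degree_add_eq_left diff_conv_add_uminus degree_minus zero_less_Suc)
 then obtain z where "poly (P - 1) z = 0" using root_exists by blast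
 hence z: "lprod B z = 1" unfolding P_def by (simp add: P)
 have "v z <= 1"
 proof (rule ccontr)
  assume g: "~ v z <= 1"
  have g1: "1 < v (z - b)" if "b \<in> set B" for b
   using v_dominant[of "- b" z] B[OF that] g by simp
  have "B ~= []" unfolding B_def by simp
  hence "1 < v (lprod B z)" using lprod_gt_1[OF g1] by blast
  thus False using z by simp
 qed
 hence "v (z - b) <= 1" if "b \<in> set B" for b using B[OF that] by (intro v_diff_le)
 hence zb: "v (z - b) = 1" if "b \<in> set B" for b using lprod_eq_1[of B z b] z that by simp
 have "v (w + \<sigma> * z - w) = v \<sigma>" using zb[of 0] unfolding B_def by (simp add: v_mult)
 moreover have "v (w + \<sigma> * z - a) = v \<sigma>" if a: "a \<in> set A" "v (a - w) <= v \<sigma>" for a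
 proof -
  have "(a - w) / \<sigma> \<in> set B" unfolding B_def using a by auto
  hence "v (z - (a - w) / \<sigma>) = 1" by (rule zb)
  moreover have "w + \<sigma> * z - a = \<sigma> * (z - (a - w) / \<sigma>)" using assms by (simp add: field_simps)
  ultimately show ?thesis by (simp add: v_mult)
 qed
 ultimately show ?thesis by blast
qed

text \<open>Replace \<open>t\<close> by a point of the sphere that is as far as possible from every
  zero in the disk; its distance to each zero is at least that of \<open>t\<close>.\<close>

lemma max_principle:
 assumes s: "\<sigma> ~= 0" and M: "!!t. v (t - w) = v \<sigma> ==> v (poly R t) <= M" and t: "v (t - w) <= v \<sigma>"
 shows "v (poly R t) <= M"
proof -
 obtain c A where R: "!!t. poly R t = c * lprod A t" using factorization by blast
 obtain t' where t': "v (t' - w) = v \<sigma>" "!!a. a \<in> set A ==> v (a - w) <= v \<sigma> ==> v (t' - a) = v \<sigma>"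
  using generic_point[OF s, of w A] by blast
 have "v (t - a) <= v (t' - a)" if a: "a \<in> set A" for a
 proof (cases "v (a - w) <= v \<sigma>")
  case True
  have "v ((t - w) - (a - w)) <= v \<sigma>" by (rule v_diff_le[OF t True])
  thus ?thesis using t'(2)[OF a True] by simp
 next
  case False
  thus ?thesis using v_far[of t w a] v_far[of t' w a] t t'(1) by simp
 qed
 hence "v (poly R t) <= v (poly R t')" unfolding R v_mult by (intro mult_left_mono lprod_mono) auto
 thus ?thesis using M[OF t'(1)] by linarith
qed

text \<open>All zeros are farther from \<open>w\<close> than \<open>t\<close> is, so
  \<open>t\<close> and \<open>w\<close> have the same distance to each of them.\<close>

lemma zero_free_const:
 assumes "!!t. v (t - w) <= s ==> poly E t ~= 0" "v (t - w) <= s"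
 shows "v (poly E t) = v (poly E w)"
proof -
 obtain c A where R: "!!t. poly E t = c * lprod A t" using factorization by blast
 have "v (t - a) = v (w - a)" if a: "a \<in> set A" for a
 proof -
  have "lprod A a = 0" using a by (simp add: prod_list_zero_iff image_iff)
  hence "poly E a = 0" unfolding R by simp
  hence "s < v (a - w)" using assms(1)[of a] by (meson not_less)
  thus ?thesis using v_far[of t w a] assms(2) v_diff_commute[of a w] by simp
 qed
 hence "v (lprod A t) = v (lprod A w)" by (intro antisym lprod_mono) auto
 thus ?thesis unfolding R v_mult by simp
qed

text \<open>Divide by the \<open>k\<close>-th power of \<open>t - w\<close> and apply
  \<open>max_principle\<close> to the quotient, which is bounded on the sphere of radius
  \<open>v \<sigma>\<close>.\<close>

lemma schwarz:
 assumes s: "\<sigma> ~= 0" and R: "q = [:- w, 1:] ^ k * R" and M: "!!t. v (t - w) <= v \<sigma> ==> v (poly q t) <= M"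
  and t: "v (t - w) <= v \<sigma>"
 shows "v (poly q t) <= M / v \<sigma> ^ k * v (t - w) ^ k"
proof -
 have vs: "0 < v \<sigma>" using s by simp
 have q: "v (poly q t) = v (t - w) ^ k * v (poly R t)" for t unfolding R by (simp add: poly_power v_mult v_power)
 have "v (poly R t) <= M / v \<sigma> ^ k"
 proof (rule max_principle[OF s _ t])
  fix t assume t: "v (t - w) = v \<sigma>"
  thus "v (poly R t) <= M / v \<sigma> ^ k" using M[of t] vs unfolding q by (simp add: pos_le_divide_eq mult.commute)
 qed
 thus ?thesis unfolding q using mult_left_mono[of "v (poly R t)" "M / v \<sigma> ^ k" "v (t - w) ^ k"] by (simp add: mult.commute)
qed

text \<open>The strict inequality excludes zeros of \<open>E\<close>, so \<open>E\<close> has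
  constant absolute value; a larger value of \<open>N\<close> would turn it into an
  equality.\<close>

lemma norm_const_aux:
 assumes nz: "!!t. poly N t ~= 0 \<or> poly E t ~= 0" and le: "v (poly N w) <= v (poly E w)"
  and h: "!!t. v (t - w) <= s ==> v (poly N w * poly E t - poly N t * poly E w) <
   max (v (poly N w)) (v (poly E w)) * max (v (poly N t)) (v (poly E t))"
  and t: "v (t - w) <= s"
 shows "max (v (poly N t)) (v (poly E t)) = max (v (poly N w)) (v (poly E w))"
proof -
 have "poly E t ~= 0" if "v (t - w) <= s" for t
 proof
  assume "poly E t = 0"
  thus False using h[OF that] le by (simp add: v_mult mult.commute)
 qed
 hence Et: "v (poly E t) = v (poly E w)" using zero_free_const t by blast
 have "v (poly N t) <= v (poly E w)"
 proof (rule ccontr)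
  assume g: "~ v (poly N t) <= v (poly E w)"
  have E0: "0 < v (poly E w)" using nz[of w] le by (metis v_eq_0 v_nonneg v_pos order_antisym)
  have "v (poly N w) * v (poly E t) <= v (poly E w) * v (poly E w)" unfolding Et using le by (intro mult_right_mono) auto
  also have "\<dots> < v (poly N t) * v (poly E w)" using g E0 by (intro mult_strict_right_mono) auto
  finally have "v (- (poly N t * poly E w) + poly N w * poly E t) = v (poly N t) * v (poly E w)"
   by (subst v_dominant) (simp_all add: v_mult)
  hence "v (poly N w * poly E t - poly N t * poly E w) = v (poly N t) * v (poly E w)" by (simp add: algebra_simps)
  thus False using h[OF t] le g Et by (simp add: mult.commute)
 qed
 thus ?thesis using Et le by simp
qed

text \<open>With representatives of constant norm on the disk, the spherical distance of two image
  points becomes the absolute value of one polynomial up to a constant. Swapping \<open>N\<close>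
  and \<open>E\<close> exchanges the two cases.\<close>

lemma norm_const:
 assumes nz: "!!t. poly N t ~= 0 \<or> poly E t ~= 0"
  and h: "!!t. v (t - w) <= s ==> spherical v (pt (poly N w) (poly E w)) (pt (poly N t) (poly E t)) < 1"
  and t: "v (t - w) <= s"
 shows "max (v (poly N t)) (v (poly E t)) = max (v (poly N w)) (v (poly E w))"
proof -
 have h': "v (poly N w * poly E t - poly N t * poly E w) < max (v (poly N w)) (v (poly E w)) * max (v (poly N t)) (v (poly E t))"
  if "v (t - w) <= s" for t
 proof -
  have p: "0 < max (v (poly N t)) (v (poly E t))" for t using nz[of t] by (auto simp: less_max_iff_disj)
  show ?thesis using h[OF that] p[of w] p[of t] unfolding spherical_pt[OF nz nz] by (simp add: divide_less_eq)
 qed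
 show ?thesis
 proof (cases "v (poly N w) <= v (poly E w)")
  case True
  thus ?thesis using norm_const_aux[OF nz _ h' t] by blast
 next
  case False
  have "max (v (poly E t)) (v (poly N t)) = max (v (poly E w)) (v (poly N w))"
  proof (rule norm_const_aux[OF _ _ _ t])
   show "poly E t ~= 0 \<or> poly N t ~= 0" for t using nz[of t] by blast
   show "v (poly E w) <= v (poly N w)" using False by simp
   show "v (poly E w * poly N t - poly E t * poly N w) < max (v (poly E w)) (v (poly N w)) * max (v (poly E t)) (v (poly N t))"
    if "v (t - w) <= s" for t
    using h'[OF that] v_diff_commute[of "poly E w * poly N t"] by (simp add: max.commute mult.commute)
  qed
  thus ?thesis by (simp add: max.commute)
 qed
qed

end

context rat_dyn
begin

text \<open>Equicontinuity bounds, uniformly in \<open>n\<close>, the polynomial that expresses the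
  distance to the image of \<open>z\<close> on the disk of radius \<open>v \<pi>\<close>.
  Criticality gives it a double zero, so points within \<open>v \<sigma>\<close> have images within
  \<open>v \<sigma> ^ 2 / (2 * v \<pi> ^ 2)\<close>. A second Schwarz estimate, with a simple zero
  at \<open>w\<close>, yields the factor \<open>v \<sigma> / (2 * v \<pi> ^ 2)\<close>; the choice
  of \<open>\<sigma>\<close> makes it at most half of \<open>scl z\<close>.\<close>

lemma fatou_critical_contracting:
 assumes crit: "critical_point v T z" and fat: "z \<in> fatou v UNIV T"
 shows "EX t>0. ALL n>=1. ALL x y. \<rho> z x <= t --> \<rho> z y <= t --> \<rho> ((T ^^ n) x) ((T ^^ n) y) <= 1 / 2 * \<rho> x y"
proof -
 let ?t0 = "ctr z"
 have sz: "0 < scl z" by (rule scl_pos)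
 obtain U where U: "openin (P1_topology v UNIV) U" "z \<in> U" "equicontinuous_iterates v T U"
  using fat unfolding fatou_def by blast
 obtain e where e: "e > 0" "!!y. \<rho> z y < e ==> y \<in> U"
  using U(1,2) unfolding P1.openin_mtopology subset_iff in_disc by blast
 obtain \<delta> where \<delta>: "\<delta> > 0" "!!y n. y \<in> U ==> \<rho> z y < \<delta> ==> \<rho> ((T ^^ n) z) ((T ^^ n) y) < 1 / 2"
  using U(2,3) unfolding equicontinuous_iterates_def by (metis half_gt_zero zero_less_one)
 define e' where "e' = min (min e \<delta> / scl z) (rad z)"
 have "0 < e'" unfolding e'_def using e(1) \<delta>(1) sz rad_ge_1[of z] by simp
 then obtain k where k: "v (of_nat p ^ k :: 'c) < e'" using small_element by blast
 define \<pi> where "\<pi> = (of_nat p ^ k :: 'c)"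
 have \<pi>: "\<pi> ~= 0" "v \<pi> < min e \<delta> / scl z" "v \<pi> < rad z" using k p_gt_1 unfolding \<pi>_def e'_def by auto
 have vp: "0 < v \<pi>" using \<pi>(1) by simp
 have "0 < min (v \<pi>) (v \<pi> ^ 2 * scl z)" using vp sz by simp
 then obtain j where j: "v (of_nat p ^ j :: 'c) < min (v \<pi>) (v \<pi> ^ 2 * scl z)" using small_element by blast
 define \<sigma> where "\<sigma> = (of_nat p ^ j :: 'c)"
 have \<sigma>: "\<sigma> ~= 0" "v \<sigma> <= v \<pi>" "v \<sigma> <= v \<pi> ^ 2 * scl z" using j p_gt_1 unfolding \<sigma>_def by auto
 have vs: "0 < v \<sigma>" using \<sigma>(1) by simp
 have main: "\<rho> ((T ^^ n) (param_at z t)) ((T ^^ n) (param_at z w)) <= 1 / 2 * (scl z * v (t - w))"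
  if n: "1 <= n" and t: "v (t - ?t0) <= v \<sigma>" and w: "v (w - ?t0) <= v \<sigma>" for n t w
 proof -
  obtain d where "ratl d (T ^^ n)" using ratl_iter by blast
  then obtain F G where FG: "form d F G" "T ^^ n = rmap d F G" unfolding ratl_def by blast
  obtain N E where NE: "!!t. (T ^^ n) (param_at z t) = pt (poly N t) (poly E t)" "!!t. poly N t ~= 0 \<or> poly E t ~= 0"
   using rmap_param[OF FG(1), of z] unfolding FG(2) by blast
  define c where "c = max (v (poly N ?t0)) (v (poly E ?t0))"
  have c: "0 < c" unfolding c_def using NE(2)[of ?t0] by (auto simp: less_max_iff_disj)
  have half: "\<rho> (pt (poly N ?t0) (poly E ?t0)) (pt (poly N t) (poly E t)) < 1 / 2" if t: "v (t - ?t0) <= v \<pi>" for t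
  proof -
   have "\<rho> z (param_at z t) = scl z * v (t - ?t0)"
    using spherical_param[of ?t0 z t] t \<pi>(3) rad_ge_1[of z] v_diff_commute[of t] by simp
   also have "\<dots> <= scl z * v \<pi>" using t sz by simp
   also have "\<dots> < min e \<delta>" using \<pi>(2) sz by (simp add: pos_less_divide_eq mult.commute)
   finally have "\<rho> ((T ^^ n) z) ((T ^^ n) (param_at z t)) < 1 / 2" using e(2) \<delta>(2) by simp
   thus ?thesis using NE(1)[of t] NE(1)[of ?t0] by simp
  qed
  have nc: "max (v (poly N t)) (v (poly E t)) = c" if t: "v (t - ?t0) <= v \<pi>" for t
  proof -
   have "\<rho> (pt (poly N ?t0) (poly E ?t0)) (pt (poly N t) (poly E t)) < 1" if "v (t - ?t0) <= v \<pi>" for t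
    using half[OF that] by simp
   thus ?thesis unfolding c_def by (rule norm_const[OF NE(2) _ t])
  qed
  \<comment> \<open>The wedge of the images of \<open>t\<close> and \<open>w\<close>, as a
    polynomial in \<open>t\<close>; it vanishes at \<open>w\<close>.\<close>
  define q where "q w = smult (poly E w) N - smult (poly N w) E" for w
  have \<rho>q: "\<rho> ((T ^^ n) (param_at z t)) ((T ^^ n) (param_at z w)) = v (poly (q w) t) / c ^ 2"
   if "v (t - ?t0) <= v \<pi>" "v (w - ?t0) <= v \<pi>" for t w
   unfolding NE(1) spherical_pt[OF NE(2) NE(2)] nc[OF that(1)] nc[OF that(2)] q_def
   by (simp add: power2_eq_square mult.commute)
  have qw: "poly (q w) w = 0" for w unfolding q_def by simp
  have bound: "v (poly (q ?t0) t) <= c ^ 2 / 2" if t: "v (t - ?t0) <= v \<pi>" for t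
  proof -
   have "\<rho> ((T ^^ n) (param_at z t)) ((T ^^ n) (param_at z ?t0)) < 1 / 2"
    using half[OF t] unfolding NE(1) by (simp only: spherical_commute)
   thus ?thesis using \<rho>q[OF t, of ?t0] vp c by (simp add: divide_less_eq)
  qed
  define R1 where "R1 = synthetic_div (q ?t0) ?t0"
  have R1: "q ?t0 = [:- ?t0, 1:] * R1" unfolding R1_def by (rule split_root[OF qw])
  \<comment> \<open>A simple zero would make the distance linear in \<open>v (t - ctr z)\<close>,
    contrary to the quadratic bound at a critical point.\<close>
  have "poly R1 ?t0 = 0"
  proof (rule ccontr)
   assume nz: "poly R1 ?t0 ~= 0"
   obtain r where r: "r > 0" "!!t. v (t - ?t0) <= r ==> v (poly R1 t) = v (poly R1 ?t0)" using poly_nonzero_near[OF nz] by blast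
   obtain r' C where r': "0 < r'" "0 < C" "!!x. \<rho> z x <= r' ==> \<rho> ((T ^^ n) z) ((T ^^ n) x) <= C * \<rho> z x ^ 2"
    using critical_iter[OF crit n] by blast
   define a where "a = v (poly R1 ?t0)"
   have a: "0 < a" unfolding a_def using nz by simp
   have C1: "0 < c ^ 2 * C * scl z ^ 2" using c r' sz by simp
   obtain e0 where e0: "0 < e0" "!!u. 0 < u ==> u <= e0 ==> c ^ 2 * C * scl z ^ 2 * u ^ 2 < a * u"
    using small_power[OF C1 a, of 2] by auto
   define e1 where "e1 = min (min e0 r) (min (r' / scl z) (v \<pi>))"
   have "0 < e1" unfolding e1_def using e0 r r' sz vp by simp
   then obtain i where i: "v (of_nat p ^ i :: 'c) < e1" using small_element by blast
   define u where "u = v (of_nat p ^ i :: 'c)"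
   define t where "t = ?t0 + of_nat p ^ i"
   have tu: "v (t - ?t0) = u" "0 < u" "u <= e0" "u <= r" "u <= r' / scl z" "u <= v \<pi>"
    using i p_gt_1 unfolding t_def u_def e1_def by auto
   have zt: "\<rho> z (param_at z t) = scl z * u"
    using spherical_param[of ?t0 z t] tu \<pi>(3) rad_ge_1[of z] v_diff_commute[of t] by simp
   have "scl z * u <= r'" using tu(5) sz by (simp add: pos_le_divide_eq mult.commute)
   hence 1: "\<rho> ((T ^^ n) z) ((T ^^ n) (param_at z t)) <= C * (scl z * u) ^ 2" using r'(3)[of "param_at z t"] zt by simp
   have "poly (q ?t0) t = (t - ?t0) * poly R1 t" by (subst R1) (simp add: algebra_simps)
   hence "v (poly (q ?t0) t) = u * a" using r(2)[of t] tu by (simp add: v_mult a_def)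
   hence "\<rho> ((T ^^ n) z) ((T ^^ n) (param_at z t)) = u * a / c ^ 2"
    using \<rho>q[of t ?t0] tu vp by (simp add: spherical_commute)
   hence "u * a <= C * (scl z * u) ^ 2 * c ^ 2" using 1 c by (simp add: pos_divide_le_eq)
   thus False using e0(2)[OF tu(2,3)] by (simp add: power_mult_distrib algebra_simps)
  qed
  then obtain R2 where "R1 = [:- ?t0, 1:] * R2" using split_root by blast
  hence R2: "q ?t0 = [:- ?t0, 1:] ^ 2 * R2" using R1 by (simp only: power2_eq_square mult.assoc)
  have small: "\<rho> ((T ^^ n) (param_at z t)) ((T ^^ n) z) <= v \<sigma> ^ 2 / (2 * v \<pi> ^ 2)" if t: "v (t - ?t0) <= v \<sigma>" for t
  proof -
   have tp: "v (t - ?t0) <= v \<pi>" using t \<sigma>(2) by linarith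
   have "v (poly (q ?t0) t) <= c ^ 2 / 2 / v \<pi> ^ 2 * v (t - ?t0) ^ 2" by (rule schwarz[OF \<pi>(1) R2 bound tp])
   also have "\<dots> <= c ^ 2 / 2 / v \<pi> ^ 2 * v \<sigma> ^ 2" using t by (intro mult_left_mono power_mono) auto
   finally show ?thesis using \<rho>q[OF tp, of ?t0] vp c by (simp add: pos_divide_le_eq algebra_simps)
  qed
  have dsk: "v (x - ?t0) <= v \<sigma>" if "v (x - w) <= v \<sigma>" for x
  proof -
   have "v ((x - w) + (w - ?t0)) <= v \<sigma>" by (rule v_add_le[OF that w])
   thus ?thesis by simp
  qed
  have bw: "v (poly (q w) x) <= c ^ 2 * (v \<sigma> ^ 2 / (2 * v \<pi> ^ 2))" if x: "v (x - w) <= v \<sigma>" for x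
  proof -
   have le: "v (x - ?t0) <= v \<pi>" "v (w - ?t0) <= v \<pi>" using dsk[OF x] w \<sigma>(2) by auto
   have "\<rho> ((T ^^ n) (param_at z x)) ((T ^^ n) (param_at z w)) <= v \<sigma> ^ 2 / (2 * v \<pi> ^ 2)"
    using small[OF dsk[OF x]] small[OF w] spherical_ultra[of "(T ^^ n) (param_at z x)" "(T ^^ n) (param_at z w)" "(T ^^ n) z"]
     spherical_commute[of "(T ^^ n) z"] by simp
   thus ?thesis unfolding \<rho>q[OF le] using c by (simp add: pos_divide_le_eq mult.commute)
  qed
  have tw: "v (t - w) <= v \<sigma>"
  proof -
   have "v ((t - ?t0) - (w - ?t0)) <= v \<sigma>" by (rule v_diff_le[OF t w])
   thus ?thesis by simp
  qed
  have Rw: "q w = [:- w, 1:] ^ 1 * synthetic_div (q w) w" using split_root[OF qw] by simp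
  have le: "v (t - ?t0) <= v \<pi>" "v (w - ?t0) <= v \<pi>" using t w \<sigma>(2) by auto
  have "v (poly (q w) t) <= c ^ 2 * (v \<sigma> ^ 2 / (2 * v \<pi> ^ 2)) / v \<sigma> ^ 1 * v (t - w) ^ 1"
   by (rule schwarz[OF \<sigma>(1) Rw bw tw])
  also have "\<dots> = c ^ 2 * (v \<sigma> / (2 * v \<pi> ^ 2)) * v (t - w)" using vs by (simp add: power2_eq_square)
  finally have "\<rho> ((T ^^ n) (param_at z t)) ((T ^^ n) (param_at z w)) <= v \<sigma> / (2 * v \<pi> ^ 2) * v (t - w)"
   unfolding \<rho>q[OF le] using c by (simp add: pos_divide_le_eq mult.commute mult.left_commute)
  also have "\<dots> <= scl z / 2 * v (t - w)"
   using \<sigma>(3) vp by (intro mult_right_mono) (auto simp: divide_le_eq mult.commute)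
  finally show ?thesis by simp
 qed
 show ?thesis
 proof (intro exI[of _ "scl z * v \<sigma>"] conjI allI impI)
  show "0 < scl z * v \<sigma>" using sz vs by simp
  fix n x y assume n: "1 <= (n::nat)" and xy: "\<rho> z x <= scl z * v \<sigma>" "\<rho> z y <= scl z * v \<sigma>"
  have lt: "scl z * v \<sigma> < scl z * rad z" using \<sigma>(2) \<pi>(3) sz by simp
  have ch: "EX t. x = param_at z t & v (t - ?t0) <= v \<sigma> & v (t - ?t0) < rad z" if x: "\<rho> z x <= scl z * v \<sigma>" for x
  proof -
   have "\<rho> z x < scl z * rad z" using x lt by linarith
   note nn = param_near[OF this]
   have "scl z * v (coord_at z x - ?t0) <= scl z * v \<sigma>"
    using spherical_param[of ?t0 z "coord_at z x"] nn rad_ge_1[of z] v_diff_commute[of ?t0] x by simp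
   thus ?thesis using nn sz by (intro exI[of _ "coord_at z x"]) simp
  qed
  obtain t where t: "x = param_at z t" "v (t - ?t0) <= v \<sigma>" "v (t - ?t0) < rad z" using ch[OF xy(1)] by blast
  obtain w where w: "y = param_at z w" "v (w - ?t0) <= v \<sigma>" "v (w - ?t0) < rad z" using ch[OF xy(2)] by blast
  show "\<rho> ((T ^^ n) x) ((T ^^ n) y) <= 1 / 2 * \<rho> x y"
   using main[OF n t(2) w(2)] spherical_param[OF t(3) w(3)] unfolding t(1) w(1) by simp
 qed
qed

end

section \<open>Periodic points in isometric balls\<close>

context cp_field
begin

text \<open>\<open>H\<close> minus the identity is Lipschitz with constant below 1, so
  \<open>H\<close> is an isometry; the displacements along an orbit then all agree with the first up
  to the factor \<open>\<theta>\<close>, and they add up.\<close>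

lemma near_id_iterates:
 assumes S: "!!t. t \<in> S ==> H t \<in> S" and \<theta>: "0 <= \<theta>" "\<theta> < 1"
  and H: "!!t t'. t \<in> S ==> t' \<in> S ==> v ((H t - t) - (H t' - t')) <= \<theta> * v (t - t')"
 shows "t \<in> S ==> (H ^^ k) t \<in> S"
  and "t \<in> S ==> t' \<in> S ==> v (((H ^^ k) t - t) - ((H ^^ k) t' - t')) <= \<theta> * v (t - t')"
  and "t \<in> S ==> v (((H ^^ k) t - t) - of_nat k * (H t - t)) <= \<theta> * v (H t - t)"
proof -
 show inS: "(H ^^ k) t \<in> S" if "t \<in> S" for t k using that S by (induction k) auto
 have iso: "v (H t - H t') = v (t - t')" if t: "t \<in> S" "t' \<in> S" for t t'
 proof (cases "t = t'")
  case False
  have "\<theta> * v (t - t') < 1 * v (t - t')" using \<theta> False by (intro mult_strict_right_mono) auto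
  hence "v ((H t - t) - (H t' - t')) < v (t - t')" using H[OF t] by linarith
  hence "v ((t - t') + ((H t - t) - (H t' - t'))) = v (t - t')" by (rule v_dominant)
  thus ?thesis by (simp add: algebra_simps)
 qed simp
 have iso': "v ((H ^^ k) t - (H ^^ k) t') = v (t - t')" if "t \<in> S" "t' \<in> S" for t t' k
  using that by (induction k) (auto simp: iso inS)
 show "v (((H ^^ k) t - t) - ((H ^^ k) t' - t')) <= \<theta> * v (t - t')" if "t \<in> S" "t' \<in> S"
 proof (induction k)
  case 0 thus ?case using \<theta> by simp
 next
  case (Suc k)
  have "v ((H ((H ^^ k) t) - (H ^^ k) t) - (H ((H ^^ k) t') - (H ^^ k) t')) <= \<theta> * v (t - t')"
   using H[OF inS[OF that(1)] inS[OF that(2)], of k k] iso'[OF that] by simp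
  from v_add_le[OF this Suc] show ?case by (simp add: algebra_simps)
 qed
 assume t: "t \<in> S"
 have d: "v ((H ^^ k) t - t) <= v (H t - t)" for k
 proof (induction k)
  case (Suc k)
  have "v (H ((H ^^ k) t) - H t) <= v (H t - t)" using iso[OF inS[OF t] t] Suc by simp
  from v_add_le[OF this order_refl] show ?case by simp
 qed simp
 show "v (((H ^^ k) t - t) - of_nat k * (H t - t)) <= \<theta> * v (H t - t)"
 proof (induction k)
  case 0 thus ?case using \<theta> by simp
 next
  case (Suc k)
  have "v ((H ((H ^^ k) t) - (H ^^ k) t) - (H t - t)) <= \<theta> * v (H t - t)"
   using H[OF inS[OF t] t, of k] mult_left_mono[OF d \<theta>(1), of k] by linarith
  from v_add_le[OF this Suc] show ?case by (simp add: algebra_simps)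
 qed
qed

text \<open>
 A map that is closer to the identity than \<open>v p\<close> has no periodic points except fixed points: if
 \<open>H\<^sup>n z = z\<close> then \<open>0 = n (H z - z)\<close> up to an error smaller than \<open>v p v (H z - z)\<close>.
\<close>

lemma near_id_periodic:
 assumes "!!t. t \<in> S ==> H t \<in> S" "0 <= \<theta>" "\<theta> < 1 / real p"
  and "!!t t'. t \<in> S ==> t' \<in> S ==> v ((H t - t) - (H t' - t')) <= \<theta> * v (t - t')"
  and "z \<in> S" "1 <= n" "(H ^^ n) z = z"
 shows "H z = z"
 using assms
proof (induction n arbitrary: H rule: less_induct)
 case (less n)
 have \<theta>1: "\<theta> < 1"
 proof -
  have "1 / real p < 1" using p_gt_1 by simp
  thus ?thesis using less.prems(3) by linarith
 qed
 have it: "(H ^^ k) t \<in> S" "v (((H ^^ k) t - t) - of_nat k * (H t - t)) <= \<theta> * v (H t - t)" if "t \<in> S" for t k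
  using near_id_iterates(1,3)[of S H \<theta> t k] less.prems(1,2,4) \<theta>1 that by blast+
 have it2: "v (((H ^^ k) t - t) - ((H ^^ k) t' - t')) <= \<theta> * v (t - t')" if "t \<in> S" "t' \<in> S" for t t' k
  using near_id_iterates(2)[of S H \<theta> t t' k] less.prems(1,2,4) \<theta>1 that by blast
 have big: "H z = z" if "\<theta> < v (of_nat k)" "(H ^^ k) z = z" for k
 proof (rule ccontr)
  assume "H z ~= z"
  hence pos: "0 < v (H z - z)" by simp
  have "v (of_nat k * (H z - z)) <= \<theta> * v (H z - z)" using it(2)[OF less.prems(5), of k] that(2) by simp
  hence "v (of_nat k) * v (H z - z) <= \<theta> * v (H z - z)" by (simp only: v_mult)
  thus False using pos that(1) by (simp add: mult_le_cancel_right)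
 qed
 show ?case
 proof (cases "p dvd n")
  case False
  thus ?thesis using big[of n] v_of_nat_coprime[OF False] \<theta>1 less.prems(7) by simp
 next
  case True
  \<comment> \<open>A factor \<open>p\<close> of the period is removed by passing to
    \<open>H ^^ p\<close>, again close to the identity. That \<open>H ^^ p\<close> fixes
    \<open>z\<close> then suffices, since \<open>\<theta>\<close> is below the absolute value of
    \<open>p\<close>.\<close>
  then obtain m where m: "n = p * m" by (rule dvdE)
  have "m ~= 0" using m less.prems(6) by (metis mult_0_right not_one_le_zero)
  hence m1: "1 <= m" "m < n" unfolding m using p_gt_1 n_less_m_mult_n[of m p] by simp_all
  have pm: "((H ^^ p) ^^ m) z = z" using less.prems(7) unfolding m by (simp add: funpow_mult mult.commute)
  have "(H ^^ p) z = z"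
   by (rule less.IH[OF m1(2) it(1) less.prems(2,3) it2 less.prems(5) m1(1) pm])
  thus ?thesis using big[of p] less.prems(3) v_p by simp
 qed
qed

lemma close_indices:
 assumes K: "bseq_compact K" and a: "!!n. \<alpha> n \<in> K" "!!n. v (\<alpha> n) <= A"
  and b: "!!n. \<beta> n \<in> K" "!!n. v (\<beta> n) <= B" and e: "0 < e"
 obtains i j where "i < (j::nat)" "v (\<alpha> i - \<alpha> j) <= e" "v (\<beta> i - \<beta> j) <= e"
proof -
 obtain l r where "l \<in> K" and r: "strict_mono (r::nat=>nat)" "!!e. 0 < e ==> EX N. ALL n>=N. v (\<alpha> (r n) - l) < e"
  by (rule bseq_compactD[OF K, of \<alpha> A]) (rule a, rule a, (rule that; assumption))
 obtain m s where "m \<in> K" and s: "strict_mono (s::nat=>nat)" "!!e. 0 < e ==> EX N. ALL n>=N. v (\<beta> (r (s n)) - m) < e"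
  by (rule bseq_compactD[OF K, of "%n. \<beta> (r n)" B]) (rule b, rule b, (rule that; assumption))
 obtain N where N: "ALL n>=N. v (\<alpha> (r n) - l) < e" using r(2)[OF e] by blast
 obtain N' where N': "ALL n>=N'. v (\<beta> (r (s n)) - m) < e" using s(2)[OF e] by blast
 define n where "n = max N N'"
 have sn: "s n >= n" "s (Suc n) >= Suc n" using seq_suble[OF s(1)] by auto
 have 1: "v (\<alpha> (r (s n)) - l) <= e" "v (\<alpha> (r (s (Suc n))) - l) <= e"
  using N sn unfolding n_def by (simp_all add: less_imp_le)
 have 2: "v (\<beta> (r (s n)) - m) <= e" "v (\<beta> (r (s (Suc n))) - m) <= e"
  using N' unfolding n_def by (simp_all add: less_imp_le)
 show ?thesis
 proof (rule that[of "r (s n)" "r (s (Suc n))"])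
  show "r (s n) < r (s (Suc n))" using r(1) s(1) by (simp add: strict_mono_less)
  show "v (\<alpha> (r (s n)) - \<alpha> (r (s (Suc n)))) <= e" using v_diff_le[OF 1] by simp
  show "v (\<beta> (r (s n)) - \<beta> (r (s (Suc n)))) <= e" using v_diff_le[OF 2] by simp
 qed
qed

lemma accumulation:
 assumes K: "bseq_compact K" and Z: "infinite Z" "Z \<subseteq> {t \<in> K. v (t - w) <= R}" and e: "0 < e" "e <= R"
 obtains y where "y \<in> K" "v (y - w) <= R" "infinite {t \<in> Z. v (t - y) <= e}"
proof -
 obtain \<sigma> :: "nat => 'c" where \<sigma>: "inj \<sigma>" "range \<sigma> \<subseteq> Z" using Z(1) infinite_countable_subset by blast
 have \<sigma>Z: "\<sigma> n \<in> Z" for n using \<sigma>(2) by blast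
 have "v (\<sigma> n) <= max R (v w)" for n using disk_bounded \<sigma>Z[of n] Z(2) by blast
 then obtain l r where l: "l \<in> K" "strict_mono (r::nat=>nat)" "!!e. 0 < e ==> EX N. ALL n>=N. v (\<sigma> (r n) - l) < e"
  using bseq_compactD[OF K, of \<sigma> "max R (v w)"] \<sigma>Z Z(2) by blast
 obtain N where N: "ALL n>=N. v (\<sigma> (r n) - l) < e" using l(3)[OF e(1)] by blast
 show ?thesis
 proof (rule that[OF l(1)])
  have "v (\<sigma> (r N) - w) <= R" using \<sigma>Z Z(2) by blast
  moreover have "v (\<sigma> (r N) - l) <= R" using N e(2) by (meson less_imp_le order_refl order_trans)
  ultimately have "v ((\<sigma> (r N) - w) - (\<sigma> (r N) - l)) <= R" by (rule v_diff_le)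
  thus "v (l - w) <= R" by simp
  have "(\<sigma> \<circ> r) ` {N..} \<subseteq> {t \<in> Z. v (t - l) <= e}" using N \<sigma>Z by (auto simp: less_imp_le)
  moreover have "inj (\<sigma> \<circ> r)" using \<sigma>(1) strict_mono_imp_inj_on[OF l(2)] by (simp add: inj_compose)
  hence "infinite ((\<sigma> \<circ> r) ` {N..})" using finite_imageD[of "\<sigma> \<circ> r" "{N..}"] infinite_Ici[of N] by (meson inj_on_subset subset_UNIV)
  ultimately show "infinite {t \<in> Z. v (t - l) <= e}" using finite_subset by blast
 qed
qed

text \<open>Infinitely many periodic points accumulate at some \<open>y\<close>. By compactness two
  iterates agree up to \<open>\<eta>\<close> both at \<open>y\<close> and in their difference
  quotient between \<open>y\<close> and a nearby \<open>y1\<close>. So \<open>G ^^ (j - i)\<close>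
  maps a small ball about \<open>(G ^^ i) y\<close> to itself with all difference quotients within
  \<open>\<theta>\<close> of 1, and its periodic points there are fixed.\<close>

lemma isometry_fixed:
 fixes w :: 'c and R :: real
 assumes K: "is_subfield K" "bseq_compact K"
 defines "D \<equiv> {t \<in> K. v (t - w) <= R}"
 assumes R: "0 < R" and GD: "!!t. t \<in> D ==> G t \<in> D"
  and iso: "!!t t'. t \<in> D ==> t' \<in> D ==> v (G t - G t') = v (t - t')"
  and C: "1 <= C"
  and \<Psi>: "!!t t'. t \<in> D ==> t' \<in> D ==> G t - G t' = \<Psi> t t' * (t - t')"
   "!!t t' s s'. t \<in> D ==> t' \<in> D ==> s \<in> D ==> s' \<in> D ==> v (\<Psi> t t' - \<Psi> s s') <= C * max (v (t - s)) (v (t' - s'))"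
  and inf: "infinite {t \<in> D. EX k>=1. (G ^^ k) t = t}"
 shows "EX l>=1. infinite {t \<in> D. (G ^^ l) t = t}"
proof -
 have p0: "0 < 1 / real p" using p_gt_1 by simp
 \<comment> \<open>Makes \<open>\<theta> = C * \<eta>\<close> smaller than \<open>1 / p\<close>, the
   threshold of \<open>near_id_periodic\<close>.\<close>
 define \<eta> where "\<eta> = min R (1 / real p / (2 * C))"
 define \<theta> where "\<theta> = C * \<eta>"
 have \<eta>: "0 < \<eta>" "\<eta> <= R" unfolding \<eta>_def using R C p0 by auto
 have \<theta>: "0 <= \<theta>" "\<theta> < 1 / real p" "\<eta> <= \<theta>"
 proof -
  have "C * \<eta> <= C * (1 / real p / (2 * C))" unfolding \<eta>_def using C by (intro mult_left_mono) auto
  also have "\<dots> = 1 / real p / 2" using C by simp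
  finally have "\<theta> <= 1 / real p / 2" unfolding \<theta>_def .
  moreover have "x / 2 < x" if "0 < x" for x :: real using that by simp
  ultimately show "\<theta> < 1 / real p" using p0 by (meson le_less_trans)
  show "0 <= \<theta>" "\<eta> <= \<theta>" unfolding \<theta>_def using C \<eta> mult_right_mono[of 1 C \<eta>] by auto
 qed
 define Z where "Z = {t \<in> D. EX k>=1. (G ^^ k) t = t}"
 obtain y where y: "y \<in> K" "v (y - w) <= R" "infinite {t \<in> Z. v (t - y) <= \<eta>}"
  by (rule accumulation[OF K(2) inf[folded Z_def] _ \<eta>]) (auto simp: Z_def D_def)
 have yD: "y \<in> D" unfolding D_def using y by simp
 have "infinite ({t \<in> Z. v (t - y) <= \<eta>} - {y})" using y(3) by simp
 then obtain y1 where y1: "y1 \<in> Z" "v (y1 - y) <= \<eta>" "y1 ~= y" using infinite_imp_nonempty by blast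
 have y1D: "y1 \<in> D" using y1 unfolding Z_def by simp
 have itD: "(G ^^ k) t \<in> D" if "t \<in> D" for k t using that GD by (induction k) auto
 have itiso: "v ((G ^^ k) t - (G ^^ k) t') = v (t - t')" if "t \<in> D" "t' \<in> D" for k t t'
  using that by (induction k) (auto simp: iso itD)
 have unit: "v (\<Psi> t t') = 1" if t: "t \<in> D" "t' \<in> D" "t ~= t'" for t t'
 proof -
  have "v (\<Psi> t t') * v (t - t') = v (t - t')" using \<Psi>(1)[OF t(1,2)] iso[OF t(1,2)] by (simp only: v_mult)
  thus ?thesis using t(3) by simp
 qed
 define q where "q k t t' = ((G ^^ k) t - (G ^^ k) t') / (t - t')" for k t t'
 have q1: "v (q k t t') = 1" if "t \<in> D" "t' \<in> D" "t ~= t'" for k t t'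
  using itiso[OF that(1,2)] that(3) unfolding q_def by (simp add: v_divide)
 \<comment> \<open>The constant does not grow with \<open>k\<close>: all difference quotients have
   absolute value 1, so in the product rule each term keeps the bound.\<close>
 have qlip: "v (q k t t' - q k s s') <= C * max (v (t - s)) (v (t' - s'))"
  if D: "t \<in> D" "t' \<in> D" "s \<in> D" "s' \<in> D" and ne: "t ~= t'" "s ~= s'" for k t t' s s'
 proof (induction k)
  case 0
  have "0 <= C * max (v (t - s)) (v (t' - s'))" using C by (intro mult_nonneg_nonneg) (auto simp: le_max_iff_disj)
  thus ?case unfolding q_def using ne by simp
 next
  case (Suc k)
  let ?\<psi> = "%t t'. \<Psi> ((G ^^ k) t) ((G ^^ k) t')"
  have step: "q (Suc k) t t' = ?\<psi> t t' * q k t t'" if "t \<in> D" "t' \<in> D" for t t'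
   unfolding q_def using \<Psi>(1)[OF itD[OF that(1), of k] itD[OF that(2), of k]] by simp
  have nek: "(G ^^ k) t ~= (G ^^ k) t'" using itiso[OF D(1,2), of k] ne(1) by (metis eq_iff_diff_eq_0 v_eq_0)
  have "v (?\<psi> t t' - ?\<psi> s s') <= C * max (v (t - s)) (v (t' - s'))"
   using \<Psi>(2)[OF itD[OF D(1), of k] itD[OF D(2), of k] itD[OF D(3), of k] itD[OF D(4), of k]] itiso[OF D(1,3)] itiso[OF D(2,4)] by simp
  hence 1: "v ((?\<psi> t t' - ?\<psi> s s') * q k s s') <= C * max (v (t - s)) (v (t' - s'))" using q1[OF D(3,4) ne(2)] by (simp add: v_mult)
  have 2: "v (?\<psi> t t' * (q k t t' - q k s s')) <= C * max (v (t - s)) (v (t' - s'))"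
   using unit[OF itD[OF D(1)] itD[OF D(2)] nek] Suc by (simp add: v_mult)
  from v_add_le[OF 1 2] show ?case unfolding step[OF D(1,2)] step[OF D(3,4)] by (simp add: algebra_simps)
 qed
 have itK: "(G ^^ k) t \<in> K" if "t \<in> D" for k t using itD[OF that] unfolding D_def by blast
 have bd: "v ((G ^^ k) y) <= max R (v w)" for k using disk_bounded itD[OF yD, of k] unfolding D_def by blast
 have qK: "q k y y1 \<in> K" for k
  unfolding q_def using is_subfieldD(7,8)[OF K(1)] itK[OF yD] itK[OF y1D] yD y1D unfolding D_def by simp
 have q1': "v (q k y y1) <= 1" for k using q1[OF yD y1D] y1(3) by simp
 obtain i j where ij: "i < j" "v ((G ^^ i) y - (G ^^ j) y) <= \<eta>" "v (q i y y1 - q j y y1) <= \<eta>"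
  by (rule close_indices[OF K(2) itK[OF yD] bd qK q1' \<eta>(1)])
 define l where "l = j - i"
 define H where "H = G ^^ l"
 define c where "c = (G ^^ i) y"
 define c1 where "c1 = (G ^^ i) y1"
 define S where "S = {t \<in> D. v (t - c) <= \<eta>}"
 have cD: "c \<in> D" "c1 \<in> D" unfolding c_def c1_def using itD yD y1D by auto
 have j: "(G ^^ l) ((G ^^ i) t) = (G ^^ j) t" for t
  using ij(1) unfolding l_def by (metis add_diff_inverse_nat add.commute comp_apply funpow_add less_imp_le_nat not_less)
 have cc1: "v (c1 - c) = v (y1 - y)" unfolding c_def c1_def by (rule itiso[OF y1D yD])
 hence "v (c1 - c) ~= 0" using y1(3) by simp
 hence cc: "v (c1 - c) <= \<eta>" "c ~= c1" using cc1 y1(2) by auto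
 have HS: "H t \<in> S" if "t \<in> S" for t
 proof -
  have t: "t \<in> D" "v (t - c) <= \<eta>" using that unfolding S_def by auto
  have "v (H t - H c) <= \<eta>" using itiso[OF t(1) cD(1)] t(2) unfolding H_def by simp
  moreover have "v (H c - c) <= \<eta>" unfolding H_def c_def j using ij(2) by (subst v_diff_commute)
  ultimately have "v ((H t - H c) + (H c - c)) <= \<eta>" by (rule v_add_le)
  thus ?thesis using itD[OF t(1)] unfolding S_def H_def by simp
 qed
 have qc: "v (q l c c1 - 1) <= \<theta>"
 proof -
  have nz: "(G ^^ i) y - (G ^^ i) y1 ~= 0" using cc(2) unfolding c_def c1_def by simp
  have "q l c c1 - 1 = (q j y y1 - q i y y1) / q i y y1"
  proof -
   have alg: "A / B - 1 = (A / \<delta> - B / \<delta>) / (B / \<delta>)" if "B ~= 0" "\<delta> ~= 0" for A B \<delta> :: 'c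
    using that by (simp add: field_simps)
   have "y - y1 ~= 0" using y1(3) by simp
   from alg[OF nz this] show ?thesis unfolding q_def c_def c1_def j .
  qed
  hence "v (q l c c1 - 1) = v (q i y y1 - q j y y1)"
   using q1[OF yD y1D, of i] y1(3) v_diff_commute[of "q j y y1"] by (simp add: v_divide)
  thus ?thesis using ij(3) \<theta>(3) by linarith
 qed
 have near: "v ((H t - t) - (H t' - t')) <= \<theta> * v (t - t')" if t: "t \<in> S" "t' \<in> S" for t t'
 proof (cases "t = t'")
  case False
  have D: "t \<in> D" "t' \<in> D" "v (t - c) <= \<eta>" "v (t' - c) <= \<eta>" using t unfolding S_def by auto
  have "v ((t' - c) - (c1 - c)) <= \<eta>" by (rule v_diff_le[OF D(4) cc(1)])
  hence "max (v (t - c)) (v (t' - c1)) <= \<eta>" using D(3) by simp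
  hence "C * max (v (t - c)) (v (t' - c1)) <= \<theta>" unfolding \<theta>_def using C by (intro mult_left_mono) auto
  hence "v (q l t t' - q l c c1) <= \<theta>" using qlip[OF D(1,2) cD False cc(2), of l] by linarith
  hence "v ((q l t t' - q l c c1) + (q l c c1 - 1)) <= \<theta>" using qc by (rule v_add_le)
  hence "v (q l t t' - 1) * v (t - t') <= \<theta> * v (t - t')" by (intro mult_right_mono) auto
  moreover have "(H t - t) - (H t' - t') = (q l t t' - 1) * (t - t')" unfolding q_def H_def using False by (simp add: field_simps)
  ultimately show ?thesis by (simp only: v_mult)
 qed simp
 have fix_: "H s = s" if s: "s \<in> (G ^^ i) ` {t \<in> Z. v (t - y) <= \<eta>}" for s
 proof -
  obtain t k where t: "t \<in> D" "v (t - y) <= \<eta>" "1 <= k" "(G ^^ k) t = t" "s = (G ^^ i) t" using s unfolding Z_def by blast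
  have "s \<in> S" unfolding S_def t(5) c_def using itiso[OF t(1) yD] itD[OF t(1)] t(2) by simp
  have "(G ^^ k) s = s" unfolding t(5) using t(4) by (metis add.commute comp_apply funpow_add)
  hence "((G ^^ k) ^^ l) s = s" by (induction l) auto
  hence "(H ^^ k) s = s" unfolding H_def by (simp add: funpow_mult mult.commute)
  thus ?thesis using near_id_periodic[OF HS \<theta>(1,2) near \<open>s \<in> S\<close> t(3)] by blast
 qed
 have "inj_on (G ^^ i) {t \<in> Z. v (t - y) <= \<eta>}"
 proof (rule inj_onI)
  fix s t assume "s \<in> {t \<in> Z. v (t - y) <= \<eta>}" "t \<in> {t \<in> Z. v (t - y) <= \<eta>}" and e: "(G ^^ i) s = (G ^^ i) t"
  hence "s \<in> D" "t \<in> D" unfolding Z_def by auto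
  hence "v (s - t) = 0" using itiso[of s t i] e by simp
  thus "s = t" by simp
 qed
 hence "infinite ((G ^^ i) ` {t \<in> Z. v (t - y) <= \<eta>})" using y(3) finite_imageD by blast
 moreover have "(G ^^ i) ` {t \<in> Z. v (t - y) <= \<eta>} \<subseteq> {t \<in> D. (G ^^ l) t = t}"
  using fix_ itD unfolding H_def Z_def by auto
 ultimately have "infinite {t \<in> D. (G ^^ l) t = t}" using finite_subset by blast
 moreover have "1 <= l" using ij(1) unfolding l_def by simp
 ultimately show ?thesis by blast
qed

end

context rat_dyn
begin

text \<open>When \<open>a\<close> is infinity the coordinate is \<open>E / N\<close>;
  \<open>N\<close> does not vanish because the image stays in the chart.\<close>

lemma coordinate_rational:
 assumes F: "ratl d F" and G: "!!t. t \<in> D ==> F (param_at a t) = param_at a (G t)"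
 obtains N E where "!!t. t \<in> D ==> poly E t ~= 0 & G t = poly N t / poly E t"
proof -
 obtain f' g' where fg: "form d f' g'" "F = rmap d f' g'" using F unfolding ratl_def by blast
 obtain N E where NE: "!!t. F (param_at a t) = pt (poly N t) (poly E t)" "!!t. poly N t ~= 0 \<or> poly E t ~= 0"
  using rmap_param[OF fg(1), of a] unfolding fg(2) by blast
 have e: "pt (poly N t) (poly E t) = param_at a (G t)" if "t \<in> D" for t using NE(1) G[OF that] by simp
 show ?thesis
 proof (cases a)
  case (Fin y)
  have "poly E t ~= 0 & G t = poly N t / poly E t" if "t \<in> D" for t
   using e[OF that] unfolding Fin pt_def by (auto split: if_splits)
  thus ?thesis using that by blast
 next
  case Infty
  have "poly N t ~= 0 & G t = poly E t / poly N t" if "t \<in> D" for t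
  proof (cases "G t = 0")
   case True
   thus ?thesis using e[OF that] NE(2)[of t] unfolding Infty pt_def by (auto split: if_splits)
  next
   case False
   hence h: "poly E t ~= 0" "poly N t / poly E t = inverse (G t)" using e[OF that] unfolding Infty pt_def by (auto split: if_splits)
   hence "poly N t ~= 0" using False by auto
   moreover have "G t = inverse (poly N t / poly E t)" using h(2) by simp
   ultimately show ?thesis by simp
  qed
  thus ?thesis using that by blast
 qed
qed

text \<open>A sequence with values tending to 0 would accumulate at a zero inside the disk.\<close>

lemma bounded_below:
 assumes nz: "!!t. t \<in> K ==> v (t - w) <= R ==> poly E t ~= 0" and R: "0 < R"
 shows "EX b>0. ALL t:K. v (t - w) <= R --> b <= v (poly E t)"
proof (rule ccontr)
 assume "~ ?thesis"
 hence "EX t. t \<in> K & v (t - w) <= R & v (poly E t) < b" if "0 < b" for b using that by (meson not_less)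
 hence "EX t. t \<in> K & v (t - w) <= R & v (poly E t) < 1 / real (Suc n)" for n by simp
 then obtain \<sigma> where \<sigma>: "!!n. \<sigma> n \<in> K" "!!n. v (\<sigma> n - w) <= R" "!!n. v (poly E (\<sigma> n)) < 1 / real (Suc n)" by metis
 have "v (\<sigma> n) <= max R (v w)" for n by (rule disk_bounded[OF \<sigma>(2)])
 then obtain l r where l: "l \<in> K" "strict_mono (r::nat=>nat)" "!!e. 0 < e ==> EX N. ALL n>=N. v (\<sigma> (r n) - l) < e"
  using bseq_compactD[OF K_compact, of \<sigma> "max R (v w)"] \<sigma>(1) by blast
 obtain N where N: "ALL n>=N. v (\<sigma> (r n) - l) < R" using l(3)[OF R] by blast
 have "v (\<sigma> (r N) - l) <= R" using N by (meson less_imp_le order_refl)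
 hence "v ((\<sigma> (r N) - w) - (\<sigma> (r N) - l)) <= R" by (rule v_diff_le[OF \<sigma>(2)])
 hence "poly E l ~= 0" using nz[OF l(1)] by simp
 then obtain s where s: "s > 0" "!!x. v (x - l) <= s ==> v (poly E x) = v (poly E l)" using poly_nonzero_near by blast
 obtain N' where N': "ALL n>=N'. v (\<sigma> (r n) - l) < s" using l(3)[OF s(1)] by blast
 have pos: "0 < v (poly E l)" using \<open>poly E l ~= 0\<close> by simp
 obtain M where M: "inverse (real (Suc M)) < v (poly E l)" using reals_Archimedean[OF pos] by blast
 define n where "n = max N' M"
 have "r n >= M" using seq_suble[OF l(2), of n] unfolding n_def by simp
 hence "1 / real (Suc (r n)) <= inverse (real (Suc M))" by (simp add: inverse_eq_divide frac_le)
 hence "v (poly E (\<sigma> (r n))) < v (poly E l)" using \<sigma>(3)[of "r n"] M by linarith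
 moreover have "v (poly E (\<sigma> (r n))) = v (poly E l)" using s(2)[of "\<sigma> (r n)"] N' unfolding n_def by (simp add: less_imp_le)
 ultimately show False by simp
qed

text \<open>In a coordinate the return map is rational with denominator bounded away from 0, so its
  divided difference is Lipschitz and \<open>isometry_fixed\<close> applies; infinitely many fixed
  points of one iterate are impossible in degree at least 2.\<close>

lemma isometry_periodic_finite:
 assumes x: "x \<in> X" and R: "0 < R" "R < 1" and n: "1 <= n"
  and E: "U.exact (T ^^ n) x R 1" and fx: "(T ^^ n) x \<in> bal x R"
 shows "finite {y \<in> bal x R. EX k>=1. (T ^^ k) y = y}"
proof (rule ccontr)
 assume inf: "infinite {y \<in> bal x R. EX k>=1. (T ^^ k) y = y}"
 define F where "F = T ^^ n"
 obtain a where a: "a \<in> X" "scl a = 1" "rad a = 1" "\<rho> a x < 1" by (rule normalized_chart[OF K_sub x])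
 define w where "w = coord_at a x"
 have w: "param_at a w = x" "v (w - ctr a) < 1" using param_near[of a x] a unfolding w_def by auto
 have wK: "w \<in> K" using param_in_P1[OF K_sub a(1), of w] w(1) x by simp
 define D where "D = {t \<in> K. v (t - w) <= R}"
 have bal: "bal x R = param_at a ` D"
  using mcball_param[OF a(1) wK, of R] w a R unfolding D_def by simp
 have ballF: "F y \<in> bal x R" if "y \<in> bal x R" for y
  using U.exactD(4)[OF E that] U.mcball_eq[OF fx, of] unfolding F_def by simp
 define G where "G t = coord_at a (F (param_at a t))" for t
 have G: "G t \<in> D" "F (param_at a t) = param_at a (G t)" if "t \<in> D" for t
 proof -
  have "F (param_at a t) \<in> param_at a ` D" using ballF that unfolding bal by blast
  thus "G t \<in> D" "F (param_at a t) = param_at a (G t)" unfolding G_def by auto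
 qed
 have nearD: "v (t - ctr a) < rad a" if "t \<in> D" for t
 proof -
  have "v ((t - w) + (w - ctr a)) < 1" using that R w(2) unfolding D_def by (intro v_add_less) auto
  thus ?thesis using a by simp
 qed
 have iso: "v (G t - G t') = v (t - t')" if t: "t \<in> D" "t' \<in> D" for t t'
 proof -
  have "\<rho> (F (param_at a t)) (F (param_at a t')) = 1 * \<rho> (param_at a t) (param_at a t')"
   unfolding F_def by (rule U.exactD(3)[OF E]) (use bal t in auto)
  thus ?thesis using spherical_param[OF nearD[OF G(1)[OF t(1)]] nearD[OF G(1)[OF t(2)]]]
    spherical_param[OF nearD[OF t(1)] nearD[OF t(2)]] a G(2)[OF t(1)] G(2)[OF t(2)] by simp
 qed
 obtain d where d: "ratl d F" unfolding F_def using ratl_iter by blast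
 obtain N E' where NE: "!!t. t \<in> D ==> poly E' t ~= 0 & G t = poly N t / poly E' t"
  using coordinate_rational[OF d G(2)] by blast
 obtain b where b: "b > 0" "!!t. t \<in> D ==> b <= v (poly E' t)"
  using bounded_below[of w R E'] NE R unfolding D_def by blast
 have bD: "v t <= max R (v w)" if "t \<in> D" for t using that disk_bounded unfolding D_def by blast
 obtain C \<Psi> where C: "1 <= C"
  "!!t t'. t \<in> D ==> t' \<in> D ==> poly N t / poly E' t - poly N t' / poly E' t' = \<Psi> t t' * (t - t') & v (\<Psi> t t') <= C"
  "!!t t' s s'. t \<in> D ==> t' \<in> D ==> s \<in> D ==> s' \<in> D ==> v (\<Psi> t t' - \<Psi> s s') <= C * max (v (t - s)) (v (t' - s'))"
  by (rule divided_difference[where D = D and n = N, OF bD b]) (assumption, assumption, (rule that; assumption))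
 have C2: "G t - G t' = \<Psi> t t' * (t - t')" if "t \<in> D" "t' \<in> D" for t t'
  using C(2)[OF that] NE[OF that(1)] NE[OF that(2)] by simp
 have Gk: "(G ^^ k) t \<in> D & (F ^^ k) (param_at a t) = param_at a ((G ^^ k) t)" if "t \<in> D" for k t
  using that by (induction k) (auto simp: G)
 have "{y \<in> bal x R. EX k>=1. (T ^^ k) y = y} \<subseteq> param_at a ` {t \<in> D. EX k>=1. (G ^^ k) t = t}"
 proof
  fix y assume "y \<in> {y \<in> bal x R. EX k>=1. (T ^^ k) y = y}"
  then obtain t k where t: "t \<in> D" "y = param_at a t" "1 <= k" "(T ^^ k) y = y" unfolding bal by blast
  have "((T ^^ k) ^^ n) y = y" using t(4) by (induction n) auto
  hence "(F ^^ k) y = y" unfolding F_def by (simp add: funpow_mult mult.commute)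
  hence "param_at a ((G ^^ k) t) = param_at a t" using Gk[OF t(1)] t(2) by simp
  hence "(G ^^ k) t = t" by (metis coord_param)
  thus "y \<in> param_at a ` {t \<in> D. EX k>=1. (G ^^ k) t = t}" using t by blast
 qed
 hence "infinite {t \<in> D. EX k>=1. (G ^^ k) t = t}" using inf by (meson finite_imageI finite_subset)
 then obtain l where l: "1 <= l" "infinite {t \<in> D. (G ^^ l) t = t}"
  using isometry_fixed[OF K_sub K_compact R(1), of w G C \<Psi>] G(1) iso C(1,3) C2 unfolding D_def by blast
 have "1 <= n * l" using n l(1) by simp
 then obtain d' where d': "2 <= d'" "ratl d' (T ^^ (n * l))" using ratl_iter[of "n * l"] by metis
 obtain f' g' where fg': "form d' f' g'" "T ^^ (n * l) = rmap d' f' g'" using d'(2) unfolding ratl_def by blast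
 have "finite {Y. (T ^^ (n * l)) Y = Y}" unfolding fg'(2) by (rule finite_fixed[OF fg'(1) d'(1)])
 moreover have "param_at a ` {t \<in> D. (G ^^ l) t = t} \<subseteq> {Y. (T ^^ (n * l)) Y = Y}"
 proof
  fix y assume "y \<in> param_at a ` {t \<in> D. (G ^^ l) t = t}"
  then obtain t where "t \<in> D" "(G ^^ l) t = t" "y = param_at a t" by blast
  hence "(F ^^ l) y = y" using Gk[of t l] by simp
  thus "y \<in> {Y. (T ^^ (n * l)) Y = Y}" unfolding F_def by (simp add: funpow_mult)
 qed
 moreover have "inj_on (param_at a) {t \<in> D. (G ^^ l) t = t}" by (rule inj_onI) (metis coord_param)
 ultimately show False using l(2) finite_subset finite_imageD by blast
qed

end

section \<open>Sub-hyperbolic maps\<close>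

locale sub_hyp = rat_dyn v p K f g for v :: "'c::field_char_0 => real" and p K f g +
 assumes sub_hyp: "sub_hyperbolic v (rat_map f g)"
begin

sublocale D: ultra_dyn X \<rho> "rat_map f g" Q
proof
 have d: "1 <= rat_degree f g" using deg by simp
 have FX: "T ` X \<subseteq> X" using T_X by blast
 show "T x \<in> X" if "x \<in> X" for x using that by (rule T_X)
 show "EX \<delta>>0. ALL y:X. \<rho> x y < \<delta> --> \<rho> (T x) (T y) < e" if "x \<in> X" "0 < e" for x e
  using continuous_iter[OF that(2), of x 1] by auto
 show "EX q>1. ALL x:X. ALL r. 0 < r & r <= 1 --> (EX y:X. r / q <= \<rho> x y & \<rho> x y <= r)"
  using P1_perfect[OF K_sub] p_gt_1 by (intro exI[of _ "real p"]) auto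
 show "EX r>0. EX a>0. EX m k mu. 1 <= m & 0 < k & k < 1 & 0 < mu &
    (ALL x:X. 0 < \<rho> z x & \<rho> z x <= r --> \<rho> (T z) (T x) = a * \<rho> z x ^ m &
      U.exact T x (k * \<rho> z x) (mu * a * \<rho> z x ^ (m - 1))) &
    (m = 1 --> mu = 1 & U.exact T z r a)" if z: "z \<in> X" for z
 proof -
  obtain r A m L k mu l where *: "0 < r" "0 < A" "1 <= (m::nat)" "0 <= L" "0 < k" "k < 1" "0 < mu"
   and A: "!!x. \<rho> z x <= r ==> \<rho> (T z) (T x) = A * \<rho> z x ^ m"
   and "!!s x y. s <= r ==> \<rho> z x <= s ==> \<rho> z y <= s ==> \<rho> (T x) (T y) <= L * s ^ (m - 1) * \<rho> x y"
   and "!!l'. has_P1_derivative v T z l' \<longleftrightarrow> l' = l" "v l = (if m = 1 then A * scl z / scl (T z) else 0)"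
   and ex: "!!x. z \<in> X ==> T ` X \<subseteq> X ==> x \<in> X ==> 0 < \<rho> z x ==> \<rho> z x <= r ==> U.exact T x (k * \<rho> z x) (mu * A * \<rho> z x ^ (m - 1))"
   and ex1: "z \<in> X ==> T ` X \<subseteq> X ==> m = 1 ==> mu = 1 & U.exact T z r A"
   by (rule local_structure[OF ratl_T d, of z]) (rule that; assumption)
  show ?thesis
   by (rule exI[of _ r], rule conjI[OF *(1)], rule exI[of _ A], rule conjI[OF *(2)], rule exI[of _ m], rule exI[of _ k], rule exI[of _ mu])
    (use * A ex[OF z FX] ex1[OF z FX] in auto)
 qed
 show "EX r>0. EX a>0. EX m>=1. ALL y:X. \<rho> x y <= r --> \<rho> ((T ^^ n) x) ((T ^^ n) y) = a * \<rho> x y ^ m" for x n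
 proof -
  obtain d where d: "1 <= d" "ratl d (T ^^ n)" using ratl_iter by blast
  obtain r A m where "0 < r" "0 < A" "1 <= (m::nat)" "!!y. \<rho> x y <= r ==> \<rho> ((T ^^ n) x) ((T ^^ n) y) = A * \<rho> x y ^ m"
   by (rule local_structure[OF d(2,1), of x]) (rule that; assumption)
  thus ?thesis by blast
 qed
 show "finite {x \<in> X. T x = q}" for q
 proof (rule finite_subset)
  show "finite {x. T x = q}" unfolding rat_map_eq_rmap
   by (rule finite_fibre) (use rat rational_form d in "auto simp: rational_over_def")
 qed blast
 show "finite Q" by (rule finite_Q[OF sub_hyp])
 show "Q \<subseteq> X" using Q_X by blast
 show "T z \<in> Q" if "z \<in> Q" for z using that by (rule Q_T)
 show "z ~: U.critset T" if "z \<in> Q" "1 <= n" "(T ^^ n) z = z" for z n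
  using julia_periodic_noncritical[OF Q_julia[OF that(1)] that(2,3)] critset_iff[OF Q_X[OF that(1)]] by blast
 show "EX r>0. EX l>1. ALL x:bal z r. \<rho> z ((T ^^ n) x) = l * \<rho> z x" if h: "z \<in> Q" "1 <= n" "(T ^^ n) z = z" for z n
 proof -
  obtain r A where r: "0 < r" "1 < A" "!!x. \<rho> z x <= r ==> \<rho> z ((T ^^ n) x) = A * \<rho> z x"
   using julia_periodic[OF Q_julia[OF h(1)] h(2,3)] by blast
  hence "ALL x:bal z r. \<rho> z ((T ^^ n) x) = A * \<rho> z x" by auto
  thus ?thesis using r(1,2) by blast
 qed
 show "EX t>0. EX \<eta><1. ALL n>=1. ALL x:bal z t. ALL y:bal z t. \<rho> ((T ^^ n) x) ((T ^^ n) y) <= \<eta> * \<rho> x y"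
  if z: "z \<in> U.critset T - Q" for z
 proof -
  have zX: "z \<in> X" using z unfolding U.critset_def by blast
  have c: "critical_point v T z" using z critset_iff[OF zX] by blast
  have "z ~: crit_star v K T" using z QI[of z 0] by auto
  hence "z \<in> fatou v UNIV T" using c zX unfolding crit_star_def julia_def P1_UNIV by blast
  from fatou_critical_contracting[OF c this] obtain t where t: "t > 0"
   "ALL n>=1. ALL x y. \<rho> z x <= t --> \<rho> z y <= t --> \<rho> ((T ^^ n) x) ((T ^^ n) y) <= 1 / 2 * \<rho> x y" by blast
  show ?thesis
   by (rule exI[of _ t], rule conjI[OF t(1)], rule exI[of _ "1/2"]) (use t(2) in auto)
 qed
 show "finite {y \<in> bal x R. EX k>=1. (T ^^ k) y = y}"
  if "x \<in> X" "0 < R" "R < 1" "1 <= n" "U.exact (T ^^ n) x R 1" "(T ^^ n) x \<in> bal x R" for x R n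
  using that by (rule isometry_periodic_finite)
qed

lemma Fat_eq: "fatou v K T = D.Fat"
 unfolding fatou_def D.Fat_def equicontinuous_iterates_def D.equi_def ..

lemma Jul_eq: "julia v K T = D.Jul"
 unfolding julia_def D.Jul_def Fat_eq ..

text \<open>Lying in the grand orbit of a critical point means landing on its forward orbit.\<close>

lemma Reg_eq: "julia_regular v K T = D.Reg"
proof -
 have "x \<in> (\<Union>c\<in>crit_star v K T. grand_orbit K T c) \<longleftrightarrow> (EX n. (T ^^ n) x \<in> Q)" if "x \<in> X" for x
  using that unfolding grand_orbit_def Q_def orbit_def by blast
 thus ?thesis unfolding julia_regular_def D.Reg_def Jul_eq using D.Jul_subset by blast
qed

text \<open>Both sides are read off the local expansion of \<open>T ^^ n\<close>: in local degree 1
  its factor is the absolute value of the multiplier; in higher degree the multiplier is 0 and small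
  distances shrink.\<close>

lemma nonrep_iff: "D.nonrep x \<longleftrightarrow> x \<in> X & nonrepelling_periodic v T x"
proof -
 have "(EX l. has_P1_derivative v (T ^^ n) x l & v l <= 1) \<longleftrightarrow> (EX r>0. ALL y:bal x r. \<rho> x ((T ^^ n) y) <= \<rho> x y)"
  if x: "x \<in> X" and n: "1 <= n" "(T ^^ n) x = x" for n
 proof -
  obtain d where d: "1 <= d" "ratl d (T ^^ n)" using ratl_iter by blast
  obtain r A m l where r: "0 < r" "0 < A" "1 <= (m::nat)"
   and A: "!!y. \<rho> x y <= r ==> \<rho> ((T ^^ n) x) ((T ^^ n) y) = A * \<rho> x y ^ m"
   and l: "!!l'. has_P1_derivative v (T ^^ n) x l' \<longleftrightarrow> l' = l" "v l = (if m = 1 then A * scl x / scl ((T ^^ n) x) else 0)"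
   by (rule local_structure[OF d(2,1), of x]) (rule that; assumption)
  have vl: "v l = (if m = 1 then A else 0)" unfolding l(2) n(2) using scl_pos[of x] by simp
  have A': "\<rho> x ((T ^^ n) y) = A * \<rho> x y ^ m" if "\<rho> x y <= r" for y using A[OF that] n(2) by simp
  have "(v l <= 1) \<longleftrightarrow> (EX r>0. ALL y:bal x r. \<rho> x ((T ^^ n) y) <= \<rho> x y)"
  proof (cases "m = 1")
   case True
   show ?thesis
   proof
    assume "v l <= 1"
    hence "A <= 1" using vl True by simp
    hence "ALL y:bal x r. \<rho> x ((T ^^ n) y) <= \<rho> x y" using A' True mult_right_mono[of A 1] by simp
    thus "EX r>0. ALL y:bal x r. \<rho> x ((T ^^ n) y) <= \<rho> x y" using r(1) by blast
   next
    assume "EX r>0. ALL y:bal x r. \<rho> x ((T ^^ n) y) <= \<rho> x y"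
    then obtain s where s: "s > 0" "!!y. y \<in> bal x s ==> \<rho> x ((T ^^ n) y) <= \<rho> x y" by blast
    obtain y where y: "y \<in> X" "0 < \<rho> x y" "\<rho> x y <= min r s" using near_point_X[OF x, of "min r s"] r(1) s(1) by auto
    have "A * \<rho> x y <= 1 * \<rho> x y" using s(2)[of y] A'[of y] y x True by simp
    hence "A <= 1" using y(2) by (simp only: mult_le_cancel_right_pos)
    thus "v l <= 1" using vl True by simp
   qed
  next
   case False
   hence m2: "2 <= m" using r(3) by simp
   obtain e where e: "0 < e" "!!u. 0 < u ==> u <= e ==> A * u ^ m < 1 * (u::real)"
    using small_power[OF r(2) zero_less_one m2] by blast
   have "\<rho> x ((T ^^ n) y) <= \<rho> x y" if y: "y \<in> bal x (min r e)" for y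
   proof (cases "y = x")
    case True
    thus ?thesis using n(2) by simp
   next
    case False
    hence "0 < \<rho> x y" using spherical_nonneg[of x y] spherical_eq_0[of x y] by (metis less_le)
    thus ?thesis using e(2)[of "\<rho> x y"] A'[of y] y by simp
   qed
   hence "EX r>0. ALL y:bal x r. \<rho> x ((T ^^ n) y) <= \<rho> x y" using r(1) e(1) by (intro exI[of _ "min r e"]) auto
   thus ?thesis using vl False by simp
  qed
  thus ?thesis using l(1) by simp
 qed
 thus ?thesis unfolding D.nonrep_def nonrepelling_periodic_def by blast
qed

text \<open>A ball without infinity lies in the chart at its finite centre, where spherical and
  absolute distances are proportional; one with infinity is recentred there and is the complement of
  an open disk of radius \<open>1 / r\<close>.\<close>

lemma disk_mcball: assumes a: "a \<in> X" and r: "0 < r" "r < 1" shows "P1_disk v K (bal a r)"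
proof (cases "EX y. a = Fin y & r < 1 / max (v y) 1")
 case True
 then obtain y where y: "a = Fin y" "r < 1 / max (v y) 1" by blast
 define m where "m = max (v y) 1"
 have m: "1 <= m" unfolding m_def by simp
 have s: "scl a = 1 / (m * m)" "rad a = m" "ctr a = y" unfolding scl_def rad_def y(1) m_def by auto
 have yK: "y \<in> K" using a y(1) by (auto simp: P1_of_def)
 have "r * (m * m) < m" using y(2) m unfolding m_def[symmetric] by (simp add: field_simps)
 hence "bal (param_at a y) (scl a * (r * (m * m))) = param_at a ` {t' \<in> K. v (t' - y) <= r * (m * m)}"
  using m by (intro mcball_param[OF a yK]) (simp_all add: s)
 moreover have "scl a * (r * (m * m)) = r" "param_at a y = a" "param_at a = Fin" using m unfolding s(1) by (auto simp: y(1))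
 ultimately have "bal a r = Fin ` {z \<in> K. v (z - y) <= r * (m * m)}" by simp
 moreover have "0 < r * (m * m)" using r m by simp
 ultimately show ?thesis unfolding P1_disk_def using yK by blast
next
 case False
 have IX: "Infty \<in> X" by (simp add: P1_of_def)
 have "Infty \<in> bal a r"
 proof (cases a)
  case (Fin y)
  hence "1 / max (v y) 1 <= r" using False by auto
  hence "1 < v y" using r by (cases "v y <= 1") auto
  thus ?thesis using \<open>1 / max (v y) 1 <= r\<close> a Fin IX by simp
 next
  case Infty
  thus ?thesis using a r by simp
 qed
 hence "bal a r = bal Infty r" by (metis U.mcball_eq)
 also have "\<dots> = X - Fin ` {z \<in> K. v (z - 0) < 1 / r}"
 proof -
  have "\<rho> Infty (Fin z) <= r \<longleftrightarrow> ~ v z < 1 / r" for z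
  proof (cases "v z <= 1")
   case True
   have "1 < 1 / r" using r by simp
   hence "v z < 1 / r" using True by linarith
   thus ?thesis using True r by simp
  next
   case False
   hence "0 < v z" by linarith
   thus ?thesis using r False by (simp add: not_less pos_divide_le_eq mult.commute)
  qed
  note z = this
  have "x \<in> bal Infty r \<longleftrightarrow> x \<in> X - Fin ` {z \<in> K. v (z - 0) < 1 / r}" for x
  proof (cases x)
   case (Fin y)
   have "Fin y \<in> X \<longleftrightarrow> y \<in> K" unfolding P1_of_def by auto
   thus ?thesis unfolding Fin P1.in_mcball using IX z[of y] by auto
  next
   case Infty
   thus ?thesis unfolding P1.in_mcball using IX r by auto
  qed
  thus ?thesis by blast
 qed
 finally have "bal a r = X - Fin ` {z \<in> K. v (z - 0) < 1 / r}" .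
 moreover have "0 < 1 / r" "0 \<in> K" using r is_subfieldD(1)[OF K_sub] by auto
 ultimately show ?thesis unfolding P1_disk_def by blast
qed

text \<open>The finite union of disks comes from compactness: a clopen set is a union of balls of
  one radius below 1, and there are finitely many of these.\<close>

lemma piece_iff: "minimal_piece v K T N \<longleftrightarrow> D.piece N"
proof
 assume N: "minimal_piece v K T N"
 hence "closedin (P1_topology v K) N" "T ` N \<subseteq> N" unfolding minimal_piece_def by auto
 thus "D.piece N" using N D.decomposes_iff unfolding D.piece_def minimal_piece_def by blast
next
 assume N: "D.piece N"
 hence cl: "openin (P1_topology v K) N" "closedin (P1_topology v K) N" "T ` N \<subseteq> N" unfolding D.piece_def by auto
 have "decomposes_into_minimal (subtopology (P1_topology v K) N) T"
  using D.decomposes_iff[OF cl(2,3)] N unfolding D.piece_def by blast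
 moreover obtain n where n: "N = \<Union>((%x. bal x (1 / real (n + 2))) ` N)" by (rule U.clopen_mcballs[OF cl(1,2)])
 have NX: "N \<subseteq> X" using closedin_subset[OF cl(2)] by simp
 have "finite ((%x. bal x (1 / real (n + 2))) ` X)" by (rule U.finite_mcballs) simp
 hence "finite ((%x. bal x (1 / real (n + 2))) ` N)" using NX by (meson finite_subset image_mono)
 moreover have "ALL B:(%x. bal x (1 / real (n + 2))) ` N. P1_disk v K B"
  using NX by (auto intro!: disk_mcball)
 ultimately show "minimal_piece v K T N" unfolding minimal_piece_def using cl n by blast
qed

lemma periodic_basin_iff: "x \<in> periodic_basin v K T y \<longleftrightarrow> x \<in> X & D.basin y x"
 unfolding periodic_basin_def D.basin_def by blast

end

theorem theorem1p6:
  fixes p :: nat and v :: "'c::field_char_0 \<Rightarrow> real" and K :: "'c set"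
    and f g :: "'c poly" and \<phi> :: "'c P1 \<Rightarrow> 'c P1"
  assumes "prime p"
    and "is_Cp p v"
    and "is_finite_extension_of K (Qp v)"
    and "rational_over K f g"
    and "rat_degree f g \<ge> 2"
    and "\<phi> = rat_map f g"
    and "sub_hyperbolic v \<phi>"
  shows "\<exists>P M \<M> B J.
      P1_of K = P \<union> M \<union> B \<union> J \<and>
      P \<inter> M = {} \<and> P \<inter> B = {} \<and> P \<inter> J = {} \<and> M \<inter> B = {} \<and> M \<inter> J = {} \<and> B \<inter> J = {} \<and>
      (finite P \<and> P = {x \<in> P1_of K. nonrepelling_periodic v \<phi> x}) \<and>
      (countable \<M> \<and> disjoint \<M> \<and> M = \<Union>\<M> \<and> (\<forall>N\<in>\<M>. minimal_piece v K \<phi> N) \<and>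
       (\<forall>N. minimal_piece v K \<phi> N \<longrightarrow> N \<subseteq> P \<union> M)) \<and>
      B = ((\<Union>y\<in>P. periodic_basin v K \<phi> y) \<union> (\<Union>N\<in>\<M>. set_basin K \<phi> N)) - (P \<union> M) \<and>
      J = julia v K \<phi> \<and>
      (\<exists>S A h. zero_one_matrix S A \<and>
         bij_betw h (julia v K \<phi>) (markov_shift S A) \<and>
         conjugate_via
           (subtopology (P1_topology v K) (julia_regular v K \<phi>)) \<phi>
           (subtopology (markov_topology S A) (h ` julia_regular v K \<phi>)) left_shift h)"
proof -
  interpret sub_hyp v p K f g
  proof
    show "nonarch_abs v" using assms(2) unfolding is_Cp_def by blast
  qed (use assms in auto)
  obtain \<M> where \<M>: "countable \<M>" "disjoint \<M>" "\<forall>N\<in>\<M>. D.piece N" "\<forall>N. D.piece N \<longrightarrow> N \<subseteq> {p. D.nonrep p} \<union> \<Union>\<M>"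
    "{p. D.nonrep p} \<inter> \<Union>\<M> = {}" "\<Union>\<M> \<inter> D.Jul = {}" "{p. D.nonrep p} \<inter> D.Jul = {}" "finite {p. D.nonrep p}"
    "\<forall>x\<in>D.Fat. x \<in> {p. D.nonrep p} \<union> \<Union>\<M> \<or> (\<exists>y. D.nonrep y \<and> D.basin y x) \<or> (\<exists>N\<in>\<M>. \<exists>n. ((rat_map f g) ^^ n) x \<in> N)"
    "\<forall>x\<in>D.Jul. \<not> (\<exists>y. D.nonrep y \<and> D.basin y x) \<and> \<not> (\<exists>N\<in>\<M>. \<exists>n. ((rat_map f g) ^^ n) x \<in> N)"
    using D.decomposition by (elim exE conjE) (rule that; assumption)
  define P where "P = {p. D.nonrep p}"
  define M where "M = \<Union>\<M>"
  define B where "B = ((\<Union>y\<in>P. periodic_basin v K (rat_map f g) y) \<union> (\<Union>N\<in>\<M>. set_basin K (rat_map f g) N)) - (P \<union> M)"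
  have P: "P = {x \<in> P1_of K. nonrepelling_periodic v (rat_map f g) x}" unfolding P_def nonrep_iff ..
  have PX: "P \<subseteq> P1_of K" unfolding P by blast
  have MX: "M \<subseteq> P1_of K"
  proof -
    have "N \<subseteq> P1_of K" if "N \<in> \<M>" for N
      using \<M>(3) that closedin_subset[of "P1_topology v K" N] unfolding D.piece_def by simp
    then show ?thesis unfolding M_def by blast
  qed
  have Bx: "x \<in> B \<longleftrightarrow> x \<in> P1_of K \<and> ((\<exists>y. D.nonrep y \<and> D.basin y x) \<or> (\<exists>N\<in>\<M>. \<exists>n. ((rat_map f g) ^^ n) x \<in> N)) \<and> x \<notin> P \<union> M" for x
    unfolding B_def P_def by (auto simp: periodic_basin_iff set_basin_def)
  have FJ: "P1_of K = D.Fat \<union> D.Jul" unfolding D.Jul_def D.Fat_def by blast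
  have "P1_of K = P \<union> M \<union> B \<union> D.Jul"
  proof
    show "P1_of K \<subseteq> P \<union> M \<union> B \<union> D.Jul"
    proof
      fix x assume x: "x \<in> P1_of K"
      show "x \<in> P \<union> M \<union> B \<union> D.Jul"
      proof (cases "x \<in> D.Jul")
        case False
        then have "x \<in> D.Fat" using x FJ by blast
        then show ?thesis using \<M>(9) x Bx unfolding P_def M_def by blast
      qed blast
    qed
    have "B \<subseteq> P1_of K" using Bx by blast
    then show "P \<union> M \<union> B \<union> D.Jul \<subseteq> P1_of K" using PX MX D.Jul_subset by (intro Un_least)
  qed
  have "P \<inter> M = {}" "P \<inter> D.Jul = {}" "M \<inter> D.Jul = {}" unfolding P_def M_def by (rule \<M>(5), rule \<M>(7), rule \<M>(6))
  have "P \<inter> B = {}" "M \<inter> B = {}" unfolding B_def by blast+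
  have "B \<inter> D.Jul = {}"
  proof -
    have "x \<notin> D.Jul" if "x \<in> B" for x using \<M>(10) that[unfolded Bx] by blast
    then show ?thesis by blast
  qed
  have "finite P" unfolding P_def by (rule \<M>(8))
  have "\<forall>N\<in>\<M>. minimal_piece v K (rat_map f g) N" using \<M>(3) piece_iff by blast
  have "\<forall>N. minimal_piece v K (rat_map f g) N \<longrightarrow> N \<subseteq> P \<union> M" using \<M>(4) piece_iff unfolding P_def M_def by blast
  note coding = D.coding[folded Reg_eq]
  show ?thesis unfolding assms(6) Jul_eq
    by (rule exI[of _ P], rule exI[of _ M], rule exI[of _ \<M>], rule exI[of _ B], rule exI[of _ D.Jul])
      (intro conjI; (rule refl | rule \<M>(1,2) P B_def M_def coding | fact))
qed

end
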